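(* Let $B$ be an $n$-dimensional C*-algebra with $n\geq 4$, endowed with a $\delta$-form $\psi$ (for some $\delta>0$), and consider the compact quantum automorphism group $\mathbb{G}^{aut}(B,\psi)$ with fundamental representation $u$. Then, for all $k,l\in\mathbb{N}$, $$\mathrm{Hom}(u^{\otimes k},u^{\otimes l})=\mathrm{span}\{T_p \mid p\in NC(k,l)\}.$$ Furthermore, the maps $T_p$ associated to distinct noncrossing partitions in $NC(k,l)$ are linearly independent.
   Context: **$\delta$-forms.** Let $B=\bigoplus_{\alpha=1}^c M_{n_\alpha}(\mathbb{C})$ be a finite dimensional C*-algebra with multiplication $m:B\otimes B\to B$ and unit map $\eta:\mathbb{C}\to B$, $\eta(1)=1_B$. A faithful state $\psi$ on $B$ makes $B$ a Hilbert space via $\langle x,y\rangle=\psi(y^*x)$. The faithful state $\psi$ is a $\delta$-form ($\delta>0$) if $mm^*=\delta\cdot \mathrm{id}_B$, where $m^*$ is the adjoint for the inner products induced by $\psi$. One has $\psi=\bigoplus_\alpha \mathrm{Tr}(Q_\alpha\,\cdot)$ with $Q_\alpha\in M_{n_\alpha}(\mathbb{C})$, $Q_\alpha>0$, $\sum_\alpha\mathrm{Tr}(Q_\alpha)=1$. The matrix units $e_{ij}^\alpha$ of $M_{n_\alpha}(\mathbb{C})$ are always taken with respect to a basis diagonalizing $Q_\alpha$; then $b_{ij}^\alpha=\psi(e_{jj}^\alpha)^{-1/2}e_{ij}^\alpha$ ($1\le i,j\le n_\alpha$, $1\le\alpha\le c$) is an orthonormal basis of $B$. **Quantum automorphism group.**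 $C(\mathbb{G}^{aut}(B,\psi))$ is the universal unital C*-algebra generated by the coefficients of an element $u\in\mathcal{L}(B)\otimes C(\mathbb{G}^{aut}(B,\psi))$ subject to: $u$ is unitary, $m\in\mathrm{Hom}(u^{\otimes 2},u)$, $\eta\in\mathrm{Hom}(1,u)$. It carries the unique comultiplication $\Delta$ with $(\mathrm{id}\otimes\Delta)(u)=u_{12}u_{13}$. Here for $v\in\mathcal{L}(H)\otimes A$, $w\in\mathcal{L}(K)\otimes A$, $\mathrm{Hom}(v,w)=\{T\in\mathcal{L}(H,K): (T\otimes 1)v=w(T\otimes 1)\}$ and $v\otimes w=v_{13}w_{23}$; $u^{\otimes 0}=1$ is the trivial representation on $\mathbb{C}$. **Noncrossing partitions and the maps $T_p$.** $NC(k,l)$ is the set of noncrossing partitions of $k$ points on an upper line and $l$ points on a lower line (strings lie between the two lines). For $p\in NC(k,l)$ with blocks $b_1,\dots,b_m$, associate basis elements $b_{i_1j_1}^{\alpha_1},\dots,b_{i_kj_k}^{\alpha_k}$ to the upper points and $b_{r_1s_1}^{\beta_1},\dots,b_{r_ls_l}^{\beta_l}$ to the lower points (ordered left to right). Let $b_v^\uparrow$ (resp. $b_v^\downarrow$) be the ordered product in $B$ of the elements at the upper (resp. lower) points of $b_v$, with the convention that it is $1_B$ if there are none. Put $\delta_p^{\alpha,\beta}(ij,rs)=\prod_{v=1}^m\psi((b_v^\downarrow)^*b_v^\uparrow)$. The linear map $T_p:B^{\otimes k}\to B^{\otimes l}$ (with $B^{\otimes 0}=\mathbb{C}$) is $$T_p(b_{i_1j_1}^{\alpha_1}\otimes\cdots\otimes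 b_{i_kj_k}^{\alpha_k})=\sum_{r,s,\beta}\delta_p^{\alpha,\beta}(ij,rs)\,b_{r_1s_1}^{\beta_1}\otimes\cdots\otimes b_{r_ls_l}^{\beta_l}.$$ *)

theory Defs
  imports
    Complex_Main
    "HOL-Algebra.Module"
    "HOL-Library.Disjoint_Sets"
    "HOL-Library.Nonpos_Ints"
    "HOL-Library.Function_Algebras"
begin

section \<open>Unital C*-algebras\<close>

definition complex_ring :: "complex ring" where
  "complex_ring = \<lparr>carrier = UNIV, monoid.mult = (*), one = 1, zero = 0, add = (+)\<rparr>"

lemma cring_complex_ring: "cring complex_ring"
proof (rule cringI)
  show "abelian_group complex_ring"
  proof (rule abelian_groupI)
    fix x :: complex
    show "\<exists>y\<in>carrier complex_ring. y \<oplus>\<^bsub>complex_ring\<^esub> x = \<zero>\<^bsub>complex_ring\<^esub>"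
      by (rule bexI[of _ "- x"]) (auto simp: complex_ring_def)
  qed (auto simp: complex_ring_def)
  show "comm_monoid complex_ring"
    by (rule comm_monoidI) (auto simp: complex_ring_def)
qed (auto simp: complex_ring_def algebra_simps)

record 'a cstar = "(complex, 'a) module" +
  star :: "'a \<Rightarrow> 'a"
  nrm  :: "'a \<Rightarrow> real"

locale cstar_algebra = ring A + Module.module complex_ring A for A :: "'a cstar" (structure) +
  assumes smult_mult_left:
      "\<lbrakk>x \<in> carrier A; y \<in> carrier A\<rbrakk> \<Longrightarrow> (a \<odot> x) \<otimes> y = a \<odot> (x \<otimes> y)"
    and smult_mult_right:
      "\<lbrakk>x \<in> carrier A; y \<in> carrier A\<rbrakk> \<Longrightarrow> x \<otimes> (a \<odot> y) = a \<odot> (x \<otimes> y)"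
    and star_closed: "x \<in> carrier A \<Longrightarrow> star A x \<in> carrier A"
    and star_star: "x \<in> carrier A \<Longrightarrow> star A (star A x) = x"
    and star_add:
      "\<lbrakk>x \<in> carrier A; y \<in> carrier A\<rbrakk> \<Longrightarrow> star A (x \<oplus> y) = star A x \<oplus> star A y"
    and star_smult: "x \<in> carrier A \<Longrightarrow> star A (a \<odot> x) = cnj a \<odot> star A x"
    and star_mult:
      "\<lbrakk>x \<in> carrier A; y \<in> carrier A\<rbrakk> \<Longrightarrow> star A (x \<otimes> y) = star A y \<otimes> star A x"
    and nrm_eq_0_iff: "x \<in> carrier A \<Longrightarrow> nrm A x = 0 \<longleftrightarrow> x = \<zero>"
    and nrm_triangle:
      "\<lbrakk>x \<in> carrier A; y \<in> carrier A\<rbrakk> \<Longrightarrow> nrm A (x \<oplus> y) \<le> nrm A x + nrm A y"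
    and nrm_smult: "x \<in> carrier A \<Longrightarrow> nrm A (a \<odot> x) = cmod a * nrm A x"
    and nrm_mult_le:
      "\<lbrakk>x \<in> carrier A; y \<in> carrier A\<rbrakk> \<Longrightarrow> nrm A (x \<otimes> y) \<le> nrm A x * nrm A y"
    and cstar_identity: "x \<in> carrier A \<Longrightarrow> nrm A (star A x \<otimes> x) = (nrm A x)\<^sup>2"
    and complete:
      "\<lbrakk>\<And>n :: nat. X n \<in> carrier A;
        \<And>\<epsilon>. 0 < \<epsilon> \<Longrightarrow> \<exists>N. \<forall>m\<ge>N. \<forall>n\<ge>N. nrm A (X m \<ominus> X n) < \<epsilon>\<rbrakk>
       \<Longrightarrow> \<exists>x\<in>carrier A. (\<lambda>n. nrm A (X n \<ominus> x)) \<longlonglongrightarrow> 0"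

definition star_hom :: "'a cstar \<Rightarrow> 'b cstar \<Rightarrow> ('a \<Rightarrow> 'b) set" where
  "star_hom A D = {h \<in> ring_hom A D.
     (\<forall>a. \<forall>x\<in>carrier A. h (a \<odot>\<^bsub>A\<^esub> x) = a \<odot>\<^bsub>D\<^esub> h x) \<and>
     (\<forall>x\<in>carrier A. h (star A x) = star D (h x))}"

definition cstar_subalgebra :: "'a set \<Rightarrow> 'a cstar \<Rightarrow> bool" where
  "cstar_subalgebra S A \<longleftrightarrow>
     S \<subseteq> carrier A \<and> \<one>\<^bsub>A\<^esub> \<in> S \<and>
     (\<forall>x\<in>S. \<forall>y\<in>S. x \<oplus>\<^bsub>A\<^esub> y \<in> S \<and> x \<otimes>\<^bsub>A\<^esub> y \<in> S) \<and>
     (\<forall>a. \<forall>x\<in>S. a \<odot>\<^bsub>A\<^esub> x \<in> S) \<and>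
     (\<forall>x\<in>S. star A x \<in> S) \<and>
     (\<forall>X. \<forall>x\<in>carrier A. (\<forall>n :: nat. X n \<in> S) \<and> (\<lambda>n. nrm A (X n \<ominus>\<^bsub>A\<^esub> x)) \<longlonglongrightarrow> 0 \<longrightarrow> x \<in> S)"

definition generated_by :: "'a cstar \<Rightarrow> 'a set \<Rightarrow> bool" where
  "generated_by A G \<longleftrightarrow> (\<forall>S. cstar_subalgebra S A \<and> G \<subseteq> S \<longrightarrow> S = carrier A)"


section \<open>Finite-dimensional C*-algebras with a faithful state\<close>

text \<open>
  An index \<open>(\<alpha>, i, j)\<close> stands for the position \<open>(i, j)\<close> in the block \<open>\<alpha>\<close>; the algebra
  has \<open>c\<close> blocks, of sizes \<open>d 0, \<dots>, d (c - 1)\<close>, and all indices count from 0.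
\<close>

type_synonym idx = "nat \<times> nat \<times> nat"

definition block_idx :: "nat \<Rightarrow> (nat \<Rightarrow> nat) \<Rightarrow> idx set" where
  "block_idx c d = {(\<alpha>, i, j). \<alpha> < c \<and> i < d \<alpha> \<and> j < d \<alpha>}"

text \<open>
  The family \<open>e\<close> is the image of the standard matrix units under a *-isomorphism of
  \<open>\<Oplus>\<^sub>\<alpha> M\<^bsub>d \<alpha>\<^esub>(\<complex>)\<close> onto \<open>B\<close>.
\<close>

definition matrix_units :: "'b cstar \<Rightarrow> nat \<Rightarrow> (nat \<Rightarrow> nat) \<Rightarrow> (idx \<Rightarrow> 'b) \<Rightarrow> bool" where
  "matrix_units B c d e \<longleftrightarrow>
     (\<forall>\<alpha><c. 0 < d \<alpha>) \<and>
     e \<in> block_idx c d \<rightarrow> carrier B \<and>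
     (\<forall>(\<alpha>, i, j)\<in>block_idx c d. \<forall>(\<beta>, k, l)\<in>block_idx c d.
        e (\<alpha>, i, j) \<otimes>\<^bsub>B\<^esub> e (\<beta>, k, l) = (if \<alpha> = \<beta> \<and> j = k then e (\<alpha>, i, l) else \<zero>\<^bsub>B\<^esub>)) \<and>
     (\<forall>(\<alpha>, i, j)\<in>block_idx c d. star B (e (\<alpha>, i, j)) = e (\<alpha>, j, i)) \<and>
     (\<forall>x\<in>carrier B. \<exists>f. x = (\<Oplus>\<^bsub>B\<^esub> a\<in>block_idx c d. f a \<odot>\<^bsub>B\<^esub> e a)) \<and>
     (\<forall>f. (\<Oplus>\<^bsub>B\<^esub> a\<in>block_idx c d. f a \<odot>\<^bsub>B\<^esub> e a) = \<zero>\<^bsub>B\<^esub> \<longrightarrow> (\<forall>a\<in>block_idx c d. f a = 0))"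

definition faithful_state :: "'b cstar \<Rightarrow> ('b \<Rightarrow> complex) \<Rightarrow> bool" where
  "faithful_state B \<psi> \<longleftrightarrow>
     (\<forall>x\<in>carrier B. \<forall>y\<in>carrier B. \<psi> (x \<oplus>\<^bsub>B\<^esub> y) = \<psi> x + \<psi> y) \<and>
     (\<forall>a. \<forall>x\<in>carrier B. \<psi> (a \<odot>\<^bsub>B\<^esub> x) = a * \<psi> x) \<and>
     (\<forall>x\<in>carrier B. \<psi> (star B x \<otimes>\<^bsub>B\<^esub> x) \<in> \<real>\<^sub>\<ge>\<^sub>0) \<and>
     \<psi> \<one>\<^bsub>B\<^esub> = 1 \<and>
     (\<forall>x\<in>carrier B. \<psi> (star B x \<otimes>\<^bsub>B\<^esub> x) = 0 \<longrightarrow> x = \<zero>\<^bsub>B\<^esub>)"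

text \<open>
  \<open>\<psi> x = \<Sum>\<^sub>\<alpha> Tr(Q\<^sub>\<alpha> x\<^sub>\<alpha>)\<close> forces \<open>(Q\<^sub>\<alpha>)\<^sub>i\<^sub>j = \<psi> (e\<^sub>j\<^sub>i\<^sup>\<alpha>)\<close>.
\<close>

definition density :: "('b \<Rightarrow> complex) \<Rightarrow> (idx \<Rightarrow> 'b) \<Rightarrow> nat \<Rightarrow> nat \<Rightarrow> nat \<Rightarrow> complex" where
  "density \<psi> e \<alpha> i j = \<psi> (e (\<alpha>, j, i))"

definition diagonalizing ::
  "nat \<Rightarrow> (nat \<Rightarrow> nat) \<Rightarrow> ('b \<Rightarrow> complex) \<Rightarrow> (idx \<Rightarrow> 'b) \<Rightarrow> bool" where
  "diagonalizing c d \<psi> e \<longleftrightarrow>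
     (\<forall>\<alpha><c. \<forall>i<d \<alpha>. \<forall>j<d \<alpha>. i \<noteq> j \<longrightarrow> density \<psi> e \<alpha> i j = 0)"

definition ip :: "'b cstar \<Rightarrow> ('b \<Rightarrow> complex) \<Rightarrow> 'b \<Rightarrow> 'b \<Rightarrow> complex" where
  "ip B \<psi> x y = \<psi> (star B y \<otimes>\<^bsub>B\<^esub> x)"

text \<open>
  \<open>\<psi> (e\<^sub>j\<^sub>j\<^sup>\<alpha>)\<close> is a positive real when \<open>\<psi>\<close> is a faithful state.
\<close>

definition onb :: "'b cstar \<Rightarrow> ('b \<Rightarrow> complex) \<Rightarrow> (idx \<Rightarrow> 'b) \<Rightarrow> idx \<Rightarrow> 'b" where
  "onb B \<psi> e = (\<lambda>(\<alpha>, i, j).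
     complex_of_real (1 / sqrt (Re (\<psi> (e (\<alpha>, j, j))))) \<odot>\<^bsub>B\<^esub> e (\<alpha>, i, j))"


section \<open>Linear maps between tensor powers\<close>

text \<open>
  Fix an orthonormal basis \<open>b\<close> of \<open>B\<close>, indexed by \<open>I\<close>.  The \<open>k\<close>-th tensor power of \<open>B\<close>
  has the orthonormal basis of pure tensors \<open>b\<^bsub>r ! 0\<^esub> \<otimes> \<dots> \<otimes> b\<^bsub>r ! (k - 1)\<^esub>\<close>, indexed by the
  lists \<open>r\<close> in \<open>tuples I k\<close>; for \<open>k = 0\<close> this is the basis \<open>1\<close> of the complex numbers.  A linear
  map from the \<open>k\<close>-th to the \<open>l\<close>-th tensor power is its matrix \<open>T s r\<close>, where \<open>r\<close> indexes the
  source and \<open>s\<close> the target, extended by 0 outside \<open>tuples I l \<times> tuples I k\<close>.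
\<close>

definition tuples :: "'i set \<Rightarrow> nat \<Rightarrow> 'i list set" where
  "tuples I k = {r. set r \<subseteq> I \<and> length r = k}"

type_synonym 'i linmap = "'i list \<Rightarrow> 'i list \<Rightarrow> complex"

definition linmaps :: "'i set \<Rightarrow> nat \<Rightarrow> nat \<Rightarrow> 'i linmap set" where
  "linmaps I k l = {T. \<forall>s r. \<not> (s \<in> tuples I l \<and> r \<in> tuples I k) \<longrightarrow> T s r = 0}"

definition mk_linmap :: "'i set \<Rightarrow> nat \<Rightarrow> nat \<Rightarrow> 'i linmap \<Rightarrow> 'i linmap" where
  "mk_linmap I k l f = (\<lambda>s r. if s \<in> tuples I l \<and> r \<in> tuples I k then f s r else 0)"

definition linmap_scale :: "complex \<Rightarrow> 'i linmap \<Rightarrow> 'i linmap" where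
  "linmap_scale a T = (\<lambda>s r. a * T s r)"

lemma vector_space_linmap: "vector_space linmap_scale"
  by unfold_locales (auto simp: linmap_scale_def fun_eq_iff algebra_simps)

definition linmap_id :: "'i set \<Rightarrow> nat \<Rightarrow> 'i linmap" where
  "linmap_id I k = mk_linmap I k k (\<lambda>s r. if s = r then 1 else 0)"

text \<open>\<open>linmap_comp I k T S\<close> is \<open>T \<circ> S\<close> when the \<open>k\<close>-th tensor power is the target of \<open>S\<close>.\<close>

definition linmap_comp :: "'i set \<Rightarrow> nat \<Rightarrow> 'i linmap \<Rightarrow> 'i linmap \<Rightarrow> 'i linmap" where
  "linmap_comp I k T S = (\<lambda>s r. \<Sum>t\<in>tuples I k. T s t * S t r)"

definition linmap_adj :: "'i linmap \<Rightarrow> 'i linmap" where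
  "linmap_adj T = (\<lambda>s r. cnj (T r s))"

definition mult_map ::
  "'b cstar \<Rightarrow> ('b \<Rightarrow> complex) \<Rightarrow> 'i set \<Rightarrow> ('i \<Rightarrow> 'b) \<Rightarrow> 'i linmap" where
  "mult_map B \<psi> I b = mk_linmap I 2 1
     (\<lambda>s r. ip B \<psi> (b (r ! 0) \<otimes>\<^bsub>B\<^esub> b (r ! 1)) (b (s ! 0)))"

definition unit_map ::
  "'b cstar \<Rightarrow> ('b \<Rightarrow> complex) \<Rightarrow> 'i set \<Rightarrow> ('i \<Rightarrow> 'b) \<Rightarrow> 'i linmap" where
  "unit_map B \<psi> I b = mk_linmap I 0 1 (\<lambda>s r. ip B \<psi> \<one>\<^bsub>B\<^esub> (b (s ! 0)))"

definition delta_form ::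
  "'b cstar \<Rightarrow> ('b \<Rightarrow> complex) \<Rightarrow> 'i set \<Rightarrow> ('i \<Rightarrow> 'b) \<Rightarrow> real \<Rightarrow> bool" where
  "delta_form B \<psi> I b \<delta> \<longleftrightarrow> faithful_state B \<psi> \<and> 0 < \<delta> \<and>
     linmap_comp I 2 (mult_map B \<psi> I b) (linmap_adj (mult_map B \<psi> I b)) =
       linmap_scale (complex_of_real \<delta>) (linmap_id I 1)"


section \<open>Representations and the quantum automorphism group\<close>

text \<open>
  An element \<open>u\<close> of \<open>\<L>(B) \<otimes> A\<close> is given by its coefficients \<open>u a b\<close>, that is
  \<open>u = \<Sum>\<^bsub>a,b\<in>I\<^esub> E\<^bsub>a b\<^esub> \<otimes> u a b\<close> with \<open>E\<^bsub>a b\<^esub>\<close> the matrix units of \<open>\<L>(B)\<close> for the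
  orthonormal basis.  With \<open>v \<otimes> w = v\<^sub>1\<^sub>3 w\<^sub>2\<^sub>3\<close>, the coefficients of a tensor power are the
  products of those of \<open>u\<close>, taken from left to right.
\<close>

fun tensor_power :: "'a cstar \<Rightarrow> ('i \<Rightarrow> 'i \<Rightarrow> 'a) \<Rightarrow> 'i list \<Rightarrow> 'i list \<Rightarrow> 'a" where
  "tensor_power A u [] [] = \<one>\<^bsub>A\<^esub>"
| "tensor_power A u (a # s) (b # r) = u a b \<otimes>\<^bsub>A\<^esub> tensor_power A u s r"
| "tensor_power A u _ _ = \<zero>\<^bsub>A\<^esub>"

text \<open>
  \<open>Hom A I u k l\<close> consists of the \<open>T\<close> with \<open>(T \<otimes> 1) u\<^bsup>\<otimes>k\<^esup> = u\<^bsup>\<otimes>l\<^esup> (T \<otimes> 1)\<close>,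
  compared coefficientwise.
\<close>

definition Hom :: "'a cstar \<Rightarrow> 'i set \<Rightarrow> ('i \<Rightarrow> 'i \<Rightarrow> 'a) \<Rightarrow> nat \<Rightarrow> nat \<Rightarrow> 'i linmap set" where
  "Hom A I u k l = {T \<in> linmaps I k l. \<forall>s\<in>tuples I l. \<forall>r\<in>tuples I k.
     (\<Oplus>\<^bsub>A\<^esub> t\<in>tuples I k. T s t \<odot>\<^bsub>A\<^esub> tensor_power A u t r) =
     (\<Oplus>\<^bsub>A\<^esub> t\<in>tuples I l. T t r \<odot>\<^bsub>A\<^esub> tensor_power A u s t)}"

definition unitary :: "'a cstar \<Rightarrow> 'i set \<Rightarrow> ('i \<Rightarrow> 'i \<Rightarrow> 'a) \<Rightarrow> bool" where
  "unitary A I u \<longleftrightarrow> (\<forall>a\<in>I. \<forall>b\<in>I.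
     (\<Oplus>\<^bsub>A\<^esub> x\<in>I. star A (u x a) \<otimes>\<^bsub>A\<^esub> u x b) = (if a = b then \<one>\<^bsub>A\<^esub> else \<zero>\<^bsub>A\<^esub>) \<and>
     (\<Oplus>\<^bsub>A\<^esub> x\<in>I. u a x \<otimes>\<^bsub>A\<^esub> star A (u b x)) = (if a = b then \<one>\<^bsub>A\<^esub> else \<zero>\<^bsub>A\<^esub>))"

definition aut_relations ::
  "'b cstar \<Rightarrow> ('b \<Rightarrow> complex) \<Rightarrow> 'i set \<Rightarrow> ('i \<Rightarrow> 'b) \<Rightarrow> 'a cstar \<Rightarrow> ('i \<Rightarrow> 'i \<Rightarrow> 'a) \<Rightarrow> bool" where
  "aut_relations B \<psi> I b A u \<longleftrightarrow>
     (\<forall>x\<in>I. \<forall>y\<in>I. u x y \<in> carrier A) \<and>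
     unitary A I u \<and>
     mult_map B \<psi> I b \<in> Hom A I u 2 1 \<and>
     unit_map B \<psi> I b \<in> Hom A I u 0 1"

text \<open>
  The universal property has to be tested against all unital C*-algebras \<open>D\<close> containing a
  solution \<open>v\<close> of the relations.  HOL cannot quantify over the carrier type of \<open>D\<close>, so \<open>D\<close> ranges
  over the C*-algebras (with arbitrary operations) whose carrier is a subset of a fixed type of
  cardinality continuum.  This loses nothing: only the C*-subalgebra generated by the finitely
  many coefficients of \<open>v\<close> matters, and as a separable metric space it has at most continuum many
  elements, hence a copy with carrier in this type.  (For instance, separable C*-algebras embed
  into the bounded operators on \<open>\<l>\<^sup>2\<close>, which are infinite complex matrices.)
  Uniqueness of \<open>h\<close> on \<open>carrier A\<close> follows from generation.
\<close>

type_synonym test_carrier = "nat \<Rightarrow> nat \<Rightarrow> complex"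

definition quantum_automorphism_algebra ::
  "'b cstar \<Rightarrow> ('b \<Rightarrow> complex) \<Rightarrow> 'i set \<Rightarrow> ('i \<Rightarrow> 'b) \<Rightarrow> 'a cstar \<Rightarrow> ('i \<Rightarrow> 'i \<Rightarrow> 'a) \<Rightarrow> bool" where
  "quantum_automorphism_algebra B \<psi> I b A u \<longleftrightarrow>
     cstar_algebra A \<and>
     aut_relations B \<psi> I b A u \<and>
     generated_by A {u x y | x y. x \<in> I \<and> y \<in> I} \<and>
     (\<forall>(D :: test_carrier cstar) v. cstar_algebra D \<and> aut_relations B \<psi> I b D v \<longrightarrow>
        (\<exists>h\<in>star_hom A D. \<forall>x\<in>I. \<forall>y\<in>I. h (u x y) = v x y))"


section \<open>Noncrossing partitions and the associated maps\<close>

text \<open>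
  \<open>Inl i\<close> is the \<open>i\<close>-th upper point and \<open>Inr j\<close> the \<open>j\<close>-th lower point, both counted from the
  left.  Strings drawn between the two lines do not cross iff the partition is noncrossing for the
  order obtained by running through the upper points from left to right and then through the lower
  points from right to left.
\<close>

definition points :: "nat \<Rightarrow> nat \<Rightarrow> (nat + nat) set" where
  "points k l = Inl ` {..<k} \<union> Inr ` {..<l}"

fun position :: "nat \<Rightarrow> nat \<Rightarrow> nat + nat \<Rightarrow> nat" where
  "position k l (Inl i) = i"
| "position k l (Inr j) = k + (l - 1 - j)"

definition noncrossing :: "('p \<Rightarrow> nat) \<Rightarrow> 'p set set \<Rightarrow> bool" where
  "noncrossing pos p \<longleftrightarrow> (\<forall>V\<in>p. \<forall>W\<in>p. \<forall>x\<in>V. \<forall>y\<in>W. \<forall>x'\<in>V. \<forall>y'\<in>W.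
     pos x < pos y \<and> pos y < pos x' \<and> pos x' < pos y' \<longrightarrow> V = W)"

definition NC :: "nat \<Rightarrow> nat \<Rightarrow> (nat + nat) set set set" where
  "NC k l = {p. partition_on (points k l) p \<and> noncrossing (position k l) p}"

definition ordered_prod :: "'b cstar \<Rightarrow> (nat \<Rightarrow> 'b) \<Rightarrow> nat set \<Rightarrow> 'b" where
  "ordered_prod B f N = foldr (\<lambda>i y. f i \<otimes>\<^bsub>B\<^esub> y) (sorted_list_of_set N) \<one>\<^bsub>B\<^esub>"

definition block_up :: "'b cstar \<Rightarrow> ('i \<Rightarrow> 'b) \<Rightarrow> 'i list \<Rightarrow> (nat + nat) set \<Rightarrow> 'b" where
  "block_up B b r V = ordered_prod B (\<lambda>i. b (r ! i)) {i. Inl i \<in> V}"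

definition block_down :: "'b cstar \<Rightarrow> ('i \<Rightarrow> 'b) \<Rightarrow> 'i list \<Rightarrow> (nat + nat) set \<Rightarrow> 'b" where
  "block_down B b s V = ordered_prod B (\<lambda>j. b (s ! j)) {j. Inr j \<in> V}"

definition partition_coeff ::
  "'b cstar \<Rightarrow> ('b \<Rightarrow> complex) \<Rightarrow> ('i \<Rightarrow> 'b) \<Rightarrow> (nat + nat) set set \<Rightarrow> 'i list \<Rightarrow> 'i list \<Rightarrow> complex" where
  "partition_coeff B \<psi> b p r s =
     (\<Prod>V\<in>p. \<psi> (star B (block_down B b s V) \<otimes>\<^bsub>B\<^esub> block_up B b r V))"

definition partition_map ::
  "'b cstar \<Rightarrow> ('b \<Rightarrow> complex) \<Rightarrow> 'i set \<Rightarrow> ('i \<Rightarrow> 'b) \<Rightarrow> nat \<Rightarrow> nat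
    \<Rightarrow> (nat + nat) set set \<Rightarrow> 'i linmap" where
  "partition_map B \<psi> I b k l p = mk_linmap I k l (\<lambda>s r. partition_coeff B \<psi> b p r s)"

end

theory Submission
  imports Defs "HOL-Analysis.Analysis"
begin

text \<open>
  In the orthonormal basis \<open>B\<close> is a Frobenius algebra with real structure constants, and a noncrossing
  partition becomes a tensor \<open>tvc xs\<close> on a circular word whose letters are labelled by the blocks.  The
  span \<open>FV m\<close> of these tensors is closed under units, multiplication, contraction and rotation.

  Every noncrossing partition is reduced to the empty one by deleting singletons and merging equal
  neighbours, that is, by \<open>\<eta>\<close> and \<open>m\<close>; together with the unitarity of \<open>u\<close>, which moves points between
  the two lines, this makes all \<open>T\<^sub>p\<close> intertwiners.

  Conversely, the orthogonal projections onto the spaces \<open>FV m\<close> prescribe the values that the Haar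
  state should take on words in the coefficients.  The resulting form is positive, and the
  Gelfand-Naimark-Segal construction yields operators on \<open>\<ell>\<^sup>2\<close> that satisfy the relations and whose
  intertwiners all come from \<open>FV\<close>.  The universal property carries the intertwiners of \<open>u\<close> to these.

  The Gram matrix of the tensors depends only on \<open>\<delta>\<close>, and \<open>\<delta> \<ge> n \<ge> 4\<close> by the Cauchy-Schwarz inequality.
  So independence may be checked in \<open>M\<^sub>2\<close> with a \<open>\<delta>\<close>-form of the same \<open>\<delta>\<close>, where the tensors of distinct
  partitions have distinct leading coefficients.
\<close>

section \<open>Noncrossing label lists\<close>

text \<open>The hard inclusion needs one concrete C*-algebra in which the relations hold and no
  further intertwiners exist; the universal property then carries every intertwiner of
  \<open>u\<close> into that model. The obstacle is positivity of the form built from the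
  projections. It is not inherited from a Haar state known beforehand but follows from an algebraic
  identity: on words of bounded length the matrix \<open>G\<close> of the form satisfies GG = GZ
  with an explicit positive definite Z, and a hermitian solution of this equation is positive
  semidefinite. Working with tensors in place of maps means bending legs. The basis is not closed
  under the star: b_a^* is \<open>lam a\<close> times the basis vector at \<open>bar a\<close>, and
  the weights \<open>lam\<close> record how far \<psi> is from a trace. They cancel in the end
  because every tensor in \<open>FV m\<close> is supported on tuples of total weight 1. The bound 4
  comes from M_2: positive eigenvalues with sum 1 and sum of inverses \<delta> exist exactly when
  \<delta> \<ge> 4.\<close>

text \<open>Blocks are the sets of positions with equal labels. Lists stand in for set partitions
  because deleting, doubling and merging neighbours become list operations; the labels matter only
  up to injective renaming.\<close>

definition nc :: "nat list \<Rightarrow> bool" where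
  "nc xs \<longleftrightarrow> (\<forall>i j k l. i < j \<and> j < k \<and> k < l \<and> l < length xs \<and>
     xs ! i = xs ! k \<and> xs ! j = xs ! l \<longrightarrow> xs ! i = xs ! j)"

lemma ncD:
  "\<lbrakk>nc xs; i < j; j < k; k < l; l < length xs; xs ! i = xs ! k; xs ! j = xs ! l\<rbrakk> \<Longrightarrow> xs ! i = xs ! j"
  unfolding nc_def by blast

text \<open>A crossing in \<open>ys\<close> is carried by \<open>h\<close> to a crossing in
  \<open>xs\<close>. Weak monotonicity is enough: consecutive members of a crossing have different
  labels, so their images are distinct.\<close>

lemma nc_pullback:
  assumes nc: "nc xs" and h: "\<And>i. i < length ys \<Longrightarrow> h i < length xs \<and> xs ! (h i) = ys ! i"
    and mono: "\<And>i j. i < j \<Longrightarrow> j < length ys \<Longrightarrow> h i \<le> h j"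
  shows "nc ys"
  unfolding nc_def
proof (intro allI impI, elim conjE, rule ccontr)
  fix i j k l
  assume *: "i < j" "j < k" "k < l" "l < length ys" "ys ! i = ys ! k" "ys ! j = ys ! l" "ys ! i \<noteq> ys ! j"
  have "h i \<le> h j" "h j \<le> h k" "h k \<le> h l" using * by (auto intro!: mono)
  moreover have "xs ! (h i) = ys ! i" "xs ! (h j) = ys ! j" "xs ! (h k) = ys ! k" "xs ! (h l) = ys ! l"
    "h l < length xs" using * h by auto
  moreover from this * have "h i \<noteq> h j" "h j \<noteq> h k" "h k \<noteq> h l" by metis+
  ultimately show False using ncD[OF nc, of "h i" "h j" "h k" "h l"] * by simp
qed

lemma nc_delete: "nc (ys @ v # zs) \<Longrightarrow> nc (ys @ zs)"
  by (erule nc_pullback[where h = "\<lambda>i. if i < length ys then i else Suc i"])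
     (simp_all add: nth_append Suc_diff_le)

lemma nc_double: "nc (ys @ v # zs) \<Longrightarrow> nc (ys @ v # v # zs)"
proof (erule nc_pullback[where h = "\<lambda>i. if i \<le> length ys then i else i - 1"])
  fix i assume i: "i < length (ys @ v # v # zs)"
  consider "i < length ys" | "i = length ys" | "i = Suc (length ys)"
    | j where "i = length ys + Suc (Suc j)"
    by (metis add_Suc_right less_imp_Suc_add linorder_neqE_nat not_less_eq add.commute)
  then show "(if i \<le> length ys then i else i - 1) < length (ys @ v # zs) \<and>
      (ys @ v # zs) ! (if i \<le> length ys then i else i - 1) = (ys @ v # v # zs) ! i"
    using i by cases (simp_all add: nth_append)
qed auto

lemma nc_map_inj:
  assumes "nc xs" "inj_on f (set xs)"
  shows "nc (map f xs)"
  unfolding nc_def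
proof (intro allI impI, elim conjE)
  fix i j k l
  assume *: "i < j" "j < k" "k < l" "l < length (map f xs)" "map f xs ! i = map f xs ! k" "map f xs ! j = map f xs ! l"
  then have "i < length xs" "j < length xs" "k < length xs" "l < length xs" by simp_all
  with * have "xs ! i = xs ! k" "xs ! j = xs ! l" by (metis assms(2) inj_onD nth_map nth_mem)+
  with * show "map f xs ! i = map f xs ! j" using ncD[OF assms(1) *(1-3)] by simp
qed

lemma nc_rev: "nc xs \<Longrightarrow> nc (rev xs)"
  unfolding nc_def
proof (intro allI impI, elim conjE)
  fix i j k l
  assume nc: "\<forall>i j k l. i < j \<and> j < k \<and> k < l \<and> l < length xs \<and> xs ! i = xs ! k \<and> xs ! j = xs ! l \<longrightarrow> xs ! i = xs ! j"
    and *: "i < j" "j < k" "k < l" "l < length (rev xs)" "rev xs ! i = rev xs ! k" "rev xs ! j = rev xs ! l"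
  let ?n = "length xs"
  have "?n - Suc l < ?n - Suc k" "?n - Suc k < ?n - Suc j" "?n - Suc j < ?n - Suc i" "?n - Suc i < ?n"
    using * by auto
  moreover have "xs ! (?n - Suc l) = xs ! (?n - Suc j)" "xs ! (?n - Suc k) = xs ! (?n - Suc i)"
    using * by (simp_all add: rev_nth)
  ultimately have "xs ! (?n - Suc l) = xs ! (?n - Suc k)" using nc by blast
  then show "rev xs ! i = rev xs ! j" using * by (simp add: rev_nth)
qed

text \<open>Positions with equal labels are both inside or both outside the inserted interval. If
  one pair of a crossing were inside and the other outside, an outer position would lie between two
  inner ones; so a crossing lives entirely in \<open>ys\<close> or entirely in
  \<open>xs1 @ xs2\<close>.\<close>

lemma nc_insert_disjoint:
  assumes "nc (xs1 @ xs2)" "nc ys" "set ys \<inter> (set xs1 \<union> set xs2) = {}"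
  shows "nc (xs1 @ ys @ xs2)"
  unfolding nc_def
proof (intro allI impI, elim conjE, rule ccontr)
  let ?zs = "xs1 @ ys @ xs2" and ?a = "length xs1" and ?b = "length xs1 + length ys"
  fix i j k l
  assume *: "i < j" "j < k" "k < l" "l < length ?zs" "?zs ! i = ?zs ! k" "?zs ! j = ?zs ! l" "?zs ! i \<noteq> ?zs ! j"
  have mid: "?a \<le> p \<and> p < ?b \<longleftrightarrow> ?zs ! p \<in> set ys" if "p < length ?zs" for p
  proof -
    have "p < ?a \<Longrightarrow> ?zs ! p \<in> set xs1" "?b \<le> p \<Longrightarrow> ?zs ! p \<in> set xs2"
      "?a \<le> p \<Longrightarrow> p < ?b \<Longrightarrow> ?zs ! p \<in> set ys" using that by (auto simp: nth_append)
    then show ?thesis using assms(3) by (meson disjoint_iff not_le UnI1 UnI2)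
  qed
  have ik: "?zs ! i \<in> set ys \<longleftrightarrow> ?zs ! k \<in> set ys" and jl: "?zs ! j \<in> set ys \<longleftrightarrow> ?zs ! l \<in> set ys" using * by auto
  have "(?zs ! i \<in> set ys \<and> ?zs ! j \<in> set ys \<and> ?zs ! k \<in> set ys \<and> ?zs ! l \<in> set ys) \<or>
    (?zs ! i \<notin> set ys \<and> ?zs ! j \<notin> set ys \<and> ?zs ! k \<notin> set ys \<and> ?zs ! l \<notin> set ys)"
  proof (cases "?zs ! i \<in> set ys")
    case True
    then have "?a \<le> i" "i < ?b" "?a \<le> k" "k < ?b" using mid[of i] mid[of k] ik * by auto
    then have "?a \<le> j \<and> j < ?b" using * by linarith
    then show ?thesis using True ik jl mid[of j] * by auto
  next
    case False
    show ?thesis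
    proof (cases "?zs ! j \<in> set ys")
      case True
      then have "?a \<le> j" "j < ?b" "?a \<le> l" "l < ?b" using mid[of j] mid[of l] jl * by auto
      then have "?a \<le> k \<and> k < ?b" using * by linarith
      then show ?thesis using True ik False mid[of k] * by auto
    qed (use False ik jl in auto)
  qed
  then show False
  proof
    assume ys: "?zs ! i \<in> set ys \<and> ?zs ! j \<in> set ys \<and> ?zs ! k \<in> set ys \<and> ?zs ! l \<in> set ys"
    have len: "i < length ?zs" "j < length ?zs" "k < length ?zs" using *(1-4) by linarith+
    have r: "?a \<le> i" "l < ?b" using mid[of i] mid[of l] ys len(1) *(4) by blast+
    have e: "?zs ! p = ys ! (p - ?a)" if "?a \<le> p" "p < ?b" for p
    proof -
      have "p - ?a < length ys" using that by linarith
      then show ?thesis using that by (simp add: nth_append)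
    qed
    have "i - ?a < j - ?a" "j - ?a < k - ?a" "k - ?a < l - ?a" "l - ?a < length ys"
      using r *(1-3) by linarith+
    moreover have "?zs ! i = ys ! (i - ?a)" "?zs ! j = ys ! (j - ?a)" "?zs ! k = ys ! (k - ?a)" "?zs ! l = ys ! (l - ?a)"
      using r *(1-3) by (intro e; linarith)+
    ultimately show False using ncD[OF assms(2), of "i - ?a" "j - ?a" "k - ?a" "l - ?a"] *(5-7) by argo
  next
    assume ys: "?zs ! i \<notin> set ys \<and> ?zs ! j \<notin> set ys \<and> ?zs ! k \<notin> set ys \<and> ?zs ! l \<notin> set ys"
    have len: "i < length ?zs" "j < length ?zs" "k < length ?zs" using *(1-4) by linarith+
    have r: "i < ?a \<or> ?b \<le> i" "j < ?a \<or> ?b \<le> j" "k < ?a \<or> ?b \<le> k" "l < ?a \<or> ?b \<le> l"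
      using mid[of i] mid[of j] mid[of k] mid[of l] ys len *(4) not_le by blast+
    define h where "h p = (if p < ?a then p else p - length ys)" for p
    have e: "?zs ! p = (xs1 @ xs2) ! h p" if "p < ?a \<or> ?b \<le> p" for p
      using that by (auto simp: h_def nth_append add.commute)
    have m: "h p < h q" if "p < ?a \<or> ?b \<le> p" "q < ?a \<or> ?b \<le> q" "p < q" for p q
      using that by (auto simp: h_def)
    have "h l < length (xs1 @ xs2)" using r(4) *(4) by (auto simp: h_def)
    from ncD[OF assms(1) m[OF r(1,2) *(1)] m[OF r(2,3) *(2)] m[OF r(3,4) *(3)] this] *(5-7)
    show False unfolding e[OF r(1)] e[OF r(2)] e[OF r(3)] e[OF r(4)] by blast
  qed
qed

lemma nc_Nil: "nc []"
  by (simp add: nc_def)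

lemma nc_insert_fresh: "nc (ys @ zs) \<Longrightarrow> v \<notin> set (ys @ zs) \<Longrightarrow> nc (ys @ v # zs)"
proof -
  assume *: "nc (ys @ zs)" "v \<notin> set (ys @ zs)"
  have "nc [v]" unfolding nc_def by (metis length_Cons less_Suc0 list.size(3) not_less_zero less_trans)
  with nc_insert_disjoint[OF *(1) this] *(2) show ?thesis by simp
qed

text \<open>A crossing of the merged word that pairs a \<open>v\<close> with a \<open>w\<close>
  becomes a crossing of the original word when one of the two positions is replaced by the
  neighbour, at \<open>?m\<close> or \<open>Suc ?m\<close>, that carries the label of the
  other.\<close>

lemma nc_join:
  assumes nc: "nc (ys @ v # w # zs)" and vw: "v \<noteq> w"
  shows "nc (map (\<lambda>l. if l = w then v else l) (ys @ v # zs))"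
  unfolding nc_def
proof (intro allI impI, elim conjE, rule ccontr)
  let ?X = "ys @ v # w # zs" and ?f = "\<lambda>l. if l = w then v else l" and ?m = "length ys"
  let ?Y = "map ?f (ys @ v # zs)"
  fix i j k l
  assume *: "i < j" "j < k" "k < l" "l < length ?Y" "?Y ! i = ?Y ! k" "?Y ! j = ?Y ! l" "?Y ! i \<noteq> ?Y ! j"
  \<comment> \<open>The merged word is one letter shorter; \<open>h\<close> maps its positions back,
    skipping \<open>Suc ?m\<close>.\<close>
  define h where "h p = (if p \<le> ?m then p else Suc p)" for p
  have Y: "?Y ! p = ?f (?X ! h p)" if "p < length ?Y" for p
  proof (cases "p \<le> ?m")
    case True
    with that show ?thesis by (cases "p = ?m") (simp_all add: h_def nth_append)
  next
    case False
    then obtain r where "p = Suc (?m + r)" using less_imp_Suc_add not_le by blast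
    with that show ?thesis by (simp add: h_def nth_append)
  qed
  have hm: "h p < h q" if "p < q" for p q using that by (auto simp: h_def)
  have len4: "i < length ?Y" "j < length ?Y" "k < length ?Y" using *(1-4) by linarith+
  have hl: "h l < length ?X" using *(4) by (auto simp: h_def)
  have mv: "?X ! ?m = v" and mw: "?X ! Suc ?m = w" by (auto simp: nth_append)
  let ?L = "\<lambda>p. ?X ! h p"
  have eq: "?f (?L i) = ?f (?L k)" "?f (?L j) = ?f (?L l)" "?f (?L i) \<noteq> ?f (?L j)"
    using *(5-7) unfolding Y[OF len4(1)] Y[OF len4(2)] Y[OF len4(3)] Y[OF *(4)] by blast+
  have ord: "h i < h j" "h j < h k" "h k < h l" using hm *(1-3) by blast+
  have nX: "\<not> (p < q \<and> q < r \<and> r < s \<and> s < length ?X \<and> ?X ! p = ?X ! r \<and> ?X ! q = ?X ! s \<and> ?X ! p \<noteq> ?X ! q)" for p q r s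
    using ncD[OF nc] by blast
  have len: "Suc ?m < length ?X" by simp
  consider "?L i = ?L k" "?L j = ?L l" | "?L i \<noteq> ?L k" | "?L j \<noteq> ?L l" by blast
  then show False
  proof cases
    case 1
    then show False using nX[of "h i" "h j" "h k" "h l"] ord hl eq 1 by metis
  next
    case 2
    then have ac: "?L i = v \<and> ?L k = w \<or> ?L i = w \<and> ?L k = v" using eq by metis
    then have jl: "?L j \<noteq> v" "?L j \<noteq> w" "?L l \<noteq> v" "?L l \<noteq> w" "?L j = ?L l" using eq vw by metis+
    obtain mi where mi: "mi = ?m \<or> mi = Suc ?m" "?X ! mi = ?L i" using ac mv mw by metis
    obtain mk where mk: "mk = ?m \<or> mk = Suc ?m" "?X ! mk = ?L k" using ac mv mw by metis
    have ne: "h j \<noteq> ?m" "h j \<noteq> Suc ?m" "h l \<noteq> ?m" "h l \<noteq> Suc ?m" using jl mv mw by metis+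
    have nei: "?L i \<noteq> ?L j" "?L k \<noteq> ?L j" using jl ac by metis+
    show False
    \<comment> \<open>Either both neighbours lie strictly between \<open>h j\<close> and
      \<open>h l\<close>, or the one labelled like \<open>k\<close> lies outside; each case exhibits
      a crossing of \<open>?X\<close>.\<close>
    proof (cases "h j < ?m \<and> ?m < h l")
      case True
      then have "h j < mi" "mi < h l" using mi(1) ne True by linarith+
      then show False using nX[of "h i" "h j" mi "h l"] ord hl mi jl nei less_trans by metis
    next
      case False
      then have "mk < h j \<or> h l < mk" using mk(1) ne False by linarith
      then show False
      proof
        assume "mk < h j"
        then show False using nX[of mk "h j" "h k" "h l"] ord hl mk jl nei less_trans by metis
      next
        assume "h l < mk"
        moreover have "mk < length ?X" using mk(1) len by linarith
        ultimately show False using nX[of "h j" "h k" "h l" mk] ord hl mk jl nei less_trans by metis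
      qed
    qed
  next
    case 3
    then have ac: "?L j = v \<and> ?L l = w \<or> ?L j = w \<and> ?L l = v" using eq by metis
    then have ik: "?L i \<noteq> v" "?L i \<noteq> w" "?L k \<noteq> v" "?L k \<noteq> w" "?L i = ?L k" using eq vw by metis+
    obtain mj where mj: "mj = ?m \<or> mj = Suc ?m" "?X ! mj = ?L j" using ac mv mw by metis
    obtain ml where ml: "ml = ?m \<or> ml = Suc ?m" "?X ! ml = ?L l" using ac mv mw by metis
    have ne: "h i \<noteq> ?m" "h i \<noteq> Suc ?m" "h k \<noteq> ?m" "h k \<noteq> Suc ?m" using ik mv mw by metis+
    have nei: "?L i \<noteq> ?L j" "?L i \<noteq> ?L l" using ik ac by metis+
    show False
    proof (cases "h i < ?m \<and> ?m < h k")
      case True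
      then have "h i < ml" "ml < h k" using ml(1) ne True by linarith+
      then show False using nX[of "h i" ml "h k" "h l"] ord hl ml ik nei less_trans by metis
    next
      case False
      then have "mj < h i \<or> h k < mj" using mj(1) ne False by linarith
      then show False
      proof
        assume "mj < h i"
        then show False using nX[of mj "h i" "h j" "h k"] ord hl mj ik nei less_trans by metis
      next
        assume "h k < mj"
        moreover have "mj < length ?X" using mj(1) len by linarith
        ultimately show False using nX[of "h i" "h j" "h k" mj] ord hl mj ik nei less_trans by metis
      qed
    qed
  qed
qed

text \<open>Take two equal labels at minimal distance \<open>d\<close>. For \<open>d = 1\<close>
  they are a doubled letter. Otherwise the letter right after the first one is a singleton: a second
  occurrence inside the gap would be closer, one outside the gap would cross.\<close>

lemma nc_reducible:
  assumes nc: "nc xs" and ne: "xs \<noteq> []"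
  obtains (fresh) ys v zs where "xs = ys @ v # zs" "v \<notin> set (ys @ zs)"
  | (double) ys v zs where "xs = ys @ v # v # zs"
proof (cases "\<exists>u v. u < v \<and> v < length xs \<and> xs ! u = xs ! v")
  case False
  then have "distinct xs" by (auto simp: distinct_conv_nth) (metis linorder_neqE_nat)
  with ne show ?thesis by (cases xs) (auto intro: fresh[of "[]"])
next
  case True
  define D where "D d \<longleftrightarrow> 0 < d \<and> (\<exists>u. u + d < length xs \<and> xs ! u = xs ! (u + d))" for d
  define d where "d = (LEAST d. D d)"
  have "\<exists>d. D d" using True unfolding D_def by (metis less_imp_add_positive)
  then have Dd: "D d" and min: "\<And>d'. D d' \<Longrightarrow> d \<le> d'" unfolding d_def by (auto intro: LeastI_ex Least_le)
  obtain u where u: "u + d < length xs" "xs ! u = xs ! (u + d)" "0 < d" using Dd D_def by auto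
  show ?thesis
  proof (cases "d = 1")
    case True
    have "xs = take u xs @ xs ! u # xs ! Suc u # drop (Suc (Suc u)) xs"
      using u True by (metis Cons_nth_drop_Suc Suc_eq_plus1 Suc_lessD append_take_drop_id)
    then show ?thesis using double[of "take u xs" "xs ! u" "drop (Suc (Suc u)) xs"] u True by simp
  next
    case False
    then have d2: "d \<ge> 2" using u by simp
    let ?b = "xs ! Suc u"
    have only: "t = Suc u" if t: "t < length xs" "xs ! t = ?b" for t
    proof (rule ccontr)
      assume ne: "t \<noteq> Suc u"
      have nab: "xs ! u \<noteq> ?b"
      proof
        assume "xs ! u = ?b"
        then have "D 1" unfolding D_def using d2 u(1) by (intro conjI exI[of _ u]) auto
        then show False using min d2 by fastforce
      qed
      consider "t < u" | "t = u" | "Suc u < t" "t < u + d" | "t = u + d" | "u + d < t" using ne by linarith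
      then show False
      proof cases
        case 1 then show False using ncD[OF nc, of t u "Suc u" "u + d"] u t nab d2 by auto
      next
        case 3
        then have "D (t - Suc u)" unfolding D_def using t by (intro conjI exI[of _ "Suc u"]) auto
        then show False using min[of "t - Suc u"] 3 by simp
      next
        case 5 then show False using ncD[OF nc, of u "Suc u" "u + d" t] u t nab d2 by auto
      qed (use t u nab in auto)
    qed
    have "xs = take (Suc u) xs @ ?b # drop (Suc (Suc u)) xs"
      using u d2 by (simp add: id_take_nth_drop)
    moreover have "?b \<notin> set (take (Suc u) xs @ drop (Suc (Suc u)) xs)"
    proof
      assume "?b \<in> set (take (Suc u) xs @ drop (Suc (Suc u)) xs)"
      then consider i where "i < Suc u" "i < length xs" "xs ! i = ?b"
        | i where "i < length xs - Suc (Suc u)" "xs ! (Suc (Suc u) + i) = ?b"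
        by (auto simp: in_set_conv_nth)
      then show False
      proof cases
        case 1 then show False using only[of i] by simp
      next
        case (2 i) then show False using only[of "Suc (Suc u) + i"] by linarith
      qed
    qed
    ultimately show ?thesis using fresh by blast
  qed
qed

text \<open>The two reductions read backwards: insert a singleton, double a letter. In the later
  inductions the first step is answered by the unit of \<open>B\<close> and the second by the
  adjoint of the multiplication.\<close>

lemma nc_induct [consumes 1, case_names Nil fresh double]:
  assumes "nc xs" and "P []"
    and fresh: "\<And>ys v zs. nc (ys @ zs) \<Longrightarrow> P (ys @ zs) \<Longrightarrow> v \<notin> set (ys @ zs) \<Longrightarrow> P (ys @ v # zs)"
    and double: "\<And>ys v zs. nc (ys @ v # zs) \<Longrightarrow> P (ys @ v # zs) \<Longrightarrow> P (ys @ v # v # zs)"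
  shows "P xs"
  using assms(1)
proof (induction xs rule: length_induct)
  case (1 xs)
  show ?case
  proof (cases "xs = []")
    case False
    from "1.prems" False show ?thesis
    proof (cases rule: nc_reducible)
      case (fresh ys v zs)
      then show ?thesis using assms(3) 1 nc_delete[of ys v zs] by auto
    next
      case (double ys v zs)
      then show ?thesis using assms(4) 1 nc_delete[of ys v "v # zs"] by auto
    qed
  qed (use assms in simp)
qed

section \<open>Frobenius algebras in coordinates\<close>

definition sel :: "nat \<Rightarrow> nat list \<Rightarrow> 'i list \<Rightarrow> 'i list" where
  "sel v xs s = map snd (filter (\<lambda>p. fst p = v) (zip xs s))"

lemma sel_simps [simp]:
  "sel v [] s = []" "sel v xs [] = []"
  "sel v (x # xs) (a # s) = (if x = v then a # sel v xs s else sel v xs s)"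
  by (simp_all add: sel_def)

lemma sel_append: "length xs = length s \<Longrightarrow> sel v (xs @ ys) (s @ t) = sel v xs s @ sel v ys t"
  by (simp add: sel_def)

lemma sel_notin: "v \<notin> set xs \<Longrightarrow> sel v xs s = []"
  by (auto simp: sel_def filter_empty_conv dest: set_zip_leftD)

lemma set_sel: "set (sel v xs s) \<subseteq> set s"
  by (auto simp: sel_def dest: set_zip_rightD)

lemma sel_map_inj:
  assumes "inj_on f (insert v (set xs))"
  shows "sel (f v) (map f xs) s = sel v xs s"
  using assms
proof (induction xs arbitrary: s)
  case (Cons x xs)
  have "inj_on f (insert v (set xs))" using Cons.prems by (rule inj_on_subset) auto
  then show ?case using Cons.IH Cons.prems by (cases s) (auto simp: inj_on_def)
qed simp

lemma sel_rev: "length xs = length s \<Longrightarrow> sel v (rev xs) (rev s) = rev (sel v xs s)"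
  by (simp add: sel_def zip_rev rev_map rev_filter)

lemma sel_map: "sel v xs (map g s) = map g (sel v xs s)"
  by (simp add: sel_def zip_map2 filter_map o_def case_prod_unfold)

text \<open>The third assumption says that no \<open>w\<close> follows a \<open>v\<close>, so in the
  merged block the letters labelled \<open>w\<close> come first.\<close>

lemma sel_join:
  assumes "length ys = length s" "v \<noteq> w" "\<And>ys1 ys2. ys = ys1 @ v # ys2 \<Longrightarrow> w \<notin> set ys2"
  shows "sel v (map (\<lambda>l. if l = w then v else l) ys) s = sel w ys s @ sel v ys s"
  using assms
proof (induction ys s rule: list_induct2)
  case (Cons y ys a s)
  have IH: "sel v (map (\<lambda>l. if l = w then v else l) ys) s = sel w ys s @ sel v ys s"
  proof (rule Cons.IH[OF Cons.prems(1)])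
    fix ys1 ys2 assume "ys = ys1 @ v # ys2"
    then show "w \<notin> set ys2" using Cons.prems(2)[of "y # ys1" ys2] by simp
  qed
  show ?case
  proof (cases "y = v")
    case True
    then have "sel w ys s = []" using Cons.prems(2)[of "[]" ys] by (intro sel_notin) simp
    then show ?thesis using IH True Cons.prems(1) by simp
  qed (use IH in simp)
qed simp

lemma sel_map_other:
  "u \<noteq> v \<Longrightarrow> u \<noteq> w \<Longrightarrow> sel u (map (\<lambda>l. if l = w then v else l) ys) s = sel u ys s"
proof (induction ys arbitrary: s)
  case (Cons y ys)
  then show ?case by (cases s) auto
qed simp

text \<open>\<open>M x a c\<close> and \<open>e x\<close> are the coefficients at b_x of b_a b_c and
  of the unit, and b_a^* = \<open>lam a\<close> b_(bar a). \<open>special\<close> says that the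
  multiplication composed with its adjoint is \<delta>, \<open>cap\<close> computes \<psi>(b_a b_c),
  \<open>frobl\<close> and \<open>frobr\<close> give the adjoints of right and left multiplication
  by b_y, and \<open>M_hom\<close>, \<open>e_hom\<close> say that \<open>lam\<close> is a
  multiplicative grading, which comes from the modular group of \<psi>. The constants are real, so
  no conjugations appear.\<close>

locale frob =
  fixes I :: "'i set" and M :: "'i \<Rightarrow> 'i \<Rightarrow> 'i \<Rightarrow> real" and e :: "'i \<Rightarrow> real"
    and bar :: "'i \<Rightarrow> 'i" and lam :: "'i \<Rightarrow> real" and \<delta> :: real
  assumes fin [simp]: "finite I"
    and bar_in [simp]: "a \<in> I \<Longrightarrow> bar a \<in> I"
    and bar_bar [simp]: "a \<in> I \<Longrightarrow> bar (bar a) = a"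
    and lam_pos: "a \<in> I \<Longrightarrow> 0 < lam a"
    and lam_bar: "a \<in> I \<Longrightarrow> lam (bar a) = 1 / lam a"
    and assoc: "\<lbrakk>x \<in> I; a \<in> I; b \<in> I; c \<in> I\<rbrakk> \<Longrightarrow>
      (\<Sum>y\<in>I. M x y c * M y a b) = (\<Sum>y\<in>I. M x a y * M y b c)"
    and unitl: "\<lbrakk>x \<in> I; c \<in> I\<rbrakk> \<Longrightarrow> (\<Sum>a\<in>I. e a * M x a c) = (if x = c then 1 else 0)"
    and unitr: "\<lbrakk>x \<in> I; c \<in> I\<rbrakk> \<Longrightarrow> (\<Sum>a\<in>I. e a * M x c a) = (if x = c then 1 else 0)"
    and special: "\<lbrakk>x \<in> I; y \<in> I\<rbrakk> \<Longrightarrow>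
      (\<Sum>a\<in>I. \<Sum>c\<in>I. M x a c * M y a c) = (if x = y then \<delta> else 0)"
    and norm: "(\<Sum>x\<in>I. e x * e x) = 1"
    and cap: "\<lbrakk>a \<in> I; c \<in> I\<rbrakk> \<Longrightarrow> (\<Sum>x\<in>I. e x * M x a c) = (if c = bar a then lam a else 0)"
    and frobl: "\<lbrakk>a \<in> I; x \<in> I; y \<in> I\<rbrakk> \<Longrightarrow> lam y * M a x y = M x a (bar y)"
    and frobr: "\<lbrakk>c \<in> I; x \<in> I; y \<in> I\<rbrakk> \<Longrightarrow> M c y x = lam y * M x (bar y) c"
    and M_hom: "\<lbrakk>x \<in> I; a \<in> I; c \<in> I; M x a c \<noteq> 0\<rbrakk> \<Longrightarrow> lam x = lam a * lam c"
    and M_bar: "\<lbrakk>x \<in> I; a \<in> I; c \<in> I\<rbrakk> \<Longrightarrow> M (bar x) (bar c) (bar a) = M x a c"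
    and e_bar: "x \<in> I \<Longrightarrow> e (bar x) = e x"
    and e_hom: "\<lbrakk>x \<in> I; e x \<noteq> 0\<rbrakk> \<Longrightarrow> lam x = 1"
begin

text \<open>The coefficient of b_y in the product of the basis vectors listed in \<open>L\<close>;
  \<open>Psi\<close> below is then the state \<psi> on that product.\<close>

primrec mu :: "'i list \<Rightarrow> 'i \<Rightarrow> real" where
  "mu [] y = e y"
| "mu (a # L) y = (\<Sum>x\<in>I. M y a x * mu L x)"

definition Psi :: "'i list \<Rightarrow> real" where
  "Psi L = (\<Sum>y\<in>I. e y * mu L y)"

lemma sum_delta_I [simp]:
  "a \<in> I \<Longrightarrow> (\<Sum>x\<in>I. (if x = a then 1 else 0) * f x) = (f a :: real)"
  "a \<in> I \<Longrightarrow> (\<Sum>x\<in>I. (if a = x then 1 else 0) * f x) = (f a :: real)"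
  by (simp_all add: if_distrib if_distribR cong: if_cong)

lemma mu_single: "\<lbrakk>a \<in> I; y \<in> I\<rbrakk> \<Longrightarrow> mu [a] y = (if y = a then 1 else 0)"
  using unitr[of y a] by (simp add: mult.commute)

lemma mu_pair: "\<lbrakk>a \<in> I; c \<in> I; y \<in> I\<rbrakk> \<Longrightarrow> mu [a, c] y = M y a c"
proof -
  assume *: "a \<in> I" "c \<in> I" "y \<in> I"
  have "mu [a, c] y = (\<Sum>x\<in>I. M y a x * (if x = c then 1 else 0))"
    unfolding mu.simps(2)[of a "[c]"] using * mu_single by (intro sum.cong) auto
  then show ?thesis using * by (simp add: if_distrib cong: if_cong del: mu.simps)
qed

lemma mu_insert0:
  assumes "set K \<subseteq> I" "y \<in> I"
  shows "(\<Sum>x\<in>I. mu K x * mu (x # L) y) = mu (K @ L) y"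
  using assms
proof (induction K arbitrary: y)
  case Nil
  have "(\<Sum>x\<in>I. mu [] x * mu (x # L) y) = (\<Sum>x\<in>I. \<Sum>z\<in>I. e x * (M y x z * mu L z))"
    by (simp add: sum_distrib_left)
  also have "\<dots> = (\<Sum>z\<in>I. (\<Sum>x\<in>I. e x * M y x z) * mu L z)"
    by (subst sum.swap) (simp add: sum_distrib_right mult.assoc)
  also have "\<dots> = (\<Sum>z\<in>I. (if y = z then 1 else 0) * mu L z)"
    using Nil by (intro sum.cong) (simp_all add: unitl)
  finally show ?case using Nil by simp
next
  case (Cons a K)
  have "(\<Sum>x\<in>I. mu (a # K) x * mu (x # L) y)
      = (\<Sum>x\<in>I. \<Sum>w\<in>I. \<Sum>z\<in>I. (M y x z * M x a w) * (mu K w * mu L z))"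
    by (simp add: sum_product mult_ac)
  also have "\<dots> = (\<Sum>w\<in>I. \<Sum>z\<in>I. \<Sum>x\<in>I. (M y x z * M x a w) * (mu K w * mu L z))"
    by (subst sum.swap, rule sum.cong[OF refl], rule sum.swap)
  also have "\<dots> = (\<Sum>w\<in>I. \<Sum>z\<in>I. (\<Sum>v\<in>I. M y a v * M v w z) * (mu K w * mu L z))"
    using Cons.prems by (intro sum.cong refl) (simp add: sum_distrib_right[symmetric] assoc)
  also have "\<dots> = (\<Sum>w\<in>I. \<Sum>z\<in>I. \<Sum>v\<in>I. (M y a v * M v w z) * (mu K w * mu L z))"
    by (simp add: sum_distrib_right)
  also have "\<dots> = (\<Sum>w\<in>I. \<Sum>v\<in>I. \<Sum>z\<in>I. (M y a v * M v w z) * (mu K w * mu L z))"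
    by (rule sum.cong[OF refl], rule sum.swap)
  also have "\<dots> = (\<Sum>v\<in>I. \<Sum>w\<in>I. \<Sum>z\<in>I. (M y a v * M v w z) * (mu K w * mu L z))"
    by (rule sum.swap)
  also have "\<dots> = (\<Sum>v\<in>I. M y a v * (\<Sum>w\<in>I. mu K w * mu (w # L) v))"
    by (simp add: sum_distrib_left mult_ac)
  also have "\<dots> = (\<Sum>v\<in>I. M y a v * mu (K @ L) v)"
    using Cons by (intro sum.cong) auto
  finally show ?case by simp
qed

text \<open>Associativity: a partial product may be replaced by its expansion in the basis. The
  context \<open>L1\<close>, \<open>L2\<close> is what allows a block to be changed in its
  middle.\<close>

lemma mu_insert:
  assumes "set K \<subseteq> I" "y \<in> I"
  shows "(\<Sum>x\<in>I. mu K x * mu (L1 @ x # L2) y) = mu (L1 @ K @ L2) y"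
  using assms(2)
proof (induction L1 arbitrary: y)
  case Nil
  then show ?case using mu_insert0[OF assms(1)] by simp
next
  case (Cons a L1)
  have "(\<Sum>x\<in>I. mu K x * mu ((a # L1) @ x # L2) y)
      = (\<Sum>z\<in>I. M y a z * (\<Sum>x\<in>I. mu K x * mu (L1 @ x # L2) z))"
    by (simp add: sum_distrib_left, subst sum.swap) (simp add: mult_ac)
  also have "\<dots> = (\<Sum>z\<in>I. M y a z * mu (L1 @ K @ L2) z)"
    using Cons by (intro sum.cong) auto
  finally show ?case by simp
qed

lemma Psi_insert:
  assumes "set K \<subseteq> I"
  shows "(\<Sum>x\<in>I. mu K x * Psi (L1 @ x # L2)) = Psi (L1 @ K @ L2)"
proof -
  have "(\<Sum>x\<in>I. mu K x * Psi (L1 @ x # L2)) = (\<Sum>y\<in>I. e y * (\<Sum>x\<in>I. mu K x * mu (L1 @ x # L2) y))"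
    unfolding Psi_def by (simp add: sum_distrib_left, subst sum.swap) (simp add: mult_ac)
  also have "\<dots> = (\<Sum>y\<in>I. e y * mu (L1 @ K @ L2) y)"
    using mu_insert[OF assms] by (intro sum.cong) auto
  finally show ?thesis by (simp add: Psi_def)
qed

lemma Psi_Nil [simp]: "Psi [] = 1"
  using norm by (simp add: Psi_def)

lemma Psi_single:
  assumes "a \<in> I"
  shows "Psi [a] = e a"
proof -
  have "Psi [a] = (\<Sum>y\<in>I. if y = a then e y else 0)"
    unfolding Psi_def using assms by (intro sum.cong refl) (simp add: mu_single del: mu.simps)
  then show ?thesis using assms by simp
qed

lemma Psi_pair: "\<lbrakk>a \<in> I; c \<in> I\<rbrakk> \<Longrightarrow> Psi [a, c] = (if c = bar a then lam a else 0)"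
  using cap[of a c] by (simp add: Psi_def mu_pair del: mu.simps)

lemma Psi_unit: "(\<Sum>a\<in>I. e a * Psi (L1 @ a # L2)) = Psi (L1 @ L2)"
  using Psi_insert[of "[]" L1 L2] by simp

lemma Psi_comult:
  "\<lbrakk>a \<in> I; c \<in> I\<rbrakk> \<Longrightarrow> (\<Sum>x\<in>I. M x a c * Psi (L1 @ x # L2)) = Psi (L1 @ a # c # L2)"
  using Psi_insert[of "[a, c]" L1 L2] by (simp add: mu_pair del: mu.simps)

text \<open>Writing the two letters as a comultiplied one produces the multiplication composed with
  its adjoint, a closed loop worth \<delta>.\<close>

lemma Psi_mult:
  assumes "x \<in> I"
  shows "(\<Sum>a\<in>I. \<Sum>c\<in>I. M x a c * Psi (L1 @ a # c # L2)) = \<delta> * Psi (L1 @ x # L2)"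
proof -
  have "(\<Sum>a\<in>I. \<Sum>c\<in>I. M x a c * Psi (L1 @ a # c # L2))
      = (\<Sum>a\<in>I. \<Sum>c\<in>I. \<Sum>y\<in>I. M x a c * (M y a c * Psi (L1 @ y # L2)))"
    by (intro sum.cong refl) (simp add: Psi_comult[symmetric] sum_distrib_left)
  also have "\<dots> = (\<Sum>a\<in>I. \<Sum>y\<in>I. \<Sum>c\<in>I. M x a c * (M y a c * Psi (L1 @ y # L2)))"
    by (rule sum.cong[OF refl], rule sum.swap)
  also have "\<dots> = (\<Sum>y\<in>I. \<Sum>a\<in>I. \<Sum>c\<in>I. M x a c * (M y a c * Psi (L1 @ y # L2)))"
    by (rule sum.swap)
  also have "\<dots> = (\<Sum>y\<in>I. (\<Sum>a\<in>I. \<Sum>c\<in>I. M x a c * M y a c) * Psi (L1 @ y # L2))"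
    by (simp add: sum_distrib_right mult.assoc)
  also have "\<dots> = (\<Sum>y\<in>I. (if x = y then \<delta> else 0) * Psi (L1 @ y # L2))"
    using assms by (intro sum.cong refl) (simp add: special)
  finally show ?thesis using assms by (simp add: if_distrib if_distribR cong: if_cong)
qed

lemma Psi_expand_right:
  assumes "set K \<subseteq> I"
  shows "Psi (L @ K) = (\<Sum>y\<in>I. mu K y * Psi (L @ [y]))"
  using Psi_insert[OF assms, of L "[]"] by simp

lemma Psi_expand_left:
  assumes "set K \<subseteq> I"
  shows "Psi (K @ L) = (\<Sum>y\<in>I. mu K y * Psi (y # L))"
  using Psi_insert[OF assms, of "[]" L] by simp

lemma mu_snoc:
  assumes "set K \<subseteq> I" "a \<in> I" "y \<in> I"
  shows "mu (K @ [a]) y = (\<Sum>x\<in>I. mu K x * M y x a)"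
  using mu_insert0[OF assms(1,3), of "[a]"] assms(2,3) by (simp add: mu_pair del: mu.simps)

lemma sum_bar: "(\<Sum>x\<in>I. f (bar x)) = (\<Sum>x\<in>I. f x)"
  by (rule sum.reindex_bij_witness[of _ bar bar]) auto

text \<open>Expanding \<open>K\<close> to one basis vector \<open>y\<close> leaves only the pairing
  \<open>Psi [c, y]\<close>, which forces \<open>c = bar y\<close>; \<open>frobl\<close> turns the
  leg round, and its factor \<open>lam y\<close> cancels that of the pairing.\<close>

lemma mult_Psi_left:
  assumes "a \<in> I" "x \<in> I" "set K \<subseteq> I"
  shows "(\<Sum>c\<in>I. M x a c * Psi (c # K)) = mu (x # K) a"
proof -
  have "(\<Sum>c\<in>I. M x a c * Psi (c # K)) = (\<Sum>c\<in>I. \<Sum>y\<in>I. M x a c * (mu K y * Psi [c, y]))"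
    using Psi_expand_right[OF assms(3), of "[_]"] by (simp add: sum_distrib_left)
  also have "\<dots> = (\<Sum>y\<in>I. \<Sum>c\<in>I. M x a c * (mu K y * Psi [c, y]))"
    by (rule sum.swap)
  also have "\<dots> = (\<Sum>y\<in>I. M a x y * mu K y)"
  proof (intro sum.cong refl)
    fix y assume y: "y \<in> I"
    have "(\<Sum>c\<in>I. M x a c * (mu K y * Psi [c, y])) = (\<Sum>c\<in>I. if c = bar y then M x a c * (mu K y * lam c) else 0)"
      using y by (intro sum.cong refl) (auto simp: Psi_pair)
    also have "\<dots> = M x a (bar y) * (mu K y * lam (bar y))" using y by simp
    also have "\<dots> = (lam y * M a x y) * (mu K y * (1 / lam y))"
      by (simp add: frobl[OF assms(1,2) y] lam_bar[OF y])
    also have "\<dots> = M a x y * mu K y"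
      using lam_pos[OF y] by simp
    finally show "(\<Sum>c\<in>I. M x a c * (mu K y * Psi [c, y])) = M a x y * mu K y" .
  qed
  finally show ?thesis by simp
qed

lemma mult_Psi_right:
  assumes "c \<in> I" "x \<in> I" "set K \<subseteq> I"
  shows "(\<Sum>a\<in>I. M x a c * Psi (K @ [a])) = mu (K @ [x]) c"
proof -
  have "(\<Sum>a\<in>I. M x a c * Psi (K @ [a])) = (\<Sum>a\<in>I. \<Sum>y\<in>I. M x a c * (mu K y * Psi [y, a]))"
    using Psi_expand_left[OF assms(3), of "[_]"] by (simp add: sum_distrib_left)
  also have "\<dots> = (\<Sum>y\<in>I. \<Sum>a\<in>I. M x a c * (mu K y * Psi [y, a]))"
    by (rule sum.swap)
  also have "\<dots> = (\<Sum>y\<in>I. mu K y * M c y x)"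
  proof (intro sum.cong refl)
    fix y assume y: "y \<in> I"
    have "(\<Sum>a\<in>I. M x a c * (mu K y * Psi [y, a])) = (\<Sum>a\<in>I. if a = bar y then M x a c * (mu K y * lam y) else 0)"
      using y by (intro sum.cong refl) (auto simp: Psi_pair)
    also have "\<dots> = M x (bar y) c * (mu K y * lam y)" using y by simp
    also have "\<dots> = mu K y * M c y x" using frobr[OF assms(1,2) y] by simp
    finally show "(\<Sum>a\<in>I. M x a c * (mu K y * Psi [y, a])) = mu K y * M c y x" .
  qed
  finally show ?thesis using mu_snoc[OF assms(3,2,1)] by simp
qed

text \<open>The second block starts with the letter being merged, so its other letters can be
  inserted right behind \<open>x\<close>. In \<open>Psi_join_right\<close> the first block ends with
  that letter. For neighbours in a noncrossing word one of the two situations always occurs.\<close>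

lemma Psi_join_left:
  assumes "x \<in> I" "set B \<subseteq> I"
  shows "(\<Sum>a\<in>I. \<Sum>c\<in>I. M x a c * (Psi (A @ a # A') * Psi (c # B))) = Psi (A @ x # B @ A')"
proof -
  have "(\<Sum>a\<in>I. \<Sum>c\<in>I. M x a c * (Psi (A @ a # A') * Psi (c # B)))
      = (\<Sum>a\<in>I. (\<Sum>c\<in>I. M x a c * Psi (c # B)) * Psi (A @ a # A'))"
    by (simp add: sum_distrib_left sum_distrib_right mult_ac)
  also have "\<dots> = (\<Sum>a\<in>I. mu (x # B) a * Psi (A @ a # A'))"
    using assms by (intro sum.cong refl) (simp only: mult_Psi_left)
  finally show ?thesis using Psi_insert[of "x # B" A A'] assms by simp
qed

lemma Psi_join_right:
  assumes "x \<in> I" "set A \<subseteq> I"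
  shows "(\<Sum>a\<in>I. \<Sum>c\<in>I. M x a c * (Psi (A @ [a]) * Psi (B @ c # B'))) = Psi (B @ A @ x # B')"
proof -
  have "(\<Sum>a\<in>I. \<Sum>c\<in>I. M x a c * (Psi (A @ [a]) * Psi (B @ c # B')))
      = (\<Sum>c\<in>I. (\<Sum>a\<in>I. M x a c * Psi (A @ [a])) * Psi (B @ c # B'))"
    by (subst sum.swap) (simp add: sum_distrib_left sum_distrib_right mult_ac)
  also have "\<dots> = (\<Sum>c\<in>I. mu (A @ [x]) c * Psi (B @ c # B'))"
    using assms by (intro sum.cong refl) (simp only: mult_Psi_right)
  finally show ?thesis using Psi_insert[of "A @ [x]" B B'] assms by simp
qed

lemma mu_hom:
  assumes "set L \<subseteq> I" "y \<in> I" "mu L y \<noteq> 0"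
  shows "lam y = prod_list (map lam L)"
  using assms
proof (induction L arbitrary: y)
  case (Cons a L)
  then obtain x where "x \<in> I" "M y a x * mu L x \<noteq> 0"
    by (metis (no_types, lifting) mu.simps(2) sum.neutral)
  then show ?case using Cons M_hom[of y a x] by auto
qed (simp add: e_hom)

text \<open>The unit has weight 1 and multiplication respects the weights, so \<psi> vanishes on
  products of any other weight.\<close>

lemma Psi_hom:
  assumes "set L \<subseteq> I" "Psi L \<noteq> 0"
  shows "prod_list (map lam L) = 1"
proof -
  obtain y where "y \<in> I" "e y * mu L y \<noteq> 0"
    using assms(2) unfolding Psi_def by (metis (no_types, lifting) sum.neutral)
  then show ?thesis using mu_hom[OF assms(1), of y] e_hom[of y] by auto
qed

text \<open>The linear map taking b_a to b_(bar a) is an antiautomorphism by \<open>M_bar\<close>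
  and \<open>e_bar\<close>. No weights appear because it is linear and differs from the star by
  exactly these weights.\<close>

lemma mu_bar:
  assumes "set L \<subseteq> I" "y \<in> I"
  shows "mu (rev (map bar L)) (bar y) = mu L y"
  using assms
proof (induction L arbitrary: y)
  case (Cons a L)
  have "set (rev (map bar L)) \<subseteq> I" using Cons.prems by auto
  then have "mu (rev (map bar (a # L))) (bar y) = (\<Sum>x\<in>I. mu (rev (map bar L)) x * M (bar y) x (bar a))"
    using mu_snoc[of "rev (map bar L)" "bar a" "bar y"] Cons.prems by simp
  also have "\<dots> = (\<Sum>x\<in>I. mu (rev (map bar L)) (bar x) * M (bar y) (bar x) (bar a))"
    by (rule sum_bar[symmetric])
  also have "\<dots> = (\<Sum>x\<in>I. M y a x * mu L x)"
    using Cons by (intro sum.cong refl) (auto simp: M_bar)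
  finally show ?case by simp
qed (simp add: e_bar)

lemma Psi_bar:
  assumes "set L \<subseteq> I"
  shows "Psi (rev (map bar L)) = Psi L"
proof -
  have "Psi (rev (map bar L)) = (\<Sum>y\<in>I. e (bar y) * mu (rev (map bar L)) (bar y))"
    unfolding Psi_def by (rule sum_bar[symmetric])
  also have "\<dots> = Psi L"
    unfolding Psi_def using assms by (intro sum.cong refl) (simp add: mu_bar e_bar)
  finally show ?thesis .
qed

end

section \<open>Vectors attached to noncrossing partitions\<close>

lemma tuples_0 [simp]: "tuples I 0 = {[]}"
  by (auto simp: tuples_def)

lemma tuples_length: "s \<in> tuples I k \<Longrightarrow> length s = k"
  by (simp add: tuples_def)

lemma tuples_set: "s \<in> tuples I k \<Longrightarrow> set s \<subseteq> I"
  by (simp add: tuples_def)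

lemma tuples_append [simp]:
  "length s = k \<Longrightarrow> s @ t \<in> tuples I (k + l) \<longleftrightarrow> s \<in> tuples I k \<and> t \<in> tuples I l"
  by (auto simp: tuples_def)

lemma tuples_appendI [intro]: "s \<in> tuples I k \<Longrightarrow> t \<in> tuples I l \<Longrightarrow> s @ t \<in> tuples I (k + l)"
  by (auto simp: tuples_def)

lemma tuples_Cons [simp]: "a # s \<in> tuples I (Suc k) \<longleftrightarrow> a \<in> I \<and> s \<in> tuples I k"
  by (auto simp: tuples_def)

lemma finite_tuples [simp]: "finite I \<Longrightarrow> finite (tuples I k)"
  unfolding tuples_def by (rule finite_lists_length_eq)

lemma tuples_splitE:
  assumes "s \<in> tuples I (k + l)"
  obtains s1 s2 where "s = s1 @ s2" "s1 \<in> tuples I k" "s2 \<in> tuples I l"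
proof -
  have "s = take k s @ drop k s" "take k s \<in> tuples I k" "drop k s \<in> tuples I l"
    using assms by (auto simp: tuples_def dest: in_set_takeD in_set_dropD)
  then show ?thesis using that by blast
qed

lemma tuples_SucE:
  assumes "s \<in> tuples I (Suc k)"
  obtains a t where "s = a # t" "a \<in> I" "t \<in> tuples I k"
  using assms by (cases s) (auto simp: tuples_def)

lemma sum_tuples_append:
  "(\<Sum>s\<in>tuples I (k + l). f s) = (\<Sum>s\<in>tuples I k. \<Sum>t\<in>tuples I l. f (s @ t))"
proof -
  have "(\<Sum>s\<in>tuples I k. \<Sum>t\<in>tuples I l. f (s @ t)) = (\<Sum>(s, t)\<in>tuples I k \<times> tuples I l. f (s @ t))"
    by (rule sum.cartesian_product)
  also have "\<dots> = (\<Sum>s\<in>tuples I (k + l). f s)"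
    by (rule sum.reindex_bij_witness[of _ "\<lambda>s. (take k s, drop k s)" "\<lambda>(s, t). s @ t"])
       (auto simp: tuples_def dest: in_set_takeD in_set_dropD)
  finally show ?thesis by simp
qed

lemma sum_tuples_1: "(\<Sum>s\<in>tuples I (Suc 0). f s) = (\<Sum>a\<in>I. f [a])"
  by (rule sum.reindex_bij_witness[of _ "\<lambda>a. [a]" hd]) (auto simp: tuples_def length_Suc_conv)

lemma sum_tuples_Cons: "(\<Sum>s\<in>tuples I (Suc k). f s) = (\<Sum>a\<in>I. \<Sum>t\<in>tuples I k. f (a # t))"
  using sum_tuples_append[of f I "Suc 0" k] by (simp add: sum_tuples_1)

lemma sum_tuples_snoc: "(\<Sum>s\<in>tuples I (Suc k). f s) = (\<Sum>t\<in>tuples I k. \<Sum>a\<in>I. f (t @ [a]))"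
  using sum_tuples_append[of f I k "Suc 0"] by (simp add: sum_tuples_1)

text \<open>Each excluded configuration would cross at the neighbours \<open>v w\<close>. Together
  these facts fix the order of the letters in the merged block and show that \<open>w\<close> begins
  or \<open>v\<close> ends at the junction.\<close>

lemma nc_adjacent:
  assumes nc: "nc (ys @ v # w # zs)" and vw: "v \<noteq> w"
  shows "ys = ys1 @ v # ys2 \<Longrightarrow> w \<notin> set ys2" "zs = zs1 @ v # zs2 \<Longrightarrow> w \<notin> set zs2"
    "w \<notin> set ys \<or> v \<notin> set zs"
proof -
  let ?X = "ys @ v # w # zs" and ?n = "length ys"
  have m: "?X ! ?n = v" "?X ! Suc ?n = w" by (simp_all add: nth_append)
  show "w \<notin> set ys2" if ys: "ys = ys1 @ v # ys2"
  proof
    assume "w \<in> set ys2"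
    then obtain q where q: "q < length ys2" "ys2 ! q = w" by (auto simp: in_set_conv_nth)
    let ?i = "length ys1" and ?j = "Suc (length ys1 + q)"
    have "?X ! ?i = v" "?X ! ?j = w" using q ys by (simp_all add: nth_append)
    then show False using ncD[OF nc, of ?i ?j ?n "Suc ?n"] m q(1) ys vw by simp
  qed
  show "w \<notin> set zs2" if zs: "zs = zs1 @ v # zs2"
  proof
    assume "w \<in> set zs2"
    then obtain q where q: "q < length zs2" "zs2 ! q = w" by (auto simp: in_set_conv_nth)
    let ?i = "?n + Suc (Suc (length zs1))" and ?j = "?n + Suc (Suc (Suc (length zs1 + q)))"
    have "?X ! ?i = v" "?X ! ?j = w" using q zs by (simp_all add: nth_append)
    then show False using ncD[OF nc, of ?n "Suc ?n" ?i ?j] m q(1) zs vw by simp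
  qed
  show "w \<notin> set ys \<or> v \<notin> set zs"
  proof (rule ccontr)
    assume "\<not> (w \<notin> set ys \<or> v \<notin> set zs)"
    then obtain p q where p: "p < length ys" "ys ! p = w" and q: "q < length zs" "zs ! q = v"
      by (auto simp: in_set_conv_nth)
    let ?j = "?n + Suc (Suc q)"
    have "?X ! p = w" "?X ! ?j = v" using p q by (simp_all add: nth_append)
    then show False using ncD[OF nc, of p ?n "Suc ?n" ?j] m p(1) q(1) vw by simp
  qed
qed

section \<open>Tensors of label lists and the operations of \<open>B\<close> on them\<close>

context frob
begin

text \<open>One factor \<psi> of an ordered product per block: the coefficients of the vector that
  belongs to a partition with lower points only.\<close>

definition tv :: "nat list \<Rightarrow> 'i list \<Rightarrow> real" where
  "tv xs s = (\<Prod>v\<in>set xs. Psi (sel v xs s))"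

text \<open>Labels that do not occur contribute \<open>Psi [] = 1\<close>, so tensors with different
  labels can be compared as products over a common label set.\<close>

lemma tv_superset:
  assumes "finite L" "set xs \<subseteq> L"
  shows "tv xs s = (\<Prod>v\<in>L. Psi (sel v xs s))"
  unfolding tv_def using assms by (intro prod.mono_neutral_left) (auto simp: sel_notin)

lemma tv_factor:
  assumes "finite L" "set xs \<subseteq> L" "v \<in> L"
  shows "tv xs s = Psi (sel v xs s) * (\<Prod>u\<in>L - {v}. Psi (sel u xs s))"
  using tv_superset[OF assms(1,2)] prod.remove[OF assms(1,3)] by simp

text \<open>Only the block \<open>v\<close> sees the inserted letters; the second factor does not
  depend on \<open>t\<close>, so linear operations on these letters pass to \<open>Psi\<close>. With
  \<open>vs = []\<close> the formula also covers the word from which they were removed.\<close>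

lemma tv_cut:
  assumes "length ys = length s1" "length zs = length s2" "length vs = length t" "set vs \<subseteq> {v}"
  shows "tv (ys @ vs @ zs) (s1 @ t @ s2) = Psi (sel v ys s1 @ t @ sel v zs s2) *
    (\<Prod>u\<in>set (ys @ v # zs) - {v}. Psi (sel u (ys @ zs) (s1 @ s2)))"
proof -
  have t: "sel v vs t = t" using assms(3,4) by (induction vs t rule: list_induct2) auto
  have u: "sel u vs t = []" if "u \<noteq> v" for u using that assms(4) by (intro sel_notin) auto
  have "tv (ys @ vs @ zs) (s1 @ t @ s2) = Psi (sel v (ys @ vs @ zs) (s1 @ t @ s2)) *
    (\<Prod>u\<in>set (ys @ v # zs) - {v}. Psi (sel u (ys @ vs @ zs) (s1 @ t @ s2)))"
    using assms(4) by (intro tv_factor) auto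
  then show ?thesis using assms t u by (simp add: sel_append)
qed

lemma tv_unit:
  assumes "length ys = length s1" "length zs = length s2"
  shows "(\<Sum>a\<in>I. e a * tv (ys @ v # zs) (s1 @ a # s2)) = tv (ys @ zs) (s1 @ s2)"
proof -
  let ?R = "\<Prod>u\<in>set (ys @ v # zs) - {v}. Psi (sel u (ys @ zs) (s1 @ s2))"
  have "(\<Sum>a\<in>I. e a * tv (ys @ v # zs) (s1 @ a # s2))
      = (\<Sum>a\<in>I. e a * Psi (sel v ys s1 @ a # sel v zs s2)) * ?R"
    using tv_cut[OF assms, of "[v]" "[_]" v] by (simp add: sum_distrib_right mult.assoc)
  also have "\<dots> = tv (ys @ zs) (s1 @ s2)"
    using tv_cut[OF assms, of "[]" "[]" v] by (simp add: Psi_unit)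
  finally show ?thesis .
qed

lemma tv_fresh:
  assumes "length ys = length s1" "length zs = length s2" "v \<notin> set (ys @ zs)" "a \<in> I"
  shows "tv (ys @ v # zs) (s1 @ a # s2) = e a * tv (ys @ zs) (s1 @ s2)"
  using tv_cut[OF assms(1,2), of "[v]" "[a]" v] tv_cut[OF assms(1,2), of "[]" "[]" v] assms(3,4)
  by (simp add: sel_notin Psi_single)

lemma tv_comult:
  assumes "length ys = length s1" "length zs = length s2" "a \<in> I" "c \<in> I"
  shows "(\<Sum>x\<in>I. M x a c * tv (ys @ v # zs) (s1 @ x # s2)) = tv (ys @ v # v # zs) (s1 @ a # c # s2)"
proof -
  let ?R = "\<Prod>u\<in>set (ys @ v # zs) - {v}. Psi (sel u (ys @ zs) (s1 @ s2))"
  have "(\<Sum>x\<in>I. M x a c * tv (ys @ v # zs) (s1 @ x # s2))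
      = (\<Sum>x\<in>I. M x a c * Psi (sel v ys s1 @ x # sel v zs s2)) * ?R"
    using tv_cut[OF assms(1,2), of "[v]" "[_]" v] by (simp add: sum_distrib_right mult.assoc)
  also have "\<dots> = tv (ys @ v # v # zs) (s1 @ a # c # s2)"
    using tv_cut[OF assms(1,2), of "[v, v]" "[a, c]" v] assms by (simp add: Psi_comult)
  finally show ?thesis .
qed

lemma tv_mult:
  assumes "length ys = length s1" "length zs = length s2" "x \<in> I"
  shows "(\<Sum>a\<in>I. \<Sum>c\<in>I. M x a c * tv (ys @ v # v # zs) (s1 @ a # c # s2)) = \<delta> * tv (ys @ v # zs) (s1 @ x # s2)"
proof -
  let ?R = "\<Prod>u\<in>set (ys @ v # zs) - {v}. Psi (sel u (ys @ zs) (s1 @ s2))"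
  have "(\<Sum>a\<in>I. \<Sum>c\<in>I. M x a c * tv (ys @ v # v # zs) (s1 @ a # c # s2))
      = (\<Sum>a\<in>I. \<Sum>c\<in>I. M x a c * Psi (sel v ys s1 @ a # c # sel v zs s2)) * ?R"
    using tv_cut[OF assms(1,2), of "[v, v]" "[_, _]" v] by (simp add: sum_distrib_right mult.assoc)
  also have "\<dots> = \<delta> * tv (ys @ v # zs) (s1 @ x # s2)"
    using tv_cut[OF assms(1,2), of "[v]" "[x]" v] assms by (simp add: Psi_mult)
  finally show ?thesis .
qed

text \<open>Only the two blocks at the junction matter. By \<open>sel_join\<close> the merged block
  reads \<open>?B\<close>, \<open>?A\<close>, \<open>x\<close>, \<open>?B'\<close>,
  \<open>?A'\<close>; noncrossing makes \<open>?A'\<close> or \<open>?B\<close> empty, and then one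
  of the two Frobenius laws \<open>Psi_join_right\<close> and \<open>Psi_join_left\<close>
  applies.\<close>

lemma tv_join:
  assumes len: "length ys = length s1" "length zs = length s2" and x: "x \<in> I"
    and s: "set s1 \<subseteq> I" "set s2 \<subseteq> I" and nc: "nc (ys @ v # w # zs)" and vw: "v \<noteq> w"
  shows "(\<Sum>a\<in>I. \<Sum>c\<in>I. M x a c * tv (ys @ v # w # zs) (s1 @ a # c # s2)) =
    tv (map (\<lambda>l. if l = w then v else l) (ys @ v # zs)) (s1 @ x # s2)"
proof -
  let ?f = "\<lambda>l. if l = w then v else l"
  let ?L = "set (ys @ v # w # zs)"
  let ?A = "sel v ys s1" and ?A' = "sel v zs s2" and ?B = "sel w ys s1" and ?B' = "sel w zs s2"
  let ?R = "\<Prod>u\<in>?L - {v} - {w}. Psi (sel u (ys @ zs) (s1 @ s2))"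
  have split: "tv xs t = Psi (sel v xs t) * Psi (sel w xs t) * (\<Prod>u\<in>?L - {v} - {w}. Psi (sel u xs t))"
    if "set xs \<subseteq> ?L" for xs t
  proof -
    have "tv xs t = Psi (sel v xs t) * (\<Prod>u\<in>?L - {v}. Psi (sel u xs t))"
      using that by (intro tv_factor) auto
    also have "(\<Prod>u\<in>?L - {v}. Psi (sel u xs t)) = Psi (sel w xs t) * (\<Prod>u\<in>?L - {v} - {w}. Psi (sel u xs t))"
      using vw by (intro prod.remove) auto
    finally show ?thesis by (simp add: mult.assoc)
  qed
  have l: "tv (ys @ v # w # zs) (s1 @ a # c # s2) = Psi (?A @ a # ?A') * Psi (?B @ c # ?B') * ?R" for a c
  proof -
    have "(\<Prod>u\<in>?L - {v} - {w}. Psi (sel u (ys @ v # w # zs) (s1 @ a # c # s2))) = ?R"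
      using len by (intro prod.cong refl) (auto simp: sel_append)
    then show ?thesis using split[of "ys @ v # w # zs"] len vw by (simp add: sel_append)
  qed
  have r: "tv (map ?f (ys @ v # zs)) (s1 @ x # s2) = Psi (?B @ ?A @ x # ?B' @ ?A') * ?R"
  proof -
    have "(\<Prod>u\<in>?L - {v} - {w}. Psi (sel u (map ?f (ys @ v # zs)) (s1 @ x # s2))) = ?R"
      using len vw by (intro prod.cong refl) (auto simp: sel_append sel_map_other)
    moreover have "sel w (map ?f (ys @ v # zs)) (s1 @ x # s2) = []"
      using vw by (intro sel_notin) auto
    moreover have "sel v (map ?f ys) s1 = ?B @ ?A" "sel v (map ?f zs) s2 = ?B' @ ?A'"
      using sel_join[OF len(1) vw] sel_join[OF len(2) vw] nc_adjacent(1,2)[OF nc vw] by blast+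
    moreover have sub: "set (map ?f (ys @ v # zs)) \<subseteq> ?L" by auto
    ultimately show ?thesis unfolding split[OF sub] using len vw by (simp add: sel_append)
  qed
  have sub: "set ?A \<subseteq> I" "set ?B' \<subseteq> I" using set_sel s by fast+
  have "(\<Sum>a\<in>I. \<Sum>c\<in>I. M x a c * (Psi (?A @ a # ?A') * Psi (?B @ c # ?B'))) = Psi (?B @ ?A @ x # ?B' @ ?A')"
  proof (cases "w \<in> set ys")
    case True
    then have "?A' = []" using nc_adjacent(3)[OF nc vw] by (intro sel_notin) auto
    then show ?thesis using Psi_join_right[OF x sub(1)] by simp
  next
    case False
    then have "?B = []" by (rule sel_notin)
    then show ?thesis using Psi_join_left[OF x sub(2)] by simp
  qed
  then have "(\<Sum>a\<in>I. \<Sum>c\<in>I. M x a c * (Psi (?A @ a # ?A') * Psi (?B @ c # ?B'))) * ?R = Psi (?B @ ?A @ x # ?B' @ ?A') * ?R"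
    by simp
  then show ?thesis by (simp only: l r sum_distrib_right mult.assoc)
qed

lemma tv_map_inj:
  assumes "inj f"
  shows "tv (map f xs) s = tv xs s"
proof -
  have "tv (map f xs) s = (\<Prod>v\<in>f ` set xs. Psi (sel v (map f xs) s))"
    by (simp add: tv_def)
  also have "\<dots> = (\<Prod>v\<in>set xs. Psi (sel (f v) (map f xs) s))"
    using assms by (intro prod.reindex_cong[of f]) (auto simp: inj_on_def inj_def)
  also have "\<dots> = tv xs s"
    unfolding tv_def
    by (intro prod.cong refl arg_cong[where f = Psi] sel_map_inj inj_on_subset[OF assms subset_UNIV])
  finally show ?thesis .
qed

lemma tv_bar:
  assumes "length xs = length s" "set s \<subseteq> I"
  shows "tv (rev xs) (rev (map bar s)) = tv xs s"
  unfolding tv_def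
proof (rule prod.cong)
  fix v
  have "set (sel v xs s) \<subseteq> I" using set_sel assms by fast
  moreover have "sel v (rev xs) (rev (map bar s)) = rev (map bar (sel v xs s))"
    using assms by (simp add: sel_rev sel_map)
  ultimately show "Psi (sel v (rev xs) (rev (map bar s))) = Psi (sel v xs s)"
    by (simp add: Psi_bar)
qed simp

lemma tv_disjoint:
  assumes len: "length xs1 = length s1" "length xs2 = length s2" "length ys = length t"
    and disj: "set ys \<inter> (set xs1 \<union> set xs2) = {}"
  shows "tv (xs1 @ ys @ xs2) (s1 @ t @ s2) = tv (xs1 @ xs2) (s1 @ s2) * tv ys t"
proof -
  have "tv (xs1 @ ys @ xs2) (s1 @ t @ s2)
      = (\<Prod>v\<in>set (xs1 @ xs2) \<union> set ys. Psi (sel v (xs1 @ ys @ xs2) (s1 @ t @ s2)))"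
    by (rule tv_superset) auto
  also have "\<dots> = (\<Prod>v\<in>set (xs1 @ xs2). Psi (sel v (xs1 @ ys @ xs2) (s1 @ t @ s2))) *
      (\<Prod>v\<in>set ys. Psi (sel v (xs1 @ ys @ xs2) (s1 @ t @ s2)))"
    using disj by (intro prod.union_disjoint) auto
  also have "(\<Prod>v\<in>set (xs1 @ xs2). Psi (sel v (xs1 @ ys @ xs2) (s1 @ t @ s2))) = tv (xs1 @ xs2) (s1 @ s2)"
    unfolding tv_def
  proof (intro prod.cong refl)
    fix v assume "v \<in> set (xs1 @ xs2)"
    then have "sel v ys t = []" using disj by (intro sel_notin) auto
    then show "Psi (sel v (xs1 @ ys @ xs2) (s1 @ t @ s2)) = Psi (sel v (xs1 @ xs2) (s1 @ s2))"
      using len by (simp add: sel_append)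
  qed
  also have "(\<Prod>v\<in>set ys. Psi (sel v (xs1 @ ys @ xs2) (s1 @ t @ s2))) = tv ys t"
    unfolding tv_def
  proof (intro prod.cong refl)
    fix v assume "v \<in> set ys"
    then have "sel v xs1 s1 = []" "sel v xs2 s2 = []" using disj by (auto intro!: sel_notin)
    then show "Psi (sel v (xs1 @ ys @ xs2) (s1 @ t @ s2)) = Psi (sel v ys t)"
      using len by (simp add: sel_append)
  qed
  finally show ?thesis .
qed

abbreviation lamp :: "'i list \<Rightarrow> real" where
  "lamp s \<equiv> prod_list (map lam s)"

lemma lamp_pos: "set s \<subseteq> I \<Longrightarrow> 0 < lamp s"
  by (induction s) (auto simp: lam_pos)

lemma lamp_bar: "set s \<subseteq> I \<Longrightarrow> lamp (map bar s) = 1 / lamp s"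
  by (induction s) (auto simp: lam_bar)

lemma lamp_rev: "lamp (rev s) = lamp s"
  by (induction s) (auto simp: mult.commute)

text \<open>The weight of a word is the product of the weights of its blocks, and by
  \<open>Psi_hom\<close> each of these is 1 when no factor vanishes.\<close>

lemma tv_hom:
  assumes "length xs = length s" "set s \<subseteq> I" "tv xs s \<noteq> 0"
  shows "lamp s = 1"
proof -
  have "(\<Prod>v\<in>L. prod_list (map lam (sel v xs s))) = lamp s" if "finite L" "set xs \<subseteq> L" for L
    using assms(1) that(2)
  proof (induction xs s rule: list_induct2)
    case (Cons x xs a s)
    have IH: "(\<Prod>v\<in>L. lamp (sel v xs s)) = lamp s" and x: "x \<in> L"
      using Cons.IH Cons.prems by auto
    have "(\<Prod>v\<in>L. lamp (sel v (x # xs) (a # s))) = (\<Prod>v\<in>L. (if v = x then lam a else 1) * lamp (sel v xs s))"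
      by (intro prod.cong) auto
    also have "\<dots> = (\<Prod>v\<in>L. if v = x then lam a else 1) * (\<Prod>v\<in>L. lamp (sel v xs s))"
      by (rule prod.distrib)
    also have "(\<Prod>v\<in>L. if v = x then lam a else 1) = lam a"
      using x that(1) by (simp only: prod.delta if_True)
    finally show ?case using IH by simp
  qed simp
  then have "(\<Prod>v\<in>set xs. lamp (sel v xs s)) = lamp s" by blast
  moreover have "lamp (sel v xs s) = 1" if "v \<in> set xs" for v
  proof (rule Psi_hom)
    show "set (sel v xs s) \<subseteq> I" using set_sel assms(2) by fast
    show "Psi (sel v xs s) \<noteq> 0" using assms(3) that unfolding tv_def by auto
  qed
  then have "(\<Prod>v\<in>set xs. lamp (sel v xs s)) = 1" by (intro prod.neutral ballI)
  ultimately show ?thesis by simp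
qed

end

lemma length_splitE:
  assumes "length xs = j + Suc l"
  obtains ys v zs where "xs = ys @ v # zs" "length ys = j" "length zs = l"
proof -
  have "xs = take j xs @ xs ! j # drop (Suc j) xs" using assms by (simp add: id_take_nth_drop)
  then show ?thesis using that[of "take j xs" "xs ! j" "drop (Suc j) xs"] assms by simp
qed

lemma length_append_splitE:
  assumes "length xs = j + l"
  obtains ys zs where "xs = ys @ zs" "length ys = j" "length zs = l"
  using that[of "take j xs" "drop j xs"] assms by simp

section \<open>The span of the noncrossing tensors\<close>

context frob
begin

definition tvc :: "nat list \<Rightarrow> 'i list \<Rightarrow> complex" where
  "tvc xs s = (if s \<in> tuples I (length xs) then complex_of_real (tv xs s) else 0)"

text \<open>Adding one multiple of a generator at a time makes linear statements accessible to rule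
  induction.\<close>

inductive_set FV :: "nat \<Rightarrow> ('i list \<Rightarrow> complex) set" for m where
  zero: "(\<lambda>s. 0) \<in> FV m"
| step: "\<lbrakk>f \<in> FV m; nc xs; length xs = m\<rbrakk> \<Longrightarrow> (\<lambda>s. f s + c * tvc xs s) \<in> FV m"

lemma FV_outside: "f \<in> FV m \<Longrightarrow> s \<notin> tuples I m \<Longrightarrow> f s = 0"
  by (induction rule: FV.induct) (auto simp: tvc_def)

lemma FV_tvc: "nc xs \<Longrightarrow> length xs = m \<Longrightarrow> tvc xs \<in> FV m"
  using FV.step[OF FV.zero, of xs m 1] by simp

lemma FV_add_scale:
  assumes "f \<in> FV m" "g \<in> FV m"
  shows "(\<lambda>s. f s + c * g s) \<in> FV m"
  using assms(2)
proof (induction rule: FV.induct)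
  case (step g xs d)
  have "(\<lambda>s. (f s + c * g s) + (c * d) * tvc xs s) \<in> FV m" using step by (intro FV.step)
  then show ?case by (simp add: algebra_simps)
qed (use assms(1) in simp)

lemma FV_add: "f \<in> FV m \<Longrightarrow> g \<in> FV m \<Longrightarrow> (\<lambda>s. f s + g s) \<in> FV m"
  using FV_add_scale[of f m g 1] by simp

lemma FV_scale: "g \<in> FV m \<Longrightarrow> (\<lambda>s. c * g s) \<in> FV m"
  using FV_add_scale[OF FV.zero, of g m c] by simp

lemma FV_sum:
  assumes "finite A" "\<And>a. a \<in> A \<Longrightarrow> f a \<in> FV m"
  shows "(\<lambda>s. \<Sum>a\<in>A. f a s) \<in> FV m"
  using assms by (induction A rule: finite_induct) (auto intro: FV.zero FV_add)

text \<open>Reduces closure under a linear operation \<open>Op\<close> to generators.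
  \<open>Z\<close> indexes the coordinates of the result and \<open>\<phi>\<close> gives the word of
  a coordinate; the result is prescribed on these words only.\<close>

lemma FV_linear:
  assumes "f \<in> FV m"
    and "\<And>z. z \<in> Z \<Longrightarrow> Op (\<lambda>s. 0) z = 0"
    and "\<And>f g c z. z \<in> Z \<Longrightarrow> Op (\<lambda>s. f s + c * g s) z = Op f z + c * Op g z"
    and "\<And>xs. nc xs \<Longrightarrow> length xs = m \<Longrightarrow> \<exists>g\<in>FV m'. \<forall>z\<in>Z. g (\<phi> z) = Op (tvc xs) z"
  shows "\<exists>g\<in>FV m'. \<forall>z\<in>Z. g (\<phi> z) = Op f z"
  using assms(1)
proof (induction rule: FV.induct)
  case zero
  then show ?case using FV.zero assms(2) by (intro bexI[of _ "\<lambda>s. 0"]) auto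
next
  case (step f xs c)
  obtain g where "g \<in> FV m'" "\<forall>z\<in>Z. g (\<phi> z) = Op f z" using step by blast
  moreover obtain h where "h \<in> FV m'" "\<forall>z\<in>Z. h (\<phi> z) = Op (tvc xs) z"
    using assms(4) step by blast
  ultimately show ?case using assms(3) by (intro bexI[of _ "\<lambda>s. g s + c * h s"]) (auto intro: FV_add_scale)
qed

lemma FV_unit:
  assumes "f \<in> FV (j + Suc l)"
  shows "\<exists>g\<in>FV (j + l). \<forall>s1\<in>tuples I j. \<forall>s2\<in>tuples I l. g (s1 @ s2) = (\<Sum>a\<in>I. complex_of_real (e a) * f (s1 @ a # s2))"
proof -
  have "\<exists>g\<in>FV (j + l). \<forall>z\<in>tuples I j \<times> tuples I l.
      g (fst z @ snd z) = (\<lambda>f z. \<Sum>a\<in>I. complex_of_real (e a) * f (fst z @ a # snd z)) f z"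
  proof (rule FV_linear[OF assms])
    fix xs assume nc: "nc xs" and "length xs = j + Suc l"
    then obtain ys v zs where xs: "xs = ys @ v # zs" "length ys = j" "length zs = l"
      using length_splitE by metis
    show "\<exists>g\<in>FV (j + l). \<forall>z\<in>tuples I j \<times> tuples I l. g (fst z @ snd z) = (\<Sum>a\<in>I. complex_of_real (e a) * tvc xs (fst z @ a # snd z))"
    proof (intro bexI[of _ "tvc (ys @ zs)"] ballI)
      show "tvc (ys @ zs) \<in> FV (j + l)" using nc_delete nc xs by (intro FV_tvc) auto
      fix z assume z: "z \<in> tuples I j \<times> tuples I l"
      have "(\<Sum>a\<in>I. complex_of_real (e a) * tvc xs (fst z @ a # snd z)) = complex_of_real (\<Sum>a\<in>I. e a * tv xs (fst z @ a # snd z))"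
        unfolding of_real_sum using z xs by (intro sum.cong refl) (auto simp: tvc_def tuples_def)
      also have "(\<Sum>a\<in>I. e a * tv xs (fst z @ a # snd z)) = tv (ys @ zs) (fst z @ snd z)"
        unfolding xs(1) using z xs by (intro tv_unit) (auto simp: tuples_def)
      finally show "tvc (ys @ zs) (fst z @ snd z) = (\<Sum>a\<in>I. complex_of_real (e a) * tvc xs (fst z @ a # snd z))"
        using z xs by (auto simp: tvc_def tuples_def)
    qed
  qed (auto simp: algebra_simps sum.distrib sum_distrib_left)
  then obtain g where "g \<in> FV (j + l)" "\<And>z. z \<in> tuples I j \<times> tuples I l \<Longrightarrow> g (fst z @ snd z) = (\<Sum>a\<in>I. complex_of_real (e a) * f (fst z @ a # snd z))"
    by blast
  then show ?thesis by (intro bexI[of _ g]) force+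
qed

lemma FV_mult:
  assumes "f \<in> FV (j + Suc (Suc l))"
  shows "\<exists>g\<in>FV (j + Suc l). \<forall>s1\<in>tuples I j. \<forall>x\<in>I. \<forall>s2\<in>tuples I l.
      g (s1 @ x # s2) = (\<Sum>a\<in>I. \<Sum>c\<in>I. complex_of_real (M x a c) * f (s1 @ a # c # s2))"
proof -
  let ?Z = "tuples I j \<times> I \<times> tuples I l"
  let ?O = "\<lambda>f z. \<Sum>a\<in>I. \<Sum>c\<in>I. complex_of_real (M (fst (snd z)) a c) * f (fst z @ a # c # snd (snd z))"
  have "\<exists>g\<in>FV (j + Suc l). \<forall>z\<in>?Z. g (fst z @ fst (snd z) # snd (snd z)) = ?O f z"
  proof (rule FV_linear[OF assms])
    fix xs assume nc: "nc xs" and len: "length xs = j + Suc (Suc l)"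
    then obtain ys v zs' where xs': "xs = ys @ v # zs'" "length ys = j" "length zs' = Suc l"
      using length_splitE by metis
    then obtain w zs where xs: "xs = ys @ v # w # zs" "length ys = j" "length zs = l"
      by (cases zs') auto
    have O: "?O (tvc xs) z = complex_of_real (\<Sum>a\<in>I. \<Sum>c\<in>I. M (fst (snd z)) a c * tv xs (fst z @ a # c # snd (snd z)))"
      if "z \<in> ?Z" for z
      unfolding of_real_sum using that xs by (intro sum.cong refl) (auto simp: tvc_def tuples_def)
    show "\<exists>g\<in>FV (j + Suc l). \<forall>z\<in>?Z. g (fst z @ fst (snd z) # snd (snd z)) = ?O (tvc xs) z"
    proof (cases "v = w")
      case True
      show ?thesis
      proof (intro bexI[of _ "\<lambda>s. complex_of_real \<delta> * tvc (ys @ v # zs) s"] ballI)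
        show "(\<lambda>s. complex_of_real \<delta> * tvc (ys @ v # zs) s) \<in> FV (j + Suc l)"
          using nc_delete[of ys v "w # zs"] nc xs True by (intro FV_scale FV_tvc) auto
        fix z assume z: "z \<in> ?Z"
        have "(\<Sum>a\<in>I. \<Sum>c\<in>I. M (fst (snd z)) a c * tv xs (fst z @ a # c # snd (snd z))) =
            \<delta> * tv (ys @ v # zs) (fst z @ fst (snd z) # snd (snd z))"
          unfolding xs(1) True[symmetric] using z xs by (intro tv_mult) (auto simp: tuples_def)
        then show "complex_of_real \<delta> * tvc (ys @ v # zs) (fst z @ fst (snd z) # snd (snd z)) = ?O (tvc xs) z"
          using O[OF z] z xs by (auto simp: tvc_def tuples_def)
      qed
    next
      case False
      let ?ws = "map (\<lambda>l. if l = w then v else l) (ys @ v # zs)"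
      show ?thesis
      proof (intro bexI[of _ "tvc ?ws"] ballI)
        show "tvc ?ws \<in> FV (j + Suc l)"
          using nc xs nc_join[OF _ False] by (intro FV_tvc) auto
        fix z assume z: "z \<in> ?Z"
        have "(\<Sum>a\<in>I. \<Sum>c\<in>I. M (fst (snd z)) a c * tv xs (fst z @ a # c # snd (snd z))) =
            tv ?ws (fst z @ fst (snd z) # snd (snd z))"
          unfolding xs(1) using z xs nc False by (intro tv_join) (auto simp: tuples_def)
        then show "tvc ?ws (fst z @ fst (snd z) # snd (snd z)) = ?O (tvc xs) z"
          using O[OF z] z xs by (auto simp: tvc_def tuples_def)
      qed
    qed
  qed (auto simp: algebra_simps sum.distrib sum_distrib_left)
  then obtain g where "g \<in> FV (j + Suc l)" "\<And>z. z \<in> ?Z \<Longrightarrow> g (fst z @ fst (snd z) # snd (snd z)) = ?O f z"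
    by blast
  then show ?thesis by (intro bexI[of _ g]) force+
qed

text \<open>This contraction is \<psi> after multiplication: merge two letters, then contract with
  the unit. In the basis only pairs \<open>a\<close>, \<open>bar a\<close> survive, with weight
  \<open>lam a\<close>.\<close>

lemma FV_cap:
  assumes "f \<in> FV (j + Suc (Suc l))"
  shows "\<exists>g\<in>FV (j + l). \<forall>s1\<in>tuples I j. \<forall>s2\<in>tuples I l. g (s1 @ s2) = (\<Sum>a\<in>I. complex_of_real (lam a) * f (s1 @ a # bar a # s2))"
proof -
  obtain g where g: "g \<in> FV (j + Suc l)"
    "\<And>s1 x s2. s1 \<in> tuples I j \<Longrightarrow> x \<in> I \<Longrightarrow> s2 \<in> tuples I l \<Longrightarrow>
      g (s1 @ x # s2) = (\<Sum>a\<in>I. \<Sum>c\<in>I. complex_of_real (M x a c) * f (s1 @ a # c # s2))"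
    using FV_mult[OF assms] by blast
  obtain h where h: "h \<in> FV (j + l)"
    "\<And>s1 s2. s1 \<in> tuples I j \<Longrightarrow> s2 \<in> tuples I l \<Longrightarrow> h (s1 @ s2) = (\<Sum>a\<in>I. complex_of_real (e a) * g (s1 @ a # s2))"
    using FV_unit[OF g(1)] by blast
  have "h (s1 @ s2) = (\<Sum>a\<in>I. complex_of_real (lam a) * f (s1 @ a # bar a # s2))"
    if s: "s1 \<in> tuples I j" "s2 \<in> tuples I l" for s1 s2
  proof -
    have "h (s1 @ s2) = (\<Sum>x\<in>I. \<Sum>a\<in>I. \<Sum>c\<in>I. complex_of_real (e x * M x a c) * f (s1 @ a # c # s2))"
      using s by (simp add: h(2) g(2) sum_distrib_left mult.assoc)
    also have "\<dots> = (\<Sum>a\<in>I. \<Sum>x\<in>I. \<Sum>c\<in>I. complex_of_real (e x * M x a c) * f (s1 @ a # c # s2))"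
      by (rule sum.swap)
    also have "\<dots> = (\<Sum>a\<in>I. \<Sum>c\<in>I. \<Sum>x\<in>I. complex_of_real (e x * M x a c) * f (s1 @ a # c # s2))"
      by (rule sum.cong[OF refl], rule sum.swap)
    also have "\<dots> = (\<Sum>a\<in>I. \<Sum>c\<in>I. complex_of_real (\<Sum>x\<in>I. e x * M x a c) * f (s1 @ a # c # s2))"
      by (simp only: of_real_sum sum_distrib_right)
    also have "\<dots> = (\<Sum>a\<in>I. \<Sum>c\<in>I. if c = bar a then complex_of_real (lam a) * f (s1 @ a # c # s2) else 0)"
      by (intro sum.cong refl) (simp add: cap)
    also have "\<dots> = (\<Sum>a\<in>I. complex_of_real (lam a) * f (s1 @ a # bar a # s2))"
      by (intro sum.cong refl) simp
    finally show ?thesis .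
  qed
  then show ?thesis using h(1) by blast
qed

text \<open>The product is bilinear, so \<open>FV_linear\<close> is used once in each argument. On
  generators the word \<open>ys\<close> is put into the gap after a shift of its labels by
  \<open>n\<close>, a bound above all labels of \<open>xs\<close>.\<close>

lemma FV_insert:
  assumes "f \<in> FV (j + l)" "g \<in> FV k"
  shows "\<exists>h\<in>FV (j + k + l). \<forall>s1\<in>tuples I j. \<forall>t\<in>tuples I k. \<forall>s2\<in>tuples I l. h (s1 @ t @ s2) = f (s1 @ s2) * g t"
proof -
  let ?Z = "tuples I j \<times> tuples I k \<times> tuples I l"
  let ?\<phi> = "\<lambda>z. fst z @ fst (snd z) @ snd (snd z)"
  have "\<exists>h\<in>FV (j + k + l). \<forall>z\<in>?Z. h (?\<phi> z) = (\<lambda>g z. f (fst z @ snd (snd z)) * g (fst (snd z))) g z"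
  proof (rule FV_linear[OF assms(2)])
    fix ys assume ys: "nc ys" "length ys = k"
    have "\<exists>h\<in>FV (j + k + l). \<forall>z\<in>?Z. h (?\<phi> z) = (\<lambda>f z. f (fst z @ snd (snd z)) * tvc ys (fst (snd z))) f z"
    proof (rule FV_linear[OF assms(1)])
      fix xs assume nc: "nc xs" and "length xs = j + l"
      then obtain xs1 xs2 where xs: "xs = xs1 @ xs2" "length xs1 = j" "length xs2 = l"
        using length_append_splitE by metis
      define n where "n = Suc (Max (insert 0 (set xs)))"
      define ys' where "ys' = map (\<lambda>v. v + n) ys"
      have "v < n" if "v \<in> set xs" for v
        unfolding n_def using that Max_ge[of "insert 0 (set xs)" v] by (simp add: less_Suc_eq_le)
      then have disj: "set ys' \<inter> (set xs1 \<union> set xs2) = {}" unfolding ys'_def xs(1) by fastforce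
      have len: "length ys' = k" by (simp add: ys'_def ys)
      have nc': "nc (xs1 @ ys' @ xs2)"
        using nc ys nc_map_inj[OF ys(1)] disj unfolding xs(1) ys'_def by (intro nc_insert_disjoint) (auto simp: inj_on_def)
      have tvy: "tv ys' t = tv ys t" for t unfolding ys'_def by (rule tv_map_inj) (simp add: inj_def)
      show "\<exists>h\<in>FV (j + k + l). \<forall>z\<in>?Z. h (?\<phi> z) = tvc xs (fst z @ snd (snd z)) * tvc ys (fst (snd z))"
      proof (intro bexI[of _ "tvc (xs1 @ ys' @ xs2)"] ballI)
        show "tvc (xs1 @ ys' @ xs2) \<in> FV (j + k + l)" using nc' len xs by (intro FV_tvc) auto
        fix z assume z: "z \<in> ?Z"
        have "tv (xs1 @ ys' @ xs2) (?\<phi> z) = tv xs (fst z @ snd (snd z)) * tv ys' (fst (snd z))"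
          unfolding xs(1) using z xs len disj by (intro tv_disjoint) (auto simp: tuples_def)
        then show "tvc (xs1 @ ys' @ xs2) (?\<phi> z) = tvc xs (fst z @ snd (snd z)) * tvc ys (fst (snd z))"
          using z xs len ys tvy by (auto simp: tvc_def tuples_def)
      qed
    qed (auto simp: algebra_simps)
    then show "\<exists>h\<in>FV (j + k + l). \<forall>z\<in>?Z. h (?\<phi> z) = f (fst z @ snd (snd z)) * tvc ys (fst (snd z))"
      by simp
  qed (auto simp: algebra_simps)
  then obtain h where "h \<in> FV (j + k + l)" "\<And>z. z \<in> ?Z \<Longrightarrow> h (?\<phi> z) = f (fst z @ snd (snd z)) * g (fst (snd z))"
    by blast
  then show ?thesis by (intro bexI[of _ h]) force+
qed

text \<open>The operation is conjugate linear, hence a separate induction. On generators it reverses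
  the label list, because \<open>bar\<close> reverses products.\<close>

lemma FV_star:
  assumes "f \<in> FV m"
  shows "\<exists>g\<in>FV m. \<forall>s\<in>tuples I m. g s = cnj (f (rev (map bar s)))"
  using assms
proof (induction rule: FV.induct)
  case zero
  then show ?case using FV.zero by (intro bexI[of _ "\<lambda>s. 0"]) auto
next
  case (step f xs c)
  then obtain g where g: "g \<in> FV m" "\<forall>s\<in>tuples I m. g s = cnj (f (rev (map bar s)))" by blast
  have "tvc (rev xs) s = cnj (tvc xs (rev (map bar s)))" if s: "s \<in> tuples I m" for s
  proof -
    have "tv (rev xs) (rev (map bar (rev (map bar s)))) = tv xs (rev (map bar s))"
      using s step by (intro tv_bar) (auto simp: tuples_def)
    moreover have "rev (map bar (rev (map bar s))) = s"
      using s by (auto simp: tuples_def rev_map intro!: map_idI)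
    ultimately show ?thesis using s step by (auto simp: tvc_def tuples_def)
  qed
  then show ?case using g step
    by (intro bexI[of _ "\<lambda>s. g s + cnj c * tvc (rev xs) s"]) (auto intro!: FV.step nc_rev)
qed

lemma rbar_tuples [intro, simp]: "t \<in> tuples I k \<Longrightarrow> rev (map bar t) \<in> tuples I k"
  by (auto simp: tuples_def)

text \<open>The caps are nested, so they are closed from the inside: the last letter of
  \<open>t\<close> is adjacent to the first letter of the reversed copy.\<close>

lemma FV_caps:
  assumes "F \<in> FV (j + (k + k) + l)"
  shows "\<exists>h\<in>FV (j + l). \<forall>x\<in>tuples I j. \<forall>z\<in>tuples I l.
    h (x @ z) = (\<Sum>t\<in>tuples I k. complex_of_real (lamp t) * F (x @ t @ rev (map bar t) @ z))"
  using assms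
proof (induction k arbitrary: F)
  case (Suc k)
  have F: "F \<in> FV ((j + k) + Suc (Suc (k + l)))" using Suc.prems by (simp add: add_ac)
  obtain G where G: "G \<in> FV ((j + k) + (k + l))"
    "\<And>s1 s2. s1 \<in> tuples I (j + k) \<Longrightarrow> s2 \<in> tuples I (k + l) \<Longrightarrow> G (s1 @ s2) = (\<Sum>a\<in>I. complex_of_real (lam a) * F (s1 @ a # bar a # s2))"
    using FV_cap[OF F] by blast
  from G(1) have "G \<in> FV (j + (k + k) + l)" by (simp add: add_ac)
  from Suc.IH[OF this] obtain h where h: "h \<in> FV (j + l)"
    "\<And>x z. x \<in> tuples I j \<Longrightarrow> z \<in> tuples I l \<Longrightarrow> h (x @ z) = (\<Sum>t\<in>tuples I k. complex_of_real (lamp t) * G (x @ t @ rev (map bar t) @ z))"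
    by blast
  have "h (x @ z) = (\<Sum>t\<in>tuples I (Suc k). complex_of_real (lamp t) * F (x @ t @ rev (map bar t) @ z))"
    if xz: "x \<in> tuples I j" "z \<in> tuples I l" for x z
  proof -
    have "G (x @ t @ rev (map bar t) @ z) = (\<Sum>a\<in>I. complex_of_real (lam a) * F (x @ (t @ [a]) @ rev (map bar (t @ [a])) @ z))"
      if t: "t \<in> tuples I k" for t
      using G(2)[OF tuples_appendI[OF xz(1) t] tuples_appendI[OF rbar_tuples[OF t] xz(2)]] by simp
    then show ?thesis using h(2)[OF xz]
      by (simp add: sum_tuples_snoc sum_distrib_left mult.assoc)
  qed
  then show ?case using h(1) by blast
qed auto

text \<open>Composition of maps in terms of tensors: \<open>g\<close> is placed next to
  \<open>f\<close>, and the common legs are closed by nested caps.\<close>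

lemma FV_contract:
  assumes "f \<in> FV (j + k + l)" "g \<in> FV (k + m)"
  shows "\<exists>h\<in>FV (j + m + l). \<forall>x\<in>tuples I j. \<forall>s\<in>tuples I m. \<forall>z\<in>tuples I l.
      h (x @ s @ z) = (\<Sum>t\<in>tuples I k. complex_of_real (lamp t) * (f (x @ t @ z) * g (rev (map bar t) @ s)))"
proof -
  obtain F where F: "F \<in> FV ((j + k) + (k + m) + l)"
    "\<And>s1 t s2. s1 \<in> tuples I (j + k) \<Longrightarrow> t \<in> tuples I (k + m) \<Longrightarrow> s2 \<in> tuples I l \<Longrightarrow> F (s1 @ t @ s2) = f (s1 @ s2) * g t"
    using FV_insert[OF assms] by blast
  have "F \<in> FV (j + (k + k) + (m + l))" using F(1) by (simp add: add_ac)
  from FV_caps[OF this] obtain h where h: "h \<in> FV (j + (m + l))"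
    "\<And>x z. x \<in> tuples I j \<Longrightarrow> z \<in> tuples I (m + l) \<Longrightarrow> h (x @ z) = (\<Sum>t\<in>tuples I k. complex_of_real (lamp t) * F (x @ t @ rev (map bar t) @ z))"
    by blast
  show ?thesis
  proof (intro bexI[of _ h] ballI)
    show "h \<in> FV (j + m + l)" using h(1) by (simp add: add_ac)
    fix x s z assume xsz: "x \<in> tuples I j" "s \<in> tuples I m" "z \<in> tuples I l"
    have "F (x @ t @ rev (map bar t) @ s @ z) = f (x @ t @ z) * g (rev (map bar t) @ s)" if "t \<in> tuples I k" for t
      using F(2)[OF tuples_appendI[OF xsz(1) that] tuples_appendI[OF rbar_tuples[OF that] xsz(2)] xsz(3)] by simp
    then show "h (x @ s @ z) = (\<Sum>t\<in>tuples I k. complex_of_real (lamp t) * (f (x @ t @ z) * g (rev (map bar t) @ s)))"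
      using h(2)[of x "s @ z"] xsz by auto
  qed
qed

text \<open>Nested pairs give the tensor that corresponds to the identity map under
  \<open>op\<close> below.\<close>

lemma FV_cups:
  "\<exists>g\<in>FV (k + k). \<forall>t\<in>tuples I k. \<forall>s\<in>tuples I k. g (rev (map bar t) @ s) = (if s = t then complex_of_real (1 / lamp t) else 0)"
proof (induction k)
  case 0
  show ?case by (intro bexI[of _ "tvc []"]) (auto simp: tvc_def tv_def nc_Nil intro: FV_tvc)
next
  case (Suc k)
  then obtain g where g: "g \<in> FV (k + k)"
    "\<And>s t. t \<in> tuples I k \<Longrightarrow> s \<in> tuples I k \<Longrightarrow> g (rev (map bar t) @ s) = (if s = t then complex_of_real (1 / lamp t) else 0)" by blast
  have nc2: "nc [0, 0]" using nc_double[of "[]" 0 "[]"] nc_insert_fresh[of "[]" "[]" 0] nc_Nil by simp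
  then have "tvc [0, 0] \<in> FV 2" by (intro FV_tvc) simp_all
  from FV_insert[OF g(1) this] obtain h where h: "h \<in> FV (k + 2 + k)"
    "\<And>s1 t s2. s1 \<in> tuples I k \<Longrightarrow> t \<in> tuples I 2 \<Longrightarrow> s2 \<in> tuples I k \<Longrightarrow> h (s1 @ t @ s2) = g (s1 @ s2) * tvc [0, 0] t"
    by blast
  show ?case
  proof (intro bexI[of _ h] ballI)
    show "h \<in> FV (Suc k + Suc k)" using h(1) by simp
    fix t s assume "t \<in> tuples I (Suc k)" "s \<in> tuples I (Suc k)"
    then obtain a t' c s' where ts: "t = a # t'" "a \<in> I" "t' \<in> tuples I k" "s = c # s'" "c \<in> I" "s' \<in> tuples I k"
      by (metis tuples_SucE)
    have "h (rev (map bar t) @ s) = g (rev (map bar t') @ s') * tvc [0, 0] [bar a, c]"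
      using h(2)[OF rbar_tuples[OF ts(3)], of "[bar a, c]" s'] ts by (simp add: tuples_def)
    also have "tvc [0, 0] [bar a, c] = (if c = a then complex_of_real (1 / lam a) else 0)"
      using ts by (auto simp: tvc_def tuples_def tv_def Psi_pair lam_bar)
    finally show "h (rev (map bar t) @ s) = (if s = t then complex_of_real (1 / lamp t) else 0)"
      using g(2)[of t' s'] ts by auto
  qed
qed

lemma FV_hom:
  assumes "f \<in> FV m" "s \<in> tuples I m" "f s \<noteq> 0"
  shows "lamp s = 1"
  using assms
proof (induction rule: FV.induct)
  case (step f xs c)
  then consider "f s \<noteq> 0" | "tv xs s \<noteq> 0"
    by (cases "f s = 0") (auto simp: tvc_def split: if_splits)
  then show ?case using step tv_hom[of xs s] by cases (auto simp: tuples_def)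
qed simp

end

section \<open>Reproducing kernels and positivity\<close>

text \<open>Induction on the support. The functions of \<open>U\<close> vanishing at
  \<open>x0\<close> form a subspace \<open>U0\<close> with a smaller support. If some
  \<open>g\<close> in \<open>U\<close> does not vanish there, subtracting its projection to
  \<open>U0\<close> gives \<open>g'\<close> orthogonal to \<open>U0\<close>, and \<open>U\<close> is
  \<open>U0\<close> plus the line through \<open>g'\<close>.\<close>

lemma riesz_finite:
  fixes U :: "('x \<Rightarrow> complex) set" and \<phi> :: "('x \<Rightarrow> complex) \<Rightarrow> complex"
  assumes "finite X" "(\<lambda>_. 0) \<in> U" "\<And>f g c. f \<in> U \<Longrightarrow> g \<in> U \<Longrightarrow> (\<lambda>x. f x + c * g x) \<in> U"
    and "\<And>f x. f \<in> U \<Longrightarrow> x \<notin> X \<Longrightarrow> f x = 0"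
    and "\<And>f g c. f \<in> U \<Longrightarrow> g \<in> U \<Longrightarrow> \<phi> (\<lambda>x. f x + c * g x) = \<phi> f + c * \<phi> g"
  shows "\<exists>k\<in>U. \<forall>f\<in>U. \<phi> f = (\<Sum>x\<in>X. f x * cnj (k x))"
  using assms
proof (induction X arbitrary: U \<phi> rule: finite_induct)
  case empty
  have "\<phi> f = 0" if "f \<in> U" for f
  proof -
    have "f = (\<lambda>_. 0)" using empty.prems(3) that by auto
    moreover have "\<phi> (\<lambda>_. 0) = \<phi> (\<lambda>_. 0) + 1 * \<phi> (\<lambda>_. 0)"
      using empty.prems(4)[OF empty.prems(1,1), of 1] by simp
    ultimately show ?thesis by simp
  qed
  then show ?case using empty.prems(1) by auto
next
  case (insert x0 X)
  let ?ip = "\<lambda>f g. \<Sum>x\<in>insert x0 X. f x * cnj (g x)"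
  define U0 where "U0 = {f \<in> U. f x0 = 0}"
  have U0: "(\<lambda>_. 0) \<in> U0" "\<And>f g c. f \<in> U0 \<Longrightarrow> g \<in> U0 \<Longrightarrow> (\<lambda>x. f x + c * g x) \<in> U0"
    "\<And>f x. f \<in> U0 \<Longrightarrow> x \<notin> X \<Longrightarrow> f x = 0" "\<And>f. f \<in> U0 \<Longrightarrow> f \<in> U"
    using insert.prems(1-3) unfolding U0_def by auto (metis insertE)
  have ip0: "?ip f g = (\<Sum>x\<in>X. f x * cnj (g x))" if "f \<in> U0" for f g
    using that insert.hyps by (simp add: U0_def)
  have "\<exists>k\<in>U0. \<forall>f\<in>U0. \<phi> f = (\<Sum>x\<in>X. f x * cnj (k x))"
    using U0 insert.prems(4) by (intro insert.IH) auto
  then obtain k0 where k0: "k0 \<in> U0" "\<And>f. f \<in> U0 \<Longrightarrow> \<phi> f = ?ip f k0" using ip0 by auto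
  show ?case
  proof (cases "U0 = U")
    case True
    then show ?thesis using k0 by auto
  next
    case False
    then obtain g where g: "g \<in> U" "g x0 \<noteq> 0" unfolding U0_def by auto
    have "\<exists>k\<in>U0. \<forall>f\<in>U0. ?ip f g = (\<Sum>x\<in>X. f x * cnj (k x))"
      using U0 by (intro insert.IH) (auto simp: algebra_simps sum.distrib sum_distrib_left)
    then obtain k1 where k1: "k1 \<in> U0" "\<And>f. f \<in> U0 \<Longrightarrow> ?ip f g = ?ip f k1" using ip0 by auto
    define g' where "g' = (\<lambda>x. g x + (-1) * k1 x)"
    have g': "g' \<in> U" "g' x0 \<noteq> 0"
      using insert.prems(2)[OF g(1) U0(4)[OF k1(1)], of "-1"] g(2) k1(1) unfolding g'_def U0_def by auto
    have orth: "?ip f g' = 0" if "f \<in> U0" for f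
    proof -
      have "?ip f g' = ?ip f g - ?ip f k1"
        unfolding g'_def sum_subtractf[symmetric] by (intro sum.cong refl) (simp add: algebra_simps)
      then show ?thesis using k1(2)[OF that] by simp
    qed
    have "?ip g' g' = complex_of_real (\<Sum>x\<in>insert x0 X. (cmod (g' x))\<^sup>2)"
      unfolding of_real_sum by (intro sum.cong refl) (metis complex_norm_square)
    moreover have "(\<Sum>x\<in>insert x0 X. (cmod (g' x))\<^sup>2) > 0"
      using insert.hyps g'(2) by (intro sum_pos2[of _ x0]) auto
    ultimately have N: "?ip g' g' \<noteq> 0" by (metis of_real_eq_0_iff less_irrefl)
    \<comment> \<open>\<open>k0\<close> is already correct on \<open>U0\<close>; the multiple of
      \<open>g'\<close> is fixed by the value of \<open>\<phi>\<close> at \<open>g'\<close>.\<close>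
    define c where "c = cnj (\<phi> g' / ?ip g' g')"
    have g'k0: "?ip g' k0 = 0"
    proof -
      have "?ip g' k0 = cnj (?ip k0 g')" by (simp add: mult.commute)
      then show ?thesis using orth[OF k0(1)] by simp
    qed
    show ?thesis
    proof (intro bexI[of _ "\<lambda>x. k0 x + c * g' x"] ballI)
      show "(\<lambda>x. k0 x + c * g' x) \<in> U" using insert.prems(2) g' U0(4) k0 by blast
      fix f assume f: "f \<in> U"
      define a where "a = f x0 / g' x0"
      define f0 where "f0 = (\<lambda>x. f x + (- a) * g' x)"
      have "f0 \<in> U" unfolding f0_def by (rule insert.prems(2)[OF f g'(1)])
      moreover have "f0 x0 = 0" unfolding f0_def a_def using g'(2) by simp
      ultimately have f0: "f0 \<in> U0" unfolding U0_def by simp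
      have ff: "f = (\<lambda>x. f0 x + a * g' x)" unfolding f0_def by auto
      have "\<phi> f = \<phi> f0 + a * \<phi> g'"
        using insert.prems(4)[OF U0(4)[OF f0] g'(1), of a] ff by simp
      moreover have "?ip f (\<lambda>x. k0 x + c * g' x) = ?ip f0 k0 + a * ?ip g' k0 + cnj c * (?ip f0 g' + a * ?ip g' g')"
        unfolding sum_distrib_left sum.distrib[symmetric] by (subst ff, intro sum.cong refl) (simp add: algebra_simps)
      moreover have "cnj c * ?ip g' g' = \<phi> g'" unfolding c_def using N by simp
      ultimately show "\<phi> f = ?ip f (\<lambda>x. k0 x + c * g' x)"
        using k0(2)[OF f0] orth[OF f0] g'k0 by (simp add: mult.left_commute)
    qed
  qed
qed

text \<open>As operators GG = GZ, and taking adjoints GG = ZG. Since Z is invertible, c = Zx for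
  some x, and <Gc, c> = <GZx, Zx> = <GGx, Zx> = <Gx, GZx> = <Gx, ZGx> \<ge> 0.\<close>

lemma psd_of_relation:
  fixes G Z :: "'x \<Rightarrow> 'x \<Rightarrow> complex"
  assumes X: "finite X"
    and Gh: "\<And>x y. x \<in> X \<Longrightarrow> y \<in> X \<Longrightarrow> G y x = cnj (G x y)"
    and Zh: "\<And>x y. x \<in> X \<Longrightarrow> y \<in> X \<Longrightarrow> Z y x = cnj (Z x y)"
    and Zpos: "\<And>c. 0 \<le> Re (\<Sum>y\<in>X. (\<Sum>x\<in>X. c x * Z x y) * cnj (c y))"
    and Zinj: "\<And>c x. (\<And>y. y \<in> X \<Longrightarrow> (\<Sum>x\<in>X. c x * Z x y) = 0) \<Longrightarrow> x \<in> X \<Longrightarrow> c x = 0"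
    and GG: "\<And>x z. x \<in> X \<Longrightarrow> z \<in> X \<Longrightarrow> (\<Sum>y\<in>X. G x y * G y z) = (\<Sum>y\<in>X. G x y * Z y z)"
  shows "0 \<le> Re (\<Sum>y\<in>X. (\<Sum>x\<in>X. c x * G x y) * cnj (c y))"
proof -
  define ap where "ap K c y = (\<Sum>x\<in>X. c x * K x y)" for K :: "'x \<Rightarrow> 'x \<Rightarrow> complex" and c y
  define ip where "ip f g = (\<Sum>x\<in>X. f x * cnj (g x))" for f g :: "'x \<Rightarrow> complex"
  have ip_cong: "ip f g = ip f' g'" if "\<And>x. x \<in> X \<Longrightarrow> f x = f' x" "\<And>x. x \<in> X \<Longrightarrow> g x = g' x" for f g f' g'
    unfolding ip_def using that by (intro sum.cong) auto
  have ap_cong: "ap K f = ap K f'" if "\<And>x. x \<in> X \<Longrightarrow> f x = f' x" for K f f'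
    unfolding ap_def using that by (intro ext sum.cong) auto
  have ip_diff: "ip f (\<lambda>x. g x - h x) = ip f g - ip f h" for f g h
    by (simp add: ip_def right_diff_distrib sum_subtractf)
  have adj: "ip (ap K c) d = ip c (ap K d)"
    if "\<And>x y. x \<in> X \<Longrightarrow> y \<in> X \<Longrightarrow> K y x = cnj (K x y)" for K c d
  proof -
    have "ip (ap K c) d = (\<Sum>y\<in>X. \<Sum>x\<in>X. c x * K x y * cnj (d y))"
      by (simp add: ip_def ap_def sum_distrib_right)
    also have "\<dots> = (\<Sum>x\<in>X. \<Sum>y\<in>X. c x * K x y * cnj (d y))" by (rule sum.swap)
    also have "\<dots> = (\<Sum>x\<in>X. \<Sum>y\<in>X. c x * cnj (d y * K y x))"
      using that by (intro sum.cong refl) (metis complex_cnj_cnj complex_cnj_mult mult.assoc mult.commute)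
    also have "\<dots> = ip c (ap K d)" by (simp add: ip_def ap_def sum_distrib_left)
    finally show ?thesis .
  qed
  have comp: "ap K (ap L c) z = (\<Sum>x\<in>X. c x * (\<Sum>y\<in>X. L x y * K y z))" for K L c z
  proof -
    have "ap K (ap L c) z = (\<Sum>y\<in>X. \<Sum>x\<in>X. c x * (L x y * K y z))"
      by (simp add: ap_def sum_distrib_right mult.assoc)
    also have "\<dots> = (\<Sum>x\<in>X. \<Sum>y\<in>X. c x * (L x y * K y z))" by (rule sum.swap)
    finally show ?thesis by (simp only: sum_distrib_left)
  qed
  have GG': "(\<Sum>y\<in>X. G x y * G y z) = (\<Sum>y\<in>X. Z x y * G y z)" if "x \<in> X" "z \<in> X" for x z
  proof -
    have "(\<Sum>y\<in>X. G x y * G y z) = cnj (\<Sum>y\<in>X. G z y * G y x)"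
      unfolding cnj_sum by (intro sum.cong refl) (metis Gh complex_cnj_mult mult.commute that)
    also have "\<dots> = cnj (\<Sum>y\<in>X. G z y * Z y x)" using GG that by simp
    also have "\<dots> = (\<Sum>y\<in>X. Z x y * G y z)"
      unfolding cnj_sum by (intro sum.cong refl) (metis Gh Zh complex_cnj_mult mult.commute that)
    finally show ?thesis .
  qed
  have c1: "ap G (ap G c) z = ap Z (ap G c) z" if "z \<in> X" for c z
    unfolding comp using GG that by (intro sum.cong refl) simp
  have c2: "ap G (ap G c) z = ap G (ap Z c) z" if "z \<in> X" for c z
    unfolding comp using GG' that by (intro sum.cong refl) simp
  \<comment> \<open>The representer of \<open>c\<close> in the range of \<open>Z\<close> differs
    from \<open>c\<close> by a vector orthogonal to this range, hence in the kernel of the hermitian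
    \<open>Z\<close>, which is trivial.\<close>
  have surj: "\<exists>\<xi>. \<forall>x\<in>X. c x = ap Z \<xi> x"
  proof -
    define U where "U = range (\<lambda>\<xi> y. if y \<in> X then ap Z \<xi> y else 0)"
    have "\<exists>k\<in>U. \<forall>f\<in>U. ip f c = (\<Sum>x\<in>X. f x * cnj (k x))"
    proof (rule riesz_finite[OF X])
      show "(\<lambda>_. 0) \<in> U" unfolding U_def by (intro range_eqI[of _ _ "\<lambda>_. 0"]) (auto simp: ap_def)
      fix f g :: "'x \<Rightarrow> complex" and d
      assume "f \<in> U" "g \<in> U"
      then obtain a b where "f = (\<lambda>y. if y \<in> X then ap Z a y else 0)" "g = (\<lambda>y. if y \<in> X then ap Z b y else 0)"
        unfolding U_def by auto
      then show "(\<lambda>x. f x + d * g x) \<in> U"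
        unfolding U_def by (intro range_eqI[of _ _ "\<lambda>x. a x + d * b x"])
          (auto simp: ap_def algebra_simps sum.distrib sum_distrib_left)
    qed (auto simp: U_def ip_def algebra_simps sum.distrib sum_distrib_left)
    then obtain k where k: "k \<in> U" "\<And>f. f \<in> U \<Longrightarrow> ip f c = ip f k" by (auto simp: ip_def)
    then obtain \<xi> where "k = (\<lambda>y. if y \<in> X then ap Z \<xi> y else 0)" unfolding U_def by blast
    then have \<xi>: "ip f c = ip f (ap Z \<xi>)" if "f \<in> U" for f
      unfolding k(2)[OF that] by (intro ip_cong) auto
    define d where "d = (\<lambda>x. c x - ap Z \<xi> x)"
    have "ap Z d z = 0" if "z \<in> X" for z
    proof -
      define dz where "dz = (\<lambda>x. if x = z then 1 else (0::complex))"
      let ?h = "\<lambda>y. if y \<in> X then ap Z dz y else 0"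
      have "ip ?h c = ip ?h (ap Z \<xi>)" by (rule \<xi>) (auto simp: U_def)
      then have "ip ?h d = 0" unfolding d_def ip_diff by simp
      moreover have "ip ?h d = ip (ap Z dz) d" by (rule ip_cong) simp_all
      moreover have "ip (ap Z dz) d = ip dz (ap Z d)" by (rule adj, rule Zh)
      moreover have "ip dz (ap Z d) = (\<Sum>x\<in>X. if x = z then cnj (ap Z d x) else 0)"
        unfolding ip_def dz_def by (intro sum.cong) auto
      ultimately show ?thesis using that X by simp
    qed
    then have "d x = 0" if "x \<in> X" for x using Zinj[of d x] that by (simp add: ap_def)
    then show ?thesis unfolding d_def by (intro exI[of _ \<xi>]) simp
  qed
  then obtain \<xi> where \<xi>: "\<And>x. x \<in> X \<Longrightarrow> c x = ap Z \<xi> x" by blast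
  let ?d = "ap G \<xi>"
  have "ip (ap G c) c = ip (ap G (ap Z \<xi>)) (ap Z \<xi>)"
    using \<xi> ap_cong[of c "ap Z \<xi>" G] by (intro ip_cong) auto
  also have "\<dots> = ip (ap G (ap G \<xi>)) (ap Z \<xi>)" using c2 by (intro ip_cong) auto
  also have "\<dots> = ip (ap G \<xi>) (ap G (ap Z \<xi>))" by (rule adj, rule Gh)
  also have "\<dots> = ip (ap G \<xi>) (ap Z (ap G \<xi>))" using c1 c2 by (intro ip_cong) auto
  also have "\<dots> = ip (ap Z (ap G \<xi>)) (ap G \<xi>)" by (rule adj[symmetric], rule Zh)
  finally show ?thesis using Zpos[of ?d] by (simp add: ip_def ap_def)
qed

section \<open>Orthogonal projections onto the noncrossing spans\<close>

context frob
begin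

text \<open>The reproducing kernel of \<open>FV m\<close>, that is, the matrix of the orthogonal
  projection onto \<open>FV m\<close>.\<close>

definition P :: "nat \<Rightarrow> 'i list \<Rightarrow> 'i list \<Rightarrow> complex" where
  "P m x y = (SOME k. k \<in> FV m \<and> (\<forall>f\<in>FV m. f y = (\<Sum>z\<in>tuples I m. f z * cnj (k z)))) x"

lemma P_ex: "\<exists>k. k \<in> FV m \<and> (\<forall>f\<in>FV m. f y = (\<Sum>z\<in>tuples I m. f z * cnj (k z)))"
  using riesz_finite[of "tuples I m" "FV m" "\<lambda>f. f y"] FV.zero FV_add_scale FV_outside by auto

lemma P_FV: "(\<lambda>x. P m x y) \<in> FV m"
  and P_repr: "f \<in> FV m \<Longrightarrow> f y = (\<Sum>z\<in>tuples I m. f z * cnj (P m z y))"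
  using someI_ex[OF P_ex[of m y]] unfolding P_def by auto

lemma P_gram: "P m x y = (\<Sum>z\<in>tuples I m. P m z y * cnj (P m z x))"
  by (rule P_repr[OF P_FV])

lemma P_herm: "P m y x = cnj (P m x y)"
  by (subst (1 2) P_gram) (simp add: mult.commute)

lemma P_repr': "f \<in> FV m \<Longrightarrow> f y = (\<Sum>z\<in>tuples I m. f z * P m y z)"
  using P_repr[of f m y] by (simp add: P_herm[of m y])

lemma P_hom: "\<lbrakk>x \<in> tuples I m; y \<in> tuples I m; P m x y \<noteq> 0\<rbrakk> \<Longrightarrow> lamp x = 1 \<and> lamp y = 1"
  using FV_hom[OF P_FV, of x m y] FV_hom[OF P_FV, of y m x] P_herm[of m y x] by auto

text \<open>Frobenius reciprocity: a tensor on \<open>k + m\<close> legs becomes a map from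
  \<open>k\<close> to \<open>m\<close> legs by bending its first \<open>k\<close> legs. The weight
  \<open>lamp t\<close> comes from b_a^* = \<open>lam a\<close> b_(bar a).\<close>

definition op :: "('i list \<Rightarrow> complex) \<Rightarrow> 'i list \<Rightarrow> 'i list \<Rightarrow> complex" where
  "op g s t = complex_of_real (lamp t) * g (rev (map bar t) @ s)"

lemma lamp_append_rbar:
  assumes "set t \<subseteq> I" "lamp (rev (map bar t) @ s) = 1"
  shows "lamp s = lamp t"
proof -
  have "lamp (rev (map bar t) @ s) = 1 / lamp t * lamp s"
    by (simp only: map_append prod_list.append lamp_rev lamp_bar[OF assms(1)])
  with assms(2) have "1 / lamp t * lamp s = 1" by metis
  then show ?thesis using lamp_pos[OF assms(1)] by (simp add: field_simps)
qed

text \<open>The tensor reflected by \<open>FV_star\<close> gives the adjoint map. It carries the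
  weight \<open>lamp s\<close> in place of \<open>lamp t\<close>; by \<open>FV_hom\<close> the two
  agree wherever the coefficient is nonzero.\<close>

lemma op_star:
  assumes "g \<in> FV (k + m)"
  shows "\<exists>g'\<in>FV (m + k). \<forall>s\<in>tuples I m. \<forall>t\<in>tuples I k. op g' t s = cnj (op g s t)"
proof -
  obtain g' where g': "g' \<in> FV (k + m)" "\<And>s. s \<in> tuples I (k + m) \<Longrightarrow> g' s = cnj (g (rev (map bar s)))"
    using FV_star[OF assms] by blast
  have "op g' t s = cnj (op g s t)" if st: "s \<in> tuples I m" "t \<in> tuples I k" for s t
  proof -
    have "rev (map bar s) @ t \<in> tuples I (k + m)"
      using tuples_appendI[OF rbar_tuples[OF st(1)] st(2)] by (simp add: add.commute)
    moreover have "rev (map bar (rev (map bar s) @ t)) = rev (map bar t) @ s"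
      using st by (auto simp: tuples_def rev_map intro!: map_idI)
    ultimately have "g' (rev (map bar s) @ t) = cnj (g (rev (map bar t) @ s))" using g'(2) by simp
    moreover have "lamp s = lamp t" if "g (rev (map bar t) @ s) \<noteq> 0"
      using FV_hom[OF assms _ that] st lamp_append_rbar[of t s] by (auto simp: tuples_set)
    ultimately show ?thesis unfolding op_def by auto
  qed
  then show ?thesis using g'(1) by (auto simp: add.commute)
qed

lemma FV_op:
  assumes "f \<in> FV (j + k + l)" "g \<in> FV (k + m)"
  shows "\<exists>h\<in>FV (j + m + l). \<forall>x\<in>tuples I j. \<forall>s\<in>tuples I m. \<forall>z\<in>tuples I l.
    h (x @ s @ z) = (\<Sum>t\<in>tuples I k. op g s t * f (x @ t @ z))"
  using FV_contract[OF assms] unfolding op_def by (simp add: mult_ac)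

text \<open>The map T = id \<otimes> \<open>op g\<close> \<otimes> id sends noncrossing tensors to
  noncrossing tensors, and so does its adjoint by \<open>op_star\<close>. Hence T intertwines the
  two orthogonal projections; this is that identity at one matrix entry.\<close>

lemma P_interchange:
  assumes g: "g \<in> FV (k + m)" and x: "x \<in> tuples I j" "x' \<in> tuples I j" and z: "z \<in> tuples I l" "z' \<in> tuples I l"
    and s: "s \<in> tuples I m" and r: "r \<in> tuples I k"
  shows "(\<Sum>t\<in>tuples I k. op g s t * P (j + k + l) (x @ t @ z) (x' @ r @ z')) =
    (\<Sum>t\<in>tuples I m. op g t r * P (j + m + l) (x @ s @ z) (x' @ t @ z'))"
proof -
  let ?p = "P (j + k + l)" and ?q = "P (j + m + l)"
  let ?y = "x' @ r @ z'" and ?w = "x @ s @ z"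
  obtain h where h: "h \<in> FV (j + m + l)" "\<And>x s z. x \<in> tuples I j \<Longrightarrow> s \<in> tuples I m \<Longrightarrow> z \<in> tuples I l \<Longrightarrow>
      h (x @ s @ z) = (\<Sum>t\<in>tuples I k. op g s t * ?p (x @ t @ z) ?y)"
    using FV_op[OF P_FV g] by blast
  obtain g' where g': "g' \<in> FV (m + k)" "\<And>s t. s \<in> tuples I m \<Longrightarrow> t \<in> tuples I k \<Longrightarrow> op g' t s = cnj (op g s t)"
    using op_star[OF g] by blast
  obtain h' where h': "h' \<in> FV (j + k + l)" "\<And>x t z. x \<in> tuples I j \<Longrightarrow> t \<in> tuples I k \<Longrightarrow> z \<in> tuples I l \<Longrightarrow>
      h' (x @ t @ z) = (\<Sum>s\<in>tuples I m. op g' t s * ?q (x @ s @ z) ?w)"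
    using FV_op[OF P_FV g'(1)] by blast
  let ?abc = "\<lambda>n F. \<Sum>a\<in>tuples I j. \<Sum>b\<in>tuples I n. \<Sum>c\<in>tuples I l. (F a b c :: complex)"
  have split: "(\<Sum>v\<in>tuples I (j + n + l). F v) = ?abc n (\<lambda>a b c. F (a @ b @ c))" for n and F :: "'i list \<Rightarrow> complex"
    by (simp add: sum_tuples_append)
  have "h ?w = ?abc m (\<lambda>a b c. h (a @ b @ c) * cnj (?q (a @ b @ c) ?w))"
    using P_repr[OF h(1), of ?w] by (simp only: split)
  also have "\<dots> = ?abc m (\<lambda>a b c. \<Sum>t\<in>tuples I k. ?p (a @ t @ c) ?y * (op g b t * cnj (?q (a @ b @ c) ?w)))"
    by (intro sum.cong refl) (simp add: h(2) sum_distrib_left sum_distrib_right mult_ac)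
  also have "\<dots> = (\<Sum>a\<in>tuples I j. \<Sum>c\<in>tuples I l. \<Sum>b\<in>tuples I m. \<Sum>t\<in>tuples I k. ?p (a @ t @ c) ?y * (op g b t * cnj (?q (a @ b @ c) ?w)))"
    by (rule sum.cong[OF refl], rule sum.swap)
  also have "\<dots> = (\<Sum>a\<in>tuples I j. \<Sum>c\<in>tuples I l. \<Sum>t\<in>tuples I k. \<Sum>b\<in>tuples I m. ?p (a @ t @ c) ?y * (op g b t * cnj (?q (a @ b @ c) ?w)))"
    by (rule sum.cong[OF refl], rule sum.cong[OF refl], rule sum.swap)
  also have "\<dots> = ?abc k (\<lambda>a t c. \<Sum>b\<in>tuples I m. ?p (a @ t @ c) ?y * (op g b t * cnj (?q (a @ b @ c) ?w)))"
    by (rule sum.cong[OF refl], rule sum.swap)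
  also have "\<dots> = ?abc k (\<lambda>a t c. cnj (h' (a @ t @ c) * cnj (?p (a @ t @ c) ?y)))"
    by (intro sum.cong refl) (simp add: h'(2) g'(2) sum_distrib_left sum_distrib_right mult_ac)
  also have "\<dots> = cnj (h' ?y)"
    using P_repr[OF h'(1), of ?y] by (simp only: split cnj_sum)
  also have "\<dots> = (\<Sum>b\<in>tuples I m. op g b r * ?q ?w (x' @ b @ z'))"
    using h'(2)[OF x(2) r z(2)] r g'(2) by (simp add: cnj_sum P_herm[of _ ?w])
  finally show ?thesis using h(2)[OF x(1) s z(1)] by simp
qed

end

lemma gram_square:
  fixes a :: "'t \<Rightarrow> complex" and v :: "'e \<Rightarrow> 't \<Rightarrow> complex"
  shows "(\<Sum>s\<in>T. (\<Sum>t\<in>T. a t * (\<Sum>e\<in>E. v e t * cnj (v e s))) * cnj (a s)) =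
    complex_of_real (\<Sum>e\<in>E. (cmod (\<Sum>t\<in>T. a t * v e t))\<^sup>2)"
proof -
  have "(\<Sum>s\<in>T. (\<Sum>t\<in>T. a t * (\<Sum>e\<in>E. v e t * cnj (v e s))) * cnj (a s))
      = (\<Sum>s\<in>T. \<Sum>t\<in>T. \<Sum>e\<in>E. (a t * v e t) * cnj (a s * v e s))"
    by (simp add: sum_distrib_left sum_distrib_right mult_ac)
  also have "\<dots> = (\<Sum>s\<in>T. \<Sum>e\<in>E. \<Sum>t\<in>T. (a t * v e t) * cnj (a s * v e s))"
    by (rule sum.cong[OF refl], rule sum.swap)
  also have "\<dots> = (\<Sum>e\<in>E. \<Sum>s\<in>T. \<Sum>t\<in>T. (a t * v e t) * cnj (a s * v e s))"
    by (rule sum.swap)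
  also have "\<dots> = (\<Sum>e\<in>E. (\<Sum>t\<in>T. a t * v e t) * cnj (\<Sum>s\<in>T. a s * v e s))"
    unfolding cnj_sum sum_product by (rule sum.cong[OF refl], rule sum.swap)
  also have "\<dots> = complex_of_real (\<Sum>e\<in>E. (cmod (\<Sum>t\<in>T. a t * v e t))\<^sup>2)"
    unfolding of_real_sum by (intro sum.cong refl) (metis complex_norm_square)
  finally show ?thesis .
qed

section \<open>The Haar form on words and its positivity\<close>

context frob
begin

abbreviation rbar :: "'i list \<Rightarrow> 'i list" where
  "rbar s \<equiv> rev (map bar s)"

lemma rbar_rbar: "s \<in> tuples I k \<Longrightarrow> rbar (rbar s) = s"
  by (auto simp: tuples_def rev_map intro!: map_idI)

lemma sum_rbar: "(\<Sum>t\<in>tuples I k. f (rbar t)) = (\<Sum>t\<in>tuples I k. f t)"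
  by (rule sum.reindex_bij_witness[of _ rbar rbar]) (simp_all only: rbar_rbar rbar_tuples)

text \<open>Composing with \<open>rbar\<close> and conjugating is an antiunitary that preserves
  \<open>FV m\<close>, so it commutes with the projection.\<close>

lemma P_rbar:
  assumes "x \<in> tuples I m" "y \<in> tuples I m"
  shows "P m (rbar x) (rbar y) = cnj (P m x y)"
proof -
  obtain h where h: "h \<in> FV m" "\<And>z. z \<in> tuples I m \<Longrightarrow> h z = cnj (P m (rbar z) (rbar y))"
    using FV_star[OF P_FV] by blast
  obtain f where f: "f \<in> FV m" "\<And>z. z \<in> tuples I m \<Longrightarrow> f z = cnj (P m (rbar z) x)"
    using FV_star[OF P_FV] by blast
  have "cnj (P m y x) = f (rbar y)"
    using f(2)[OF rbar_tuples[OF assms(2)]] by (simp only: rbar_rbar[OF assms(2)])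
  also have "\<dots> = (\<Sum>z\<in>tuples I m. f z * cnj (P m z (rbar y)))"
    by (rule P_repr[OF f(1)])
  also have "\<dots> = (\<Sum>z\<in>tuples I m. f (rbar z) * cnj (P m (rbar z) (rbar y)))"
    by (rule sum_rbar[symmetric])
  also have "\<dots> = (\<Sum>z\<in>tuples I m. h z * P m x z)"
  proof (rule sum.cong[OF refl])
    fix z assume z: "z \<in> tuples I m"
    have "f (rbar z) = P m x z"
      using f(2)[OF rbar_tuples[OF z]] P_herm[of m x z] by (simp only: rbar_rbar[OF z])
    then show "f (rbar z) * cnj (P m (rbar z) (rbar y)) = h z * P m x z" by (simp only: h(2)[OF z] mult.commute)
  qed
  also have "\<dots> = h x" by (rule P_repr'[OF h(1), symmetric])
  also have "\<dots> = cnj (P m (rbar x) (rbar y))" by (rule h(2)[OF assms(1)])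
  finally show ?thesis using P_herm[of m y x] by simp
qed

definition W :: "('i list \<times> 'i list) set" where
  "W = {w. fst w \<in> tuples I (length (fst w)) \<and> snd w \<in> tuples I (length (fst w))}"

text \<open>
  \<open>G\<close> is the sesquilinear form \<open>h(y\<^sup>* x)\<close> of the Haar state \<open>h\<close> on words in the generators; the
  pair \<open>(s, r)\<close> stands for the word \<open>u\<^bsub>s\<^sub>1r\<^sub>1\<^esub> u\<^bsub>s\<^sub>2r\<^sub>2\<^esub> \<dots>\<close>.
\<close>

definition G :: "'i list \<times> 'i list \<Rightarrow> 'i list \<times> 'i list \<Rightarrow> complex" where
  "G w w' = (if w \<in> W \<and> w' \<in> W then complex_of_real (lamp (snd w') / lamp (fst w')) *
     P (length (fst w') + length (fst w)) (rbar (fst w') @ fst w) (rbar (snd w') @ snd w) else 0)"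

lemma in_W: "s \<in> tuples I k \<Longrightarrow> (s, r) \<in> W \<longleftrightarrow> r \<in> tuples I k"
  by (auto simp: W_def tuples_def)

lemma W_E:
  assumes "w \<in> W"
  obtains s r k where "w = (s, r)" "s \<in> tuples I k" "r \<in> tuples I k"
  using assms by (cases w) (auto simp: W_def)

lemma G_eq:
  assumes "s \<in> tuples I k" "r \<in> tuples I k" "s' \<in> tuples I k'" "r' \<in> tuples I k'"
  shows "G (s, r) (s', r') = complex_of_real (lamp r' / lamp s') * P (k' + k) (rbar s' @ s) (rbar r' @ r)"
  using assms by (simp add: G_def in_W tuples_length)

lemma G_outside: "w \<notin> W \<or> w' \<notin> W \<Longrightarrow> G w w' = 0"
  by (auto simp: G_def)

lemma P_hom_rbar:
  assumes "s \<in> tuples I k" "r \<in> tuples I k" "s' \<in> tuples I k'" "r' \<in> tuples I k'"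
    and "P (k' + k) (rbar s' @ s) (rbar r' @ r) \<noteq> 0"
  shows "lamp s = lamp s'" "lamp r = lamp r'"
  using P_hom[OF _ _ assms(5)] assms(1-4) lamp_append_rbar[of s' s] lamp_append_rbar[of r' r]
  by (auto simp: tuples_set intro!: tuples_appendI)

lemma G_herm: "G w' w = cnj (G w w')"
proof (cases "w \<in> W \<and> w' \<in> W")
  case True
  then obtain s r k s' r' k' where w: "w = (s, r)" "s \<in> tuples I k" "r \<in> tuples I k"
    and w': "w' = (s', r')" "s' \<in> tuples I k'" "r' \<in> tuples I k'"
    by (metis W_E)
  let ?x = "rbar s' @ s" and ?y = "rbar r' @ r"
  have xy: "?x \<in> tuples I (k' + k)" "?y \<in> tuples I (k' + k)" using w w' by (auto intro!: tuples_appendI)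
  have "rbar ?x = rbar s @ s'" "rbar ?y = rbar r @ r'"
    using rbar_rbar[OF w'(2)] rbar_rbar[OF w'(3)] by simp_all
  then have "P (k + k') (rbar s @ s') (rbar r @ r') = cnj (P (k' + k) ?x ?y)"
    using P_rbar[OF xy] by (simp only: add.commute)
  moreover have "complex_of_real (lamp r / lamp s) * cnj (P (k' + k) ?x ?y) = complex_of_real (lamp r' / lamp s') * cnj (P (k' + k) ?x ?y)"
    using P_hom_rbar[OF w(2,3) w'(2,3)] by (cases "P (k' + k) ?x ?y = 0") simp_all
  ultimately show ?thesis
    unfolding w(1) w'(1) G_eq[OF w(2,3) w'(2,3)] G_eq[OF w'(2,3) w(2,3)] complex_cnj_mult complex_cnj_complex_of_real
    by (simp only:)
qed (metis G_outside complex_cnj_zero)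

text \<open>In the quantum group the adjoint of u_ab is \<open>lam b / lam a\<close> times the
  generator at \<open>bar a\<close>, \<open>bar b\<close>. The weights in \<open>G\<close> make both
  sides multiples of the same entry of \<open>P\<close> with equal total factor.\<close>

lemma G_adj:
  assumes "a \<in> I" "b \<in> I"
  shows "G (a # s, b # r) (s', r') = complex_of_real (lam b / lam a) * G (s, r) (bar a # s', bar b # r')"
proof -
  have mem: "(a # s, b # r) \<in> W \<longleftrightarrow> (s, r) \<in> W" "(bar a # s', bar b # r') \<in> W \<longleftrightarrow> (s', r') \<in> W"
    using assms by (auto simp: W_def)
  show ?thesis
  proof (cases "(s, r) \<in> W \<and> (s', r') \<in> W")
    case True
    then obtain k k' where k: "s \<in> tuples I k" "r \<in> tuples I k" "s' \<in> tuples I k'" "r' \<in> tuples I k'"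
      by (auto simp: W_def)
    have "G (a # s, b # r) (s', r') = complex_of_real (lamp r' / lamp s') * P (k' + Suc k) (rbar s' @ a # s) (rbar r' @ b # r)"
      using k assms by (intro G_eq) auto
    moreover have "G (s, r) (bar a # s', bar b # r') = complex_of_real (lamp (bar b # r') / lamp (bar a # s')) *
        P (Suc k' + k) (rbar (bar a # s') @ s) (rbar (bar b # r') @ r)"
      using k assms by (intro G_eq) auto
    moreover have "lam b / lam a * (lamp (bar b # r') / lamp (bar a # s')) = lamp r' / lamp s'"
      using lam_pos[OF assms(1)] lam_pos[OF assms(2)] assms by (simp add: lam_bar)
    ultimately show ?thesis using assms by (simp add: mult.assoc[symmetric] of_real_mult[symmetric] del: of_real_mult of_real_divide)
  qed (use mem in \<open>auto simp: G_outside\<close>)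
qed

text \<open>The intertwiner relation of \<open>op g\<close>, tested in the form \<open>G\<close> at
  the left end of words; it is \<open>P_interchange\<close> with the remaining letters as
  context.\<close>

lemma G_relation:
  assumes g: "g \<in> FV (k + m)" and s: "s \<in> tuples I m" and r: "r \<in> tuples I k"
  shows "(\<Sum>t\<in>tuples I k. op g s t * G (t @ s0, r @ r0) w') = (\<Sum>t\<in>tuples I m. op g t r * G (s @ s0, t @ r0) w')"
proof -
  have mem: "(t @ s0, t' @ r0) \<in> W \<longleftrightarrow> (s0, r0) \<in> W" if "t \<in> tuples I n" "t' \<in> tuples I n" for t t' n
    using that by (auto simp: W_def tuples_def)
  show ?thesis
  proof (cases "(s0, r0) \<in> W \<and> w' \<in> W")
    case True
    then obtain s' r' k' l where w': "w' = (s', r')" "s' \<in> tuples I k'" "r' \<in> tuples I k'"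
      and l: "s0 \<in> tuples I l" "r0 \<in> tuples I l"
      by (metis W_E prod.inject)
    let ?f = "complex_of_real (lamp r' / lamp s')"
    have "(\<Sum>t\<in>tuples I k. op g s t * G (t @ s0, r @ r0) w')
        = ?f * (\<Sum>t\<in>tuples I k. op g s t * P (k' + k + l) (rbar s' @ t @ s0) (rbar r' @ r @ r0))"
      unfolding sum_distrib_left w'(1)
      by (intro sum.cong refl, subst G_eq[OF tuples_appendI[OF _ l(1)] tuples_appendI[OF r l(2)] w'(2,3)])
         (simp_all add: add.assoc mult_ac)
    also have "\<dots> = ?f * (\<Sum>t\<in>tuples I m. op g t r * P (k' + m + l) (rbar s' @ s @ s0) (rbar r' @ t @ r0))"
      using P_interchange[OF g rbar_tuples[OF w'(2)] rbar_tuples[OF w'(3)] l s r] by (simp only:)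
    also have "\<dots> = (\<Sum>t\<in>tuples I m. op g t r * G (s @ s0, t @ r0) w')"
      unfolding sum_distrib_left w'(1)
      by (intro sum.cong refl, subst G_eq[OF tuples_appendI[OF s l(1)] tuples_appendI[OF _ l(2)] w'(2,3)])
         (simp_all add: add.assoc mult_ac)
    finally show ?thesis .
  next
    case False
    then show ?thesis using mem s r by (simp add: G_outside)
  qed
qed

definition WN :: "nat \<Rightarrow> ('i list \<times> 'i list) set" where
  "WN N = {w \<in> W. length (fst w) \<le> N}"

text \<open>Contracted projection kernels. They form the operator Z of the positivity argument,
  which acts on the first component of a word and keeps the second; the cutoff \<open>N\<close>
  keeps the sums finite.\<close>

definition zz :: "nat \<Rightarrow> 'i list \<Rightarrow> 'i list \<Rightarrow> complex" where
  "zz N t s' = (\<Sum>k\<le>N. \<Sum>s\<in>tuples I k. P (length s' + k) (rbar s' @ s) (rbar t @ s))"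

lemma WN_Sigma: "bij_betw (\<lambda>(k, s, r). (s, r)) (SIGMA k:{..N}. tuples I k \<times> tuples I k) (WN N)"
  by (rule bij_betwI[where g = "\<lambda>(s, r). (length s, s, r)"]) (auto simp: WN_def W_def tuples_def)

lemma finite_WN: "finite (WN N)"
  using bij_betw_finite[OF WN_Sigma] by auto

lemma sum_WN: "(\<Sum>w\<in>WN N. f w) = (\<Sum>k\<le>N. \<Sum>s\<in>tuples I k. \<Sum>r\<in>tuples I k. f (s, r))"
proof -
  have "(\<Sum>w\<in>WN N. f w) = (\<Sum>x\<in>(SIGMA k:{..N}. tuples I k \<times> tuples I k). f (case x of (k, s, r) \<Rightarrow> (s, r)))"
    by (rule sum.reindex_bij_betw[OF WN_Sigma, symmetric])
  also have "\<dots> = (\<Sum>k\<le>N. \<Sum>x\<in>tuples I k \<times> tuples I k. f x)"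
    by (subst sum.Sigma) (auto intro!: sum.cong)
  finally show ?thesis by (simp add: sum.cartesian_product)
qed

lemma sum_WN_diag:
  fixes f :: "'i list \<times> 'i list \<Rightarrow> complex"
  assumes "r \<in> tuples I k" "k \<le> N"
  shows "(\<Sum>w\<in>WN N. f w * (if snd w = r then h (fst w) else 0)) = (\<Sum>t\<in>tuples I k. f (t, r) * h t)"
proof -
  have "(\<Sum>t\<in>tuples I k. f (t, r) * h t) = (\<Sum>w\<in>{w \<in> WN N. snd w = r}. f w * h (fst w))"
    using assms by (intro sum.reindex_bij_witness[of _ fst "\<lambda>t. (t, r)"]) (auto simp: WN_def W_def tuples_def)
  also have "\<dots> = (\<Sum>w\<in>WN N. if snd w = r then f w * h (fst w) else 0)"
    using finite_WN by (simp add: sum.inter_filter)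
  also have "\<dots> = (\<Sum>w\<in>WN N. f w * (if snd w = r then h (fst w) else 0))"
    by (intro sum.cong) auto
  finally show ?thesis by simp
qed

lemma zz_gram:
  assumes "s' \<in> tuples I k'"
  shows "zz N t s' = (\<Sum>e\<in>(SIGMA k:{..N}. tuples I k \<times> tuples I (k' + k)).
    P (k' + fst e) (snd (snd e)) (rbar t @ fst (snd e)) * cnj (P (k' + fst e) (snd (snd e)) (rbar s' @ fst (snd e))))"
proof -
  have "zz N t s' = (\<Sum>k\<le>N. \<Sum>s\<in>tuples I k. \<Sum>q\<in>tuples I (k' + k).
      P (k' + k) q (rbar t @ s) * cnj (P (k' + k) q (rbar s' @ s)))"
    unfolding zz_def tuples_length[OF assms] by (intro sum.cong refl P_gram)
  also have "\<dots> = (\<Sum>k\<le>N. \<Sum>x\<in>tuples I k \<times> tuples I (k' + k).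
      P (k' + k) (snd x) (rbar t @ fst x) * cnj (P (k' + k) (snd x) (rbar s' @ fst x)))"
    by (simp add: sum.cartesian_product case_prod_unfold)
  finally show ?thesis by (subst (asm) sum.Sigma) (auto simp: case_prod_unfold)
qed

lemma zz_square:
  "(\<Sum>s'\<in>tuples I k'. (\<Sum>t\<in>tuples I k'. a t * zz N t s') * cnj (a s')) =
    complex_of_real (\<Sum>e\<in>(SIGMA k:{..N}. tuples I k \<times> tuples I (k' + k)).
      (cmod (\<Sum>t\<in>tuples I k'. a t * P (k' + fst e) (snd (snd e)) (rbar t @ fst (snd e))))\<^sup>2)"
proof -
  have "(\<Sum>s'\<in>tuples I k'. (\<Sum>t\<in>tuples I k'. a t * zz N t s') * cnj (a s')) =
    (\<Sum>s'\<in>tuples I k'. (\<Sum>t\<in>tuples I k'. a t * (\<Sum>e\<in>(SIGMA k:{..N}. tuples I k \<times> tuples I (k' + k)).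
    P (k' + fst e) (snd (snd e)) (rbar t @ fst (snd e)) * cnj (P (k' + fst e) (snd (snd e)) (rbar s' @ fst (snd e))))) * cnj (a s'))"
    by (intro sum.cong refl) (simp add: zz_gram)
  then show ?thesis by (simp only: gram_square[of a "\<lambda>e t. P (k' + fst e) (snd (snd e)) (rbar t @ fst (snd e))"])
qed

text \<open>By \<open>zz_square\<close> a vector in the kernel makes all sums over \<open>P\<close>
  vanish. Those with \<open>k = k'\<close>, present because \<open>k' \<le> N\<close>, are paired
  with the tensor of the identity map from \<open>FV_cups\<close>: it lies in \<open>FV\<close>, so
  \<open>P\<close> reproduces it, and it isolates the coefficient \<open>a s\<close>.\<close>

lemma zz_inj:
  assumes k: "k' \<le> N" and zero: "\<And>s'. s' \<in> tuples I k' \<Longrightarrow> (\<Sum>t\<in>tuples I k'. a t * zz N t s') = 0"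
    and s: "s \<in> tuples I k'"
  shows "a s = 0"
proof -
  let ?E = "SIGMA k:{..N}. tuples I k \<times> tuples I (k' + k)"
  let ?f = "\<lambda>e. \<Sum>t\<in>tuples I k'. a t * P (k' + fst e) (snd (snd e)) (rbar t @ fst (snd e))"
  have "complex_of_real (\<Sum>e\<in>?E. (cmod (?f e))\<^sup>2) = 0"
    unfolding zz_square[symmetric] by (rule sum.neutral) (simp add: zero)
  then have "(\<Sum>e\<in>?E. (cmod (?f e))\<^sup>2) = 0" by (simp only: of_real_eq_0_iff)
  moreover have "finite ?E" by (intro finite_SigmaI finite_cartesian_product finite_tuples fin) simp
  ultimately have all: "\<forall>e\<in>?E. (cmod (?f e))\<^sup>2 = 0"
    by (subst (asm) sum_nonneg_eq_0_iff) (assumption, rule zero_le_power2)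
  have sq: "?f e = 0" if "e \<in> ?E" for e
    using all[rule_format, OF that] by (simp only: zero_eq_power2 norm_eq_zero)
  have f0: "(\<Sum>t\<in>tuples I k'. a t * P (k' + k') q (rbar t @ s)) = 0" if "q \<in> tuples I (k' + k')" for q
    using sq[of "(k', s, q)"] that k s by simp
  obtain n where n: "n \<in> FV (k' + k')" "\<And>t s. t \<in> tuples I k' \<Longrightarrow> s \<in> tuples I k' \<Longrightarrow>
      n (rbar t @ s) = (if s = t then complex_of_real (1 / lamp t) else 0)"
    using FV_cups[of k'] by blast
  have "(\<Sum>t\<in>tuples I k'. cnj (a t) * n (rbar t @ s))
      = (\<Sum>t\<in>tuples I k'. \<Sum>q\<in>tuples I (k' + k'). n q * cnj (a t * P (k' + k') q (rbar t @ s)))"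
    by (intro sum.cong refl, subst P_repr[OF n(1)]) (simp add: sum_distrib_left mult_ac)
  also have "\<dots> = (\<Sum>q\<in>tuples I (k' + k'). n q * cnj (\<Sum>t\<in>tuples I k'. a t * P (k' + k') q (rbar t @ s)))"
    unfolding cnj_sum sum_distrib_left by (rule sum.swap)
  also have "\<dots> = 0" using f0 by simp
  finally have "(\<Sum>t\<in>tuples I k'. cnj (a t) * n (rbar t @ s)) = 0" .
  moreover have "(\<Sum>t\<in>tuples I k'. cnj (a t) * n (rbar t @ s)) = (\<Sum>t\<in>tuples I k'. if s = t then cnj (a t) * complex_of_real (1 / lamp t) else 0)"
    using s n(2) by (intro sum.cong refl) auto
  ultimately show ?thesis using s lamp_pos[OF tuples_set[OF s]] by simp
qed

text \<open>The identity GG = GZ. For fixed \<open>s\<close> the factor \<open>G (s, r) w'\<close>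
  is, as a function of \<open>r\<close>, a scaled and conjugated entry of \<open>op f\<close> for a
  tensor \<open>f\<close> in \<open>FV\<close>; the relation of \<open>f\<close> moves the sum from
  second indices \<open>r\<close> to first indices \<open>t\<close>.\<close>

lemma G_convolution:
  assumes w: "w0 \<in> WN N" and w': "w' \<in> WN N"
  shows "(\<Sum>w\<in>WN N. G w0 w * G w w') = (\<Sum>w\<in>WN N. G w0 w * (if snd w = snd w' then zz N (fst w) (fst w') else 0))"
proof -
  obtain s' r' k' where e: "w' = (s', r')" "s' \<in> tuples I k'" "r' \<in> tuples I k'" "k' \<le> N"
    using w' by (auto simp: WN_def tuples_length elim!: W_E)
  have inner: "(\<Sum>r\<in>tuples I k. G w0 (s, r) * G (s, r) w') =
      (\<Sum>t\<in>tuples I k'. G w0 (t, r') * P (k' + k) (rbar s' @ s) (rbar t @ s))" if s: "s \<in> tuples I k" for s k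
  proof -
    \<comment> \<open>A column of the projection kernel, which is itself a noncrossing
      tensor.\<close>
    define f where "f = (\<lambda>x. P (k' + k) x (rbar s' @ s))"
    have f: "f \<in> FV (k' + k)" unfolding f_def by (rule P_FV)
    have fP: "cnj (f x) = P (k' + k) (rbar s' @ s) x" for x
      unfolding f_def by (rule P_herm[symmetric])
    have pos: "lamp s' \<noteq> 0" using lamp_pos[OF tuples_set[OF e(2)]] by simp
    have "(\<Sum>t\<in>tuples I k'. op f s t * G (t, r') w0) = (\<Sum>t\<in>tuples I k. op f t r' * G (s, t) w0)"
      using G_relation[OF f s e(3), of "[]" "[]" w0] by simp
    then have "cnj (\<Sum>t\<in>tuples I k'. op f s t * G (t, r') w0) = cnj (\<Sum>t\<in>tuples I k. op f t r' * G (s, t) w0)"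
      by (rule arg_cong)
    then have rel: "(\<Sum>t\<in>tuples I k'. cnj (op f s t) * G w0 (t, r')) = (\<Sum>t\<in>tuples I k. cnj (op f t r') * G w0 (s, t))"
      by (simp add: cnj_sum G_herm[of w0])
    have "(\<Sum>r\<in>tuples I k. G w0 (s, r) * G (s, r) w')
        = (\<Sum>r\<in>tuples I k. complex_of_real (1 / lamp s') * (cnj (op f r r') * G w0 (s, r)))"
      using s e by (intro sum.cong refl) (simp add: G_eq op_def fP)
    also have "\<dots> = (\<Sum>t\<in>tuples I k'. complex_of_real (1 / lamp s') * (cnj (op f s t) * G w0 (t, r')))"
      unfolding sum_distrib_left[symmetric] rel ..
    also have "\<dots> = (\<Sum>t\<in>tuples I k'. G w0 (t, r') * P (k' + k) (rbar s' @ s) (rbar t @ s))"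
    proof (intro sum.cong refl)
      fix t assume t: "t \<in> tuples I k'"
      show "complex_of_real (1 / lamp s') * (cnj (op f s t) * G w0 (t, r')) = G w0 (t, r') * P (k' + k) (rbar s' @ s) (rbar t @ s)"
        using P_hom_rbar[OF s s e(2) t] pos
        by (cases "P (k' + k) (rbar s' @ s) (rbar t @ s) = 0") (auto simp: op_def fP)
    qed
    finally show ?thesis .
  qed
  have "(\<Sum>w\<in>WN N. G w0 w * G w w') = (\<Sum>k\<le>N. \<Sum>s\<in>tuples I k. \<Sum>t\<in>tuples I k'. G w0 (t, r') * P (k' + k) (rbar s' @ s) (rbar t @ s))"
    unfolding sum_WN by (intro sum.cong refl inner)
  also have "\<dots> = (\<Sum>k\<le>N. \<Sum>t\<in>tuples I k'. \<Sum>s\<in>tuples I k. G w0 (t, r') * P (k' + k) (rbar s' @ s) (rbar t @ s))"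
    by (rule sum.cong[OF refl], rule sum.swap)
  also have "\<dots> = (\<Sum>t\<in>tuples I k'. \<Sum>k\<le>N. \<Sum>s\<in>tuples I k. G w0 (t, r') * P (k' + k) (rbar s' @ s) (rbar t @ s))"
    by (rule sum.swap)
  also have "\<dots> = (\<Sum>t\<in>tuples I k'. G w0 (t, r') * zz N t s')"
    unfolding zz_def tuples_length[OF e(2)] sum_distrib_left ..
  also have "\<dots> = (\<Sum>w\<in>WN N. G w0 w * (if snd w = r' then zz N (fst w) s' else 0))"
    by (rule sum_WN_diag[OF e(3,4), symmetric])
  finally show ?thesis by (simp only: e(1) fst_conv snd_conv)
qed

lemma G_psd_WN: "0 \<le> Re (\<Sum>w'\<in>WN N. (\<Sum>w\<in>WN N. c w * G w w') * cnj (c w'))"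
proof (rule psd_of_relation[where Z = "\<lambda>w w'. if snd w = snd w' then zz N (fst w) (fst w') else 0"])
  fix w w' assume ww': "w \<in> WN N" "w' \<in> WN N"
  show "G w' w = cnj (G w w')" by (rule G_herm)
  show "(if snd w' = snd w then zz N (fst w') (fst w) else 0) = cnj (if snd w = snd w' then zz N (fst w) (fst w') else 0)"
  proof (cases "snd w = snd w'")
    case True
    then have "length (fst w) = length (fst w')" using ww' by (auto simp: WN_def W_def tuples_def)
    then show ?thesis using True by (simp add: zz_def cnj_sum P_herm[symmetric])
  qed simp
next
  fix c
  have diag: "(\<Sum>w\<in>WN N. c w * (if snd w = r' then zz N (fst w) s' else 0)) = (\<Sum>t\<in>tuples I k'. c (t, r') * zz N t s')"
    if "r' \<in> tuples I k'" "k' \<le> N" for s' r' k'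
    by (rule sum_WN_diag[OF that])
  have "(\<Sum>w'\<in>WN N. (\<Sum>w\<in>WN N. c w * (if snd w = snd w' then zz N (fst w) (fst w') else 0)) * cnj (c w'))
      = (\<Sum>k'\<le>N. \<Sum>s'\<in>tuples I k'. \<Sum>r'\<in>tuples I k'. (\<Sum>t\<in>tuples I k'. c (t, r') * zz N t s') * cnj (c (s', r')))"
    unfolding sum_WN[of "\<lambda>w'. (\<Sum>w\<in>WN N. c w * (if snd w = snd w' then zz N (fst w) (fst w') else 0)) * cnj (c w')"]
    by (intro sum.cong refl) (simp add: diag)
  also have "\<dots> = (\<Sum>k'\<le>N. \<Sum>r'\<in>tuples I k'. \<Sum>s'\<in>tuples I k'. (\<Sum>t\<in>tuples I k'. c (t, r') * zz N t s') * cnj (c (s', r')))"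
    by (rule sum.cong[OF refl], rule sum.swap)
  finally show "0 \<le> Re (\<Sum>w'\<in>WN N. (\<Sum>w\<in>WN N. c w * (if snd w = snd w' then zz N (fst w) (fst w') else 0)) * cnj (c w'))"
    by (simp only: zz_square Re_sum) (auto intro!: sum_nonneg)
  fix w
  assume zero: "\<And>w'. w' \<in> WN N \<Longrightarrow> (\<Sum>w\<in>WN N. c w * (if snd w = snd w' then zz N (fst w) (fst w') else 0)) = 0"
    and w: "w \<in> WN N"
  then obtain s r k where e: "w = (s, r)" "s \<in> tuples I k" "r \<in> tuples I k" "k \<le> N"
    by (auto simp: WN_def tuples_length elim!: W_E)
  have "(\<Sum>t\<in>tuples I k. c (t, r) * zz N t s') = 0" if "s' \<in> tuples I k" for s'
  proof -
    have "(s', r) \<in> WN N" using that e by (auto simp: WN_def W_def tuples_def)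
    from zero[OF this] show ?thesis using diag[OF e(3,4)] by simp
  qed
  then show "c w = 0" using zz_inj[OF e(4) _ e(2), of "\<lambda>t. c (t, r)"] e(1) by simp
qed (auto intro: finite_WN G_convolution)

text \<open>A finite set of words lies in some \<open>WN N\<close> apart from pairs outside
  \<open>W\<close>, where \<open>G\<close> vanishes.\<close>

lemma G_psd:
  assumes "finite F"
  shows "0 \<le> Re (\<Sum>w'\<in>F. (\<Sum>w\<in>F. c w * G w w') * cnj (c w'))"
proof -
  define N where "N = Max (insert 0 ((\<lambda>w. length (fst w)) ` F))"
  define c' where "c' w = (if w \<in> F then c w else 0)" for w
  have N: "w \<in> F \<Longrightarrow> w \<in> W \<Longrightarrow> w \<in> WN N" for w
    using assms unfolding WN_def N_def by auto
  have 1: "(\<Sum>w\<in>F. c w * G w w') = (\<Sum>w\<in>WN N. c' w * G w w')" for w'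
  proof (rule sum.mono_neutral_cong)
    fix w assume "w \<in> F - WN N"
    then have "w \<notin> W" using N by blast
    then show "c w * G w w' = 0" by (simp add: G_outside)
  qed (use assms finite_WN in \<open>auto simp: c'_def\<close>)
  have "(\<Sum>w'\<in>F. (\<Sum>w\<in>WN N. c' w * G w w') * cnj (c w')) = (\<Sum>w'\<in>WN N. (\<Sum>w\<in>WN N. c' w * G w w') * cnj (c' w'))"
  proof (rule sum.mono_neutral_cong)
    fix w' assume "w' \<in> F - WN N"
    then have "w' \<notin> W" using N by blast
    then show "(\<Sum>w\<in>WN N. c' w * G w w') * cnj (c w') = 0" by (simp add: G_outside)
  qed (use assms finite_WN in \<open>auto simp: c'_def\<close>)
  then show ?thesis using 1 G_psd_WN[of c' N] by simp
qed

text \<open>The converse of \<open>G_relation\<close>. Tested on words of length \<open>k\<close>,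
  the relation says that id \<otimes> T commutes with the projections. Applied to the tensor
  \<open>n\<close> of the identity map, which already lies in \<open>FV\<close>, it shows that the
  tensor of T equals its own projection \<open>g\<close>.\<close>

lemma op_of_relation:
  assumes rel: "\<And>s r w'. s \<in> tuples I l \<Longrightarrow> r \<in> tuples I k \<Longrightarrow>
    (\<Sum>t\<in>tuples I k. T s t * G (t, r) w') = (\<Sum>t\<in>tuples I l. T t r * G (s, t) w')"
  shows "\<exists>g\<in>FV (k + l). \<forall>s\<in>tuples I l. \<forall>t\<in>tuples I k. T s t = op g s t"
proof -
  obtain n where n: "n \<in> FV (k + k)" "\<And>t s. t \<in> tuples I k \<Longrightarrow> s \<in> tuples I k \<Longrightarrow>
      n (rbar t @ s) = (if s = t then complex_of_real (1 / lamp t) else 0)"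
    using FV_cups[of k] by blast
  define g where "g x = (\<Sum>r'\<in>tuples I k. \<Sum>r\<in>tuples I k. \<Sum>t\<in>tuples I l.
      (T t r * n (rbar r' @ r)) * P (k + l) x (rbar r' @ t))" for x
  have g: "g \<in> FV (k + l)"
    unfolding g_def by (intro FV_sum FV_scale P_FV finite_tuples fin)
  have "T s s' = op g s s'" if s: "s \<in> tuples I l" and s': "s' \<in> tuples I k" for s s'
  proof -
    have pos: "0 < lamp s'" using lamp_pos[OF tuples_set[OF s']] .
    have P_rel: "(\<Sum>t\<in>tuples I k. T s t * P (k + k) (rbar s' @ t) (rbar r' @ r)) = (\<Sum>t\<in>tuples I l. T t r * P (k + l) (rbar s' @ s) (rbar r' @ t))"
      if r: "r \<in> tuples I k" "r' \<in> tuples I k" for r r'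
    proof -
      let ?c = "complex_of_real (lamp r' / lamp s')"
      have c: "?c \<noteq> 0" using pos lamp_pos[OF tuples_set[OF r(2)]] by simp
      have "?c * (\<Sum>t\<in>tuples I k. T s t * P (k + k) (rbar s' @ t) (rbar r' @ r)) = (\<Sum>t\<in>tuples I k. T s t * G (t, r) (s', r'))"
        unfolding sum_distrib_left using r s' by (intro sum.cong refl) (simp add: G_eq)
      also have "\<dots> = (\<Sum>t\<in>tuples I l. T t r * G (s, t) (s', r'))" by (rule rel[OF s r(1)])
      also have "\<dots> = ?c * (\<Sum>t\<in>tuples I l. T t r * P (k + l) (rbar s' @ s) (rbar r' @ t))"
        unfolding sum_distrib_left using r s s' by (intro sum.cong refl) (simp add: G_eq)
      finally show ?thesis by (rule mult_left_cancel[OF c, THEN iffD1])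
    qed
    have "g (rbar s' @ s) = (\<Sum>r'\<in>tuples I k. \<Sum>r\<in>tuples I k. n (rbar r' @ r) * (\<Sum>t\<in>tuples I l. T t r * P (k + l) (rbar s' @ s) (rbar r' @ t)))"
      unfolding g_def sum_distrib_left by (intro sum.cong refl) (simp add: mult_ac)
    also have "\<dots> = (\<Sum>r'\<in>tuples I k. \<Sum>r\<in>tuples I k. n (rbar r' @ r) * (\<Sum>t\<in>tuples I k. T s t * P (k + k) (rbar s' @ t) (rbar r' @ r)))"
      by (intro sum.cong refl) (simp add: P_rel)
    also have "\<dots> = (\<Sum>r'\<in>tuples I k. \<Sum>r\<in>tuples I k. n (r' @ r) * (\<Sum>t\<in>tuples I k. T s t * P (k + k) (rbar s' @ t) (r' @ r)))"
      by (rule sum_rbar)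
    also have "\<dots> = (\<Sum>q\<in>tuples I (k + k). \<Sum>t\<in>tuples I k. T s t * (n q * P (k + k) (rbar s' @ t) q))"
      unfolding sum_tuples_append sum_distrib_left by (intro sum.cong refl) (simp add: mult_ac)
    also have "\<dots> = (\<Sum>t\<in>tuples I k. T s t * n (rbar s' @ t))"
      by (subst sum.swap) (simp only: sum_distrib_left[symmetric] P_repr'[OF n(1), symmetric])
    also have "\<dots> = (\<Sum>t\<in>tuples I k. if t = s' then T s t * complex_of_real (1 / lamp s') else 0)"
      using s' by (intro sum.cong refl) (simp add: n(2))
    finally show ?thesis using s' pos by (simp add: op_def)
  qed
  then show ?thesis using g by blast
qed

end

section \<open>The Hilbert space of square summable sequences\<close>

typedef ell2 = "{x :: nat \<Rightarrow> complex. summable (\<lambda>n. (cmod (x n))\<^sup>2)}"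
  by (rule exI[of _ "\<lambda>_. 0"]) simp

setup_lifting type_definition_ell2

lemma cmod_add_square_le: "(cmod (x + y))\<^sup>2 \<le> 2 * (cmod x)\<^sup>2 + 2 * (cmod y)\<^sup>2"
proof -
  have "(cmod (x + y))\<^sup>2 \<le> (cmod x + cmod y)\<^sup>2" by (simp add: norm_triangle_ineq power_mono)
  also have "\<dots> \<le> 2 * (cmod x)\<^sup>2 + 2 * (cmod y)\<^sup>2"
    using zero_le_power2[of "cmod x - cmod y"] by (simp add: power2_eq_square algebra_simps)
  finally show ?thesis .
qed

lemma square_summable_add:
  assumes "summable (\<lambda>n. (cmod (x n))\<^sup>2)" "summable (\<lambda>n. (cmod (y n))\<^sup>2)"
  shows "summable (\<lambda>n. (cmod (x n + y n))\<^sup>2)"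
proof (rule summable_comparison_test')
  show "summable (\<lambda>n. 2 * (cmod (x n))\<^sup>2 + 2 * (cmod (y n))\<^sup>2)"
    by (intro summable_add summable_mult assms)
  show "norm ((cmod (x n + y n))\<^sup>2) \<le> 2 * (cmod (x n))\<^sup>2 + 2 * (cmod (y n))\<^sup>2" if "n \<ge> 0" for n
    using cmod_add_square_le by simp
qed

lemma square_summable_mult:
  assumes "summable (\<lambda>n. (cmod (x n))\<^sup>2)"
  shows "summable (\<lambda>n. (cmod (c * x n))\<^sup>2)"
  using summable_mult[OF assms, of "(cmod c)\<^sup>2"] by (simp add: norm_mult power_mult_distrib)

text \<open>The type classes carry the real Hilbert space; the complex structure is added below
  through \<open>J\<close>, \<open>cscale\<close> and \<open>cin\<close>.\<close>

instantiation ell2 :: real_vector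
begin

lift_definition zero_ell2 :: ell2 is "\<lambda>_. 0" by simp
lift_definition plus_ell2 :: "ell2 \<Rightarrow> ell2 \<Rightarrow> ell2" is "\<lambda>x y n. x n + y n"
  by (rule square_summable_add)
lift_definition uminus_ell2 :: "ell2 \<Rightarrow> ell2" is "\<lambda>x n. - x n" by simp
lift_definition minus_ell2 :: "ell2 \<Rightarrow> ell2 \<Rightarrow> ell2" is "\<lambda>x y n. x n - y n"
  using square_summable_add[of _ "\<lambda>n. - _ n"] by simp
lift_definition scaleR_ell2 :: "real \<Rightarrow> ell2 \<Rightarrow> ell2" is "\<lambda>r x n. complex_of_real r * x n"
  by (rule square_summable_mult)

instance
  by (standard; transfer) (auto simp: algebra_simps)

end

lift_definition coord :: "ell2 \<Rightarrow> nat \<Rightarrow> complex" is "\<lambda>x. x" .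

lemma coord_simps [simp]:
  "coord 0 n = 0" "coord (x + y) n = coord x n + coord y n" "coord (- x) n = - coord x n"
  "coord (x - y) n = coord x n - coord y n" "coord (r *\<^sub>R x) n = complex_of_real r * coord x n"
  by (transfer; simp)+

lemma coord_summable: "summable (\<lambda>n. (cmod (coord x n))\<^sup>2)"
  by transfer simp

lemma ell2_eqI: "(\<And>n. coord x n = coord y n) \<Longrightarrow> x = y"
  by transfer auto

lemma prod_summable: "summable (\<lambda>n. Re (coord x n * cnj (coord y n)))"
proof (rule summable_comparison_test')
  show "summable (\<lambda>n. (cmod (coord x n))\<^sup>2 + (cmod (coord y n))\<^sup>2)"
    by (intro summable_add coord_summable)
  fix n :: nat
  have "\<bar>Re (coord x n * cnj (coord y n))\<bar> \<le> cmod (coord x n) * cmod (coord y n)"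
    using abs_Re_le_cmod[of "coord x n * cnj (coord y n)"] by (simp add: norm_mult)
  also have "\<dots> \<le> (cmod (coord x n))\<^sup>2 + (cmod (coord y n))\<^sup>2"
    using sum_squares_bound[of "cmod (coord x n)" "cmod (coord y n)"]
      mult_nonneg_nonneg[OF norm_ge_zero[of "coord x n"] norm_ge_zero[of "coord y n"]] by linarith
  finally show "norm (Re (coord x n * cnj (coord y n))) \<le> (cmod (coord x n))\<^sup>2 + (cmod (coord y n))\<^sup>2"
    by simp
qed

instantiation ell2 :: real_inner
begin

definition inner_ell2 :: "ell2 \<Rightarrow> ell2 \<Rightarrow> real" where
  "inner_ell2 x y = (\<Sum>n. Re (coord x n * cnj (coord y n)))"
definition norm_ell2 :: "ell2 \<Rightarrow> real" where "norm_ell2 x = sqrt (inner x x)"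
definition dist_ell2 :: "ell2 \<Rightarrow> ell2 \<Rightarrow> real" where "dist_ell2 x y = norm (x - y)"
definition sgn_ell2 :: "ell2 \<Rightarrow> ell2" where "sgn_ell2 x = x /\<^sub>R norm x"
definition uniformity_ell2 :: "(ell2 \<times> ell2) filter" where
  "uniformity_ell2 = (INF e\<in>{0 <..}. principal {(x, y). dist x y < e})"
definition open_ell2 :: "ell2 set \<Rightarrow> bool" where
  "open_ell2 U = (\<forall>x\<in>U. eventually (\<lambda>(x', y). x' = x \<longrightarrow> y \<in> U) uniformity)"

lemma inner_ell2_self: "inner (x::ell2) x = (\<Sum>n. (cmod (coord x n))\<^sup>2)"
  by (simp only: inner_ell2_def complex_norm_square[symmetric] Re_complex_of_real flip: of_real_power)

instance
proof
  fix x y z :: ell2 and r :: real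
  show "inner x y = inner y x"
    unfolding inner_ell2_def by (intro suminf_cong) (simp add: algebra_simps)
  show "inner (x + y) z = inner x z + inner y z"
    unfolding inner_ell2_def
    by (subst suminf_add[OF prod_summable prod_summable]) (simp add: algebra_simps)
  show "inner (r *\<^sub>R x) y = r * inner x y"
    unfolding inner_ell2_def
    by (subst suminf_mult[OF prod_summable, symmetric]) (simp add: algebra_simps)
  show "0 \<le> inner x x" unfolding inner_ell2_self by (intro suminf_nonneg coord_summable) simp
  show "inner x x = 0 \<longleftrightarrow> x = 0"
    unfolding inner_ell2_self using suminf_eq_zero_iff[OF coord_summable, of x]
    by (auto intro!: ell2_eqI)
qed (simp_all only: norm_ell2_def dist_ell2_def sgn_ell2_def uniformity_ell2_def open_ell2_def)

end

lemma norm_ell2_square: "(norm (x::ell2))\<^sup>2 = (\<Sum>n. (cmod (coord x n))\<^sup>2)"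
  using inner_ell2_self[of x] by (simp add: power2_norm_eq_inner)

lemma partial_le_norm: "(\<Sum>n<N. (cmod (coord x n))\<^sup>2) \<le> (norm x)\<^sup>2"
  unfolding norm_ell2_square by (intro sum_le_suminf coord_summable) auto

lemma coord_le_norm: "cmod (coord x n) \<le> norm x"
proof -
  have "(cmod (coord x n))\<^sup>2 \<le> (\<Sum>k<Suc n. (cmod (coord x k))\<^sup>2)" by (simp add: sum_nonneg)
  also have "\<dots> \<le> (norm x)\<^sup>2" by (rule partial_le_norm)
  finally show ?thesis by (rule power2_le_imp_le) simp
qed

instance ell2 :: complete_space
proof
  fix X :: "nat \<Rightarrow> ell2" assume C: "Cauchy X"
  have "Cauchy (\<lambda>m. coord (X m) n)" for n
  proof (rule metric_CauchyI)
    fix e :: real assume "e > 0"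
    then obtain M where "\<forall>m\<ge>M. \<forall>k\<ge>M. dist (X m) (X k) < e" using metric_CauchyD[OF C] by blast
    then show "\<exists>M. \<forall>m\<ge>M. \<forall>k\<ge>M. dist (coord (X m) n) (coord (X k) n) < e"
      using coord_le_norm[of "X _ - X _" n] unfolding dist_norm by (metis coord_simps(4) le_less_trans)
  qed
  then have L: "(\<lambda>m. coord (X m) n) \<longlonglongrightarrow> L n" if "L = (\<lambda>n. lim (\<lambda>m. coord (X m) n))" for n L
    unfolding that by (simp only: Cauchy_convergent convergent_LIMSEQ_iff[symmetric])
  then obtain L where L: "\<And>n. (\<lambda>m. coord (X m) n) \<longlonglongrightarrow> L n" by blast
  \<comment> \<open>A bound on all partial sums at once allows the limit in the second index to be
    taken under a finite sum.\<close>
  have tail: "\<exists>M. \<forall>m\<ge>M. \<forall>K. (\<Sum>n<K. (cmod (coord (X m) n - L n))\<^sup>2) \<le> e\<^sup>2" if e: "e > 0" for e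
  proof -
    obtain M where M: "\<And>m k. m \<ge> M \<Longrightarrow> k \<ge> M \<Longrightarrow> dist (X m) (X k) < e"
      using metric_CauchyD[OF C e] by blast
    have "(\<Sum>n<K. (cmod (coord (X m) n - L n))\<^sup>2) \<le> e\<^sup>2" if m: "m \<ge> M" for m K
    proof (rule LIMSEQ_le_const2)
      show "(\<lambda>k. \<Sum>n<K. (cmod (coord (X m) n - coord (X k) n))\<^sup>2) \<longlonglongrightarrow> (\<Sum>n<K. (cmod (coord (X m) n - L n))\<^sup>2)"
        by (intro tendsto_sum tendsto_power tendsto_norm tendsto_diff tendsto_const L)
      have "(\<Sum>n<K. (cmod (coord (X m) n - coord (X k) n))\<^sup>2) \<le> e\<^sup>2" if "k \<ge> M" for k
      proof -
        have "(\<Sum>n<K. (cmod (coord (X m) n - coord (X k) n))\<^sup>2) \<le> (norm (X m - X k))\<^sup>2"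
          using partial_le_norm[of "X m - X k" K] by simp
        also have "\<dots> \<le> e\<^sup>2" using M[OF m that] by (intro power_mono) (simp_all add: dist_norm)
        finally show ?thesis .
      qed
      then show "\<exists>N. \<forall>k\<ge>N. (\<Sum>n<K. (cmod (coord (X m) n - coord (X k) n))\<^sup>2) \<le> e\<^sup>2" by blast
    qed
    then show ?thesis by blast
  qed
  have sq: "summable (\<lambda>n. (cmod (coord (X m) n - L n))\<^sup>2)" "(\<Sum>n. (cmod (coord (X m) n - L n))\<^sup>2) \<le> e\<^sup>2"
    if "\<forall>K. (\<Sum>n<K. (cmod (coord (X m) n - L n))\<^sup>2) \<le> e\<^sup>2" for m e
  proof -
    show "summable (\<lambda>n. (cmod (coord (X m) n - L n))\<^sup>2)"
      using that by (intro summableI_nonneg_bounded[of _ "e\<^sup>2"]) auto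
    then show "(\<Sum>n. (cmod (coord (X m) n - L n))\<^sup>2) \<le> e\<^sup>2"
      using that by (intro suminf_le_const) auto
  qed
  obtain M where "\<forall>m\<ge>M. \<forall>K. (\<Sum>n<K. (cmod (coord (X m) n - L n))\<^sup>2) \<le> 1\<^sup>2" using tail[of 1] by auto
  then have "summable (\<lambda>n. (cmod (coord (X M) n - L n))\<^sup>2)" using sq(1)[of M 1] by blast
  then have "summable (\<lambda>n. (cmod (- 1 * (coord (X M) n - L n)))\<^sup>2)" by (rule square_summable_mult)
  from square_summable_add[OF coord_summable[of "X M"] this]
  have Lsum: "summable (\<lambda>n. (cmod (L n))\<^sup>2)" by simp
  define l where "l = Abs_ell2 L"
  have l: "coord l n = L n" for n unfolding l_def using Lsum by (simp add: coord.rep_eq Abs_ell2_inverse)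
  have "X \<longlonglongrightarrow> l"
  proof (rule metric_LIMSEQ_I)
    fix e :: real assume e: "e > 0"
    obtain M where M: "\<forall>m\<ge>M. \<forall>K. (\<Sum>n<K. (cmod (coord (X m) n - L n))\<^sup>2) \<le> (e / 2)\<^sup>2"
      using tail[of "e / 2"] e by auto
    have "dist (X m) l < e" if "m \<ge> M" for m
    proof -
      have "(norm (X m - l))\<^sup>2 \<le> (e / 2)\<^sup>2"
        unfolding norm_ell2_square using sq(2)[of m "e / 2"] M that by (simp add: l)
      then have "norm (X m - l) \<le> e / 2" by (rule power2_le_imp_le) (use e in simp)
      then show ?thesis using e by (simp add: dist_norm)
    qed
    then show "\<exists>no. \<forall>n\<ge>no. dist (X n) l < e" by blast
  qed
  then show "convergent X" by (auto simp: convergent_def)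
qed

instance ell2 :: banach ..

lift_definition J :: "ell2 \<Rightarrow> ell2" is "\<lambda>x n. \<i> * x n"
  by (rule square_summable_mult)

lemma coord_J [simp]: "coord (J x) n = \<i> * coord x n"
  by transfer simp

lemma J_linear: "J (x + y) = J x + J y" "J (r *\<^sub>R x) = r *\<^sub>R J x" "J (J x) = - x"
  by (auto intro!: ell2_eqI simp: algebra_simps)

lemma inner_J: "inner (J x) y = - inner x (J y)"
proof -
  have "inner (J x) y = (\<Sum>n. - Re (coord x n * cnj (coord (J y) n)))"
    unfolding inner_ell2_def by (intro suminf_cong) simp
  also have "\<dots> = - inner x (J y)"
    unfolding inner_ell2_def by (rule suminf_minus[OF prod_summable])
  finally show ?thesis .
qed

lemma norm_J: "norm (J x) = norm x"
  by (simp add: norm_eq_sqrt_inner inner_J J_linear(3))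

lemma bounded_linear_J: "bounded_linear J"
  by (rule bounded_linear_intro[of _ 1]) (simp_all add: J_linear norm_J)

definition cscale :: "complex \<Rightarrow> ell2 \<Rightarrow> ell2" where
  "cscale a x = Re a *\<^sub>R x + Im a *\<^sub>R J x"

lemma coord_cscale [simp]: "coord (cscale a x) n = a * coord x n"
  by (cases a) (simp add: cscale_def complex_eq_iff)

lemma norm_cscale: "norm (cscale a x) = cmod a * norm x"
proof -
  have "(norm (cscale a x))\<^sup>2 = (\<Sum>n. (cmod a)\<^sup>2 * (cmod (coord x n))\<^sup>2)"
    unfolding norm_ell2_square by (simp add: norm_mult power_mult_distrib)
  also have "\<dots> = (cmod a * norm x)\<^sup>2"
    unfolding power_mult_distrib norm_ell2_square by (rule suminf_mult[OF coord_summable])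
  finally show ?thesis by (rule power2_eq_imp_eq) auto
qed

text \<open>Linear in the first argument; the second component is the imaginary part because Re
  (-\<i> z) = Im z.\<close>

definition cin :: "ell2 \<Rightarrow> ell2 \<Rightarrow> complex" where
  "cin x y = Complex (inner x y) (inner x (J y))"

lemma cin_add_left: "cin (x + y) z = cin x z + cin y z"
  by (simp add: cin_def inner_add_left complex_eq_iff)

lemma cin_cscale_left: "cin (cscale a x) y = a * cin x y"
  by (simp add: cin_def cscale_def inner_add_left inner_J J_linear complex_eq_iff algebra_simps)

lemma cin_cnj: "cin y x = cnj (cin x y)"
  using inner_J[of x y] by (simp add: cin_def complex_eq_iff inner_commute)

lemma cin_self: "cin x x = complex_of_real ((norm x)\<^sup>2)"
proof -
  have "inner x (J x) = 0" using inner_J[of x x] by (simp add: inner_commute)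
  then show ?thesis by (simp add: cin_def complex_eq_iff power2_norm_eq_inner)
qed

lemma cin_add_right: "cin z (x + y) = cin z x + cin z y"
  by (simp add: cin_cnj[of z] cin_add_left)

lemma cin_cscale_right: "cin y (cscale a x) = cnj a * cin y x"
  by (simp add: cin_cnj[of y] cin_cscale_left)

lemma cin_zero [simp]: "cin 0 x = 0" "cin x 0 = 0"
  by (simp_all add: cin_def complex_eq_iff J_linear(2)[of 0, simplified])

lemma cin_sum_left: "cin (\<Sum>a\<in>A. f a) y = (\<Sum>a\<in>A. cin (f a) y)"
  by (induction A rule: infinite_finite_induct) (auto simp: cin_add_left)

lemma cin_sum_right: "cin y (\<Sum>a\<in>A. f a) = (\<Sum>a\<in>A. cin y (f a))"
  by (induction A rule: infinite_finite_induct) (auto simp: cin_add_right)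

lemma coord_sum [simp]: "coord (\<Sum>a\<in>A. f a) n = (\<Sum>a\<in>A. coord (f a) n)"
  by (induction A rule: infinite_finite_induct) auto

lift_definition ket :: "nat \<Rightarrow> ell2" is "\<lambda>n k. if k = n then 1 else 0"
proof -
  fix n :: nat
  have "summable (\<lambda>k. if k = n then (1::real) else 0)" by (rule summable_single)
  moreover have "(\<lambda>k. (cmod (if k = n then 1 else 0))\<^sup>2) = (\<lambda>k. if k = n then (1::real) else 0)" by auto
  ultimately show "summable (\<lambda>k. (cmod (if k = n then 1 else 0))\<^sup>2)" by simp
qed

lemma coord_ket [simp]: "coord (ket n) k = (if k = n then 1 else 0)"
  by transfer simp

lemma inner_ket: "inner x (ket n) = Re (coord x n)"
proof -
  have "inner x (ket n) = (\<Sum>k. if k = n then Re (coord x n) else 0)"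
    unfolding inner_ell2_def by (intro suminf_cong) auto
  then show ?thesis using sums_unique[OF sums_single[of n "\<lambda>k. Re (coord x n)"]] by simp
qed

lemma cin_ket: "cin x (ket n) = coord x n"
  using inner_J[of x "ket n"] by (simp add: cin_def inner_ket complex_eq_iff)

lemma ket_expansion: "(\<lambda>n. cscale (coord x n) (ket n)) sums x"
proof -
  have part: "coord (\<Sum>n<N. cscale (coord x n) (ket n)) k = (if k < N then coord x k else 0)" for N k
    by (simp add: if_distrib[of "\<lambda>t. _ * t"] cong: if_cong)
  have "(\<lambda>N. (\<Sum>n. (cmod (coord x (n + N)))\<^sup>2)) \<longlonglongrightarrow> 0"
    by (rule suminf_exist_split2[OF coord_summable])
  moreover have "(\<Sum>n. (cmod (coord x (n + N)))\<^sup>2) = (norm (x - (\<Sum>n<N. cscale (coord x n) (ket n))))\<^sup>2" for N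
  proof -
    let ?y = "x - (\<Sum>n<N. cscale (coord x n) (ket n))"
    have c: "coord ?y k = (if k < N then 0 else coord x k)" for k
      unfolding coord_simps(4) part by simp
    have "(norm ?y)\<^sup>2 = (\<Sum>n. (cmod (coord ?y (n + N)))\<^sup>2) + (\<Sum>n<N. (cmod (coord ?y n))\<^sup>2)"
      unfolding norm_ell2_square by (rule suminf_split_initial_segment[OF coord_summable])
    then show ?thesis unfolding c by simp
  qed
  ultimately have "(\<lambda>N. (norm (x - (\<Sum>n<N. cscale (coord x n) (ket n))))\<^sup>2) \<longlonglongrightarrow> 0" by simp
  then have "(\<lambda>N. sqrt ((norm (x - (\<Sum>n<N. cscale (coord x n) (ket n))))\<^sup>2)) \<longlonglongrightarrow> sqrt 0"
    by (rule tendsto_real_sqrt)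
  then have "(\<lambda>N. norm (x - (\<Sum>n<N. cscale (coord x n) (ket n)))) \<longlonglongrightarrow> 0" by simp
  then have "(\<lambda>N. norm ((\<Sum>n<N. cscale (coord x n) (ket n)) - x)) \<longlonglongrightarrow> 0"
    by (simp add: norm_minus_commute)
  then show ?thesis unfolding sums_def by (rule LIM_zero_cancel[OF tendsto_norm_zero_cancel])
qed

section \<open>The C*-algebra of bounded operators\<close>

text \<open>
  Operators are real bounded operators commuting with multiplication by \<open>\<i>\<close>; asking for an adjoint
  instead of proving that there is one avoids the Riesz representation theorem.
\<close>

definition is_adj :: "(ell2 \<Rightarrow>\<^sub>L ell2) \<Rightarrow> (ell2 \<Rightarrow>\<^sub>L ell2) \<Rightarrow> bool" where
  "is_adj S T \<longleftrightarrow> (\<forall>x y. inner (blinfun_apply T x) y = inner x (blinfun_apply S y))"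

definition Bops :: "(ell2 \<Rightarrow>\<^sub>L ell2) set" where
  "Bops = {T. (\<forall>x. blinfun_apply T (J x) = J (blinfun_apply T x)) \<and> (\<exists>S. is_adj S T)}"

definition adj :: "(ell2 \<Rightarrow>\<^sub>L ell2) \<Rightarrow> ell2 \<Rightarrow>\<^sub>L ell2" where
  "adj T = (SOME S. is_adj S T)"

lemma is_adj_sym: "is_adj S T \<Longrightarrow> is_adj T S"
  unfolding is_adj_def by (metis inner_commute)

lemma is_adj_unique:
  assumes "is_adj S T" "is_adj S' T"
  shows "S = S'"
proof (rule blinfun_eqI)
  fix y
  have "inner x (blinfun_apply S y - blinfun_apply S' y) = 0" for x
    using assms unfolding is_adj_def by (simp add: inner_diff_right)
  then show "blinfun_apply S y = blinfun_apply S' y"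
    by (metis inner_eq_zero_iff right_minus_eq)
qed

lemma adj_eqI: "is_adj S T \<Longrightarrow> adj T = S"
  unfolding adj_def using is_adj_unique by (metis someI_ex)

lemma BopsD: "T \<in> Bops \<Longrightarrow> blinfun_apply T (J x) = J (blinfun_apply T x)"
  and Bops_adj: "T \<in> Bops \<Longrightarrow> is_adj (adj T) T"
  by (auto simp: Bops_def adj_def intro: someI_ex)

lemma BopsI: "(\<And>x. blinfun_apply T (J x) = J (blinfun_apply T x)) \<Longrightarrow> is_adj S T \<Longrightarrow> T \<in> Bops"
  by (auto simp: Bops_def)

lemma adj_Bops: "T \<in> Bops \<Longrightarrow> adj T \<in> Bops"
proof (rule BopsI)
  assume T: "T \<in> Bops"
  show "is_adj T (adj T)" using is_adj_sym[OF Bops_adj[OF T]] .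
  fix x
  have "inner z (blinfun_apply (adj T) (J x)) = inner z (J (blinfun_apply (adj T) x))" for z
  proof -
    have "inner z (blinfun_apply (adj T) (J x)) = inner (blinfun_apply T z) (J x)"
      using Bops_adj[OF T] by (simp add: is_adj_def)
    also have "\<dots> = - inner (blinfun_apply T (J z)) x" by (simp add: BopsD[OF T] inner_J)
    also have "\<dots> = - inner (J z) (blinfun_apply (adj T) x)"
      using Bops_adj[OF T] by (simp add: is_adj_def)
    also have "\<dots> = inner z (J (blinfun_apply (adj T) x))" by (simp add: inner_J)
    finally show ?thesis .
  qed
  then have "inner z (blinfun_apply (adj T) (J x) - J (blinfun_apply (adj T) x)) = 0" for z
    by (simp add: inner_diff_right)
  then show "blinfun_apply (adj T) (J x) = J (blinfun_apply (adj T) x)"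
    by (metis inner_eq_zero_iff right_minus_eq)
qed

lemma adj_adj: "T \<in> Bops \<Longrightarrow> adj (adj T) = T"
  by (rule adj_eqI, rule is_adj_sym, rule Bops_adj)

definition Jb :: "ell2 \<Rightarrow>\<^sub>L ell2" where "Jb = Blinfun J"

lemma Jb_apply [simp]: "blinfun_apply Jb x = J x"
  by (simp add: Jb_def bounded_linear_Blinfun_apply bounded_linear_J)

definition sc :: "complex \<Rightarrow> (ell2 \<Rightarrow>\<^sub>L ell2) \<Rightarrow> ell2 \<Rightarrow>\<^sub>L ell2" where
  "sc a T = Re a *\<^sub>R T + Im a *\<^sub>R (Jb o\<^sub>L T)"

lemma sc_apply: "blinfun_apply (sc a T) x = cscale a (blinfun_apply T x)"
  by (simp add: sc_def cscale_def blinfun.add_left blinfun.scaleR_left)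

lemma cscale_J: "cscale a (J x) = J (cscale a x)"
  by (rule ell2_eqI) simp

lemma inner_cscale: "inner (cscale a x) y = inner x (cscale (cnj a) y)"
  by (simp add: cscale_def inner_add_left inner_add_right inner_diff_right inner_J)

lemma Bops_cscale: "T \<in> Bops \<Longrightarrow> blinfun_apply T (cscale a x) = cscale a (blinfun_apply T x)"
  by (simp add: cscale_def blinfun.add_right blinfun.scaleR_right BopsD)

lemma is_adj_add: "is_adj S T \<Longrightarrow> is_adj S' T' \<Longrightarrow> is_adj (S + S') (T + T')"
  by (simp add: is_adj_def blinfun.add_left inner_add_left inner_add_right)

lemma is_adj_diff: "is_adj S T \<Longrightarrow> is_adj S' T' \<Longrightarrow> is_adj (S - S') (T - T')"
  by (simp add: is_adj_def blinfun.diff_left inner_diff_left inner_diff_right)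

lemma is_adj_comp: "is_adj S T \<Longrightarrow> is_adj S' T' \<Longrightarrow> is_adj (S' o\<^sub>L S) (T o\<^sub>L T')"
  by (simp add: is_adj_def)

lemma is_adj_sc: "T \<in> Bops \<Longrightarrow> is_adj S T \<Longrightarrow> is_adj (sc (cnj a) S) (sc a T)"
  unfolding is_adj_def sc_apply inner_cscale
proof (intro allI)
  fix x y assume T: "T \<in> Bops" and adj: "\<forall>x y. inner (blinfun_apply T x) y = inner x (blinfun_apply S y)"
  have "S \<in> Bops" using adj_eqI[of S T] adj adj_Bops[OF T] by (auto simp: is_adj_def)
  then show "inner (blinfun_apply T x) (cscale (cnj a) y) = inner x (cscale (cnj a) (blinfun_apply S y))"
    using adj by (simp add: Bops_cscale)
qed

lemma is_adj_id: "is_adj id_blinfun id_blinfun" and is_adj_zero: "is_adj 0 0"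
  by (simp_all add: is_adj_def)

lemma Bops_add: "S \<in> Bops \<Longrightarrow> T \<in> Bops \<Longrightarrow> S + T \<in> Bops"
  by (rule BopsI[OF _ is_adj_add[OF Bops_adj Bops_adj]]) (simp_all add: BopsD blinfun.add_left J_linear)

lemma J_diff: "J (x - y) = J x - J y"
  by (rule ell2_eqI) (simp add: algebra_simps)

lemma Bops_diff: "S \<in> Bops \<Longrightarrow> T \<in> Bops \<Longrightarrow> S - T \<in> Bops"
  by (rule BopsI[OF _ is_adj_diff[OF Bops_adj Bops_adj]]) (simp_all add: BopsD blinfun.diff_left J_diff)

lemma Bops_comp: "S \<in> Bops \<Longrightarrow> T \<in> Bops \<Longrightarrow> S o\<^sub>L T \<in> Bops"
  by (rule BopsI[OF _ is_adj_comp[OF Bops_adj Bops_adj]]) (simp_all add: BopsD)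

lemma Bops_sc: "T \<in> Bops \<Longrightarrow> sc a T \<in> Bops"
  by (rule BopsI[OF _ is_adj_sc[OF _ Bops_adj]]) (simp_all add: BopsD sc_apply cscale_J)

lemma Bops_id: "id_blinfun \<in> Bops" and Bops_zero: "0 \<in> Bops"
  by (rule BopsI[OF _ is_adj_id], simp) (rule BopsI[OF _ is_adj_zero], simp add: J_linear(2)[of 0, simplified])

lemmas Bops_intros = Bops_add Bops_diff Bops_comp Bops_sc Bops_id Bops_zero adj_Bops

lemma Bops_sum: "(\<And>a. a \<in> A \<Longrightarrow> f a \<in> Bops) \<Longrightarrow> (\<Sum>a\<in>A. f a) \<in> Bops"
  by (induction A rule: infinite_finite_induct) (auto intro: Bops_intros)

lemma adj_add: "S \<in> Bops \<Longrightarrow> T \<in> Bops \<Longrightarrow> adj (S + T) = adj S + adj T"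
  by (intro adj_eqI is_adj_add Bops_adj)

lemma adj_diff: "S \<in> Bops \<Longrightarrow> T \<in> Bops \<Longrightarrow> adj (S - T) = adj S - adj T"
  by (intro adj_eqI is_adj_diff Bops_adj)

lemma adj_comp: "S \<in> Bops \<Longrightarrow> T \<in> Bops \<Longrightarrow> adj (S o\<^sub>L T) = adj T o\<^sub>L adj S"
  by (intro adj_eqI is_adj_comp Bops_adj)

lemma adj_sc: "T \<in> Bops \<Longrightarrow> adj (sc a T) = sc (cnj a) (adj T)"
  by (intro adj_eqI is_adj_sc Bops_adj)

lemma norm_adj_le:
  assumes "is_adj S T"
  shows "norm S \<le> norm T"
proof (rule norm_blinfun_bound)
  fix y
  let ?s = "blinfun_apply S y"
  have "norm ?s * norm ?s = inner (blinfun_apply T ?s) y"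
    using assms by (simp add: is_adj_def power2_norm_eq_inner[symmetric] power2_eq_square)
  also have "\<dots> \<le> norm (blinfun_apply T ?s) * norm y" by (rule norm_cauchy_schwarz)
  also have "\<dots> \<le> (norm T * norm ?s) * norm y" by (intro mult_right_mono norm_blinfun) simp
  finally have "norm ?s * norm ?s \<le> norm ?s * (norm T * norm y)" by (simp add: mult_ac)
  then show "norm ?s \<le> norm T * norm y"
    by (cases "norm ?s = 0") (simp_all add: mult_le_cancel_left)
qed simp

lemma norm_adj: "T \<in> Bops \<Longrightarrow> norm (adj T) = norm T"
  using norm_adj_le[OF Bops_adj] norm_adj_le[OF is_adj_sym[OF Bops_adj]] by (meson antisym)

lemma norm_adj_comp:
  assumes "T \<in> Bops"
  shows "norm (adj T o\<^sub>L T) = (norm T)\<^sup>2"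
proof (rule antisym)
  show "norm (adj T o\<^sub>L T) \<le> (norm T)\<^sup>2"
    using norm_blinfun_compose[of "adj T" T] norm_adj[OF assms] by (simp add: power2_eq_square)
  have "norm T \<le> sqrt (norm (adj T o\<^sub>L T))"
  proof (rule norm_blinfun_bound)
    fix x
    have "(norm (blinfun_apply T x))\<^sup>2 = inner x (blinfun_apply (adj T o\<^sub>L T) x)"
      using Bops_adj[OF assms] by (simp add: is_adj_def power2_norm_eq_inner)
    also have "\<dots> \<le> norm x * norm (blinfun_apply (adj T o\<^sub>L T) x)" by (rule norm_cauchy_schwarz)
    also have "\<dots> \<le> norm x * (norm (adj T o\<^sub>L T) * norm x)" by (intro mult_left_mono norm_blinfun) simp
    also have "\<dots> = (sqrt (norm (adj T o\<^sub>L T)) * norm x)\<^sup>2" by (simp add: power_mult_distrib power2_eq_square)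
    finally show "norm (blinfun_apply T x) \<le> sqrt (norm (adj T o\<^sub>L T)) * norm x"
      by (rule power2_le_imp_le) simp
  qed simp
  then have "(norm T)\<^sup>2 \<le> (sqrt (norm (adj T o\<^sub>L T)))\<^sup>2" by (intro power_mono) simp_all
  then show "(norm T)\<^sup>2 \<le> norm (adj T o\<^sub>L T)" by simp
qed

lemma norm_sc: "norm (sc a T) = cmod a * norm T"
proof (rule antisym)
  have le: "norm (sc a T) \<le> cmod a * norm T" for a T
  proof (rule norm_blinfun_bound)
    fix x
    show "norm (blinfun_apply (sc a T) x) \<le> cmod a * norm T * norm x"
      unfolding sc_apply norm_cscale mult.assoc by (intro mult_left_mono norm_blinfun) simp
  qed simp
  show "norm (sc a T) \<le> cmod a * norm T" by (rule le)
  show "cmod a * norm T \<le> norm (sc a T)"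
  proof (cases "a = 0")
    case False
    have "T = sc (1 / a) (sc a T)"
    proof (intro blinfun_eqI ell2_eqI)
      fix x n
      show "coord (blinfun_apply T x) n = coord (blinfun_apply (sc (1 / a) (sc a T)) x) n"
        using False by (simp add: sc_apply)
    qed
    then have "norm T \<le> cmod (1 / a) * norm (sc a T)" using le[of "1 / a" "sc a T"] by simp
    then show ?thesis using False by (simp add: norm_divide field_simps)
  qed simp
qed

lemma cin_sums: "f sums x \<Longrightarrow> (\<lambda>n. cin (f n) y) sums cin x y"
proof -
  assume f: "f sums x"
  have "(\<lambda>n. complex_of_real (inner (f n) y) + \<i> * complex_of_real (inner (f n) (J y))) sums
    (complex_of_real (inner x y) + \<i> * complex_of_real (inner x (J y)))"
    by (intro sums_add sums_mult sums_of_real bounded_linear.sums[OF bounded_linear_inner_left f])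
  then show ?thesis by (simp add: cin_def Complex_eq)
qed

lemma cin_sums_right: "f sums x \<Longrightarrow> (\<lambda>n. cin y (f n)) sums cin y x"
  using cin_sums[of f x y] by (simp add: cin_cnj[of y] sums_cnj)

lemma Bops_expansion:
  assumes "\<And>x. blinfun_apply T (J x) = J (blinfun_apply T x)"
  shows "(\<lambda>n. cscale (coord x n) (blinfun_apply T (ket n))) sums blinfun_apply T x"
proof -
  have "(\<lambda>n. blinfun_apply T (cscale (coord x n) (ket n))) sums blinfun_apply T x"
    by (rule bounded_linear.sums[OF blinfun.bounded_linear_right ket_expansion])
  then show ?thesis using assms by (simp add: cscale_def blinfun.add_right blinfun.scaleR_right)
qed

lemma Bops_ket_eqI:
  assumes "S \<in> Bops" "T \<in> Bops" "\<And>n. blinfun_apply S (ket n) = blinfun_apply T (ket n)"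
  shows "S = T"
proof (rule blinfun_eqI)
  fix x
  show "blinfun_apply S x = blinfun_apply T x"
    using Bops_expansion[of S x] Bops_expansion[of T x] BopsD[OF assms(1)] BopsD[OF assms(2)] assms(3)
    by (auto intro: sums_unique2)
qed

text \<open>The identity on basis vectors extends to one argument after the other by summing
  \<open>ket_expansion\<close>.\<close>

lemma is_adj_ketI:
  assumes T: "\<And>x. blinfun_apply T (J x) = J (blinfun_apply T x)"
    and S: "\<And>x. blinfun_apply S (J x) = J (blinfun_apply S x)"
    and ket: "\<And>m n. cin (blinfun_apply T (ket n)) (ket m) = cin (ket n) (blinfun_apply S (ket m))"
  shows "is_adj S T"
proof -
  have 1: "cin (blinfun_apply T x) (ket m) = cin x (blinfun_apply S (ket m))" for x m
  proof (rule sums_unique2)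
    show "(\<lambda>n. cin (cscale (coord x n) (blinfun_apply T (ket n))) (ket m)) sums cin (blinfun_apply T x) (ket m)"
      by (intro cin_sums Bops_expansion T)
    show "(\<lambda>n. cin (cscale (coord x n) (blinfun_apply T (ket n))) (ket m)) sums cin x (blinfun_apply S (ket m))"
      using cin_sums[OF ket_expansion, of x "blinfun_apply S (ket m)"] by (simp add: cin_cscale_left ket)
  qed
  have "cin (blinfun_apply T x) y = cin x (blinfun_apply S y)" for x y
  proof (rule sums_unique2)
    show "(\<lambda>n. cin x (cscale (coord y n) (blinfun_apply S (ket n)))) sums cin x (blinfun_apply S y)"
      by (intro cin_sums_right Bops_expansion S)
    show "(\<lambda>n. cin x (cscale (coord y n) (blinfun_apply S (ket n)))) sums cin (blinfun_apply T x) y"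
      using cin_sums_right[OF ket_expansion, of "blinfun_apply T x" y] by (simp add: cin_cscale_right 1)
  qed
  then show ?thesis unfolding is_adj_def cin_def by simp
qed

text \<open>The assumption says that the columns define a contraction on finite combinations. It
  makes the series for \<open>t x\<close> Cauchy and bounds its limit by the norm of
  \<open>x\<close>.\<close>

lemma operator_of_columns:
  fixes y :: "nat \<Rightarrow> ell2"
  assumes bound: "\<And>c F. finite F \<Longrightarrow> (norm (\<Sum>n\<in>F. cscale (c n) (y n)))\<^sup>2 \<le> (\<Sum>n\<in>F. (cmod (c n))\<^sup>2)"
  obtains T where "\<And>n. blinfun_apply T (ket n) = y n" "\<And>x. blinfun_apply T (J x) = J (blinfun_apply T x)"
proof -
  define t where "t x = (\<Sum>n. cscale (coord x n) (y n))" for x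
  have summ: "summable (\<lambda>n. cscale (coord x n) (y n))" for x
  proof (subst summable_Cauchy, intro allI impI)
    fix e :: real assume e: "0 < e"
    then have "0 < e\<^sup>2" by simp
    then obtain N where N: "\<And>m n. m \<ge> N \<Longrightarrow> norm (\<Sum>k=m..<n. (cmod (coord x k))\<^sup>2) < e\<^sup>2"
      using coord_summable[of x] unfolding summable_Cauchy by blast
    have "norm (\<Sum>k=m..<n. cscale (coord x k) (y k)) < e" if "m \<ge> N" for m n
    proof -
      have "(norm (\<Sum>k=m..<n. cscale (coord x k) (y k)))\<^sup>2 \<le> (\<Sum>k=m..<n. (cmod (coord x k))\<^sup>2)"
        by (rule bound) simp
      also have "\<dots> < e\<^sup>2" using N[OF that, of n] by simp
      finally show ?thesis using e by (simp add: power2_less_imp_less)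
    qed
    then show "\<exists>N. \<forall>m\<ge>N. \<forall>n. norm (\<Sum>k=m..<n. cscale (coord x k) (y k)) < e" by blast
  qed
  have cs: "cscale (a + b) z = cscale a z + cscale b z" "cscale (of_real r * a) z = r *\<^sub>R cscale a z"
    "cscale (\<i> * a) z = J (cscale a z)" for a b r z
    by (auto intro!: ell2_eqI simp: algebra_simps)
  have bl: "bounded_linear t"
  proof (rule bounded_linear_intro[of _ 1])
    fix x z :: ell2 and r :: real
    show "t (x + z) = t x + t z" unfolding t_def by (simp add: cs suminf_add[OF summ summ])
    show "t (r *\<^sub>R x) = r *\<^sub>R t x" unfolding t_def by (simp add: cs suminf_scaleR_right[OF summ])
    have "(\<lambda>N. norm (\<Sum>n<N. cscale (coord x n) (y n))) \<longlonglongrightarrow> norm (t x)"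
      unfolding t_def by (intro tendsto_norm summable_LIMSEQ summ)
    moreover have "norm (\<Sum>n<N. cscale (coord x n) (y n)) \<le> norm x" for N
    proof -
      have "(norm (\<Sum>n<N. cscale (coord x n) (y n)))\<^sup>2 \<le> (norm x)\<^sup>2"
        by (rule order_trans[OF bound partial_le_norm]) simp
      then show ?thesis by (rule power2_le_imp_le) simp
    qed
    ultimately show "norm (t x) \<le> norm x * 1" by (auto intro: LIMSEQ_le_const2)
  qed
  define T where "T = Blinfun t"
  have T: "blinfun_apply T = t" unfolding T_def by (rule bounded_linear_Blinfun_apply[OF bl])
  show ?thesis
  proof (rule that[of T])
    fix n
    have "(\<lambda>k. cscale (coord (ket n) k) (y k)) = (\<lambda>k. if k = n then y k else 0)"
      by (auto intro!: ext ell2_eqI)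
    then show "blinfun_apply T (ket n) = y n"
      unfolding T t_def using sums_unique[OF sums_single[of n y]] by simp
  next
    fix x
    show "blinfun_apply T (J x) = J (blinfun_apply T x)"
      unfolding T t_def by (simp add: cs bounded_linear.suminf[OF bounded_linear_J summ])
  qed
qed

text \<open>The universal property is tested on C*-algebras whose elements are infinite matrices, so
  the operators are transported along their matrix encoding; \<open>dec\<close> inverts it on
  \<open>Bops\<close>.\<close>

definition enc :: "(ell2 \<Rightarrow>\<^sub>L ell2) \<Rightarrow> test_carrier" where
  "enc T = (\<lambda>i j. coord (blinfun_apply T (ket j)) i)"

definition dec :: "test_carrier \<Rightarrow> ell2 \<Rightarrow>\<^sub>L ell2" where
  "dec = inv_into Bops enc"

lemma inj_enc: "inj_on enc Bops"
proof (rule inj_onI)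
  fix S T assume "S \<in> Bops" "T \<in> Bops" "enc S = enc T"
  then show "S = T" by (intro Bops_ket_eqI ell2_eqI) (auto simp: enc_def dest: fun_cong)
qed

lemma dec_enc [simp]: "T \<in> Bops \<Longrightarrow> dec (enc T) = T"
  unfolding dec_def by (rule inv_into_f_f[OF inj_enc])

definition Dalg :: "test_carrier cstar" where
  "Dalg = \<lparr>carrier = enc ` Bops, monoid.mult = (\<lambda>x y. enc (dec x o\<^sub>L dec y)), one = enc id_blinfun,
     zero = enc 0, add = (\<lambda>x y. enc (dec x + dec y)), module.smult = (\<lambda>a x. enc (sc a (dec x))),
     star = (\<lambda>x. enc (adj (dec x))), nrm = (\<lambda>x. norm (dec x))\<rparr>"

lemma Dalg_simps:
  "carrier Dalg = enc ` Bops" "\<one>\<^bsub>Dalg\<^esub> = enc id_blinfun" "\<zero>\<^bsub>Dalg\<^esub> = enc 0"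
  "S \<in> Bops \<Longrightarrow> T \<in> Bops \<Longrightarrow> enc S \<otimes>\<^bsub>Dalg\<^esub> enc T = enc (S o\<^sub>L T)"
  "S \<in> Bops \<Longrightarrow> T \<in> Bops \<Longrightarrow> enc S \<oplus>\<^bsub>Dalg\<^esub> enc T = enc (S + T)"
  "T \<in> Bops \<Longrightarrow> a \<odot>\<^bsub>Dalg\<^esub> enc T = enc (sc a T)"
  "T \<in> Bops \<Longrightarrow> star Dalg (enc T) = enc (adj T)"
  "T \<in> Bops \<Longrightarrow> nrm Dalg (enc T) = norm T"
  by (simp_all add: Dalg_def)

lemma sc_simps:
  "sc (a + b) T = sc a T + sc b T" "sc a (S + T) = sc a S + sc a T" "sc (a * b) T = sc a (sc b T)"
  "sc 1 T = T" "sc a S o\<^sub>L T = sc a (S o\<^sub>L T)" "sc a 0 = 0"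
  by (intro blinfun_eqI ell2_eqI; simp add: sc_apply blinfun.add_left algebra_simps)+

lemma comp_sc: "S \<in> Bops \<Longrightarrow> S o\<^sub>L sc a T = sc a (S o\<^sub>L T)"
  by (intro blinfun_eqI) (simp add: sc_apply Bops_cscale)

lemma comp_simps:
  "(S o\<^sub>L T) o\<^sub>L U = S o\<^sub>L (T o\<^sub>L U)" "id_blinfun o\<^sub>L T = T" "T o\<^sub>L id_blinfun = T"
  "(S + T) o\<^sub>L U = (S o\<^sub>L U) + (T o\<^sub>L U)" "U o\<^sub>L (S + T) = (U o\<^sub>L S) + (U o\<^sub>L T)"
  by (intro blinfun_eqI; simp add: blinfun.add_left blinfun.add_right)+

lemma abelian_group_Dalg: "abelian_group Dalg"
proof (rule abelian_groupI)
  fix x assume "x \<in> carrier Dalg"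
  then obtain T where T: "x = enc T" "T \<in> Bops" by (auto simp: Dalg_simps)
  show "\<exists>y\<in>carrier Dalg. y \<oplus>\<^bsub>Dalg\<^esub> x = \<zero>\<^bsub>Dalg\<^esub>"
    using T Bops_diff[OF Bops_zero T(2)]
    by (intro bexI[of _ "enc (0 - T)"]) (auto simp: Dalg_simps)
qed (auto simp: Dalg_simps Bops_intros add_ac)

lemma ring_Dalg: "ring Dalg"
proof (rule ringI[OF abelian_group_Dalg])
  show "Group.monoid Dalg"
    by (rule monoidI) (auto simp: Dalg_simps Bops_intros comp_simps)
qed (auto simp: Dalg_simps Bops_intros comp_simps)

lemma module_Dalg: "Module.module complex_ring Dalg"
  by (rule moduleI[OF cring_complex_ring abelian_group_Dalg])
    (auto simp: Dalg_simps sc_simps Bops_intros complex_ring_def)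

lemma Dalg_minus:
  assumes "S \<in> Bops" "T \<in> Bops"
  shows "enc S \<ominus>\<^bsub>Dalg\<^esub> enc T = enc (S - T)"
proof -
  have m: "0 - T \<in> Bops" using assms Bops_intros by blast
  have "\<ominus>\<^bsub>Dalg\<^esub> enc T = enc (0 - T)"
    using assms m by (intro abelian_group.minus_equality[OF abelian_group_Dalg]) (auto simp: Dalg_simps)
  then show ?thesis using assms m by (simp add: a_minus_def Dalg_simps)
qed

lemma Bops_complete:
  assumes T: "\<And>n. T n \<in> Bops" and C: "Cauchy T"
  shows "\<exists>L\<in>Bops. T \<longlonglongrightarrow> L"
proof -
  obtain L where L: "T \<longlonglongrightarrow> L" using C Cauchy_convergent convergent_def by blast
  have "dist (adj (T m)) (adj (T n)) = dist (T m) (T n)" for m n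
    using norm_adj[OF Bops_diff[OF T T], of m n] by (simp add: dist_norm adj_diff[OF T T])
  then have "Cauchy (\<lambda>n. adj (T n))" using C unfolding Cauchy_def by simp
  then obtain S where S: "(\<lambda>n. adj (T n)) \<longlonglongrightarrow> S" using Cauchy_convergent convergent_def by blast
  have ev: "(\<lambda>n. blinfun_apply (F n) x) \<longlonglongrightarrow> blinfun_apply G x" if "F \<longlonglongrightarrow> G" for F :: "nat \<Rightarrow> ell2 \<Rightarrow>\<^sub>L ell2" and G x
    by (intro tendsto_intros that)
  have "blinfun_apply L (J x) = J (blinfun_apply L x)" for x
  proof (rule LIMSEQ_unique)
    show "(\<lambda>n. blinfun_apply (T n) (J x)) \<longlonglongrightarrow> blinfun_apply L (J x)" by (rule ev[OF L])
    show "(\<lambda>n. blinfun_apply (T n) (J x)) \<longlonglongrightarrow> J (blinfun_apply L x)"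
      unfolding BopsD[OF T] by (rule bounded_linear.tendsto[OF bounded_linear_J ev[OF L]])
  qed
  moreover have "is_adj S L"
    unfolding is_adj_def
  proof (intro allI)
    fix x y
    show "inner (blinfun_apply L x) y = inner x (blinfun_apply S y)"
    proof (rule LIMSEQ_unique)
      show "(\<lambda>n. inner (blinfun_apply (T n) x) y) \<longlonglongrightarrow> inner (blinfun_apply L x) y"
        by (intro tendsto_inner ev[OF L] tendsto_const)
      have "inner (blinfun_apply (T n) x) y = inner x (blinfun_apply (adj (T n)) y)" for n
        using Bops_adj[OF T] by (simp add: is_adj_def)
      then show "(\<lambda>n. inner (blinfun_apply (T n) x) y) \<longlonglongrightarrow> inner x (blinfun_apply S y)"
        by (simp only:) (intro tendsto_inner ev[OF S] tendsto_const)
    qed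
  qed
  ultimately show ?thesis using L BopsI by blast
qed

lemma cstar_algebra_Dalg: "cstar_algebra Dalg"
proof (intro cstar_algebra.intro ring_Dalg module_Dalg cstar_algebra_axioms.intro)
  fix X :: "nat \<Rightarrow> test_carrier"
  assume X: "\<And>n. X n \<in> carrier Dalg"
    and C: "\<And>\<epsilon>. 0 < \<epsilon> \<Longrightarrow> \<exists>N. \<forall>m\<ge>N. \<forall>n\<ge>N. nrm Dalg (X m \<ominus>\<^bsub>Dalg\<^esub> X n) < \<epsilon>"
  define T where "T n = dec (X n)" for n
  have T: "T n \<in> Bops" "X n = enc (T n)" for n using X[of n] by (auto simp: T_def Dalg_simps)
  have "Cauchy T"
    unfolding Cauchy_def dist_norm using C
    by (simp add: T(2) Dalg_minus[OF T(1) T(1)] Dalg_simps(8)[OF Bops_diff[OF T(1) T(1)]])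
  then obtain L where L: "L \<in> Bops" "T \<longlonglongrightarrow> L" using Bops_complete[of T] T(1) by blast
  have "nrm Dalg (X n \<ominus>\<^bsub>Dalg\<^esub> enc L) = norm (T n - L)" for n
    by (simp add: T(2) Dalg_minus[OF T(1) L(1)] Dalg_simps(8)[OF Bops_diff[OF T(1) L(1)]])
  then show "\<exists>x\<in>carrier Dalg. (\<lambda>n. nrm Dalg (X n \<ominus>\<^bsub>Dalg\<^esub> x)) \<longlonglongrightarrow> 0"
    using L by (intro bexI[of _ "enc L"]) (simp_all add: Dalg_simps tendsto_norm_zero_iff LIM_zero)
next
  fix x assume "x \<in> carrier Dalg"
  then obtain T where T: "x = enc T" "T \<in> Bops" by (auto simp: Dalg_simps)
  show "nrm Dalg x = 0 \<longleftrightarrow> x = \<zero>\<^bsub>Dalg\<^esub>"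
    using T inj_onD[OF inj_enc _ T(2) Bops_zero] by (auto simp: Dalg_simps Bops_zero)
  show "nrm Dalg (star Dalg x \<otimes>\<^bsub>Dalg\<^esub> x) = (nrm Dalg x)\<^sup>2"
    using T by (simp add: Dalg_simps Bops_intros norm_adj_comp)
qed (auto simp: Dalg_simps Bops_intros sc_simps comp_sc adj_add adj_comp adj_sc adj_adj norm_sc
    norm_triangle_ineq norm_blinfun_compose)

lemma finsum_Dalg:
  assumes "finite A" "\<And>a. a \<in> A \<Longrightarrow> f a \<in> Bops"
  shows "(\<Oplus>\<^bsub>Dalg\<^esub>a\<in>A. enc (f a)) = enc (\<Sum>a\<in>A. f a)"
proof -
  interpret ring Dalg by (rule ring_Dalg)
  show ?thesis using assms
  proof (induction A rule: finite_induct)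
    case empty
    then show ?case by (simp add: Dalg_simps)
  next
    case (insert x F)
    then have "(\<Oplus>\<^bsub>Dalg\<^esub>a\<in>insert x F. enc (f a)) = enc (f x) \<oplus>\<^bsub>Dalg\<^esub> (\<Oplus>\<^bsub>Dalg\<^esub>a\<in>F. enc (f a))"
      by (intro finsum_insert) (auto simp: Dalg_simps)
    then show ?case using insert by (simp add: Dalg_simps Bops_sum)
  qed
qed

section \<open>The Gelfand-Naimark-Segal construction\<close>

text \<open>A positive kernel is realised by vectors \<open>xi n\<close> of \<open>ell2\<close>
  through Gram-Schmidt in coordinates, with no quotient and no completion; a vector depending on its
  predecessors is assigned the zero function.\<close>

locale psd_kernel =
  fixes K :: "nat \<Rightarrow> nat \<Rightarrow> complex"
  assumes herm: "K m n = cnj (K n m)"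
    and psd: "finite F \<Longrightarrow> 0 \<le> Re (\<Sum>m\<in>F. (\<Sum>n\<in>F. c n * K n m) * cnj (c m))"
begin

definition fm :: "nat \<Rightarrow> (nat \<Rightarrow> complex) \<Rightarrow> (nat \<Rightarrow> complex) \<Rightarrow> complex" where
  "fm N c d = (\<Sum>m\<le>N. (\<Sum>n\<le>N. c n * K n m) * cnj (d m))"

lemma fm_add_left: "fm N (\<lambda>n. c n + a * c' n) d = fm N c d + a * fm N c' d"
  by (simp add: fm_def algebra_simps sum.distrib sum_distrib_left)

lemma fm_cnj: "fm N d c = cnj (fm N c d)"
proof -
  have "cnj (fm N c d) = (\<Sum>m\<le>N. \<Sum>n\<le>N. d m * K m n * cnj (c n))"
    by (simp add: fm_def sum_distrib_left sum_distrib_right herm[symmetric] mult_ac)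
  also have "\<dots> = (\<Sum>n\<le>N. \<Sum>m\<le>N. d m * K m n * cnj (c n))" by (rule sum.swap)
  also have "\<dots> = fm N d c" by (simp add: fm_def sum_distrib_right)
  finally show ?thesis by simp
qed

lemma fm_sum_left: "finite A \<Longrightarrow> fm N (\<lambda>n. \<Sum>i\<in>A. a i * c i n) d = (\<Sum>i\<in>A. a i * fm N (c i) d)"
proof (induction A rule: finite_induct)
  case empty
  then show ?case by (simp add: fm_def)
next
  case (insert i A)
  then show ?case using fm_add_left[of N "\<lambda>n. \<Sum>i\<in>A. a i * c i n" "a i" "c i" d] by (simp add: add.commute)
qed

lemma fm_pos: "0 \<le> Re (fm N c c)"
  unfolding fm_def by (rule psd) simp

lemma fm_self: "fm N c c = complex_of_real (Re (fm N c c))"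
  using fm_cnj[of N c c] by (simp add: complex_eq_iff)

text \<open>Cauchy-Schwarz in the degenerate case: otherwise adding to \<open>c\<close> a large
  negative multiple of the conjugate of \<open>fm N r c\<close> times \<open>r\<close> would make
  the form negative.\<close>

lemma fm_null:
  assumes "Re (fm N r r) = 0"
  shows "fm N r c = 0"
proof -
  have r: "fm N r r = 0" using fm_self[of N r] assms by simp
  define z where "z = fm N r c"
  have "0 \<le> Re (fm N c c) - 2 * t * (cmod z)\<^sup>2" for t :: real
  proof -
    define a where "a = - complex_of_real t * cnj z"
    have 1: "fm N (\<lambda>n. c n + a * r n) d = fm N c d + a * fm N r d" for d by (rule fm_add_left)
    have 2: "fm N d (\<lambda>n. c n + a * r n) = fm N d c + cnj a * fm N d r" for d
    proof -
      have "fm N d (\<lambda>n. c n + a * r n) = cnj (fm N (\<lambda>n. c n + a * r n) d)" by (rule fm_cnj)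
      then show ?thesis unfolding 1 by (simp add: fm_cnj[symmetric])
    qed
    have "fm N (\<lambda>n. c n + a * r n) (\<lambda>n. c n + a * r n) = fm N c c + (cnj a * cnj z + a * z)"
      unfolding 1 2 using r fm_cnj[of N c r] by (simp add: z_def[symmetric] algebra_simps)
    also have "cnj a * cnj z + a * z = - complex_of_real (2 * t * (cmod z)\<^sup>2)"
      unfolding a_def using complex_norm_square[of z] by (simp add: algebra_simps)
    finally have "Re (fm N (\<lambda>n. c n + a * r n) (\<lambda>n. c n + a * r n)) = Re (fm N c c) - 2 * t * (cmod z)\<^sup>2"
      by simp
    then show ?thesis using fm_pos[of N "\<lambda>n. c n + a * r n"] by simp
  qed
  \<comment> \<open>For this parameter the bound becomes \<open>- Re (fm N c c) - 2\<close>, which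
    is negative.\<close>
  from this[of "(Re (fm N c c) + 1) / (cmod z)\<^sup>2"] show ?thesis
    using fm_pos[of N c] unfolding z_def[symmetric] by (cases "z = 0") auto
qed

text \<open>Coefficients of the \<open>n\<close>-th orthonormal vector in terms of the given ones.
  The later \<open>cf\<close> and \<open>res\<close> appear here unfolded, since they refer to
  \<open>gs\<close> themselves; \<open>gs_eq\<close> is the readable form.\<close>

function gs :: "nat \<Rightarrow> nat \<Rightarrow> complex" where
  "gs n = (let r = (\<lambda>m. (if m = n then 1 else 0) - (\<Sum>i<n. (\<Sum>j\<le>i. cnj (gs i j) * K n j) * gs i m))
     in if Re (fm n r r) = 0 then (\<lambda>_. 0) else (\<lambda>m. r m / complex_of_real (sqrt (Re (fm n r r)))))"
  by auto
termination by (relation "Wellfounded.measure id") auto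

declare gs.simps [simp del]

definition cf :: "nat \<Rightarrow> nat \<Rightarrow> complex" where
  "cf n i = (\<Sum>j\<le>i. cnj (gs i j) * K n j)"

definition dl :: "nat \<Rightarrow> nat \<Rightarrow> complex" where
  "dl n m = (if m = n then 1 else 0)"

definition res :: "nat \<Rightarrow> nat \<Rightarrow> complex" where
  "res n m = dl n m - (\<Sum>i<n. cf n i * gs i m)"

lemma gs_eq: "gs n = (if Re (fm n (res n) (res n)) = 0 then (\<lambda>_. 0)
    else (\<lambda>m. res n m / complex_of_real (sqrt (Re (fm n (res n) (res n))))))"
proof -
  have "res n = (\<lambda>m. (if m = n then 1 else 0) - (\<Sum>i<n. (\<Sum>j\<le>i. cnj (gs i j) * K n j) * gs i m))"
    by (simp add: res_def dl_def cf_def fun_eq_iff)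
  then show ?thesis by (subst gs.simps) (simp add: Let_def)
qed

lemma gs_support: "m > n \<Longrightarrow> gs n m = 0"
proof (induction n arbitrary: m rule: less_induct)
  case (less n)
  have "(\<Sum>i<n. cf n i * gs i m) = 0" using less by (intro sum.neutral) auto
  then have "res n m = 0" using less.prems by (simp add: res_def dl_def)
  then show ?case by (subst gs_eq) simp
qed

lemma res_support: "m > n \<Longrightarrow> res n m = 0"
  by (auto simp: res_def dl_def gs_support intro!: sum.neutral)

lemma fm_stable:
  assumes "\<And>m. m > n \<Longrightarrow> c m = 0" "\<And>m. m > n' \<Longrightarrow> d m = 0" "n \<le> N" "n' \<le> N" "n \<le> N'" "n' \<le> N'"
  shows "fm N c d = fm N' c d"
proof -
  have "fm N c d = (\<Sum>m\<le>n'. (\<Sum>i\<le>n. c i * K i m) * cnj (d m))" if "n \<le> N" "n' \<le> N" for N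
  proof -
    have "(\<Sum>i\<le>N. c i * K i m) = (\<Sum>i\<le>n. c i * K i m)" for m
      using that assms(1) by (intro sum.mono_neutral_right) auto
    then have "fm N c d = (\<Sum>m\<le>N. (\<Sum>i\<le>n. c i * K i m) * cnj (d m))" by (simp add: fm_def)
    also have "\<dots> = (\<Sum>m\<le>n'. (\<Sum>i\<le>n. c i * K i m) * cnj (d m))"
      using that assms(2) by (intro sum.mono_neutral_right) auto
    finally show ?thesis .
  qed
  then show ?thesis using assms by metis
qed

lemma fm_dl_left: "n \<le> N \<Longrightarrow> fm N (dl n) d = (\<Sum>m\<le>N. cnj (d m) * K n m)"
  by (simp add: fm_def dl_def if_distrib if_distribR mult.commute cong: if_cong)

lemma fm_dl_gs: "n \<le> N \<Longrightarrow> i \<le> N \<Longrightarrow> fm N (dl n) (gs i) = cf n i"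
proof -
  assume *: "n \<le> N" "i \<le> N"
  have "fm N (dl n) (gs i) = (\<Sum>m\<le>N. cnj (gs i m) * K n m)" by (rule fm_dl_left[OF *(1)])
  also have "\<dots> = (\<Sum>m\<le>i. cnj (gs i m) * K n m)"
    using * gs_support by (intro sum.mono_neutral_right) auto
  finally show ?thesis by (simp add: cf_def)
qed

text \<open>The statements are proved together because the expansion of \<open>dl n\<close> needs
  the residue, whose orthogonality rests on the earlier pairs. If the residue is null,
  \<open>fm_null\<close> still gives the expansion although \<open>gs n\<close> is zero.\<close>

lemma gs_orth:
  assumes "n \<le> N"
  shows "(\<forall>i<n. fm N (gs n) (gs i) = 0) \<and> fm N (gs n) (gs n) = (if gs n = (\<lambda>_. 0) then 0 else 1) \<and>
    (\<forall>c. fm N (dl n) c = (\<Sum>i\<le>n. cf n i * fm N (gs i) c))"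
  using assms
proof (induction n rule: less_induct)
  case (less n)
  define q where "q = Re (fm n (res n) (res n))"
  have qN: "Re (fm N (res n) (res n)) = q"
    unfolding q_def by (subst fm_stable[of n _ n _ N n]) (use less.prems res_support in auto)
  have gs: "gs n = (if q = 0 then (\<lambda>_. 0) else (\<lambda>m. res n m / complex_of_real (sqrt q)))"
    unfolding q_def by (rule gs_eq)
  have q0: "q \<ge> 0" using fm_pos[of N "res n"] qN by simp
  have res: "fm N (res n) c = fm N (dl n) c - (\<Sum>i<n. cf n i * fm N (gs i) c)" for c
  proof -
    have "res n = (\<lambda>m. dl n m + (-1) * (\<Sum>i<n. cf n i * gs i m))" by (simp add: res_def fun_eq_iff)
    then show ?thesis using fm_add_left[of N "dl n" "-1" "\<lambda>m. \<Sum>i<n. cf n i * gs i m" c] by (simp add: fm_sum_left)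
  qed
  have pair: "fm N (gs i) (gs j) = (if i = j \<and> gs j \<noteq> (\<lambda>_. 0) then 1 else 0)" if "i < n" "j < n" for i j
  proof -
    consider "i = j" | "i < j" | "j < i" by linarith
    then show ?thesis
    proof cases
      case 1 then show ?thesis using less.IH[of i] that less.prems by auto
    next
      case 2
      then have "fm N (gs j) (gs i) = 0" using less.IH[of j] that less.prems by auto
      then show ?thesis using 2 fm_cnj[of N "gs i" "gs j"] by simp
    next
      case 3 then show ?thesis using less.IH[of i] that less.prems by auto
    qed
  qed
  have cf0: "cf k j = 0" if "gs j = (\<lambda>_. 0)" for j k using that by (simp add: cf_def)
  have rorth: "fm N (res n) (gs j) = 0" if j: "j < n" for j
  proof -
    have "(\<Sum>i<n. cf n i * fm N (gs i) (gs j)) = (\<Sum>i<n. if i = j then cf n i else 0)"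
      using j cf0 by (intro sum.cong) (auto simp: pair)
    also have "\<dots> = cf n j" using j by simp
    finally show ?thesis unfolding res using fm_dl_gs[of n N j] less.prems j by simp
  qed
  have split: "(\<Sum>i\<le>n. cf n i * fm N (gs i) c) = (\<Sum>i<n. cf n i * fm N (gs i) c) + cf n n * fm N (gs n) c" for c
    by (simp add: lessThan_Suc_atMost[symmetric])
  show ?case
  proof (cases "q = 0")
    case True
    then have g: "gs n = (\<lambda>_. 0)" using gs by simp
    have "fm N (res n) c = 0" for c using fm_null qN True by simp
    then have "fm N (dl n) c = (\<Sum>i\<le>n. cf n i * fm N (gs i) c)" for c
      unfolding split using res[of c] cf0[OF g] by simp
    then show ?thesis using g by (simp add: fm_def)
  next
    case False
    then have sq: "sqrt q > 0" using q0 by simp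
    let ?s = "complex_of_real (sqrt q)"
    have s: "?s \<noteq> 0" "?s * ?s = complex_of_real q" using sq q0 by (simp_all add: of_real_mult[symmetric] del: of_real_mult)
    have g: "gs n = (\<lambda>m. (\<lambda>_. 0) m + (1 / ?s) * res n m)" using gs False by (simp add: fun_eq_iff)
    have z: "fm N (\<lambda>_. 0) c = 0" for c by (simp add: fm_def)
    have gl: "fm N (gs n) c = (1 / ?s) * fm N (res n) c" for c
      unfolding g fm_add_left z by simp
    have rr: "fm N (res n) (res n) = complex_of_real q" using fm_self[of N "res n"] qN by simp
    have rg: "fm N (res n) (gs n) = ?s"
    proof -
      have "fm N (res n) (gs n) = cnj (fm N (gs n) (res n))" by (rule fm_cnj)
      also have "\<dots> = complex_of_real q / ?s" unfolding gl rr by simp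
      also have "\<dots> = ?s" using s by (simp add: field_simps)
      finally show ?thesis .
    qed
    have gg: "fm N (gs n) (gs n) = 1" unfolding gl rg using s by simp
    have orth: "fm N (gs n) (gs i) = 0" if "i < n" for i unfolding gl rorth[OF that] by simp
    have "cf n n = fm N (dl n) (gs n)" using fm_dl_gs less.prems by simp
    also have "\<dots> = fm N (res n) (gs n) + (\<Sum>i<n. cf n i * fm N (gs i) (gs n))" using res by simp
    also have "(\<Sum>i<n. cf n i * fm N (gs i) (gs n)) = 0"
      using orth fm_cnj[of N "gs _" "gs n"] by (intro sum.neutral) auto
    finally have cfn: "cf n n = ?s" using rg by simp
    have "fm N (dl n) c = (\<Sum>i\<le>n. cf n i * fm N (gs i) c)" for c
      unfolding split cfn gl using res[of c] s by simp
    moreover have "gs n \<noteq> (\<lambda>_. 0)" using gg by (auto simp: z)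
    ultimately show ?thesis using gg orth by simp
  qed
qed

lemma gs_pair:
  assumes "i \<le> N" "j \<le> N"
  shows "fm N (gs i) (gs j) = (if i = j \<and> gs j \<noteq> (\<lambda>_. 0) then 1 else 0)"
proof -
  consider "i = j" | "i < j" | "j < i" by linarith
  then show ?thesis
  proof cases
    case 2
    then have "fm N (gs j) (gs i) = 0" using gs_orth[OF assms(2)] by blast
    then show ?thesis using 2 fm_cnj[of N "gs i" "gs j"] by simp
  qed (use gs_orth[OF assms(1)] in auto)
qed

text \<open>In the form, \<open>dl n\<close> behaves like a combination of \<open>gs 0\<close>, ...,
  \<open>gs n\<close>, and later vectors are orthogonal to these. Thus \<open>cf\<close> is
  triangular and \<open>K_cf\<close> is a Cholesky factorisation.\<close>

lemma cf_above: "i > n \<Longrightarrow> cf n i = 0"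
proof -
  assume *: "i > n"
  have "cf n i = fm i (dl n) (gs i)" using * fm_dl_gs[of n i i] by simp
  also have "\<dots> = (\<Sum>j\<le>n. cf n j * fm i (gs j) (gs i))" using gs_orth[of n i] * by auto
  also have "\<dots> = 0" using * gs_pair[of _ i i] by (intro sum.neutral) auto
  finally show ?thesis .
qed

lemma K_cf: "K n m = (\<Sum>i\<le>n. cf n i * cnj (cf m i))"
proof -
  let ?N = "max n m"
  have "K n m = fm ?N (dl n) (dl m)"
    by (subst fm_dl_left) (simp_all add: dl_def if_distrib if_distribR cong: if_cong)
  also have "\<dots> = (\<Sum>i\<le>n. cf n i * fm ?N (gs i) (dl m))" using gs_orth[of n ?N] by auto
  also have "\<dots> = (\<Sum>i\<le>n. cf n i * cnj (cf m i))"
  proof (intro sum.cong refl)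
    fix i assume "i \<in> {..n}"
    then have "fm ?N (dl m) (gs i) = cf m i" by (intro fm_dl_gs) auto
    then show "cf n i * fm ?N (gs i) (dl m) = cf n i * cnj (cf m i)"
      using fm_cnj[of ?N "gs i" "dl m"] by simp
  qed
  finally show ?thesis .
qed

definition xi :: "nat \<Rightarrow> ell2" where
  "xi n = (\<Sum>i\<le>n. cscale (cf n i) (ket i))"

lemma coord_xi: "coord (xi n) i = cf n i"
  using cf_above[of n i] by (auto simp: xi_def if_distrib[of "\<lambda>t. _ * t"] cong: if_cong)

lemma cin_xi: "cin (xi n) (xi m) = K n m"
proof -
  have "cin (xi n) (xi m) = (\<Sum>i\<le>n. cf n i * cin (ket i) (xi m))"
    by (simp add: xi_def[of n] cin_sum_left cin_cscale_left)
  also have "\<dots> = (\<Sum>i\<le>n. cf n i * cnj (cf m i))"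
  proof (intro sum.cong refl)
    fix i
    show "cf n i * cin (ket i) (xi m) = cf n i * cnj (cf m i)"
      using cin_cnj[of "xi m" "ket i"] by (simp add: cin_ket coord_xi)
  qed
  finally show ?thesis by (simp add: K_cf)
qed

text \<open>Basis vectors with nonzero \<open>gs n\<close> lie in the span of the
  \<open>xi m\<close>, the others are orthogonal to it by \<open>gs_zero_cf\<close>. This splits
  \<open>ell2\<close> into the GNS space and a complement.\<close>

lemma ket_xi:
  assumes "gs n \<noteq> (\<lambda>_. 0)"
  shows "ket n = (\<Sum>m\<le>n. cscale (gs n m) (xi m))"
proof (rule ell2_eqI)
  fix k
  let ?N = "max n k"
  have "coord (\<Sum>m\<le>n. cscale (gs n m) (xi m)) k = (\<Sum>m\<le>n. gs n m * cf m k)" by (simp add: coord_xi)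
  also have "\<dots> = (\<Sum>m\<le>?N. gs n m * fm ?N (dl m) (gs k))"
    using gs_support by (intro sum.mono_neutral_cong_left) (auto simp: fm_dl_gs)
  also have "\<dots> = fm ?N (\<lambda>j. \<Sum>m\<le>?N. gs n m * dl m j) (gs k)" by (rule fm_sum_left[symmetric]) simp
  also have "(\<lambda>j. \<Sum>m\<le>?N. gs n m * dl m j) = gs n"
    using gs_support[of n] by (auto simp: dl_def fun_eq_iff if_distrib[of "\<lambda>t. _ * t"] cong: if_cong)
  also have "fm ?N (gs n) (gs k) = (if n = k then 1 else 0)" using gs_pair[of n ?N k] assms by auto
  finally show "coord (ket n) k = coord (\<Sum>m\<le>n. cscale (gs n m) (xi m)) k" by simp
qed

lemma gs_zero_cf: "gs n = (\<lambda>_. 0) \<Longrightarrow> cf m n = 0"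
  by (simp add: cf_def)

end

lemma finsum_Dalg_eq:
  assumes "finite A" "\<And>a. a \<in> A \<Longrightarrow> f a = enc (g a)" "\<And>a. a \<in> A \<Longrightarrow> g a \<in> Bops"
  shows "finsum Dalg f A = enc (\<Sum>a\<in>A. g a)"
proof -
  interpret ring Dalg by (rule ring_Dalg)
  have "finsum Dalg f A = (\<Oplus>\<^bsub>Dalg\<^esub>a\<in>A. enc (g a))"
    using assms by (intro finsum_cong') (auto simp: Dalg_simps)
  then show ?thesis using finsum_Dalg[OF assms(1,3)] by simp
qed

lemma sum_tuples_2: "(\<Sum>t\<in>tuples I 2. f t) = (\<Sum>x\<in>I. \<Sum>y\<in>I. f [x, y])"
  by (simp add: numeral_2_eq_2 sum_tuples_Cons)

lemma tuples_2E:
  assumes "t \<in> tuples I 2"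
  obtains x y where "t = [x, y]" "x \<in> I" "y \<in> I"
  using assms by (auto simp: tuples_def length_Suc_conv numeral_2_eq_2)

lemma cscale_apply:
  assumes "\<And>x. blinfun_apply T (J x) = J (blinfun_apply T x)"
  shows "blinfun_apply T (cscale a x) = cscale a (blinfun_apply T x)"
  using assms by (simp add: cscale_def blinfun.add_right blinfun.scaleR_right)

lemma cscale_zero [simp]: "cscale 0 x = 0" "cscale a 0 = 0" "cscale 1 x = x"
  by (auto intro!: ell2_eqI)

lemma cscale_cscale: "cscale a (cscale b x) = cscale (a * b) x"
  by (auto intro!: ell2_eqI)

lemma cscale_add_right: "cscale a (x + y) = cscale a x + cscale a y"
  by (auto intro!: ell2_eqI simp: algebra_simps)

lemma cin_bilinear:
  "cin (\<Sum>p\<in>A. cscale (c p) (x p)) (\<Sum>q\<in>B. cscale (d q) (y q)) =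
    (\<Sum>p\<in>A. \<Sum>q\<in>B. c p * cnj (d q) * cin (x p) (y q))"
  by (simp only: cin_sum_left cin_cscale_left)
    (simp only: cin_sum_right cin_cscale_right sum_distrib_left mult.assoc)

lemma blinfun_apply_sum: "blinfun_apply (\<Sum>a\<in>A. f a) x = (\<Sum>a\<in>A. blinfun_apply (f a) x)"
  by (induction A rule: infinite_finite_induct) (auto simp: blinfun.add_left)

section \<open>The left regular representation on the GNS space\<close>

context frob
begin

lemma op_Nil: "op g s [] = g s"
  by (simp add: op_def)

lemma nc_replicate_2: "nc [0, 0]" and nc_replicate_3: "nc [0, 0, 0]" and nc_single: "nc [0]"
proof -
  show 1: "nc [0]" using nc_insert_fresh[of "[]" "[]" 0] nc_Nil by simp
  then show 2: "nc [0, 0]" using nc_double[of "[]" 0 "[]"] by simp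
  then show "nc [0, 0, 0]" using nc_double[of "[]" 0 "[0]"] by simp
qed

lemma tvc_cap: "x \<in> I \<Longrightarrow> y \<in> I \<Longrightarrow> tvc [0, 0] [x, y] = (if y = bar x then complex_of_real (lam x) else 0)"
  by (simp add: tvc_def tuples_def tv_def Psi_pair)

lemma FV_cap2: "tvc [0, 0] \<in> FV (2 + 0)" "tvc [0, 0] \<in> FV (0 + 2)"
  using nc_replicate_2 by (auto intro: FV_tvc)

lemma op_cap: "x \<in> I \<Longrightarrow> y \<in> I \<Longrightarrow> op (tvc [0, 0]) [] [x, y] = (if y = bar x then complex_of_real (lam x) else 0)"
proof -
  assume xy: "x \<in> I" "y \<in> I"
  have "bar x = bar (bar y) \<longleftrightarrow> y = bar x" using xy by (metis bar_bar bar_in)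
  then show ?thesis using xy lam_pos[OF xy(2)]
    by (auto simp: op_def tvc_cap lam_bar)
qed

lemma op_cup: "x \<in> I \<Longrightarrow> y \<in> I \<Longrightarrow> op (tvc [0, 0]) [x, y] [] = (if y = bar x then complex_of_real (lam x) else 0)"
  by (simp add: op_Nil tvc_cap)

end

text \<open>\<open>\<xi> w\<close> is the GNS vector of the word \<open>w\<close>. \<open>S\<close>
  marks the basis vectors of \<open>ell2\<close> in the GNS space, expressed through words by
  \<open>E\<close> and \<open>wd\<close>; \<open>xi_fin\<close> keeps the expansions in the other
  direction finite.\<close>

locale frob_gns = frob I M e bar lam \<delta>
  for I :: "'i set" and M e bar lam \<delta> +
  fixes \<xi> :: "'i list \<times> 'i list \<Rightarrow> ell2" and S :: "nat set" and E :: "nat \<Rightarrow> nat \<Rightarrow> complex"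
    and wd :: "nat \<Rightarrow> 'i list \<times> 'i list"
  assumes cin_xi: "cin (\<xi> w) (\<xi> w') = G w w'"
    and ket_S: "n \<in> S \<Longrightarrow> ket n = (\<Sum>m\<le>n. cscale (E n m) (\<xi> (wd m)))"
    and xi_coord: "n \<notin> S \<Longrightarrow> coord (\<xi> w) n = 0"
    and xi_fin: "\<exists>N. \<forall>n>N. coord (\<xi> w) n = 0"
begin

definition lw :: "'i \<Rightarrow> 'i \<Rightarrow> 'i list \<times> 'i list \<Rightarrow> 'i list \<times> 'i list" where
  "lw a b w = (a # fst w, b # snd w)"

lemma G_lw_adj:
  "a \<in> I \<Longrightarrow> b \<in> I \<Longrightarrow> G (lw a b w) w' = complex_of_real (lam b / lam a) * G w (lw (bar a) (bar b) w')"
  using G_adj[of a b "fst w" "snd w" "fst w'" "snd w'"] by (simp add: lw_def)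

text \<open>The entries of one column of the unitary matrix have squares adding up to 1. One
  generator is moved to the other side by \<open>G_lw_adj\<close>, and the sum over \<open>a\<close>
  becomes the relation of the pair partition at the left end of a word.\<close>

lemma G_lw_sum:
  assumes b: "b \<in> I"
  shows "(\<Sum>a\<in>I. G (lw a b w) (lw a b w')) = G w w'"
proof -
  let ?H = "\<lambda>x. G ([x, bar x] @ fst w', [bar b, b] @ snd w') w"
  have t: "[bar b, b] \<in> tuples I 2" using b by (simp add: tuples_def)
  have "(\<Sum>x\<in>I. complex_of_real (lam x) * ?H x)
      = (\<Sum>x\<in>I. \<Sum>y\<in>I. op (tvc [0, 0]) [] [x, y] * G ([x, y] @ fst w', [bar b, b] @ snd w') w)"
  proof (rule sum.cong[OF refl])
    fix x assume x: "x \<in> I"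
    have "(\<Sum>y\<in>I. op (tvc [0, 0]) [] [x, y] * G ([x, y] @ fst w', [bar b, b] @ snd w') w)
        = (\<Sum>y\<in>I. if y = bar x then complex_of_real (lam x) * G ([x, y] @ fst w', [bar b, b] @ snd w') w else 0)"
      using x by (intro sum.cong refl) (simp add: op_cap)
    then show "complex_of_real (lam x) * ?H x = (\<Sum>y\<in>I. op (tvc [0, 0]) [] [x, y] * G ([x, y] @ fst w', [bar b, b] @ snd w') w)"
      using x by simp
  qed
  also have "\<dots> = op (tvc [0, 0]) [] [bar b, b] * G w' w"
    using G_relation[OF FV_cap2(1) _ t, of "[]" "fst w'" "snd w'" w] by (simp add: sum_tuples_2)
  also have "\<dots> = complex_of_real (1 / lam b) * G w' w" using b by (simp add: op_cap lam_bar)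
  finally have H: "(\<Sum>x\<in>I. complex_of_real (lam x) * ?H x) = complex_of_real (1 / lam b) * G w' w" .
  have "(\<Sum>a\<in>I. G (lw a b w) (lw a b w')) = (\<Sum>a\<in>I. complex_of_real (lam b) * cnj (complex_of_real (lam (bar a)) * ?H (bar a)))"
  proof (rule sum.cong[OF refl])
    fix a assume a: "a \<in> I"
    have "G (lw a b w) (lw a b w') = complex_of_real (lam b / lam a) * G w (lw (bar a) (bar b) (lw a b w'))"
      by (rule G_lw_adj[OF a b])
    moreover have "G w (lw (bar a) (bar b) (lw a b w')) = cnj (?H (bar a))"
      using a G_herm[of w] by (simp add: lw_def)
    ultimately show "G (lw a b w) (lw a b w') = complex_of_real (lam b) * cnj (complex_of_real (lam (bar a)) * ?H (bar a))"
      using a by (simp add: lam_bar)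
  qed
  also have "\<dots> = (\<Sum>x\<in>I. complex_of_real (lam b) * cnj (complex_of_real (lam x) * ?H x))"
    by (rule sum_bar)
  also have "\<dots> = complex_of_real (lam b) * cnj (complex_of_real (1 / lam b) * G w' w)"
    unfolding H[symmetric] cnj_sum sum_distrib_left ..
  also have "\<dots> = G w w'" using lam_pos[OF b] G_herm[of w w'] by simp
  finally show ?thesis .
qed

inductive_set Sp :: "ell2 set" where
  Sp_zero: "0 \<in> Sp"
| Sp_step: "z \<in> Sp \<Longrightarrow> z + cscale c (\<xi> w) \<in> Sp"

lemma Sp_add: "y \<in> Sp \<Longrightarrow> x \<in> Sp \<Longrightarrow> x + y \<in> Sp"
  by (induction y rule: Sp.induct) (auto simp: add.assoc[symmetric] intro: Sp_step)

lemma Sp_cscale: "x \<in> Sp \<Longrightarrow> cscale c x \<in> Sp"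
  by (induction x rule: Sp.induct) (auto simp: cscale_add_right cscale_cscale intro: Sp.intros)

lemma Sp_xi: "\<xi> w \<in> Sp"
  using Sp_step[OF Sp_zero, of 1 w] by simp

lemma Sp_sum: "(\<And>a. a \<in> A \<Longrightarrow> f a \<in> Sp) \<Longrightarrow> (\<Sum>a\<in>A. f a) \<in> Sp"
  by (induction A rule: infinite_finite_induct) (auto intro: Sp_zero Sp_add)

text \<open>The difference lies in the span of the vectors \<open>\<xi> w\<close> and is orthogonal
  to that span, hence to itself.\<close>

lemma Sp_eqI:
  assumes x: "x \<in> Sp" and y: "y \<in> Sp" and eq: "\<And>w. cin x (\<xi> w) = cin y (\<xi> w)"
  shows "x = y"
proof -
  let ?z = "x + cscale (-1) y"
  have z: "?z \<in> Sp" using x y by (intro Sp_add Sp_cscale)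
  have "cin ?z t = 0" if "t \<in> Sp" for t
    using that by (induction rule: Sp.induct) (simp_all add: cin_add_left cin_add_right cin_cscale_left cin_cscale_right eq)
  from this[OF z] have "norm ?z = 0" unfolding cin_self by simp
  then have "?z = 0" by simp
  then have "coord ?z n = 0" for n by simp
  then show ?thesis by (intro ell2_eqI) simp
qed

text \<open>In the GNS space the column is left multiplication by the generator. On the complement
  the counit is used, so that the relations hold on all of \<open>ell2\<close>.\<close>

definition col :: "'i \<Rightarrow> 'i \<Rightarrow> nat \<Rightarrow> ell2" where
  "col a b n = (if n \<in> S then \<Sum>m\<le>n. cscale (E n m) (\<xi> (lw a b (wd m))) else if a = b then ket n else 0)"

lemma cin_col_S:
  assumes "n \<in> S" "m \<in> S"
  shows "cin (col a b n) (col a' b' m) = (\<Sum>p\<le>n. \<Sum>q\<le>m. E n p * cnj (E m q) * G (lw a b (wd p)) (lw a' b' (wd q)))"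
  using assms by (simp add: col_def cin_bilinear cin_xi)

lemma coord_col: "n \<in> S \<Longrightarrow> m \<notin> S \<Longrightarrow> coord (col a b n) m = 0"
  by (simp add: col_def xi_coord)

lemma cin_ket_ket: "cin (ket n) (ket m) = (if n = m then 1 else 0)"
  by (simp add: cin_ket)

lemma cin_ket_left: "cin (ket n) x = cnj (coord x n)"
  using cin_cnj[of x "ket n"] by (simp add: cin_ket)

lemma ket_gram:
  assumes "n \<in> S" "m \<in> S"
  shows "(\<Sum>p\<le>n. \<Sum>q\<le>m. E n p * cnj (E m q) * G (wd p) (wd q)) = (if n = m then 1 else 0)"
proof -
  have "cin (ket n) (ket m) = (\<Sum>p\<le>n. \<Sum>q\<le>m. E n p * cnj (E m q) * G (wd p) (wd q))"
    unfolding ket_S[OF assms(1)] ket_S[OF assms(2)] by (simp add: cin_bilinear cin_xi)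
  then show ?thesis by (simp add: cin_ket_ket)
qed

text \<open>A single entry of the unitary matrix need not be isometric; the sum over
  \<open>a\<close> is, and it gives the bound 1 for each entry in \<open>col_bound\<close>.\<close>

lemma col_gram:
  assumes b: "b \<in> I"
  shows "(\<Sum>a\<in>I. cin (col a b n) (col a b m)) = (if n = m then 1 else 0)"
proof -
  consider "n \<in> S" "m \<in> S" | "n \<in> S" "m \<notin> S" | "n \<notin> S" "m \<in> S" | "n \<notin> S" "m \<notin> S" by blast
  then show ?thesis
  proof cases
    case 1
    have "(\<Sum>a\<in>I. cin (col a b n) (col a b m))
        = (\<Sum>a\<in>I. \<Sum>p\<le>n. \<Sum>q\<le>m. E n p * cnj (E m q) * G (lw a b (wd p)) (lw a b (wd q)))"
      by (simp add: cin_col_S[OF 1])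
    also have "\<dots> = (\<Sum>p\<le>n. \<Sum>a\<in>I. \<Sum>q\<le>m. E n p * cnj (E m q) * G (lw a b (wd p)) (lw a b (wd q)))"
      by (rule sum.swap)
    also have "\<dots> = (\<Sum>p\<le>n. \<Sum>q\<le>m. \<Sum>a\<in>I. E n p * cnj (E m q) * G (lw a b (wd p)) (lw a b (wd q)))"
      by (rule sum.cong[OF refl], rule sum.swap)
    also have "\<dots> = (\<Sum>p\<le>n. \<Sum>q\<le>m. E n p * cnj (E m q) * G (wd p) (wd q))"
      by (simp add: sum_distrib_left[symmetric] G_lw_sum[OF b])
    finally show ?thesis using ket_gram[OF 1] by simp
  next
    case 2
    then have "cin (col a b n) (col a b m) = 0" for a
      using coord_col[of n m a b] by (auto simp: col_def[of a b m] cin_ket)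
    then show ?thesis using 2 by auto
  next
    case 3
    then have "cin (col a b n) (col a b m) = 0" for a
      using coord_col[of m n a b] by (auto simp: col_def[of a b n] cin_ket_left)
    then show ?thesis using 3 by auto
  next
    case 4
    then have "(\<Sum>a\<in>I. cin (col a b n) (col a b m)) = (\<Sum>a\<in>I. if a = b then (if n = m then 1 else 0) else 0)"
      by (intro sum.cong refl) (simp add: col_def cin_ket_ket)
    then show ?thesis using b by simp
  qed
qed

lemma col_bound:
  assumes a: "a \<in> I" and b: "b \<in> I" and F: "finite F"
  shows "(norm (\<Sum>n\<in>F. cscale (c n) (col a b n)))\<^sup>2 \<le> (\<Sum>n\<in>F. (cmod (c n))\<^sup>2)"
proof -
  let ?x = "\<lambda>a. \<Sum>n\<in>F. cscale (c n) (col a b n)"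
  have "complex_of_real (\<Sum>a\<in>I. (norm (?x a))\<^sup>2) = (\<Sum>a\<in>I. cin (?x a) (?x a))"
    by (simp add: cin_self)
  also have "\<dots> = (\<Sum>a\<in>I. \<Sum>n\<in>F. \<Sum>m\<in>F. c n * cnj (c m) * cin (col a b n) (col a b m))"
    by (simp only: cin_bilinear)
  also have "\<dots> = (\<Sum>n\<in>F. \<Sum>a\<in>I. \<Sum>m\<in>F. c n * cnj (c m) * cin (col a b n) (col a b m))"
    by (rule sum.swap)
  also have "\<dots> = (\<Sum>n\<in>F. \<Sum>m\<in>F. \<Sum>a\<in>I. c n * cnj (c m) * cin (col a b n) (col a b m))"
    by (rule sum.cong[OF refl], rule sum.swap)
  also have "\<dots> = (\<Sum>n\<in>F. \<Sum>m\<in>F. if n = m then c n * cnj (c m) else 0)"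
    unfolding sum_distrib_left[symmetric] col_gram[OF b] by (intro sum.cong refl) simp
  also have "\<dots> = (\<Sum>n\<in>F. c n * cnj (c n))" using F by simp
  also have "\<dots> = complex_of_real (\<Sum>n\<in>F. (cmod (c n))\<^sup>2)"
    unfolding of_real_sum by (intro sum.cong refl) (metis complex_norm_square)
  finally have eq: "(\<Sum>a\<in>I. (norm (?x a))\<^sup>2) = (\<Sum>n\<in>F. (cmod (c n))\<^sup>2)" by (simp only: of_real_eq_iff)
  have "(norm (?x a))\<^sup>2 \<le> (\<Sum>a\<in>I. (norm (?x a))\<^sup>2)" using a by (intro member_le_sum) auto
  then show ?thesis unfolding eq .
qed

definition tt :: "'i \<Rightarrow> 'i \<Rightarrow> ell2 \<Rightarrow>\<^sub>L ell2" where
  "tt a b = (SOME T. (\<forall>n. blinfun_apply T (ket n) = col a b n) \<and> (\<forall>x. blinfun_apply T (J x) = J (blinfun_apply T x)))"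

lemma
  assumes "a \<in> I" "b \<in> I"
  shows tt_ket: "blinfun_apply (tt a b) (ket n) = col a b n"
    and tt_J: "blinfun_apply (tt a b) (J x) = J (blinfun_apply (tt a b) x)"
proof -
  obtain T where "\<And>n. blinfun_apply T (ket n) = col a b n" "\<And>x. blinfun_apply T (J x) = J (blinfun_apply T x)"
    using operator_of_columns[of "col a b", OF col_bound[OF assms]] by blast
  then have "\<exists>T. (\<forall>n. blinfun_apply T (ket n) = col a b n) \<and> (\<forall>x. blinfun_apply T (J x) = J (blinfun_apply T x))" by blast
  from someI_ex[OF this] show "blinfun_apply (tt a b) (ket n) = col a b n"
    "blinfun_apply (tt a b) (J x) = J (blinfun_apply (tt a b) x)"
    unfolding tt_def by blast+
qed

lemma xi_expansion:
  obtains N where "\<xi> w = (\<Sum>k\<le>N. cscale (coord (\<xi> w) k) (ket k))"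
proof -
  obtain N where N: "\<And>n. n > N \<Longrightarrow> coord (\<xi> w) n = 0" using xi_fin by blast
  have "\<xi> w = (\<Sum>k\<le>N. cscale (coord (\<xi> w) k) (ket k))"
  proof (rule ell2_eqI)
    fix n
    have "(\<Sum>k\<le>N. coord (\<xi> w) k * (if n = k then 1 else 0)) = (\<Sum>k\<le>N. if k = n then coord (\<xi> w) k else 0)"
      by (intro sum.cong) auto
    then show "coord (\<xi> w) n = coord (\<Sum>k\<le>N. cscale (coord (\<xi> w) k) (ket k)) n"
      using N[of n] by auto
  qed
  then show ?thesis by (rule that)
qed

text \<open>The operator is defined on basis vectors, so its effect on words has to be recovered:
  both sides lie in the span of the words and have the same inner products with all words by
  \<open>G_lw_adj\<close>.\<close>

lemma tt_xi:
  assumes ab: "a \<in> I" "b \<in> I"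
  shows "blinfun_apply (tt a b) (\<xi> w) = \<xi> (lw a b w)"
proof -
  obtain N where N: "\<xi> w = (\<Sum>k\<le>N. cscale (coord (\<xi> w) k) (ket k))" by (rule xi_expansion)
  have T: "blinfun_apply (tt a b) (\<xi> w) = (\<Sum>k\<le>N. cscale (coord (\<xi> w) k) (col a b k))"
    by (subst N) (simp add: blinfun.sum_right cscale_apply tt_J[OF ab] tt_ket[OF ab])
  show ?thesis
  proof (rule Sp_eqI)
    have "cscale (coord (\<xi> w) k) (col a b k) \<in> Sp" for k
    proof (cases "k \<in> S")
      case True
      then show ?thesis unfolding col_def by (auto intro!: Sp_cscale Sp_sum Sp_xi)
    qed (simp add: xi_coord Sp_zero)
    then show "blinfun_apply (tt a b) (\<xi> w) \<in> Sp" unfolding T by (intro Sp_sum)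
    show "\<xi> (lw a b w) \<in> Sp" by (rule Sp_xi)
    fix w'
    let ?c = "complex_of_real (lam b / lam a)" and ?w = "lw (bar a) (bar b) w'"
    have "cin (cscale (coord (\<xi> w) k) (col a b k)) (\<xi> w') = ?c * cin (cscale (coord (\<xi> w) k) (ket k)) (\<xi> ?w)" for k
    proof (cases "k \<in> S")
      case True
      then show ?thesis
        unfolding ket_S[OF True]
        by (simp add: col_def cin_cscale_left cin_sum_left cin_xi G_lw_adj[OF ab] sum_distrib_left mult_ac)
    qed (simp add: xi_coord)
    then have "cin (blinfun_apply (tt a b) (\<xi> w)) (\<xi> w') = ?c * cin (\<Sum>k\<le>N. cscale (coord (\<xi> w) k) (ket k)) (\<xi> ?w)"
      unfolding T by (simp add: cin_sum_left sum_distrib_left)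
    also have "\<dots> = cin (\<xi> (lw a b w)) (\<xi> w')"
      unfolding N[symmetric] cin_xi G_lw_adj[OF ab] ..
    finally show "cin (blinfun_apply (tt a b) (\<xi> w)) (\<xi> w') = cin (\<xi> (lw a b w)) (\<xi> w')" .
  qed
qed

lemma tt_adj:
  assumes ab: "a \<in> I" "b \<in> I"
  shows "is_adj (sc (complex_of_real (lam b / lam a)) (tt (bar a) (bar b))) (tt a b)"
proof (rule is_adj_ketI)
  let ?c = "complex_of_real (lam b / lam a)"
  have ab': "bar a \<in> I" "bar b \<in> I" using ab by simp_all
  show "blinfun_apply (tt a b) (J x) = J (blinfun_apply (tt a b) x)" for x by (rule tt_J[OF ab])
  show "blinfun_apply (sc ?c (tt (bar a) (bar b))) (J x) = J (blinfun_apply (sc ?c (tt (bar a) (bar b))) x)" for x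
    by (simp add: sc_apply tt_J[OF ab'] cscale_J)
  fix m n
  have eq: "bar a = bar b \<longleftrightarrow> a = b" using ab by (metis bar_bar)
  have "cin (col a b n) (ket m) = ?c * cin (ket n) (col (bar a) (bar b) m)"
  proof -
    consider "n \<in> S" "m \<in> S" | "n \<in> S" "m \<notin> S" | "n \<notin> S" "m \<in> S" | "n \<notin> S" "m \<notin> S" by blast
    then show ?thesis
    proof cases
      case 1
      then show ?thesis
        unfolding ket_S[OF 1(1)] ket_S[OF 1(2)]
        by (simp add: col_def cin_sum_left cin_sum_right cin_cscale_left cin_cscale_right cin_xi G_lw_adj[OF ab] sum_distrib_left mult_ac)
    next
      case 2
      then show ?thesis using coord_col[of n m a b] by (auto simp: cin_ket col_def[of "bar a"] cin_ket_left)
    next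
      case 3
      then show ?thesis using coord_col[of m n "bar a" "bar b"] by (auto simp: cin_ket_left col_def[of a b])
    next
      case 4
      then show ?thesis using eq lam_pos[OF ab(1)] by (auto simp: col_def cin_ket_ket)
    qed
  qed
  then show "cin (blinfun_apply (tt a b) (ket n)) (ket m) = cin (ket n) (blinfun_apply (sc ?c (tt (bar a) (bar b))) (ket m))"
    by (simp add: tt_ket[OF ab] tt_ket[OF ab'] sc_apply cin_cscale_right)
qed

lemma tt_Bops: "a \<in> I \<Longrightarrow> b \<in> I \<Longrightarrow> tt a b \<in> Bops"
  by (rule BopsI[OF _ tt_adj]) (simp_all add: tt_J)

lemma adj_tt: "a \<in> I \<Longrightarrow> b \<in> I \<Longrightarrow> adj (tt a b) = sc (complex_of_real (lam b / lam a)) (tt (bar a) (bar b))"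
  by (rule adj_eqI[OF tt_adj])

fun Vop :: "'i list \<Rightarrow> 'i list \<Rightarrow> ell2 \<Rightarrow>\<^sub>L ell2" where
  "Vop [] [] = id_blinfun"
| "Vop (a # s) (b # r) = tt a b o\<^sub>L Vop s r"
| "Vop _ _ = 0"

lemma Vop_Bops: "s \<in> tuples I k \<Longrightarrow> r \<in> tuples I k \<Longrightarrow> Vop s r \<in> Bops"
proof (induction s r arbitrary: k rule: Vop.induct)
  case (2 a s b r)
  then show ?case by (cases k) (auto simp: tuples_def intro!: Bops_comp tt_Bops)
qed (auto intro: Bops_intros)

lemma Vop_xi:
  "s \<in> tuples I k \<Longrightarrow> r \<in> tuples I k \<Longrightarrow> blinfun_apply (Vop s r) (\<xi> (s0, r0)) = \<xi> (s @ s0, r @ r0)"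
proof (induction s r arbitrary: k rule: Vop.induct)
  case (2 a s b r)
  then obtain k' where "a \<in> I" "b \<in> I" "s \<in> tuples I k'" "r \<in> tuples I k'" by (cases k) (auto simp: tuples_def)
  then show ?case using 2 by (simp add: tt_xi lw_def)
qed (auto simp: tuples_def)

lemma Vop_ket:
  "n \<notin> S \<Longrightarrow> s \<in> tuples I k \<Longrightarrow> r \<in> tuples I k \<Longrightarrow> blinfun_apply (Vop s r) (ket n) = (if s = r then ket n else 0)"
proof (induction s r arbitrary: k rule: Vop.induct)
  case (2 a s b r)
  then obtain k' where "a \<in> I" "b \<in> I" "s \<in> tuples I k'" "r \<in> tuples I k'" by (cases k) (auto simp: tuples_def)
  then show ?case using 2 by (simp add: tt_ket col_def blinfun.zero_right)
qed (auto simp: tuples_def)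

text \<open>On the GNS space the relation reduces to \<open>G_relation\<close>; on the complement
  both sides act as the scalar \<open>op g s r\<close>.\<close>

lemma Vop_relation:
  assumes g: "g \<in> FV (k + m)" and s: "s \<in> tuples I m" and r: "r \<in> tuples I k"
  shows "(\<Sum>t\<in>tuples I k. sc (op g s t) (Vop t r)) = (\<Sum>t\<in>tuples I m. sc (op g t r) (Vop s t))"
    (is "?X = ?Y")
proof (rule Bops_ket_eqI)
  show X: "?X \<in> Bops" and Y: "?Y \<in> Bops"
    using s r by (auto intro!: Bops_sum Bops_sc Vop_Bops)
  fix n
  show "blinfun_apply ?X (ket n) = blinfun_apply ?Y (ket n)"
  proof (cases "n \<in> S")
    case True
    have "blinfun_apply ?X (\<xi> w) = blinfun_apply ?Y (\<xi> w)" for w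
    proof -
      obtain s0 r0 where w: "w = (s0, r0)" by (cases w)
      have "blinfun_apply ?X (\<xi> w) = (\<Sum>t\<in>tuples I k. cscale (op g s t) (\<xi> (t @ s0, r @ r0)))"
        unfolding w blinfun_apply_sum sc_apply using r by (intro sum.cong refl) (simp add: Vop_xi)
      moreover have "blinfun_apply ?Y (\<xi> w) = (\<Sum>t\<in>tuples I m. cscale (op g t r) (\<xi> (s @ s0, t @ r0)))"
        unfolding w blinfun_apply_sum sc_apply using s by (intro sum.cong refl) (simp add: Vop_xi)
      moreover have "(\<Sum>t\<in>tuples I k. cscale (op g s t) (\<xi> (t @ s0, r @ r0))) = (\<Sum>t\<in>tuples I m. cscale (op g t r) (\<xi> (s @ s0, t @ r0)))"
        by (intro Sp_eqI Sp_sum Sp_cscale Sp_xi)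
           (simp add: cin_sum_left cin_cscale_left cin_xi G_relation[OF g s r])
      ultimately show ?thesis by simp
    qed
    then show ?thesis
      unfolding ket_S[OF True] by (simp add: blinfun.sum_right Bops_cscale[OF X] Bops_cscale[OF Y])
  next
    case False
    have "blinfun_apply ?X (ket n) = (\<Sum>t\<in>tuples I k. if t = r then cscale (op g s t) (ket n) else 0)"
      unfolding blinfun_apply_sum sc_apply using r by (intro sum.cong refl) (simp add: Vop_ket[OF False])
    moreover have "blinfun_apply ?Y (ket n) = (\<Sum>t\<in>tuples I m. if t = s then cscale (op g t r) (ket n) else 0)"
      unfolding blinfun_apply_sum sc_apply using s by (intro sum.cong refl) (auto simp: Vop_ket[OF False])
    ultimately show ?thesis using r s by simp
  qed
qed

definition vv :: "'i \<Rightarrow> 'i \<Rightarrow> test_carrier" where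
  "vv a b = enc (tt a b)"

lemma tensor_power_vv:
  "s \<in> tuples I k \<Longrightarrow> r \<in> tuples I k \<Longrightarrow> tensor_power Dalg vv s r = enc (Vop s r)"
proof (induction s r arbitrary: k rule: Vop.induct)
  case (2 a s b r)
  then obtain k' where "a \<in> I" "b \<in> I" "s \<in> tuples I k'" "r \<in> tuples I k'" by (cases k) (auto simp: tuples_def)
  then show ?case using 2 by (simp add: vv_def Dalg_simps tt_Bops Vop_Bops)
qed (auto simp: tuples_def Dalg_simps)

lemma Hom_vv_iff:
  "T \<in> Hom Dalg I vv k l \<longleftrightarrow> T \<in> linmaps I k l \<and> (\<forall>s\<in>tuples I l. \<forall>r\<in>tuples I k.
     (\<Sum>t\<in>tuples I k. sc (T s t) (Vop t r)) = (\<Sum>t\<in>tuples I l. sc (T t r) (Vop s t)))"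
proof -
  have "(\<Oplus>\<^bsub>Dalg\<^esub> t\<in>tuples I k. T s t \<odot>\<^bsub>Dalg\<^esub> tensor_power Dalg vv t r) = enc (\<Sum>t\<in>tuples I k. sc (T s t) (Vop t r))"
    "(\<Oplus>\<^bsub>Dalg\<^esub> t\<in>tuples I l. T t r \<odot>\<^bsub>Dalg\<^esub> tensor_power Dalg vv s t) = enc (\<Sum>t\<in>tuples I l. sc (T t r) (Vop s t))"
    if "s \<in> tuples I l" "r \<in> tuples I k" for s r
    using that by (intro finsum_Dalg_eq; simp add: tensor_power_vv Dalg_simps Vop_Bops Bops_sc)+
  moreover have "(\<Sum>t\<in>tuples I k. sc (T s t) (Vop t r)) \<in> Bops" "(\<Sum>t\<in>tuples I l. sc (T t r) (Vop s t)) \<in> Bops"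
    if "s \<in> tuples I l" "r \<in> tuples I k" for s r
    using that by (auto intro!: Bops_sum Bops_sc Vop_Bops)
  ultimately show ?thesis unfolding Hom_def by (simp add: inj_on_eq_iff[OF inj_enc])
qed

lemma Hom_vv_op: "g \<in> FV (k + m) \<Longrightarrow> mk_linmap I k m (op g) \<in> Hom Dalg I vv k m"
  unfolding Hom_vv_iff using Vop_relation[of g k m] by (simp add: linmaps_def mk_linmap_def cong: sum.cong)

text \<open>Evaluated at the vector of the empty word, the intertwiner relation becomes a relation
  of \<open>G\<close>, to which \<open>op_of_relation\<close> applies.\<close>

lemma Hom_vv_E:
  assumes T: "T \<in> Hom Dalg I vv k l"
  shows "\<exists>g\<in>FV (k + l). T = mk_linmap I k l (op g)"
proof -
  have "(\<Sum>t\<in>tuples I k. T s t * G (t, r) w') = (\<Sum>t\<in>tuples I l. T t r * G (s, t) w')"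
    if sr: "s \<in> tuples I l" "r \<in> tuples I k" for s r w'
  proof -
    have "(\<Sum>t\<in>tuples I k. sc (T s t) (Vop t r)) = (\<Sum>t\<in>tuples I l. sc (T t r) (Vop s t))"
      using T sr unfolding Hom_vv_iff by blast
    then have "cin (blinfun_apply (\<Sum>t\<in>tuples I k. sc (T s t) (Vop t r)) (\<xi> ([], []))) (\<xi> w') =
        cin (blinfun_apply (\<Sum>t\<in>tuples I l. sc (T t r) (Vop s t)) (\<xi> ([], []))) (\<xi> w')" by simp
    then show ?thesis
      using sr by (simp add: blinfun_apply_sum sc_apply cin_sum_left cin_cscale_left Vop_xi cin_xi cong: sum.cong)
  qed
  from op_of_relation[OF this] obtain g where g: "g \<in> FV (k + l)" "\<And>s t. s \<in> tuples I l \<Longrightarrow> t \<in> tuples I k \<Longrightarrow> T s t = op g s t"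
    by blast
  have "T = mk_linmap I k l (op g)"
    using T g(2) unfolding Hom_vv_iff linmaps_def mk_linmap_def by (auto simp: fun_eq_iff)
  then show ?thesis using g(1) by blast
qed

text \<open>By \<open>adj_tt\<close> the adjoint entries are weighted entries at \<open>bar\<close>,
  so the two identities are the relations of the pair partition, once as a cap and once as a
  cup.\<close>

lemma unitary_vv: "unitary Dalg I vv"
  unfolding unitary_def
proof (intro ballI conjI)
  fix a b assume ab: "a \<in> I" "b \<in> I"
  have "(\<Oplus>\<^bsub>Dalg\<^esub> x\<in>I. star Dalg (vv x a) \<otimes>\<^bsub>Dalg\<^esub> vv x b) = enc (\<Sum>x\<in>I. adj (tt x a) o\<^sub>L tt x b)"
    using ab by (intro finsum_Dalg_eq) (auto simp: vv_def Dalg_simps tt_Bops Bops_intros)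
  also have "(\<Sum>x\<in>I. adj (tt x a) o\<^sub>L tt x b) = sc (if a = b then 1 else 0) id_blinfun"
  proof -
    have t: "[bar a, b] \<in> tuples I 2" using ab by (simp add: tuples_def)
    have "(\<Sum>x\<in>I. sc (complex_of_real (lam x)) (tt x (bar a) o\<^sub>L tt (bar x) b))
        = (\<Sum>x\<in>I. \<Sum>y\<in>I. sc (op (tvc [0, 0]) [] [x, y]) (Vop [x, y] [bar a, b]))"
    proof (rule sum.cong[OF refl])
      fix x assume x: "x \<in> I"
      have "(\<Sum>y\<in>I. sc (op (tvc [0, 0]) [] [x, y]) (Vop [x, y] [bar a, b]))
          = (\<Sum>y\<in>I. if y = bar x then sc (complex_of_real (lam x)) (tt x (bar a) o\<^sub>L tt y b) else 0)"
        using x by (intro sum.cong refl) (auto simp: op_cap comp_simps sc_def)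
      then show "sc (complex_of_real (lam x)) (tt x (bar a) o\<^sub>L tt (bar x) b) =
          (\<Sum>y\<in>I. sc (op (tvc [0, 0]) [] [x, y]) (Vop [x, y] [bar a, b]))" using x by simp
    qed
    also have "\<dots> = sc (op (tvc [0, 0]) [] [bar a, b]) id_blinfun"
      using Vop_relation[OF FV_cap2(1) _ t, of "[]"] by (simp add: sum_tuples_2)
    finally have rel: "(\<Sum>x\<in>I. sc (complex_of_real (lam x)) (tt x (bar a) o\<^sub>L tt (bar x) b)) =
      sc (if a = b then complex_of_real (1 / lam a) else 0) id_blinfun"
      using ab by (cases "a = b") (auto simp: op_cap lam_bar)
    have "(\<Sum>x\<in>I. adj (tt x a) o\<^sub>L tt x b) = (\<Sum>x\<in>I. sc (complex_of_real (lam a)) (sc (complex_of_real (lam (bar x))) (tt (bar x) (bar a) o\<^sub>L tt (bar (bar x)) b)))"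
      using ab by (intro sum.cong refl) (simp add: adj_tt sc_simps(3)[symmetric] sc_simps(5) lam_bar)
    also have "\<dots> = (\<Sum>x\<in>I. sc (complex_of_real (lam a)) (sc (complex_of_real (lam x)) (tt x (bar a) o\<^sub>L tt (bar x) b)))"
      by (rule sum.reindex_bij_witness[of _ bar bar]) auto
    also have "\<dots> = sc (complex_of_real (lam a)) (\<Sum>x\<in>I. sc (complex_of_real (lam x)) (tt x (bar a) o\<^sub>L tt (bar x) b))"
      by (induction I rule: infinite_finite_induct) (auto simp: sc_simps)
    also have "\<dots> = sc (if a = b then 1 else 0) id_blinfun"
      unfolding rel sc_simps(3)[symmetric] using lam_pos[OF ab(1)] by (cases "a = b") simp_all
    finally show ?thesis .
  qed
  finally show "(\<Oplus>\<^bsub>Dalg\<^esub> x\<in>I. star Dalg (vv x a) \<otimes>\<^bsub>Dalg\<^esub> vv x b) = (if a = b then \<one>\<^bsub>Dalg\<^esub> else \<zero>\<^bsub>Dalg\<^esub>)"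
    by (simp add: Dalg_simps sc_simps sc_def)
  have "(\<Oplus>\<^bsub>Dalg\<^esub> x\<in>I. vv a x \<otimes>\<^bsub>Dalg\<^esub> star Dalg (vv b x)) = enc (\<Sum>x\<in>I. tt a x o\<^sub>L adj (tt b x))"
    using ab by (intro finsum_Dalg_eq) (auto simp: vv_def Dalg_simps tt_Bops Bops_intros)
  also have "(\<Sum>x\<in>I. tt a x o\<^sub>L adj (tt b x)) = sc (if a = b then 1 else 0) id_blinfun"
  proof -
    have t: "[a, bar b] \<in> tuples I 2" using ab by (simp add: tuples_def)
    have bb: "bar b = bar a \<longleftrightarrow> a = b" using ab by (metis bar_bar)
    have "(\<Sum>x\<in>I. sc (complex_of_real (lam x)) (tt a x o\<^sub>L tt (bar b) (bar x)))
        = (\<Sum>x\<in>I. \<Sum>y\<in>I. sc (op (tvc [0, 0]) [x, y] []) (Vop [a, bar b] [x, y]))"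
    proof (rule sum.cong[OF refl])
      fix x assume x: "x \<in> I"
      have "(\<Sum>y\<in>I. sc (op (tvc [0, 0]) [x, y] []) (Vop [a, bar b] [x, y]))
          = (\<Sum>y\<in>I. if y = bar x then sc (complex_of_real (lam x)) (tt a x o\<^sub>L tt (bar b) y) else 0)"
        using x by (intro sum.cong refl) (auto simp: op_cup comp_simps sc_def)
      then show "sc (complex_of_real (lam x)) (tt a x o\<^sub>L tt (bar b) (bar x)) =
          (\<Sum>y\<in>I. sc (op (tvc [0, 0]) [x, y] []) (Vop [a, bar b] [x, y]))" using x by simp
    qed
    also have "\<dots> = sc (op (tvc [0, 0]) [a, bar b] []) id_blinfun"
      using Vop_relation[OF FV_cap2(2) t, of "[]"] by (simp add: sum_tuples_2)
    finally have rel: "(\<Sum>x\<in>I. sc (complex_of_real (lam x)) (tt a x o\<^sub>L tt (bar b) (bar x))) =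
      sc (if a = b then complex_of_real (lam a) else 0) id_blinfun"
      using ab bb by (simp add: op_cup)
    have "(\<Sum>x\<in>I. tt a x o\<^sub>L adj (tt b x)) = (\<Sum>x\<in>I. sc (complex_of_real (1 / lam b)) (sc (complex_of_real (lam x)) (tt a x o\<^sub>L tt (bar b) (bar x))))"
      using ab by (intro sum.cong refl) (simp add: adj_tt comp_sc tt_Bops sc_simps(3)[symmetric])
    also have "\<dots> = sc (complex_of_real (1 / lam b)) (\<Sum>x\<in>I. sc (complex_of_real (lam x)) (tt a x o\<^sub>L tt (bar b) (bar x)))"
      by (induction I rule: infinite_finite_induct) (auto simp: sc_simps)
    also have "\<dots> = sc (if a = b then 1 else 0) id_blinfun"
      unfolding rel sc_simps(3)[symmetric] using lam_pos[OF ab(2)] by (cases "a = b") simp_all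
    finally show ?thesis .
  qed
  finally show "(\<Oplus>\<^bsub>Dalg\<^esub> x\<in>I. vv a x \<otimes>\<^bsub>Dalg\<^esub> star Dalg (vv b x)) = (if a = b then \<one>\<^bsub>Dalg\<^esub> else \<zero>\<^bsub>Dalg\<^esub>)"
    by (simp add: Dalg_simps sc_simps sc_def)
qed

end

text \<open>Words are enumerated by \<open>from_nat\<close>, possibly with repetitions. Positivity
  of the pulled back kernel follows by collecting the coefficients of equal words in
  \<open>d\<close>, and \<open>xi\<close> depends only on the word.\<close>

lemma frob_gns_exists:
  fixes I :: "'i::countable set"
  assumes "frob I M e bar lam \<delta>"
  shows "\<exists>\<xi> S E wd. frob_gns I M e bar lam \<delta> \<xi> S E wd"
proof -
  interpret frob I M e bar lam \<delta> by fact
  let ?w = "from_nat :: nat \<Rightarrow> 'i list \<times> 'i list"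
  interpret psd_kernel "\<lambda>n m. G (?w n) (?w m)"
  proof
    fix m n :: nat
    show "G (?w m) (?w n) = cnj (G (?w n) (?w m))" by (rule G_herm)
  next
    fix F :: "nat set" and c :: "nat \<Rightarrow> complex"
    assume F: "finite F"
    define d where "d w = (\<Sum>n\<in>{n \<in> F. ?w n = w}. c n)" for w
    have fin: "finite (?w ` F)" using F by simp
    have group: "(\<Sum>w\<in>?w ` F. d w * h w) = (\<Sum>n\<in>F. c n * h (?w n))" for h :: "'i list \<times> 'i list \<Rightarrow> complex"
    proof -
      have "(\<Sum>w\<in>?w ` F. d w * h w) = (\<Sum>w\<in>?w ` F. \<Sum>n\<in>{n \<in> F. ?w n = w}. c n * h (?w n))"
        unfolding d_def sum_distrib_right by (intro sum.cong refl) auto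
      also have "\<dots> = (\<Sum>n\<in>F. c n * h (?w n))" by (rule sum.image_gen[OF F, symmetric])
      finally show ?thesis .
    qed
    have group': "(\<Sum>w\<in>?w ` F. h w * cnj (d w)) = (\<Sum>n\<in>F. h (?w n) * cnj (c n))" for h :: "'i list \<times> 'i list \<Rightarrow> complex"
    proof -
      have "(\<Sum>w\<in>?w ` F. h w * cnj (d w)) = cnj (\<Sum>w\<in>?w ` F. d w * cnj (h w))" by (simp add: cnj_sum mult.commute)
      also have "\<dots> = cnj (\<Sum>n\<in>F. c n * cnj (h (?w n)))" by (simp only: group)
      finally show ?thesis by (simp add: cnj_sum mult.commute)
    qed
    have "0 \<le> Re (\<Sum>w'\<in>?w ` F. (\<Sum>w\<in>?w ` F. d w * G w w') * cnj (d w'))" by (rule G_psd[OF fin])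
    then show "0 \<le> Re (\<Sum>m\<in>F. (\<Sum>n\<in>F. c n * G (?w n) (?w m)) * cnj (c m))"
      by (simp only: group group')
  qed
  have xi_eq: "xi (to_nat (?w m)) = xi m" for m
    by (rule ell2_eqI) (simp add: coord_xi cf_def)
  have "frob_gns I M e bar lam \<delta> (\<lambda>w. xi (to_nat w)) {n. gs n \<noteq> (\<lambda>_. 0)} gs ?w"
  proof (intro frob_gns.intro frob_gns_axioms.intro assms)
    show "cin (xi (to_nat w)) (xi (to_nat w')) = G w w'" for w w'
      using cin_xi[of "to_nat w" "to_nat w'"] by simp
    show "ket n = (\<Sum>m\<le>n. cscale (gs n m) (xi (to_nat (?w m))))" if "n \<in> {n. gs n \<noteq> (\<lambda>_. 0)}" for n
      using that by (simp only: xi_eq mem_Collect_eq) (rule ket_xi)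
    show "coord (xi (to_nat w)) n = 0" if "n \<notin> {n. gs n \<noteq> (\<lambda>_. 0)}" for n and w :: "'i list \<times> 'i list"
      using that gs_zero_cf by (simp add: coord_xi)
    show "\<exists>N. \<forall>n>N. coord (xi (to_nat w)) n = 0" for w :: "'i list \<times> 'i list"
      using cf_above by (auto simp: coord_xi)
  qed
  then show ?thesis by blast
qed

section \<open>Fixed vectors give intertwiners\<close>

locale ring_sums = ring A for A (structure)
begin

lemmas mult_closed = m_closed
  and mult_assoc = m_assoc
  and one_left = l_one
  and unit_closed = one_closed
  and sum_zero = finsum_zero

lemma fs_closed [simp]: "(\<And>x. x \<in> S \<Longrightarrow> f x \<in> carrier A) \<Longrightarrow> finsum A f S \<in> carrier A"
  by (rule finsum_closed) auto

lemma fs_cong: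
  "(\<And>x. x \<in> S \<Longrightarrow> f x = g x) \<Longrightarrow> (\<And>x. x \<in> S \<Longrightarrow> g x \<in> carrier A) \<Longrightarrow> finsum A f S = finsum A g S"
  by (rule finsum_cong') auto

lemma fs_insert:
  "\<lbrakk>finite S; a \<notin> S; \<And>x. x \<in> insert a S \<Longrightarrow> f x \<in> carrier A\<rbrakk> \<Longrightarrow> finsum A f (insert a S) = f a \<oplus> finsum A f S"
  by (rule finsum_insert) auto

lemma fs_mult_left:
  "\<lbrakk>finite S; y \<in> carrier A; \<And>x. x \<in> S \<Longrightarrow> f x \<in> carrier A\<rbrakk> \<Longrightarrow> y \<otimes> finsum A f S = finsum A (\<lambda>x. y \<otimes> f x) S"
  by (rule finsum_rdistr) auto

lemma fs_mult_right:
  "\<lbrakk>finite S; y \<in> carrier A; \<And>x. x \<in> S \<Longrightarrow> f x \<in> carrier A\<rbrakk> \<Longrightarrow> finsum A f S \<otimes> y = finsum A (\<lambda>x. f x \<otimes> y) S"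
  by (rule finsum_ldistr) auto

lemma fs_add:
  "\<lbrakk>\<And>x. x \<in> S \<Longrightarrow> f x \<in> carrier A; \<And>x. x \<in> S \<Longrightarrow> g x \<in> carrier A\<rbrakk> \<Longrightarrow>
    finsum A (\<lambda>x. f x \<oplus> g x) S = finsum A f S \<oplus> finsum A g S"
  by (rule finsum_addf) auto

lemma fs_swap:
  assumes "finite S" "finite T" "\<And>x y. x \<in> S \<Longrightarrow> y \<in> T \<Longrightarrow> f x y \<in> carrier A"
  shows "finsum A (\<lambda>x. finsum A (f x) T) S = finsum A (\<lambda>y. finsum A (\<lambda>x. f x y) S) T"
  using assms(1,3)
proof (induction S rule: finite_induct)
  case empty
  then show ?case by simp
next
  case (insert a S)
  then have "finsum A (\<lambda>x. finsum A (f x) T) (insert a S) = finsum A (f a) T \<oplus> finsum A (\<lambda>y. finsum A (\<lambda>x. f x y) S) T"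
    by (simp add: fs_insert)
  also have "\<dots> = finsum A (\<lambda>y. f a y \<oplus> finsum A (\<lambda>x. f x y) S) T"
    using insert by (intro fs_add[symmetric]) auto
  also have "\<dots> = finsum A (\<lambda>y. finsum A (\<lambda>x. f x y) (insert a S)) T"
    using insert by (intro fs_cong) (auto simp: fs_insert)
  finally show ?case .
qed

lemma fs_delta:
  assumes "finite S" "a \<in> S" "f a \<in> carrier A"
  shows "finsum A (\<lambda>x. if x = a then f x else \<zero>) S = f a"
proof -
  have "finsum A (\<lambda>x. if x = a then f x else \<zero>) (insert a (S - {a})) = f a \<oplus> finsum A (\<lambda>x. if x = a then f x else \<zero>) (S - {a})"
    using assms by (subst fs_insert) auto
  also have "finsum A (\<lambda>x. if x = a then f x else \<zero>) (S - {a}) = finsum A (\<lambda>x. \<zero>) (S - {a})"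
    by (rule fs_cong) auto
  finally show ?thesis using assms by (simp add: insert_absorb finsum_zero)
qed

lemma fs_reindex:
  assumes "bij_betw h S T" "\<And>x. x \<in> T \<Longrightarrow> f x \<in> carrier A"
  shows "finsum A (\<lambda>x. f (h x)) S = finsum A f T"
  using assms finsum_reindex[of f h S] by (auto simp: bij_betw_def)

lemma fs_product:
  assumes "finite S" "finite T" "\<And>x y. x \<in> S \<Longrightarrow> y \<in> T \<Longrightarrow> f (x, y) \<in> carrier A"
  shows "finsum A f (S \<times> T) = finsum A (\<lambda>x. finsum A (\<lambda>y. f (x, y)) T) S"
  using assms(1,3)
proof (induction S rule: finite_induct)
  case empty
  then show ?case by simp
next
  case (insert a S)
  have "insert a S \<times> T = Pair a ` T \<union> S \<times> T" by auto
  moreover have "finsum A f (Pair a ` T \<union> S \<times> T) = finsum A f (Pair a ` T) \<oplus> finsum A f (S \<times> T)"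
    using insert assms(2) by (intro finsum_Un_disjoint) auto
  moreover have "finsum A f (Pair a ` T) = finsum A (\<lambda>y. f (a, y)) T"
    using insert by (intro finsum_reindex) (auto simp: inj_on_def)
  ultimately show ?case using insert by (simp add: fs_insert)
qed

lemma fs_tuples_append:
  assumes "finite I" "\<And>t. t \<in> tuples I (j + l) \<Longrightarrow> f t \<in> carrier A"
  shows "finsum A f (tuples I (j + l)) = finsum A (\<lambda>s. finsum A (\<lambda>t. f (s @ t)) (tuples I l)) (tuples I j)"
proof -
  have "bij_betw (\<lambda>(s, t). s @ t) (tuples I j \<times> tuples I l) (tuples I (j + l))"
    by (rule bij_betwI[where g = "\<lambda>s. (take j s, drop j s)"])
       (auto simp: tuples_def dest: in_set_takeD in_set_dropD)
  from fs_reindex[OF this, of f]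
  have "finsum A f (tuples I (j + l)) = finsum A (\<lambda>x. f (case x of (s, t) \<Rightarrow> s @ t)) (tuples I j \<times> tuples I l)"
    using assms(2) by simp
  also have "\<dots> = finsum A (\<lambda>s. finsum A (\<lambda>t. f (s @ t)) (tuples I l)) (tuples I j)"
    using assms by (subst fs_product) auto
  finally show ?thesis .
qed

lemma fs_tuples_0: "f [] \<in> carrier A \<Longrightarrow> finsum A f (tuples I 0) = f []"
  using fs_insert[of "{}" "[]" f] by simp

lemma fs_tuples_1:
  assumes "\<And>a. a \<in> I \<Longrightarrow> f [a] \<in> carrier A"
  shows "finsum A f (tuples I (Suc 0)) = finsum A (\<lambda>a. f [a]) I"
proof -
  have "bij_betw (\<lambda>a. [a]) I (tuples I (Suc 0))"
    by (rule bij_betwI[where g = hd]) (auto simp: tuples_def length_Suc_conv)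
  moreover have "f t \<in> carrier A" if "t \<in> tuples I (Suc 0)" for t
    using that assms by (auto elim!: tuples_SucE)
  ultimately show ?thesis by (rule fs_reindex[symmetric])
qed

lemma fs_tuples_snoc:
  assumes "finite I" "\<And>t. t \<in> tuples I (Suc k) \<Longrightarrow> f t \<in> carrier A"
  shows "finsum A f (tuples I (Suc k)) = finsum A (\<lambda>t. finsum A (\<lambda>a. f (t @ [a])) I) (tuples I k)"
proof -
  have "finsum A f (tuples I (k + Suc 0)) = finsum A (\<lambda>s. finsum A (\<lambda>t. f (s @ t)) (tuples I (Suc 0))) (tuples I k)"
    using assms by (intro fs_tuples_append) auto
  also have "\<dots> = finsum A (\<lambda>t. finsum A (\<lambda>a. f (t @ [a])) I) (tuples I k)"
  proof (rule fs_cong)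
    have c: "f (t @ [a]) \<in> carrier A" if "t \<in> tuples I k" "a \<in> I" for t a
      using that assms(2)[of "t @ [a]"] by (auto simp: tuples_def)
    then show "finsum A (\<lambda>t. f (s @ t)) (tuples I (Suc 0)) = finsum A (\<lambda>a. f (s @ [a])) I" if "s \<in> tuples I k" for s
      using that by (intro fs_tuples_1) auto
    show "finsum A (\<lambda>a. f (t @ [a])) I \<in> carrier A" if "t \<in> tuples I k" for t
      using that c by auto
  qed
  finally show ?thesis by simp
qed

lemma fs_tuples_2:
  assumes "finite I" "\<And>a b. a \<in> I \<Longrightarrow> b \<in> I \<Longrightarrow> f [a, b] \<in> carrier A"
  shows "finsum A f (tuples I 2) = finsum A (\<lambda>a. finsum A (\<lambda>b. f [a, b]) I) I"
proof -
  have t2: "t \<in> tuples I (Suc (Suc 0)) \<Longrightarrow> f t \<in> carrier A" for t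
    using assms(2) by (auto simp: tuples_def length_Suc_conv)
  have "finsum A f (tuples I (Suc (Suc 0))) = finsum A (\<lambda>t. finsum A (\<lambda>a. f (t @ [a])) I) (tuples I (Suc 0))"
    using t2 assms(1) by (intro fs_tuples_snoc)
  also have "\<dots> = finsum A (\<lambda>a. finsum A (\<lambda>b. f ([a] @ [b])) I) I"
    using assms by (intro fs_tuples_1) auto
  finally show ?thesis by (simp add: numeral_2_eq_2)
qed

end

context cstar_algebra
begin

sublocale RA: ring_sums A
  using cstar_algebra_axioms by (simp add: cstar_algebra_def ring_sums_def)

lemmas fs_closed [simp] = RA.fs_closed
lemmas fs_cong = RA.fs_cong
  and fs_insert = RA.fs_insert
  and fs_mult_left = RA.fs_mult_left
  and fs_mult_right = RA.fs_mult_right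
  and fs_add = RA.fs_add
  and fs_swap = RA.fs_swap
  and fs_delta = RA.fs_delta
  and fs_reindex = RA.fs_reindex
  and fs_product = RA.fs_product
  and fs_tuples_append = RA.fs_tuples_append
  and fs_tuples_0 = RA.fs_tuples_0
  and fs_tuples_1 = RA.fs_tuples_1
  and fs_tuples_snoc = RA.fs_tuples_snoc
  and fs_tuples_2 = RA.fs_tuples_2

lemma smult_in [simp]: "x \<in> carrier A \<Longrightarrow> a \<odot> x \<in> carrier A"
  using smult_closed[of a x] by (simp add: complex_ring_def)

lemma smult_smult: "x \<in> carrier A \<Longrightarrow> a \<odot> (b \<odot> x) = (a * b) \<odot> x"
  using smult_assoc1[of a b x] by (simp add: complex_ring_def)

lemma smult_1 [simp]: "x \<in> carrier A \<Longrightarrow> 1 \<odot> x = x"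
  using smult_one[of x] by (simp add: complex_ring_def)

lemma smult_add: "x \<in> carrier A \<Longrightarrow> (a + b) \<odot> x = a \<odot> x \<oplus> b \<odot> x"
  using smult_l_distr[of a b x] by (simp add: complex_ring_def)

lemma smult_zero [simp]: "x \<in> carrier A \<Longrightarrow> 0 \<odot> x = \<zero>" "a \<odot> \<zero> = \<zero>"
proof -
  show "a \<odot> \<zero> = \<zero>" using smult_r_null[of a] by (simp add: complex_ring_def)
  assume "x \<in> carrier A"
  then show "0 \<odot> x = \<zero>" using smult_l_null[of x] by (simp add: complex_ring_def)
qed

lemma fs_smult:
  "\<lbrakk>finite S; \<And>x. x \<in> S \<Longrightarrow> f x \<in> carrier A\<rbrakk> \<Longrightarrow> a \<odot> finsum A f S = finsum A (\<lambda>x. a \<odot> f x) S"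
  by (rule finsum_smult_ldistr) (auto simp: complex_ring_def)

lemma fs_smult_sum:
  "\<lbrakk>finite S; y \<in> carrier A\<rbrakk> \<Longrightarrow> (\<Sum>x\<in>S. c x) \<odot> y = finsum A (\<lambda>x. c x \<odot> y) S"
  by (induction S rule: finite_induct) (simp_all add: fs_insert smult_add)

lemma fs_pull:
  assumes "finite X" "\<And>x. x \<in> X \<Longrightarrow> w x \<in> carrier A" "y \<in> carrier A" "z \<in> carrier A"
  shows "finsum A (\<lambda>x. (c x * d) \<odot> (y \<otimes> (w x \<otimes> z))) X = d \<odot> (y \<otimes> (finsum A (\<lambda>x. c x \<odot> w x) X \<otimes> z))"
proof -
  have "d \<odot> (y \<otimes> (finsum A (\<lambda>x. c x \<odot> w x) X \<otimes> z)) = finsum A (\<lambda>x. d \<odot> (y \<otimes> ((c x \<odot> w x) \<otimes> z))) X"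
    using assms by (simp add: fs_mult_right fs_mult_left fs_smult)
  also have "\<dots> = finsum A (\<lambda>x. (c x * d) \<odot> (y \<otimes> (w x \<otimes> z))) X"
    using assms by (intro fs_cong) (auto simp: smult_mult_left smult_mult_right smult_smult mult.commute)
  finally show ?thesis by simp
qed

end

section \<open>Relations between the generators in any solution\<close>

locale frob_rep = frob I M e bar lam \<delta> + cstar_algebra A
  for I :: "'i set" and M e bar lam \<delta> and A :: "'a cstar" (structure) +
  fixes u :: "'i \<Rightarrow> 'i \<Rightarrow> 'a"
  assumes u_in [simp]: "x \<in> I \<Longrightarrow> y \<in> I \<Longrightarrow> u x y \<in> carrier A"
    and uni: "unitary A I u"
    and mult_Hom: "mk_linmap I 2 1 (\<lambda>s r. complex_of_real (M (s ! 0) (r ! 0) (r ! 1))) \<in> Hom A I u 2 1"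
    and unit_Hom: "mk_linmap I 0 1 (\<lambda>s r. complex_of_real (e (s ! 0))) \<in> Hom A I u 0 1"
begin

abbreviation fs :: "'x set \<Rightarrow> ('x \<Rightarrow> 'a) \<Rightarrow> 'a" where
  "fs S f \<equiv> finsum A f S"

abbreviation tp :: "'i list \<Rightarrow> 'i list \<Rightarrow> 'a" where
  "tp \<equiv> tensor_power A u"

lemma tp_closed [simp]: "s \<in> tuples I k \<Longrightarrow> r \<in> tuples I k \<Longrightarrow> tp s r \<in> carrier A"
proof (induction s arbitrary: r k)
  case (Cons a s)
  then obtain k' where k: "k = Suc k'" by (cases k) (auto simp: tuples_def)
  with Cons.prems obtain b r' where "r = b # r'" "b \<in> I" "r' \<in> tuples I k'" by (auto elim: tuples_SucE)
  then show ?case using Cons k by auto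
qed (auto simp: tuples_def)

lemma tp_append:
  "s1 \<in> tuples I j \<Longrightarrow> t1 \<in> tuples I j \<Longrightarrow> s2 \<in> tuples I l \<Longrightarrow> t2 \<in> tuples I l \<Longrightarrow>
    tp (s1 @ s2) (t1 @ t2) = tp s1 t1 \<otimes> tp s2 t2"
proof (induction s1 arbitrary: t1 j)
  case Nil
  then show ?case by (auto simp: tuples_def intro!: RA.one_left[symmetric] tp_closed[of _ l])
next
  case (Cons a s)
  then obtain k' where k: "j = Suc k'" by (cases j) (auto simp: tuples_def)
  with Cons.prems obtain b r' where "t1 = b # r'" "b \<in> I" "r' \<in> tuples I k'" by (auto elim: tuples_SucE)
  moreover have "tp s2 t2 \<in> carrier A" using Cons.prems by auto
  ultimately show ?case using Cons k by (auto simp: RA.mult_assoc)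
qed

lemma unit_rel: "a \<in> I \<Longrightarrow> fs I (\<lambda>x. complex_of_real (e x) \<odot> u a x) = complex_of_real (e a) \<odot> \<one>"
proof -
  assume a: "a \<in> I"
  let ?T = "mk_linmap I 0 1 (\<lambda>s r. complex_of_real (e (s ! 0)))"
  have "fs I (\<lambda>x. complex_of_real (e x) \<odot> u a x) = fs I (\<lambda>x. ?T [x] [] \<odot> tp [a] [x])"
    using a by (intro fs_cong) (auto simp: mk_linmap_def tuples_def)
  also have "\<dots> = fs (tuples I (Suc 0)) (\<lambda>t. ?T t [] \<odot> tp [a] t)"
    using a by (intro fs_tuples_1[symmetric]) auto
  also have "\<dots> = fs (tuples I 0) (\<lambda>t. ?T [a] t \<odot> tp t [])"
    using unit_Hom a unfolding Hom_def by (simp add: tuples_def)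
  also have "\<dots> = complex_of_real (e a) \<odot> \<one>"
    using a by (subst fs_tuples_0) (auto simp: mk_linmap_def tuples_def)
  finally show ?thesis .
qed

lemma mult_rel:
  assumes a: "a \<in> I" and xy: "x \<in> I" "y \<in> I"
  shows "fs I (\<lambda>p. fs I (\<lambda>q. complex_of_real (M a p q) \<odot> (u p x \<otimes> u q y))) = fs I (\<lambda>z. complex_of_real (M z x y) \<odot> u a z)"
proof -
  let ?T = "mk_linmap I 2 1 (\<lambda>s r. complex_of_real (M (s ! 0) (r ! 0) (r ! 1)))"
  have t: "[a] \<in> tuples I (Suc 0)" "[x, y] \<in> tuples I 2" using a xy by (simp_all add: tuples_def)
  have "fs I (\<lambda>p. fs I (\<lambda>q. complex_of_real (M a p q) \<odot> (u p x \<otimes> u q y))) = fs I (\<lambda>p. fs I (\<lambda>q. ?T [a] [p, q] \<odot> tp [p, q] [x, y]))"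
    using a xy by (intro fs_cong) (auto simp: mk_linmap_def tuples_def)
  also have "\<dots> = fs (tuples I 2) (\<lambda>t. ?T [a] t \<odot> tp t [x, y])"
    using a xy by (intro fs_tuples_2[symmetric]) auto
  also have "\<dots> = fs (tuples I (Suc 0)) (\<lambda>t. ?T t [x, y] \<odot> tp [a] t)"
    using mult_Hom t unfolding Hom_def by simp
  also have "\<dots> = fs I (\<lambda>z. ?T [z] [x, y] \<odot> tp [a] [z])"
    using a by (intro fs_tuples_1) auto
  also have "\<dots> = fs I (\<lambda>z. complex_of_real (M z x y) \<odot> u a z)"
    using a xy by (intro fs_cong) (auto simp: mk_linmap_def tuples_def)
  finally show ?thesis .
qed

lemma star_in [simp]: "x \<in> I \<Longrightarrow> y \<in> I \<Longrightarrow> star A (u x y) \<in> carrier A"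
  by (simp add: star_closed)

lemma uni1: "a \<in> I \<Longrightarrow> b \<in> I \<Longrightarrow> fs I (\<lambda>x. star A (u x a) \<otimes> u x b) = (if a = b then \<one> else \<zero>)"
  and uni2: "a \<in> I \<Longrightarrow> b \<in> I \<Longrightarrow> fs I (\<lambda>x. u a x \<otimes> star A (u b x)) = (if a = b then \<one> else \<zero>)"
  using uni unfolding unitary_def by blast+

lemma star_zero: "star A \<zero> = \<zero>"
  using star_smult[of \<zero> 0] by (simp add: star_closed)

lemma star_fs: "finite S \<Longrightarrow> (\<And>x. x \<in> S \<Longrightarrow> f x \<in> carrier A) \<Longrightarrow> star A (fs S f) = fs S (\<lambda>x. star A (f x))"
  by (induction S rule: finite_induct) (simp_all add: star_zero fs_insert star_add star_closed)

lemma star_one: "star A \<one> = \<one>"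
  by (metis RA.one_left RA.unit_closed star_closed star_mult star_star)

text \<open>The adjoint of \<open>unit_rel\<close>: multiply that relation by the adjoint of
  \<open>u\<close>, use unitarity and take stars. The coefficients \<open>e a\<close> are
  real.\<close>

lemma counit_rel:
  assumes z: "z \<in> I"
  shows "fs I (\<lambda>a. complex_of_real (e a) \<odot> u a z) = complex_of_real (e z) \<odot> \<one>"
proof -
  have "fs I (\<lambda>a. complex_of_real (e a) \<odot> star A (u a z)) = fs I (\<lambda>a. star A (u a z) \<otimes> (complex_of_real (e a) \<odot> \<one>))"
    using z by (intro fs_cong) (simp_all add: smult_mult_right)
  also have "\<dots> = fs I (\<lambda>a. star A (u a z) \<otimes> fs I (\<lambda>x. complex_of_real (e x) \<odot> u a x))"
    using z by (intro fs_cong) (simp_all add: unit_rel)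
  also have "\<dots> = fs I (\<lambda>a. fs I (\<lambda>x. complex_of_real (e x) \<odot> (star A (u a z) \<otimes> u a x)))"
    using z by (intro fs_cong) (auto simp: fs_mult_left smult_mult_right intro!: fs_cong)
  also have "\<dots> = fs I (\<lambda>x. fs I (\<lambda>a. complex_of_real (e x) \<odot> (star A (u a z) \<otimes> u a x)))"
    using z by (intro fs_swap) simp_all
  also have "\<dots> = fs I (\<lambda>x. complex_of_real (e x) \<odot> fs I (\<lambda>a. star A (u a z) \<otimes> u a x))"
    using z by (intro fs_cong) (simp_all add: fs_smult)
  also have "\<dots> = fs I (\<lambda>x. if x = z then complex_of_real (e x) \<odot> \<one> else \<zero>)"
    using z by (intro fs_cong) (auto simp: uni1)
  also have "\<dots> = complex_of_real (e z) \<odot> \<one>" using z by (intro fs_delta) simp_all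
  finally have eq: "fs I (\<lambda>a. complex_of_real (e a) \<odot> star A (u a z)) = complex_of_real (e z) \<odot> \<one>" .
  have "fs I (\<lambda>a. complex_of_real (e a) \<odot> u a z) = fs I (\<lambda>a. star A (complex_of_real (e a) \<odot> star A (u a z)))"
    using z by (intro fs_cong) (simp_all add: star_smult star_star)
  also have "\<dots> = star A (fs I (\<lambda>a. complex_of_real (e a) \<odot> star A (u a z)))"
    using z by (intro star_fs[symmetric]) simp_all
  also have "\<dots> = complex_of_real (e z) \<odot> \<one>" unfolding eq by (simp add: star_smult star_one)
  finally show ?thesis .
qed

text \<open>The contraction is multiplication followed by the adjoint of the unit, so
  \<open>mult_rel\<close> and \<open>counit_rel\<close> combine.\<close>

lemma cap_rel:
  assumes xy: "x \<in> I" "y \<in> I"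
  shows "fs I (\<lambda>p. complex_of_real (lam p) \<odot> (u p x \<otimes> u (bar p) y)) = (if y = bar x then complex_of_real (lam x) \<odot> \<one> else \<zero>)"
proof -
  let ?w = "\<lambda>p q. u p x \<otimes> u q y"
  have w: "?w p q \<in> carrier A" if "p \<in> I" "q \<in> I" for p q using that xy by simp
  have "fs I (\<lambda>p. complex_of_real (lam p) \<odot> ?w p (bar p)) = fs I (\<lambda>p. fs I (\<lambda>q. if q = bar p then complex_of_real (lam p) \<odot> ?w p q else \<zero>))"
    using w by (intro fs_cong) (auto simp: fs_delta)
  also have "\<dots> = fs I (\<lambda>p. fs I (\<lambda>q. (\<Sum>a\<in>I. complex_of_real (e a * M a p q)) \<odot> ?w p q))"
    using w by (intro fs_cong) (auto simp: of_real_sum[symmetric] cap simp del: of_real_sum of_real_mult)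
  also have "\<dots> = fs I (\<lambda>p. fs I (\<lambda>q. fs I (\<lambda>a. complex_of_real (e a * M a p q) \<odot> ?w p q)))"
    using w by (intro fs_cong) (auto simp: fs_smult_sum)
  also have "\<dots> = fs I (\<lambda>p. fs I (\<lambda>a. fs I (\<lambda>q. complex_of_real (e a * M a p q) \<odot> ?w p q)))"
    using w by (intro fs_cong fs_swap) auto
  also have "\<dots> = fs I (\<lambda>a. fs I (\<lambda>p. fs I (\<lambda>q. complex_of_real (e a * M a p q) \<odot> ?w p q)))"
    using w by (intro fs_swap) auto
  also have "\<dots> = fs I (\<lambda>a. complex_of_real (e a) \<odot> fs I (\<lambda>p. fs I (\<lambda>q. complex_of_real (M a p q) \<odot> ?w p q)))"
    using w by (intro fs_cong) (auto simp: fs_smult smult_smult intro!: fs_cong)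
  also have "\<dots> = fs I (\<lambda>a. complex_of_real (e a) \<odot> fs I (\<lambda>z. complex_of_real (M z x y) \<odot> u a z))"
    using xy by (intro fs_cong) (simp_all add: mult_rel)
  also have "\<dots> = fs I (\<lambda>a. fs I (\<lambda>z. complex_of_real (M z x y) \<odot> (complex_of_real (e a) \<odot> u a z)))"
    by (intro fs_cong) (auto simp: fs_smult smult_smult mult.commute intro!: fs_cong)
  also have "\<dots> = fs I (\<lambda>z. fs I (\<lambda>a. complex_of_real (M z x y) \<odot> (complex_of_real (e a) \<odot> u a z)))"
    by (intro fs_swap) auto
  also have "\<dots> = fs I (\<lambda>z. complex_of_real (M z x y) \<odot> (complex_of_real (e z) \<odot> \<one>))"
    by (intro fs_cong) (simp_all add: fs_smult[symmetric] counit_rel)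
  also have "\<dots> = fs I (\<lambda>z. complex_of_real (e z * M z x y) \<odot> \<one>)"
    by (intro fs_cong) (simp_all add: smult_smult mult.commute)
  also have "\<dots> = complex_of_real (\<Sum>z\<in>I. e z * M z x y) \<odot> \<one>"
    by (simp add: fs_smult_sum)
  finally show ?thesis using xy by (simp add: cap)
qed

text \<open>The matrix \<open>L\<close> is a left inverse of \<open>u\<close> by
  \<open>cap_rel\<close>, and the adjoint of \<open>u\<close> is a right inverse, so they
  coincide.\<close>

lemma star_u:
  assumes xa: "x \<in> I" "a \<in> I"
  shows "star A (u x a) = complex_of_real (lam a / lam x) \<odot> u (bar x) (bar a)"
proof -
  define L where "L b y = complex_of_real (lam b / lam y) \<odot> u (bar y) (bar b)" for b y
  have L_in: "L b y \<in> carrier A" if "b \<in> I" "y \<in> I" for b y using that by (simp add: L_def)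
  have Lu: "fs I (\<lambda>y. L a y \<otimes> u y z) = (if z = a then \<one> else \<zero>)" if z: "z \<in> I" for z
  proof -
    have bij: "bij_betw bar I I" by (rule bij_betwI[where g = bar]) auto
    have "fs I (\<lambda>y. L a y \<otimes> u y z) = fs I (\<lambda>y. L a (bar y) \<otimes> u (bar y) z)"
      using xa z L_in by (intro fs_reindex[OF bij, symmetric]) auto
    also have "\<dots> = fs I (\<lambda>y. complex_of_real (lam a) \<odot> (complex_of_real (lam y) \<odot> (u y (bar a) \<otimes> u (bar y) z)))"
      using xa z by (intro fs_cong) (auto simp: L_def lam_bar smult_mult_left smult_smult)
    also have "\<dots> = complex_of_real (lam a) \<odot> fs I (\<lambda>y. complex_of_real (lam y) \<odot> (u y (bar a) \<otimes> u (bar y) z))"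
      using xa z by (intro fs_smult[symmetric]) auto
    also have "\<dots> = (if z = a then \<one> else \<zero>)"
      using xa z lam_pos[OF xa(2)] by (auto simp: cap_rel lam_bar smult_smult)
    finally show ?thesis .
  qed
  have "L a x = fs I (\<lambda>y. if y = x then L a y else \<zero>)" using xa L_in by (intro fs_delta[symmetric]) auto
  also have "\<dots> = fs I (\<lambda>y. L a y \<otimes> fs I (\<lambda>z. u y z \<otimes> star A (u x z)))"
    using xa L_in by (intro fs_cong) (auto simp: uni2)
  also have "\<dots> = fs I (\<lambda>y. fs I (\<lambda>z. L a y \<otimes> (u y z \<otimes> star A (u x z))))"
    using xa L_in by (intro fs_cong) (auto simp: fs_mult_left)
  also have "\<dots> = fs I (\<lambda>z. fs I (\<lambda>y. L a y \<otimes> (u y z \<otimes> star A (u x z))))"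
    using xa L_in by (intro fs_swap) auto
  also have "\<dots> = fs I (\<lambda>z. fs I (\<lambda>y. L a y \<otimes> u y z) \<otimes> star A (u x z))"
    using xa L_in by (intro fs_cong) (auto simp: fs_mult_right RA.mult_assoc intro!: fs_cong)
  also have "\<dots> = fs I (\<lambda>z. if z = a then star A (u x z) else \<zero>)"
    using xa by (intro fs_cong) (auto simp: Lu)
  also have "\<dots> = star A (u x a)" using xa by (intro fs_delta) auto
  finally show ?thesis by (simp add: L_def)
qed

lemma cup_rel:
  assumes qb: "q \<in> I" "b \<in> I"
  shows "fs I (\<lambda>y. complex_of_real (lam y) \<odot> (u q y \<otimes> u b (bar y))) = (if b = bar q then complex_of_real (lam q) \<odot> \<one> else \<zero>)"
proof -
  have "fs I (\<lambda>y. complex_of_real (lam y) \<odot> (u q y \<otimes> u b (bar y))) = fs I (\<lambda>y. complex_of_real (lam (bar b)) \<odot> (u q y \<otimes> star A (u (bar b) y)))"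
    using qb lam_pos[OF qb(2)] by (intro fs_cong) (auto simp: star_u smult_mult_right smult_smult lam_bar)
  also have "\<dots> = complex_of_real (lam (bar b)) \<odot> fs I (\<lambda>y. u q y \<otimes> star A (u (bar b) y))"
    using qb by (intro fs_smult[symmetric]) auto
  also have "\<dots> = (if b = bar q then complex_of_real (lam q) \<odot> \<one> else \<zero>)"
    using qb by (auto simp: uni2)
  finally show ?thesis .
qed

text \<open>The adjoint of the multiplication is the multiplication with one leg bent by
  \<open>frobl\<close>; after \<open>mult_rel\<close> the bent leg is straightened by
  \<open>cup_rel\<close>.\<close>

lemma comult_rel:
  assumes ab: "a \<in> I" "b \<in> I" and z: "z \<in> I"
  shows "fs I (\<lambda>x. fs I (\<lambda>y. complex_of_real (M z x y) \<odot> (u a x \<otimes> u b y))) = fs I (\<lambda>w. complex_of_real (M w a b) \<odot> u w z)"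
proof -
  have bij: "bij_betw bar I I" by (rule bij_betwI[where g = bar]) auto
  have M1: "M z x (bar y) = lam y * M x z y" if "x \<in> I" "y \<in> I" for x y
    using frobl[of x z y] that z by simp
  have "fs I (\<lambda>x. fs I (\<lambda>y. complex_of_real (M z x y) \<odot> (u a x \<otimes> u b y)))
      = fs I (\<lambda>x. fs I (\<lambda>y. complex_of_real (M z x (bar y)) \<odot> (u a x \<otimes> u b (bar y))))"
    using ab by (intro fs_cong fs_reindex[OF bij, symmetric]) auto
  also have "\<dots> = fs I (\<lambda>y. fs I (\<lambda>x. complex_of_real (M z x (bar y)) \<odot> (u a x \<otimes> u b (bar y))))"
    using ab by (intro fs_swap) auto
  also have "\<dots> = fs I (\<lambda>y. complex_of_real (lam y) \<odot> (fs I (\<lambda>x. complex_of_real (M x z y) \<odot> u a x) \<otimes> u b (bar y)))"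
    using ab z by (intro fs_cong) (auto simp: M1 fs_mult_right fs_smult smult_mult_left smult_smult intro!: fs_cong)
  also have "\<dots> = fs I (\<lambda>y. complex_of_real (lam y) \<odot> (fs I (\<lambda>p. fs I (\<lambda>q. complex_of_real (M a p q) \<odot> (u p z \<otimes> u q y))) \<otimes> u b (bar y)))"
    using ab z by (intro fs_cong) (auto simp: mult_rel)
  also have "\<dots> = fs I (\<lambda>y. fs I (\<lambda>p. fs I (\<lambda>q. (complex_of_real (M a p q) * complex_of_real (lam y)) \<odot> (u p z \<otimes> (u q y \<otimes> u b (bar y))))))"
    using ab z by (intro fs_cong) (auto simp: fs_mult_right fs_smult smult_mult_left smult_smult RA.mult_assoc mult.commute intro!: fs_cong)
  also have "\<dots> = fs I (\<lambda>p. fs I (\<lambda>y. fs I (\<lambda>q. (complex_of_real (M a p q) * complex_of_real (lam y)) \<odot> (u p z \<otimes> (u q y \<otimes> u b (bar y))))))"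
    using ab z by (intro fs_swap) auto
  also have "\<dots> = fs I (\<lambda>p. fs I (\<lambda>q. fs I (\<lambda>y. (complex_of_real (M a p q) * complex_of_real (lam y)) \<odot> (u p z \<otimes> (u q y \<otimes> u b (bar y))))))"
    using ab z by (intro fs_cong fs_swap) auto
  also have "\<dots> = fs I (\<lambda>p. fs I (\<lambda>q. complex_of_real (M a p q) \<odot> (u p z \<otimes> fs I (\<lambda>y. complex_of_real (lam y) \<odot> (u q y \<otimes> u b (bar y))))))"
    using ab z by (intro fs_cong) (auto simp: fs_mult_left fs_smult smult_mult_right smult_smult intro!: fs_cong)
  also have "\<dots> = fs I (\<lambda>p. fs I (\<lambda>q. if q = bar b then complex_of_real (M a p q * lam q) \<odot> u p z else \<zero>))"
    using ab z by (intro fs_cong) (auto simp: cup_rel smult_mult_right smult_smult)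
  also have "\<dots> = fs I (\<lambda>p. complex_of_real (M a p (bar b) * lam (bar b)) \<odot> u p z)"
    using ab z by (intro fs_cong) (auto simp: fs_delta)
  also have "\<dots> = fs I (\<lambda>p. complex_of_real (M p a b) \<odot> u p z)"
  proof (rule fs_cong)
    fix p assume p: "p \<in> I"
    show "complex_of_real (M a p (bar b) * lam (bar b)) \<odot> u p z = complex_of_real (M p a b) \<odot> u p z"
      using frobl[of a p "bar b"] p ab by (simp add: mult.commute)
  qed (use z in auto)
  finally show ?thesis .
qed

text \<open>These are the vectors in the space of intertwiners from the trivial representation to
  the \<open>m\<close>-th tensor power.\<close>

definition fixed :: "nat \<Rightarrow> ('i list \<Rightarrow> complex) \<Rightarrow> bool" where
  "fixed m f \<longleftrightarrow> (\<forall>s\<in>tuples I m. fs (tuples I m) (\<lambda>t. f t \<odot> tp s t) = f s \<odot> \<one>)"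

lemma fs_tuples3:
  assumes "\<And>t. t \<in> tuples I (j + (k + l)) \<Longrightarrow> f t \<in> carrier A"
  shows "fs (tuples I (j + (k + l))) f = fs (tuples I j) (\<lambda>t1. fs (tuples I l) (\<lambda>t2. fs (tuples I k) (\<lambda>p. f (t1 @ p @ t2))))"
proof -
  have c: "f (t1 @ p @ t2) \<in> carrier A" if "t1 \<in> tuples I j" "p \<in> tuples I k" "t2 \<in> tuples I l" for t1 p t2
    using that by (intro assms tuples_appendI)
  have "fs (tuples I (j + (k + l))) f = fs (tuples I j) (\<lambda>t1. fs (tuples I (k + l)) (\<lambda>t. f (t1 @ t)))"
    using assms by (intro fs_tuples_append) auto
  also have "\<dots> = fs (tuples I j) (\<lambda>t1. fs (tuples I k) (\<lambda>p. fs (tuples I l) (\<lambda>t2. f (t1 @ p @ t2))))"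
  proof (rule fs_cong)
    fix t1 assume t1: "t1 \<in> tuples I j"
    show "fs (tuples I (k + l)) (\<lambda>t. f (t1 @ t)) = fs (tuples I k) (\<lambda>p. fs (tuples I l) (\<lambda>t2. f (t1 @ p @ t2)))"
      using t1 assms by (intro fs_tuples_append[of I k l "\<lambda>t. f (t1 @ t)", simplified]) auto
    show "fs (tuples I k) (\<lambda>p. fs (tuples I l) (\<lambda>t2. f (t1 @ p @ t2))) \<in> carrier A" using c t1 by simp
  qed
  also have "\<dots> = fs (tuples I j) (\<lambda>t1. fs (tuples I l) (\<lambda>t2. fs (tuples I k) (\<lambda>p. f (t1 @ p @ t2))))"
    using c by (intro fs_cong fs_swap) auto
  finally show ?thesis .
qed

text \<open>The coefficients of a tensor power factor into a left, a middle and a right part. The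
  intertwiner \<open>Q\<close> commutes past the middle factor, so it may be applied to the middle
  legs of a fixed vector.\<close>

lemma fixed_local:
  assumes f: "fixed (j + (k + l)) f"
    and Q: "\<And>q p. q \<in> tuples I m \<Longrightarrow> p \<in> tuples I k \<Longrightarrow>
      fs (tuples I m) (\<lambda>q'. Q q' p \<odot> tp q q') = fs (tuples I k) (\<lambda>p'. Q q p' \<odot> tp p' p)"
    and f': "\<And>s1 q s2. s1 \<in> tuples I j \<Longrightarrow> q \<in> tuples I m \<Longrightarrow> s2 \<in> tuples I l \<Longrightarrow>
      f' (s1 @ q @ s2) = (\<Sum>p\<in>tuples I k. Q q p * f (s1 @ p @ s2))"
  shows "fixed (j + (m + l)) f'"
  unfolding fixed_def
proof
  fix s assume "s \<in> tuples I (j + (m + l))"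
  then obtain s1 q s2 where s: "s = s1 @ q @ s2" and s1: "s1 \<in> tuples I j" and q: "q \<in> tuples I m" and s2: "s2 \<in> tuples I l"
    by (metis tuples_splitE)
  have sc: "s1 @ q @ s2 \<in> tuples I (j + (m + l))" using s1 q s2 by (intro tuples_appendI)
  have sp: "s1 @ p @ s2 \<in> tuples I (j + (k + l))" if "p \<in> tuples I k" for p using s1 s2 that by (intro tuples_appendI)
  have ts: "tp (s1 @ q @ s2) (t1 @ q' @ t2) = tp s1 t1 \<otimes> (tp q q' \<otimes> tp s2 t2)"
    if "q \<in> tuples I n" "t1 \<in> tuples I j" "q' \<in> tuples I n" "t2 \<in> tuples I l" for n q t1 q' t2
    using tp_append[OF s1 that(2) tuples_appendI[OF that(1) s2] tuples_appendI[OF that(3,4)]] tp_append[OF that(1,3) s2 that(4)] by simp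
  let ?x = "\<lambda>p t1 t2. tp s1 t1 \<otimes> (p \<otimes> tp s2 t2)"
  have L: "fs (tuples I (j + (m + l))) (\<lambda>t. f' t \<odot> tp s t) =
      fs (tuples I j) (\<lambda>t1. fs (tuples I l) (\<lambda>t2. fs (tuples I k) (\<lambda>p.
        f (t1 @ p @ t2) \<odot> ?x (fs (tuples I m) (\<lambda>q'. Q q' p \<odot> tp q q')) t1 t2)))"
  proof -
    have "fs (tuples I (j + (m + l))) (\<lambda>t. f' t \<odot> tp s t) =
        fs (tuples I j) (\<lambda>t1. fs (tuples I l) (\<lambda>t2. fs (tuples I m) (\<lambda>q'. f' (t1 @ q' @ t2) \<odot> tp s (t1 @ q' @ t2))))"
      using sc s by (intro fs_tuples3) auto
    also have "\<dots> = fs (tuples I j) (\<lambda>t1. fs (tuples I l) (\<lambda>t2. fs (tuples I k) (\<lambda>p.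
        f (t1 @ p @ t2) \<odot> ?x (fs (tuples I m) (\<lambda>q'. Q q' p \<odot> tp q q')) t1 t2)))"
    proof (intro fs_cong)
      fix t1 t2 assume t: "t1 \<in> tuples I j" "t2 \<in> tuples I l"
      have c: "?x (tp q q') t1 t2 \<in> carrier A" if "q' \<in> tuples I m" for q'
        using that t s1 s2 q by (intro RA.mult_closed) auto
      have "fs (tuples I m) (\<lambda>q'. f' (t1 @ q' @ t2) \<odot> tp s (t1 @ q' @ t2))
          = fs (tuples I m) (\<lambda>q'. fs (tuples I k) (\<lambda>p. (Q q' p * f (t1 @ p @ t2)) \<odot> ?x (tp q q') t1 t2))"
        using t c ts[OF q] unfolding s by (intro fs_cong) (auto simp: f' fs_smult_sum)
      also have "\<dots> = fs (tuples I k) (\<lambda>p. fs (tuples I m) (\<lambda>q'. (Q q' p * f (t1 @ p @ t2)) \<odot> ?x (tp q q') t1 t2))"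
        using c by (intro fs_swap) auto
      also have "\<dots> = fs (tuples I k) (\<lambda>p. f (t1 @ p @ t2) \<odot> ?x (fs (tuples I m) (\<lambda>q'. Q q' p \<odot> tp q q')) t1 t2)"
      proof (rule fs_cong)
        fix p assume "p \<in> tuples I k"
        show "fs (tuples I m) (\<lambda>q'. (Q q' p * f (t1 @ p @ t2)) \<odot> ?x (tp q q') t1 t2) =
            f (t1 @ p @ t2) \<odot> ?x (fs (tuples I m) (\<lambda>q'. Q q' p \<odot> tp q q')) t1 t2"
          using t s1 s2 q by (intro fs_pull) auto
        show "f (t1 @ p @ t2) \<odot> ?x (fs (tuples I m) (\<lambda>q'. Q q' p \<odot> tp q q')) t1 t2 \<in> carrier A"
          using t s1 s2 q by (intro smult_in RA.mult_closed fs_closed tp_closed) auto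
      qed
      finally show "fs (tuples I m) (\<lambda>q'. f' (t1 @ q' @ t2) \<odot> tp s (t1 @ q' @ t2)) =
          fs (tuples I k) (\<lambda>p. f (t1 @ p @ t2) \<odot> ?x (fs (tuples I m) (\<lambda>q'. Q q' p \<odot> tp q q')) t1 t2)" .
    qed (use s1 s2 q in \<open>auto intro!: fs_closed smult_in RA.mult_closed\<close>)
    finally show ?thesis .
  qed
  \<comment> \<open>The same normal form reached from the other side, using that \<open>f\<close> is
    fixed at every word with middle part \<open>p'\<close>.\<close>
  have R: "fs (tuples I k) (\<lambda>p'. Q q p' \<odot> (f (s1 @ p' @ s2) \<odot> \<one>)) =
      fs (tuples I j) (\<lambda>t1. fs (tuples I l) (\<lambda>t2. fs (tuples I k) (\<lambda>p.
        f (t1 @ p @ t2) \<odot> ?x (fs (tuples I k) (\<lambda>p'. Q q p' \<odot> tp p' p)) t1 t2)))"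
  proof -
    let ?y = "\<lambda>p' p t1 t2. (Q q p' * f (t1 @ p @ t2)) \<odot> ?x (tp p' p) t1 t2"
    have c: "?x (tp p' p) t1 t2 \<in> carrier A" if "p' \<in> tuples I k" "p \<in> tuples I k" "t1 \<in> tuples I j" "t2 \<in> tuples I l" for p' p t1 t2
      using that s1 s2 by (intro RA.mult_closed) auto
    have "fs (tuples I k) (\<lambda>p'. Q q p' \<odot> (f (s1 @ p' @ s2) \<odot> \<one>))
        = fs (tuples I k) (\<lambda>p'. Q q p' \<odot> fs (tuples I (j + (k + l))) (\<lambda>t. f t \<odot> tp (s1 @ p' @ s2) t))"
      using f sp unfolding fixed_def by (intro fs_cong) auto
    also have "\<dots> = fs (tuples I k) (\<lambda>p'. fs (tuples I j) (\<lambda>t1. fs (tuples I l) (\<lambda>t2. fs (tuples I k) (\<lambda>p. ?y p' p t1 t2))))"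
    proof (rule fs_cong)
      fix p' assume p': "p' \<in> tuples I k"
      have "fs (tuples I (j + (k + l))) (\<lambda>t. f t \<odot> tp (s1 @ p' @ s2) t) =
          fs (tuples I j) (\<lambda>t1. fs (tuples I l) (\<lambda>t2. fs (tuples I k) (\<lambda>p. f (t1 @ p @ t2) \<odot> tp (s1 @ p' @ s2) (t1 @ p @ t2))))"
        using sp[OF p'] by (intro fs_tuples3) auto
      also have "\<dots> = fs (tuples I j) (\<lambda>t1. fs (tuples I l) (\<lambda>t2. fs (tuples I k) (\<lambda>p. f (t1 @ p @ t2) \<odot> ?x (tp p' p) t1 t2)))"
        using c p' ts[OF p'] by (intro fs_cong) auto
      finally have e1: "fs (tuples I (j + (k + l))) (\<lambda>t. f t \<odot> tp (s1 @ p' @ s2) t) =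
          fs (tuples I j) (\<lambda>t1. fs (tuples I l) (\<lambda>t2. fs (tuples I k) (\<lambda>p. f (t1 @ p @ t2) \<odot> ?x (tp p' p) t1 t2)))" .
      have "Q q p' \<odot> fs (tuples I j) (\<lambda>t1. fs (tuples I l) (\<lambda>t2. fs (tuples I k) (\<lambda>p. f (t1 @ p @ t2) \<odot> ?x (tp p' p) t1 t2)))
          = fs (tuples I j) (\<lambda>t1. fs (tuples I l) (\<lambda>t2. fs (tuples I k) (\<lambda>p. Q q p' \<odot> (f (t1 @ p @ t2) \<odot> ?x (tp p' p) t1 t2))))"
        using c p' by (auto simp: fs_smult intro!: fs_cong)
      also have "\<dots> = fs (tuples I j) (\<lambda>t1. fs (tuples I l) (\<lambda>t2. fs (tuples I k) (\<lambda>p. ?y p' p t1 t2)))"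
        using c p' by (intro fs_cong) (auto simp: smult_smult)
      finally show "Q q p' \<odot> fs (tuples I (j + (k + l))) (\<lambda>t. f t \<odot> tp (s1 @ p' @ s2) t)
          = fs (tuples I j) (\<lambda>t1. fs (tuples I l) (\<lambda>t2. fs (tuples I k) (\<lambda>p. ?y p' p t1 t2)))" unfolding e1 .
      show "fs (tuples I j) (\<lambda>t1. fs (tuples I l) (\<lambda>t2. fs (tuples I k) (\<lambda>p. ?y p' p t1 t2))) \<in> carrier A"
        using c p' by simp
    qed
    also have "\<dots> = fs (tuples I j) (\<lambda>t1. fs (tuples I k) (\<lambda>p'. fs (tuples I l) (\<lambda>t2. fs (tuples I k) (\<lambda>p. ?y p' p t1 t2))))"
      using c by (intro fs_swap) auto
    also have "\<dots> = fs (tuples I j) (\<lambda>t1. fs (tuples I l) (\<lambda>t2. fs (tuples I k) (\<lambda>p'. fs (tuples I k) (\<lambda>p. ?y p' p t1 t2))))"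
      using c by (intro fs_cong fs_swap) auto
    also have "\<dots> = fs (tuples I j) (\<lambda>t1. fs (tuples I l) (\<lambda>t2. fs (tuples I k) (\<lambda>p. fs (tuples I k) (\<lambda>p'. ?y p' p t1 t2))))"
      using c by (intro fs_cong fs_swap) auto
    also have "\<dots> = fs (tuples I j) (\<lambda>t1. fs (tuples I l) (\<lambda>t2. fs (tuples I k) (\<lambda>p.
        f (t1 @ p @ t2) \<odot> ?x (fs (tuples I k) (\<lambda>p'. Q q p' \<odot> tp p' p)) t1 t2)))"
      using s1 s2 by (intro fs_cong fs_pull smult_in RA.mult_closed fs_closed tp_closed) auto
    finally show ?thesis .
  qed
  have "fs (tuples I k) (\<lambda>p'. Q q p' \<odot> (f (s1 @ p' @ s2) \<odot> \<one>)) = f' s \<odot> \<one>"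
    unfolding s f'[OF s1 q s2] by (simp add: fs_smult_sum smult_smult cong: fs_cong)
  moreover have "fs (tuples I j) (\<lambda>t1. fs (tuples I l) (\<lambda>t2. fs (tuples I k) (\<lambda>p.
        f (t1 @ p @ t2) \<odot> ?x (fs (tuples I m) (\<lambda>q'. Q q' p \<odot> tp q q')) t1 t2))) =
      fs (tuples I j) (\<lambda>t1. fs (tuples I l) (\<lambda>t2. fs (tuples I k) (\<lambda>p.
        f (t1 @ p @ t2) \<odot> ?x (fs (tuples I k) (\<lambda>p'. Q q p' \<odot> tp p' p)) t1 t2)))"
    using Q[OF q] s1 s2 by (intro fs_cong) (auto intro!: fs_closed RA.mult_closed)
  ultimately show "fs (tuples I (j + (m + l))) (\<lambda>t. f' t \<odot> tp s t) = f' s \<odot> \<one>"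
    using L R by simp
qed

lemma fixed_tvc: "nc xs \<Longrightarrow> fixed (length xs) (tvc xs)"
proof (induction xs rule: nc_induct)
  case Nil
  have "tp [] [] = \<one>" by simp
  then show ?case unfolding fixed_def using fs_tuples_0[of "\<lambda>t. tvc [] t \<odot> tp [] t"] by simp
next
  case (fresh ys v zs)
  have "fixed (length ys + (Suc 0 + length zs)) (tvc (ys @ v # zs))"
  \<comment> \<open>Here \<open>Q\<close> is the unit map, from no leg to one.\<close>
  proof (rule fixed_local[where k = 0 and Q = "\<lambda>q p. complex_of_real (e (hd q))"])
    show "fixed (length ys + (0 + length zs)) (tvc (ys @ zs))" using fresh by simp
    show "fs (tuples I (Suc 0)) (\<lambda>q'. complex_of_real (e (hd q')) \<odot> tp q q') = fs (tuples I 0) (\<lambda>p'. complex_of_real (e (hd q)) \<odot> tp p' p)"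
      if qp: "q \<in> tuples I (Suc 0)" "p \<in> tuples I 0" for q p
    proof -
      obtain a where a: "q = [a]" "a \<in> I" using qp(1) by (auto elim!: tuples_SucE)
      have "fs (tuples I (Suc 0)) (\<lambda>q'. complex_of_real (e (hd q')) \<odot> tp q q') = fs I (\<lambda>x. complex_of_real (e (hd [x])) \<odot> tp q [x])"
        using a by (intro fs_tuples_1) auto
      also have "\<dots> = fs I (\<lambda>x. complex_of_real (e x) \<odot> u a x)" using a by (intro fs_cong) auto
      also have "\<dots> = complex_of_real (e a) \<odot> \<one>" by (rule unit_rel[OF a(2)])
      also have "\<dots> = fs (tuples I 0) (\<lambda>p'. complex_of_real (e (hd q)) \<odot> tp p' p)"
        using qp(2) a fs_tuples_0[of "\<lambda>p'. complex_of_real (e (hd q)) \<odot> tp p' p"] by simp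
      finally show ?thesis .
    qed
    show "tvc (ys @ v # zs) (s1 @ q @ s2) = (\<Sum>p\<in>tuples I 0. complex_of_real (e (hd q)) * tvc (ys @ zs) (s1 @ p @ s2))"
      if s: "s1 \<in> tuples I (length ys)" "q \<in> tuples I (Suc 0)" "s2 \<in> tuples I (length zs)" for s1 q s2
    proof -
      obtain a where a: "q = [a]" "a \<in> I" using s(2) by (auto elim!: tuples_SucE)
      have "tv (ys @ v # zs) (s1 @ a # s2) = e a * tv (ys @ zs) (s1 @ s2)"
        using s a fresh by (intro tv_fresh) (auto simp: tuples_def)
      moreover have "(\<Sum>p\<in>tuples I 0. complex_of_real (e (hd q)) * tvc (ys @ zs) (s1 @ p @ s2)) =
          complex_of_real (e a) * tvc (ys @ zs) (s1 @ s2)" using a by simp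
      ultimately show ?thesis using s a by (auto simp: tvc_def tuples_def)
    qed
  qed
  then show ?case by simp
next
  case (double ys v zs)
  \<comment> \<open>Here \<open>?Q\<close> is the adjoint of the multiplication, from one leg to
    two.\<close>
  let ?Q = "\<lambda>q p. complex_of_real (M (hd p) (q ! 0) (q ! 1))"
  have "fixed (length ys + (2 + length zs)) (tvc (ys @ v # v # zs))"
  proof (rule fixed_local[where k = "Suc 0" and Q = ?Q])
    show "fixed (length ys + (Suc 0 + length zs)) (tvc (ys @ v # zs))" using double by simp
    show "fs (tuples I 2) (\<lambda>q'. ?Q q' p \<odot> tp q q') = fs (tuples I (Suc 0)) (\<lambda>p'. ?Q q p' \<odot> tp p' p)"
      if qp: "q \<in> tuples I 2" "p \<in> tuples I (Suc 0)" for q p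
    proof -
      obtain a b where q: "q = [a, b]" "a \<in> I" "b \<in> I" using qp(1) by (rule tuples_2E)
      obtain z where z: "p = [z]" "z \<in> I" using qp(2) by (auto elim!: tuples_SucE)
      have "fs (tuples I 2) (\<lambda>q'. ?Q q' p \<odot> tp q q') = fs I (\<lambda>x. fs I (\<lambda>y. ?Q [x, y] p \<odot> tp q [x, y]))"
        using q by (intro fs_tuples_2) auto
      also have "\<dots> = fs I (\<lambda>x. fs I (\<lambda>y. complex_of_real (M z x y) \<odot> (u a x \<otimes> u b y)))"
        using q z by (intro fs_cong) auto
      also have "\<dots> = fs I (\<lambda>w. complex_of_real (M w a b) \<odot> u w z)" by (rule comult_rel[OF q(2,3) z(2)])
      also have "\<dots> = fs I (\<lambda>w. ?Q q [w] \<odot> tp [w] p)" using q z by (intro fs_cong) auto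
      also have "\<dots> = fs (tuples I (Suc 0)) (\<lambda>p'. ?Q q p' \<odot> tp p' p)"
        using q z by (intro fs_tuples_1[symmetric]) auto
      finally show ?thesis .
    qed
    show "tvc (ys @ v # v # zs) (s1 @ q @ s2) = (\<Sum>p\<in>tuples I (Suc 0). ?Q q p * tvc (ys @ v # zs) (s1 @ p @ s2))"
      if s: "s1 \<in> tuples I (length ys)" "q \<in> tuples I 2" "s2 \<in> tuples I (length zs)" for s1 q s2
    proof -
      obtain a b where q: "q = [a, b]" "a \<in> I" "b \<in> I" using s(2) by (rule tuples_2E)
      have "(\<Sum>p\<in>tuples I (Suc 0). ?Q q p * tvc (ys @ v # zs) (s1 @ p @ s2)) = complex_of_real (\<Sum>x\<in>I. M x a b * tv (ys @ v # zs) (s1 @ x # s2))"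
        unfolding sum_tuples_1 of_real_sum using s q by (intro sum.cong refl) (auto simp: tvc_def tuples_def)
      also have "(\<Sum>x\<in>I. M x a b * tv (ys @ v # zs) (s1 @ x # s2)) = tv (ys @ v # v # zs) (s1 @ a # b # s2)"
        using s q by (intro tv_comult) (auto simp: tuples_def)
      finally show ?thesis using s q by (auto simp: tvc_def tuples_def)
    qed
  qed
  then show ?case by simp
qed

lemma fixed_FV: "f \<in> FV m \<Longrightarrow> fixed m f"
proof (induction rule: FV.induct)
  case zero
  have "fs (tuples I m) (\<lambda>t. 0 \<odot> tp s t) = \<zero>" if "s \<in> tuples I m" for s
    using that fs_cong[of "tuples I m" "\<lambda>t. 0 \<odot> tp s t" "\<lambda>t. \<zero>"] by (simp add: RA.sum_zero)
  then show ?case by (simp add: fixed_def)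
next
  case (step f xs c)
  have x: "fixed m (tvc xs)" using fixed_tvc step by blast
  show ?case
    unfolding fixed_def
  proof
    fix s assume s: "s \<in> tuples I m"
    have "fs (tuples I m) (\<lambda>t. (f t + c * tvc xs t) \<odot> tp s t) = fs (tuples I m) (\<lambda>t. f t \<odot> tp s t \<oplus> c \<odot> (tvc xs t \<odot> tp s t))"
      using s by (intro fs_cong) (auto simp: smult_add smult_smult)
    also have "\<dots> = fs (tuples I m) (\<lambda>t. f t \<odot> tp s t) \<oplus> c \<odot> fs (tuples I m) (\<lambda>t. tvc xs t \<odot> tp s t)"
      using s by (simp add: fs_add fs_smult)
    also have "\<dots> = f s \<odot> \<one> \<oplus> c \<odot> (tvc xs s \<odot> \<one>)"
      using s step.IH x unfolding fixed_def by simp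
    finally show "fs (tuples I m) (\<lambda>t. (f t + c * tvc xs t) \<odot> tp s t) = (f s + c * tvc xs s) \<odot> \<one>"
      by (simp add: smult_add smult_smult)
  qed
qed

lemma tuples_snocE:
  assumes "s \<in> tuples I (Suc k)"
  obtains t a where "s = t @ [a]" "t \<in> tuples I k" "a \<in> I"
proof (cases s rule: rev_cases)
  case (snoc t a)
  then show ?thesis using that[of t a] assms by (auto simp: tuples_def)
qed (use assms in \<open>auto simp: tuples_def\<close>)

text \<open>The innermost pair consists of the last letter of \<open>t\<close> and the first letter
  of \<open>rbar t\<close>. Contracting it by \<open>cap_rel\<close> leaves the nested caps of the
  shorter words.\<close>

lemma cap_nest:
  "r \<in> tuples I k \<Longrightarrow> p \<in> tuples I k \<Longrightarrow>
    fs (tuples I k) (\<lambda>t. complex_of_real (lamp t) \<odot> (tp t r \<otimes> tp (rbar t) (rbar p))) =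
    (if p = r then complex_of_real (lamp r) \<odot> \<one> else \<zero>)"
proof (induction k arbitrary: r p)
  case 0
  then show ?case using fs_tuples_0[of "\<lambda>t. complex_of_real (lamp t) \<odot> (tp t r \<otimes> tp (rbar t) (rbar p))"] by simp
next
  case (Suc k)
  obtain r' c where r: "r = r' @ [c]" "r' \<in> tuples I k" "c \<in> I"
    using Suc.prems(1) by (rule tuples_snocE)
  obtain p' d where p: "p = p' @ [d]" "p' \<in> tuples I k" "d \<in> I"
    using Suc.prems(2) by (rule tuples_snocE)
  have tm: "tp (t @ [a]) r \<otimes> tp (rbar (t @ [a])) (rbar p) = tp t r' \<otimes> ((u a c \<otimes> u (bar a) (bar d)) \<otimes> tp (rbar t) (rbar p'))"
    if t: "t \<in> tuples I k" "a \<in> I" for t a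
  proof -
    have "tp (t @ [a]) r = tp t r' \<otimes> u a c"
      unfolding r(1) using tp_append[OF t(1) r(2), of "[a]" "Suc 0" "[c]"] t r by simp
    moreover have "tp (rbar t) (rbar p') \<in> carrier A" "tp t r' \<in> carrier A"
      using tp_closed[OF rbar_tuples[OF t(1)] rbar_tuples[OF p(2)]] tp_closed[OF t(1) r(2)] by blast+
    ultimately show ?thesis using t p r by (simp add: RA.mult_assoc)
  qed
  have "fs (tuples I (Suc k)) (\<lambda>t. complex_of_real (lamp t) \<odot> (tp t r \<otimes> tp (rbar t) (rbar p)))
      = fs (tuples I k) (\<lambda>t. fs I (\<lambda>a. complex_of_real (lamp (t @ [a])) \<odot> (tp (t @ [a]) r \<otimes> tp (rbar (t @ [a])) (rbar p))))"
  proof (rule fs_tuples_snoc)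
    fix t assume "t \<in> tuples I (Suc k)"
    then show "complex_of_real (lamp t) \<odot> (tp t r \<otimes> tp (rbar t) (rbar p)) \<in> carrier A"
      using Suc.prems by (intro smult_in RA.mult_closed tp_closed[of _ "Suc k"] rbar_tuples)
  qed simp
  also have "\<dots> = fs (tuples I k) (\<lambda>t. complex_of_real (lamp t) \<odot> (tp t r' \<otimes>
      (fs I (\<lambda>a. complex_of_real (lam a) \<odot> (u a c \<otimes> u (bar a) (bar d))) \<otimes> tp (rbar t) (rbar p'))))"
  proof (rule fs_cong)
    fix t assume t: "t \<in> tuples I k"
    have cl: "tp t r' \<in> carrier A" "tp (rbar t) (rbar p') \<in> carrier A"
      using tp_closed[OF rbar_tuples[OF t] rbar_tuples[OF p(2)]] tp_closed[OF t r(2)] by blast+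
    have "fs I (\<lambda>a. complex_of_real (lamp (t @ [a])) \<odot> (tp (t @ [a]) r \<otimes> tp (rbar (t @ [a])) (rbar p)))
        = fs I (\<lambda>a. (complex_of_real (lam a) * complex_of_real (lamp t)) \<odot> (tp t r' \<otimes> ((u a c \<otimes> u (bar a) (bar d)) \<otimes> tp (rbar t) (rbar p'))))"
    proof (rule fs_cong)
      fix a assume a: "a \<in> I"
      show "complex_of_real (lamp (t @ [a])) \<odot> (tp (t @ [a]) r \<otimes> tp (rbar (t @ [a])) (rbar p)) =
        (complex_of_real (lam a) * complex_of_real (lamp t)) \<odot> (tp t r' \<otimes> ((u a c \<otimes> u (bar a) (bar d)) \<otimes> tp (rbar t) (rbar p')))"
        unfolding tm[OF t a] by (simp add: mult.commute)
      show "(complex_of_real (lam a) * complex_of_real (lamp t)) \<odot> (tp t r' \<otimes> ((u a c \<otimes> u (bar a) (bar d)) \<otimes> tp (rbar t) (rbar p'))) \<in> carrier A"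
        using a cl r p by (intro smult_in RA.mult_closed) auto
    qed
    also have "\<dots> = complex_of_real (lamp t) \<odot> (tp t r' \<otimes>
      (fs I (\<lambda>a. complex_of_real (lam a) \<odot> (u a c \<otimes> u (bar a) (bar d))) \<otimes> tp (rbar t) (rbar p')))"
      using cl r p by (intro fs_pull) auto
    finally show "fs I (\<lambda>a. complex_of_real (lamp (t @ [a])) \<odot> (tp (t @ [a]) r \<otimes> tp (rbar (t @ [a])) (rbar p))) =
      complex_of_real (lamp t) \<odot> (tp t r' \<otimes> (fs I (\<lambda>a. complex_of_real (lam a) \<odot> (u a c \<otimes> u (bar a) (bar d))) \<otimes> tp (rbar t) (rbar p')))" .
    show "complex_of_real (lamp t) \<odot> (tp t r' \<otimes> (fs I (\<lambda>a. complex_of_real (lam a) \<odot> (u a c \<otimes> u (bar a) (bar d))) \<otimes> tp (rbar t) (rbar p'))) \<in> carrier A"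
      using cl r p by (intro smult_in RA.mult_closed fs_closed) auto
  qed
  also have "\<dots> = fs (tuples I k) (\<lambda>t. (if d = c then complex_of_real (lam c) else 0) \<odot> (complex_of_real (lamp t) \<odot> (tp t r' \<otimes> tp (rbar t) (rbar p'))))"
  proof (rule fs_cong)
    fix t assume t: "t \<in> tuples I k"
    have cl: "tp t r' \<in> carrier A" "tp (rbar t) (rbar p') \<in> carrier A"
      using tp_closed[OF rbar_tuples[OF t] rbar_tuples[OF p(2)]] tp_closed[OF t r(2)] by blast+
    have "bar d = bar c \<longleftrightarrow> d = c" using r p by (metis bar_bar)
    then show "complex_of_real (lamp t) \<odot> (tp t r' \<otimes> (fs I (\<lambda>a. complex_of_real (lam a) \<odot> (u a c \<otimes> u (bar a) (bar d))) \<otimes> tp (rbar t) (rbar p'))) =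
      (if d = c then complex_of_real (lam c) else 0) \<odot> (complex_of_real (lamp t) \<odot> (tp t r' \<otimes> tp (rbar t) (rbar p')))"
      using cl r p by (simp add: cap_rel smult_mult_left smult_mult_right smult_smult mult.commute)
    show "(if d = c then complex_of_real (lam c) else 0) \<odot> (complex_of_real (lamp t) \<odot> (tp t r' \<otimes> tp (rbar t) (rbar p'))) \<in> carrier A"
      using cl by (intro smult_in RA.mult_closed)
  qed
  also have "\<dots> = (if d = c then complex_of_real (lam c) else 0) \<odot> fs (tuples I k) (\<lambda>t. complex_of_real (lamp t) \<odot> (tp t r' \<otimes> tp (rbar t) (rbar p')))"
    using r p by (intro fs_smult[symmetric] smult_in RA.mult_closed tp_closed rbar_tuples) auto
  also have "\<dots> = (if p = r then complex_of_real (lamp r) \<odot> \<one> else \<zero>)"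
    unfolding Suc.IH[OF r(2) p(2)] using r p by (auto simp: smult_smult mult.commute)
  finally show ?case .
qed

text \<open>The legs of \<open>g\<close> that became inputs of \<open>op g\<close> have to be
  cancelled: the identity saying that \<open>g\<close> is fixed is multiplied by
  \<open>tp t r\<close>, and \<open>cap_nest\<close> contracts this factor with the one at the bent
  legs.\<close>

lemma Hom_op:
  assumes g: "g \<in> FV (k + l)"
  shows "mk_linmap I k l (op g) \<in> Hom A I u k l"
proof -
  have fx: "fixed (k + l) g" by (rule fixed_FV[OF g])
  have "fs (tuples I k) (\<lambda>t. op g s t \<odot> tp t r) = fs (tuples I l) (\<lambda>q. op g q r \<odot> tp s q)"
    if s: "s \<in> tuples I l" and r: "r \<in> tuples I k" for s r
  proof -
    have bij: "bij_betw rbar (tuples I k) (tuples I k)"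
      by (rule bij_betwI[where g = rbar]) (intro Pi_I rbar_tuples rbar_rbar; assumption)+
    let ?x = "\<lambda>t p. tp t r \<otimes> tp (rbar t) (rbar p)"
    \<comment> \<open>The factor \<open>\<one>\<close> brings the term into the shape treated by
      \<open>fs_pull\<close>.\<close>
    let ?y = "\<lambda>t p q. (complex_of_real (lamp t) * g (rbar p @ q)) \<odot> (\<one> \<otimes> (?x t p \<otimes> tp s q))"
    have x: "?x t p \<in> carrier A" if "t \<in> tuples I k" "p \<in> tuples I k" for t p
      using that r by (intro RA.mult_closed tp_closed[of _ k] rbar_tuples)
    have y: "?y t p q \<in> carrier A" if "t \<in> tuples I k" "p \<in> tuples I k" "q \<in> tuples I l" for t p q
      by (rule smult_in, rule RA.mult_closed, rule RA.unit_closed, rule RA.mult_closed, rule x[OF that(1,2)],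
        rule tp_closed[OF s that(3)])
    have "fs (tuples I k) (\<lambda>t. op g s t \<odot> tp t r) = fs (tuples I k) (\<lambda>t. fs (tuples I k) (\<lambda>p. fs (tuples I l) (\<lambda>q. ?y t p q)))"
    proof (rule fs_cong)
      fix t assume t: "t \<in> tuples I k"
      have ts: "rbar t @ s \<in> tuples I (k + l)" using t s by (intro tuples_appendI rbar_tuples)
      have tr: "tp t r \<in> carrier A" using t r by auto
      have cl: "g w \<odot> tp (rbar t @ s) w \<in> carrier A" if "w \<in> tuples I (k + l)" for w
        using that ts by (intro smult_in tp_closed)
      have cl2: "g (p @ q) \<odot> tp (rbar t @ s) (p @ q) \<in> carrier A" if "p \<in> tuples I k" "q \<in> tuples I l" for p q
        using that by (intro cl tuples_appendI)
      have "g (rbar t @ s) \<odot> \<one> = fs (tuples I (k + l)) (\<lambda>w. g w \<odot> tp (rbar t @ s) w)"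
        using fx ts unfolding fixed_def by simp
      also have "\<dots> = fs (tuples I k) (\<lambda>p. fs (tuples I l) (\<lambda>q. g (p @ q) \<odot> tp (rbar t @ s) (p @ q)))"
        using cl by (intro fs_tuples_append) auto
      also have "\<dots> = fs (tuples I k) (\<lambda>p. fs (tuples I l) (\<lambda>q. g (rbar p @ q) \<odot> tp (rbar t @ s) (rbar p @ q)))"
        using cl2 by (intro fs_reindex[OF bij, symmetric] fs_closed)
      finally have e1: "g (rbar t @ s) \<odot> \<one> = fs (tuples I k) (\<lambda>p. fs (tuples I l) (\<lambda>q. g (rbar p @ q) \<odot> tp (rbar t @ s) (rbar p @ q)))" .
      have cl3: "g (rbar p @ q) \<odot> tp (rbar t @ s) (rbar p @ q) \<in> carrier A" if "p \<in> tuples I k" "q \<in> tuples I l" for p q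
        using that by (intro cl2 rbar_tuples)
      have "op g s t \<odot> tp t r = complex_of_real (lamp t) \<odot> (tp t r \<otimes> (g (rbar t @ s) \<odot> \<one>))"
        using tr by (simp add: op_def smult_mult_right smult_smult)
      also have "\<dots> = fs (tuples I k) (\<lambda>p. fs (tuples I l) (\<lambda>q. complex_of_real (lamp t) \<odot> (tp t r \<otimes> (g (rbar p @ q) \<odot> tp (rbar t @ s) (rbar p @ q)))))"
        unfolding e1 using cl3 tr by (auto simp: fs_mult_left fs_smult intro!: fs_cong)
      also have "\<dots> = fs (tuples I k) (\<lambda>p. fs (tuples I l) (\<lambda>q. ?y t p q))"
      proof (intro fs_cong)
        fix p q assume pq: "p \<in> tuples I k" "q \<in> tuples I l"
        have c: "tp (rbar t) (rbar p) \<in> carrier A" "tp s q \<in> carrier A"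
          using tp_closed[OF rbar_tuples[OF t] rbar_tuples[OF pq(1)]] tp_closed[OF s pq(2)] by blast+
        show "complex_of_real (lamp t) \<odot> (tp t r \<otimes> (g (rbar p @ q) \<odot> tp (rbar t @ s) (rbar p @ q))) = ?y t p q"
          unfolding tp_append[OF rbar_tuples[OF t] rbar_tuples[OF pq(1)] s pq(2)]
          using c tr by (simp add: smult_mult_right smult_smult RA.mult_assoc RA.one_left)
      qed (use y t in auto)
      finally show "op g s t \<odot> tp t r = fs (tuples I k) (\<lambda>p. fs (tuples I l) (\<lambda>q. ?y t p q))" .
    qed (use y in auto)
    also have "\<dots> = fs (tuples I k) (\<lambda>p. fs (tuples I k) (\<lambda>t. fs (tuples I l) (\<lambda>q. ?y t p q)))"
      using y by (intro fs_swap fs_closed) auto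
    also have "\<dots> = fs (tuples I k) (\<lambda>p. fs (tuples I l) (\<lambda>q. fs (tuples I k) (\<lambda>t. ?y t p q)))"
      using y by (intro fs_cong fs_swap fs_closed) auto
    also have "\<dots> = fs (tuples I k) (\<lambda>p. if p = r then fs (tuples I l) (\<lambda>q. op g q p \<odot> tp s q) else \<zero>)"
    proof (rule fs_cong)
      fix p assume p: "p \<in> tuples I k"
      have "fs (tuples I k) (\<lambda>t. ?y t p q) = (if p = r then op g q p \<odot> tp s q else \<zero>)" if q: "q \<in> tuples I l" for q
      proof -
        have c: "tp s q \<in> carrier A" using s q by auto
        have "fs (tuples I k) (\<lambda>t. ?y t p q) = g (rbar p @ q) \<odot> (\<one> \<otimes> (fs (tuples I k) (\<lambda>t. complex_of_real (lamp t) \<odot> ?x t p) \<otimes> tp s q))"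
          using x p c by (intro fs_pull) auto
        then show ?thesis
          unfolding cap_nest[OF r p] using c by (auto simp: smult_mult_left smult_smult op_def RA.one_left mult.commute)
      qed
      then have "fs (tuples I l) (\<lambda>q. fs (tuples I k) (\<lambda>t. ?y t p q)) = fs (tuples I l) (\<lambda>q. if p = r then op g q p \<odot> tp s q else \<zero>)"
        using s by (intro fs_cong) auto
      then show "fs (tuples I l) (\<lambda>q. fs (tuples I k) (\<lambda>t. ?y t p q)) = (if p = r then fs (tuples I l) (\<lambda>q. op g q p \<odot> tp s q) else \<zero>)"
        by (simp add: RA.sum_zero)
    qed (use s in auto)
    also have "\<dots> = fs (tuples I l) (\<lambda>q. op g q r \<odot> tp s q)"
      using r s by (intro fs_delta[where f = "\<lambda>p. fs (tuples I l) (\<lambda>q. op g q p \<odot> tp s q)"]) auto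
    finally show ?thesis .
  qed
  moreover have "fs (tuples I k) (\<lambda>t. mk_linmap I k l (op g) s t \<odot> tp t r) = fs (tuples I k) (\<lambda>t. op g s t \<odot> tp t r)"
    "fs (tuples I l) (\<lambda>t. mk_linmap I k l (op g) t r \<odot> tp s t) = fs (tuples I l) (\<lambda>q. op g q r \<odot> tp s q)"
    if "s \<in> tuples I l" "r \<in> tuples I k" for s r
    using that by (auto simp: mk_linmap_def intro!: fs_cong)
  ultimately show ?thesis unfolding Hom_def by (simp add: linmaps_def mk_linmap_def)
qed

end

section \<open>Gram matrices\<close>

context frob
begin

definition gram :: "nat list \<Rightarrow> nat list \<Rightarrow> real" where
  "gram xs ys = (\<Sum>s\<in>tuples I (length xs). tv xs s * tv ys s)"

lemma sum_tuples_mid: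
  "(\<Sum>s\<in>tuples I (j + Suc l). f s) = (\<Sum>s1\<in>tuples I j. \<Sum>s2\<in>tuples I l. \<Sum>a\<in>I. (f (s1 @ a # s2) :: real))"
  unfolding sum_tuples_append sum_tuples_Cons by (rule sum.cong[OF refl], rule sum.swap)

lemma sum_tuples_mid2:
  "(\<Sum>s\<in>tuples I (j + Suc (Suc l)). f s) =
    (\<Sum>s1\<in>tuples I j. \<Sum>s2\<in>tuples I l. \<Sum>a\<in>I. \<Sum>c\<in>I. (f (s1 @ a # c # s2) :: real))"
proof -
  have "(\<Sum>s\<in>tuples I (j + Suc (Suc l)). f s) = (\<Sum>s1\<in>tuples I j. \<Sum>a\<in>I. \<Sum>s2\<in>tuples I l. \<Sum>c\<in>I. f (s1 @ a # c # s2))"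
    unfolding sum_tuples_append sum_tuples_Cons
    by (rule sum.cong[OF refl], rule sum.cong[OF refl], rule sum.swap)
  also have "\<dots> = (\<Sum>s1\<in>tuples I j. \<Sum>s2\<in>tuples I l. \<Sum>a\<in>I. \<Sum>c\<in>I. f (s1 @ a # c # s2))"
    by (rule sum.cong[OF refl], rule sum.swap)
  finally show ?thesis .
qed

text \<open>A singleton of \<open>ys\<close> contributes the unit vector, and contracting
  \<open>xs\<close> with it deletes the corresponding letter, whatever its block.\<close>

lemma gram_fresh:
  assumes len: "length xs1 = length ys1" "length xs2 = length ys2" and v: "v \<notin> set (ys1 @ ys2)"
  shows "gram (xs1 @ w # xs2) (ys1 @ v # ys2) = gram (xs1 @ xs2) (ys1 @ ys2)"
proof -
  have "gram (xs1 @ w # xs2) (ys1 @ v # ys2) = (\<Sum>s1\<in>tuples I (length xs1). \<Sum>s2\<in>tuples I (length xs2).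
      \<Sum>a\<in>I. tv (xs1 @ w # xs2) (s1 @ a # s2) * tv (ys1 @ v # ys2) (s1 @ a # s2))"
    unfolding gram_def sum_tuples_mid[symmetric, where f = "\<lambda>s. tv _ s * tv _ s"] by simp
  also have "\<dots> = (\<Sum>s1\<in>tuples I (length xs1). \<Sum>s2\<in>tuples I (length xs2). tv (xs1 @ xs2) (s1 @ s2) * tv (ys1 @ ys2) (s1 @ s2))"
  proof (intro sum.cong refl)
    fix s1 s2 assume s: "s1 \<in> tuples I (length xs1)" "s2 \<in> tuples I (length xs2)"
    have "(\<Sum>a\<in>I. tv (xs1 @ w # xs2) (s1 @ a # s2) * tv (ys1 @ v # ys2) (s1 @ a # s2))
        = (\<Sum>a\<in>I. e a * tv (xs1 @ w # xs2) (s1 @ a # s2)) * tv (ys1 @ ys2) (s1 @ s2)"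
      unfolding sum_distrib_right using s len v
      by (intro sum.cong refl) (subst tv_fresh, auto simp: tuples_def)
    also have "(\<Sum>a\<in>I. e a * tv (xs1 @ w # xs2) (s1 @ a # s2)) = tv (xs1 @ xs2) (s1 @ s2)"
      using s by (intro tv_unit) (auto simp: tuples_def)
    finally show "(\<Sum>a\<in>I. tv (xs1 @ w # xs2) (s1 @ a # s2) * tv (ys1 @ v # ys2) (s1 @ a # s2)) =
      tv (xs1 @ xs2) (s1 @ s2) * tv (ys1 @ ys2) (s1 @ s2)" .
  qed
  finally show ?thesis by (simp add: gram_def sum_tuples_append)
qed

text \<open>The doubled letter of \<open>ys\<close> is a comultiplication; its transpose multiplies
  the two letters of \<open>xs\<close>. This gives a loop \<delta> if they share a block and merges
  the two blocks otherwise.\<close>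

lemma gram_double:
  assumes len: "length xs1 = length ys1" "length xs2 = length ys2" and nc: "nc (xs1 @ w # w' # xs2)"
  shows "gram (xs1 @ w # w' # xs2) (ys1 @ v # v # ys2) =
    (if w = w' then \<delta> * gram (xs1 @ w # xs2) (ys1 @ v # ys2)
     else gram (map (\<lambda>l. if l = w' then w else l) (xs1 @ w # xs2)) (ys1 @ v # ys2))"
proof -
  let ?m = "if w = w' then xs1 @ w # xs2 else map (\<lambda>l. if l = w' then w else l) (xs1 @ w # xs2)"
  let ?c = "if w = w' then \<delta> else 1"
  have lm: "length ?m = length xs1 + Suc (length xs2)" by simp
  have m: "(\<Sum>a\<in>I. \<Sum>c\<in>I. M x a c * tv (xs1 @ w # w' # xs2) (s1 @ a # c # s2)) = ?c * tv ?m (s1 @ x # s2)"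
    if "s1 \<in> tuples I (length xs1)" "s2 \<in> tuples I (length xs2)" "x \<in> I" for s1 s2 x
  proof (cases "w = w'")
    case True
    then show ?thesis using that tv_mult[of xs1 s1 xs2 s2 x w] by (simp add: tuples_def)
  next
    case False
    then show ?thesis using that nc tv_join[of xs1 s1 xs2 s2 x w w'] by (simp add: tuples_def)
  qed
  have "gram (xs1 @ w # w' # xs2) (ys1 @ v # v # ys2) = (\<Sum>s1\<in>tuples I (length xs1). \<Sum>s2\<in>tuples I (length xs2).
      \<Sum>a\<in>I. \<Sum>c\<in>I. tv (xs1 @ w # w' # xs2) (s1 @ a # c # s2) * tv (ys1 @ v # v # ys2) (s1 @ a # c # s2))"
    unfolding gram_def sum_tuples_mid2[symmetric, where f = "\<lambda>s. tv _ s * tv _ s"] by simp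
  also have "\<dots> = (\<Sum>s1\<in>tuples I (length xs1). \<Sum>s2\<in>tuples I (length xs2).
      \<Sum>x\<in>I. ?c * (tv ?m (s1 @ x # s2) * tv (ys1 @ v # ys2) (s1 @ x # s2)))"
  proof (rule sum.cong[OF refl], rule sum.cong[OF refl])
    fix s1 s2 assume s: "s1 \<in> tuples I (length xs1)" "s2 \<in> tuples I (length xs2)"
    let ?t = "\<lambda>a c. tv (xs1 @ w # w' # xs2) (s1 @ a # c # s2)" and ?u = "\<lambda>x. tv (ys1 @ v # ys2) (s1 @ x # s2)"
    have "(\<Sum>a\<in>I. \<Sum>c\<in>I. ?t a c * tv (ys1 @ v # v # ys2) (s1 @ a # c # s2)) = (\<Sum>a\<in>I. \<Sum>c\<in>I. \<Sum>x\<in>I. M x a c * ?t a c * ?u x)"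
    proof (rule sum.cong[OF refl], rule sum.cong[OF refl])
      fix a c assume ac: "a \<in> I" "c \<in> I"
      have "tv (ys1 @ v # v # ys2) (s1 @ a # c # s2) = (\<Sum>x\<in>I. M x a c * ?u x)"
        using s len ac by (intro tv_comult[symmetric]) (auto simp: tuples_def)
      then show "?t a c * tv (ys1 @ v # v # ys2) (s1 @ a # c # s2) = (\<Sum>x\<in>I. M x a c * ?t a c * ?u x)"
        by (simp add: sum_distrib_left mult_ac)
    qed
    also have "\<dots> = (\<Sum>a\<in>I. \<Sum>x\<in>I. \<Sum>c\<in>I. M x a c * ?t a c * ?u x)"
      by (rule sum.cong[OF refl], rule sum.swap)
    also have "\<dots> = (\<Sum>x\<in>I. \<Sum>a\<in>I. \<Sum>c\<in>I. M x a c * ?t a c * ?u x)" by (rule sum.swap)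
    also have "\<dots> = (\<Sum>x\<in>I. ?c * (tv ?m (s1 @ x # s2) * ?u x))"
    proof (rule sum.cong[OF refl])
      fix x assume x: "x \<in> I"
      have "(\<Sum>a\<in>I. \<Sum>c\<in>I. M x a c * ?t a c * ?u x) = (\<Sum>a\<in>I. \<Sum>c\<in>I. M x a c * ?t a c) * ?u x"
        by (simp only: sum_distrib_right)
      then show "(\<Sum>a\<in>I. \<Sum>c\<in>I. M x a c * ?t a c * ?u x) = ?c * (tv ?m (s1 @ x # s2) * ?u x)"
        by (simp only: m[OF s x] mult.assoc)
    qed
    finally show "(\<Sum>a\<in>I. \<Sum>c\<in>I. ?t a c * tv (ys1 @ v # v # ys2) (s1 @ a # c # s2)) = (\<Sum>x\<in>I. ?c * (tv ?m (s1 @ x # s2) * ?u x))" .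
  qed
  also have "\<dots> = ?c * gram ?m (ys1 @ v # ys2)"
    unfolding gram_def lm sum_tuples_mid sum_distrib_left ..
  finally show ?thesis by simp
qed

end

text \<open>Reducing \<open>ys\<close> to the empty word evaluates the inner product by rules that
  involve only the label lists and \<delta>.\<close>

lemma gram_universal:
  assumes "frob I M e bar lam \<delta>" "frob I' M' e' bar' lam' \<delta>" "nc ys" "nc xs" "length xs = length ys"
  shows "frob.gram I M e xs ys = frob.gram I' M' e' xs ys"
proof -
  interpret A: frob I M e bar lam \<delta> by fact
  interpret B: frob I' M' e' bar' lam' \<delta> by fact
  show ?thesis
    using assms(3-5)
  proof (induction ys arbitrary: xs rule: nc_induct)
    case Nil
    then show ?case by (simp add: A.gram_def B.gram_def A.tv_def B.tv_def)
  next
    case (fresh ys1 v ys2)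
    have "length xs = length ys1 + Suc (length ys2)" using fresh.prems by simp
    then obtain xs1 w xs2 where xs: "xs = xs1 @ w # xs2" "length xs1 = length ys1" "length xs2 = length ys2"
      by (rule length_splitE)
    have "nc (xs1 @ xs2)" using fresh.prems xs nc_delete by blast
    then show ?case using fresh.IH[of "xs1 @ xs2"] xs fresh.hyps by (simp add: A.gram_fresh B.gram_fresh)
  next
    case (double ys1 v ys2)
    have "length xs = length ys1 + Suc (Suc (length ys2))" using double.prems by simp
    then obtain xs1 w xs2' where xs': "xs = xs1 @ w # xs2'" "length xs1 = length ys1" "length xs2' = Suc (length ys2)"
      by (rule length_splitE)
    then obtain w' xs2 where xs: "xs = xs1 @ w # w' # xs2" "length xs2 = length ys2" by (cases xs2') auto
    have nc: "nc (xs1 @ w # w' # xs2)" using double.prems xs by simp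
    have nc1: "nc (xs1 @ w # xs2)" using nc_delete[of "xs1 @ [w]" w' xs2] nc by simp
    have nc2: "nc (map (\<lambda>l. if l = w' then w else l) (xs1 @ w # xs2))" if "w \<noteq> w'" using nc_join[OF nc that] .
    show ?case
      unfolding xs(1) A.gram_double[OF xs'(2) xs(2) nc] B.gram_double[OF xs'(2) xs(2) nc]
      using double.IH[OF nc1] double.IH[OF nc2] xs xs'(2) by (cases "w = w'") simp_all
  qed
qed

section \<open>Direct sums of matrix algebras\<close>

text \<open>Structure constants for b_ij = e_ij / sqrt (q_j): in b_il b_lj = b_ij / sqrt (q_l) only
  the middle index leaves a factor. The unit, the star and its weights in the next definitions come
  from the same normalisation.\<close>

definition bM :: "(nat \<Rightarrow> nat \<Rightarrow> real) \<Rightarrow> idx \<Rightarrow> idx \<Rightarrow> idx \<Rightarrow> real" where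
  "bM q = (\<lambda>(\<alpha>, i, j) (\<beta>, k, l) (\<gamma>, m, n).
     if \<beta> = \<gamma> \<and> l = m \<and> \<alpha> = \<beta> \<and> i = k \<and> j = n then 1 / sqrt (q \<beta> l) else 0)"

definition be :: "(nat \<Rightarrow> nat \<Rightarrow> real) \<Rightarrow> idx \<Rightarrow> real" where
  "be q = (\<lambda>(\<alpha>, i, j). if i = j then sqrt (q \<alpha> i) else 0)"

definition bbar :: "idx \<Rightarrow> idx" where
  "bbar = (\<lambda>(\<alpha>, i, j). (\<alpha>, j, i))"

definition blam :: "(nat \<Rightarrow> nat \<Rightarrow> real) \<Rightarrow> idx \<Rightarrow> real" where
  "blam q = (\<lambda>(\<alpha>, i, j). sqrt (q \<alpha> i) / sqrt (q \<alpha> j))"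

lemma block_idx_Sigma: "block_idx c d = (SIGMA \<alpha>:{..<c}. {..<d \<alpha>} \<times> {..<d \<alpha>})"
  by (auto simp: block_idx_def)

lemma sum_block_idx: "(\<Sum>x\<in>block_idx c d. f x) = (\<Sum>\<alpha><c. \<Sum>i<d \<alpha>. \<Sum>j<d \<alpha>. (f (\<alpha>, i, j) :: 'z :: comm_monoid_add))"
  unfolding block_idx_Sigma sum.cartesian_product by (subst sum.Sigma) (auto simp: split_def)

lemma finite_block_idx [simp]: "finite (block_idx c d)"
  by (simp add: block_idx_Sigma)

lemma in_block_idx [simp]: "(\<alpha>, i, j) \<in> block_idx c d \<longleftrightarrow> \<alpha> < c \<and> i < d \<alpha> \<and> j < d \<alpha>"
  by (simp add: block_idx_def)

lemma sum_if_eq: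
  "finite S \<Longrightarrow> (P \<Longrightarrow> z \<in> S) \<Longrightarrow> (\<Sum>y\<in>S. if P \<and> y = z then f y else 0) = (if P then f z else (0::real))"
  by (cases P) auto

lemma if_mult_if:
  assumes "P1 \<and> P2 \<longleftrightarrow> Q1 \<and> Q2" "P1 \<Longrightarrow> P2 \<Longrightarrow> a * b = c * d"
  shows "(if P1 then (if P2 then a else 0) * b else 0) = (if Q1 then (if Q2 then c else 0) * d else (0::real))"
  using assms by (cases "P1 \<and> P2") (auto split: if_splits)

lemma mult_if_if:
  assumes "P \<and> Q \<longleftrightarrow> R" "P \<Longrightarrow> Q \<Longrightarrow> a * b = c"
  shows "(if P then a else 0) * (if Q then b else 0) = (if R then c else (0::real))"
  using assms by (cases "P \<and> Q") auto

lemma mult_if: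
  assumes "P \<longleftrightarrow> R" "P \<Longrightarrow> a * b = c"
  shows "a * (if P then b else 0) = (if R then c else (0::real))"
  using assms by (cases P) auto

lemma if_eq_if:
  assumes "P \<longleftrightarrow> R" "P \<Longrightarrow> b = c"
  shows "(if P then b else 0) = (if R then c else (0::real))"
  using assms by (cases P) auto

lemma if_nonzeroD: "(if P then a else 0) \<noteq> (0::real) \<Longrightarrow> P"
  by (cases P) auto

text \<open>Multiplication composed with its adjoint acts on each block as the trace of the inverse
  density. A \<delta>-form is thus one for which this trace is \<delta> in every block.\<close>

lemma bM_special:
  assumes q: "\<And>\<alpha> i. \<alpha> < c \<Longrightarrow> i < d \<alpha> \<Longrightarrow> 0 < q \<alpha> i" and xy: "x \<in> block_idx c d" "y \<in> block_idx c d"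
  shows "(\<Sum>a\<in>block_idx c d. \<Sum>g\<in>block_idx c d. bM q x a g * bM q y a g)
    = (if x = y then \<Sum>k<d (fst x). 1 / q (fst x) k else 0)"
proof -
  let ?I = "block_idx c d"
  have nz2: "1 / sqrt (q \<alpha> i) * (1 / sqrt (q \<alpha> i)) = 1 / q \<alpha> i" if "\<alpha> < c" "i < d \<alpha>" for \<alpha> i
    using q[OF that] by simp
  obtain \<alpha> i j where e: "x = (\<alpha>, i, j)" by (cases x)
  have f: "fst x = \<alpha>" by (simp add: e)
  have "(\<Sum>g\<in>?I. bM q x a g * bM q y a g) = (if x = y \<and> a \<in> (\<lambda>k. (\<alpha>, i, k)) ` {..<d \<alpha>} then 1 / q \<alpha> (snd (snd a)) else 0)"
    if a: "a \<in> ?I" for a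
  proof -
    obtain \<beta> k l where f: "a = (\<beta>, k, l)" by (cases a)
    have "(\<Sum>g\<in>?I. bM q x a g * bM q y a g) = (\<Sum>g\<in>?I. if (x = y \<and> \<beta> = \<alpha> \<and> k = i) \<and> g = (\<alpha>, l, j) then 1 / q \<beta> l else 0)"
    proof (rule sum.cong[OF refl])
      fix g :: idx
      obtain \<gamma> m n where g: "g = (\<gamma>, m, n)" by (cases g)
      obtain \<alpha>' i' j' where y: "y = (\<alpha>', i', j')" by (cases y)
      show "bM q x a g * bM q y a g = (if (x = y \<and> \<beta> = \<alpha> \<and> k = i) \<and> g = (\<alpha>, l, j) then 1 / q \<beta> l else 0)"
        using a nz2[of \<beta> l] unfolding e f g y bM_def prod.case by (intro mult_if_if) auto
    qed
    also have "\<dots> = (if x = y \<and> \<beta> = \<alpha> \<and> k = i then 1 / q \<beta> l else 0)"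
      using a xy by (intro sum_if_eq) (auto simp: e f)
    finally show ?thesis using a by (auto simp: f)
  qed
  then have "(\<Sum>a\<in>?I. \<Sum>g\<in>?I. bM q x a g * bM q y a g)
      = (\<Sum>a\<in>?I. if x = y \<and> a \<in> (\<lambda>k. (\<alpha>, i, k)) ` {..<d \<alpha>} then 1 / q \<alpha> (snd (snd a)) else 0)"
    by (intro sum.cong refl)
  also have "\<dots> = (if x = y then \<Sum>k<d (fst x). 1 / q (fst x) k else 0)"
  proof (cases "x = y")
    case True
    have sub: "(\<lambda>k. (\<alpha>, i, k)) ` {..<d \<alpha>} \<subseteq> ?I" using xy e by auto
    have "(\<Sum>a\<in>?I. if a \<in> (\<lambda>k. (\<alpha>, i, k)) ` {..<d \<alpha>} then 1 / q \<alpha> (snd (snd a)) else 0)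
        = (\<Sum>a\<in>(\<lambda>k. (\<alpha>, i, k)) ` {..<d \<alpha>}. 1 / q \<alpha> (snd (snd a)))"
      using sub by (subst sum.inter_restrict[symmetric]) (auto simp: inf.absorb2)
    also have "\<dots> = (\<Sum>k<d \<alpha>. 1 / q \<alpha> k)"
      by (subst sum.reindex) (auto simp: inj_on_def)
    finally show ?thesis unfolding f using True by simp
  qed simp
  finally show ?thesis .
qed

lemma frob_block:
  assumes q: "\<And>\<alpha> i. \<alpha> < c \<Longrightarrow> i < d \<alpha> \<Longrightarrow> 0 < q \<alpha> i"
    and tr: "(\<Sum>\<alpha><c. \<Sum>i<d \<alpha>. q \<alpha> i) = 1"
    and inv: "\<And>\<alpha>. \<alpha> < c \<Longrightarrow> (\<Sum>j<d \<alpha>. 1 / q \<alpha> j) = \<delta>"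
  shows "frob (block_idx c d) (bM q) (be q) bbar (blam q) \<delta>"
proof
  let ?I = "block_idx c d"
  have sq: "0 < sqrt (q \<alpha> i)" "sqrt (q \<alpha> i) * sqrt (q \<alpha> i) = q \<alpha> i" if "\<alpha> < c" "i < d \<alpha>" for \<alpha> i
    using q[OF that] by simp_all
  have nz: "sqrt (q \<alpha> i) \<noteq> 0" if "\<alpha> < c" "i < d \<alpha>" for \<alpha> i
    using q[OF that] by simp
  \<comment> \<open>The product of two basis vectors is a multiple of at most one basis vector, so
    every sum over the output index collapses.\<close>
  have sum1: "(\<Sum>y\<in>?I. f y * bM q y a b) = (case a of (\<beta>, k, l) \<Rightarrow> case b of (\<gamma>, m, n) \<Rightarrow>
      if \<beta> = \<gamma> \<and> l = m then f (\<beta>, k, n) * (1 / sqrt (q \<beta> l)) else 0)"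
    if ab: "a \<in> ?I" "b \<in> ?I" for f a b
  proof -
    obtain \<beta> k l \<gamma> m n where e: "a = (\<beta>, k, l)" "b = (\<gamma>, m, n)" by (cases a, cases b)
    have "(\<Sum>y\<in>?I. f y * bM q y a b) = (\<Sum>y\<in>?I. if (\<beta> = \<gamma> \<and> l = m) \<and> y = (\<beta>, k, n) then f y * (1 / sqrt (q \<beta> l)) else 0)"
      by (intro sum.cong refl) (auto simp: e bM_def split: prod.splits)
    also have "\<dots> = (if \<beta> = \<gamma> \<and> l = m then f (\<beta>, k, n) * (1 / sqrt (q \<beta> l)) else 0)"
      using ab e by (intro sum_if_eq) auto
    finally show ?thesis by (simp add: e)
  qed
  show "finite ?I" by simp
  show "bbar a \<in> ?I" if "a \<in> ?I" for a using that by (cases a) (simp add: bbar_def)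
  show "bbar (bbar a) = a" if "a \<in> ?I" for a by (cases a) (simp add: bbar_def)
  show "0 < blam q a" if "a \<in> ?I" for a using that sq by (cases a) (simp add: blam_def)
  show "blam q (bbar a) = 1 / blam q a" if "a \<in> ?I" for a by (cases a) (simp add: blam_def bbar_def)
  show "(\<Sum>y\<in>?I. bM q x y g * bM q y a b) = (\<Sum>y\<in>?I. bM q x a y * bM q y b g)"
    if "x \<in> ?I" "a \<in> ?I" "b \<in> ?I" "g \<in> ?I" for x a b g
    unfolding sum1[OF that(2,3)] sum1[OF that(3,4)]
  proof -
    obtain \<alpha> i j where x: "x = (\<alpha>, i, j)" by (cases x)
    obtain \<beta> k l where a: "a = (\<beta>, k, l)" by (cases a)
    obtain \<gamma> m n where b: "b = (\<gamma>, m, n)" by (cases b)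
    obtain \<epsilon> o' p where g: "g = (\<epsilon>, o', p)" by (cases g)
    show "(case a of (\<beta>, k, l) \<Rightarrow> case b of (\<gamma>, m, n) \<Rightarrow>
        if \<beta> = \<gamma> \<and> l = m then bM q x (\<beta>, k, n) g * (1 / sqrt (q \<beta> l)) else 0) =
      (case b of (\<beta>, k, l) \<Rightarrow> case g of (\<gamma>, m, n) \<Rightarrow>
        if \<beta> = \<gamma> \<and> l = m then bM q x a (\<beta>, k, n) * (1 / sqrt (q \<beta> l)) else 0)"
      unfolding x a b g bM_def prod.case by (rule if_mult_if) (blast | simp only: mult.commute conj_assoc)+
  qed
  show "(\<Sum>a\<in>?I. be q a * bM q x a g) = (if x = g then 1 else 0)" if "x \<in> ?I" "g \<in> ?I" for x g
  proof -
    obtain \<alpha> i j \<gamma> m n where e: "x = (\<alpha>, i, j)" "g = (\<gamma>, m, n)" by (cases x, cases g)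
    have "(\<Sum>a\<in>?I. be q a * bM q x a g) = (\<Sum>a\<in>?I. if x = g \<and> a = (\<gamma>, m, m) then 1 else 0)"
    proof (rule sum.cong[OF refl])
      fix a assume "a \<in> ?I"
      obtain \<beta> k l where f: "a = (\<beta>, k, l)" by (cases a)
      have "\<gamma> < c" "m < d \<gamma>" using that e by auto
      from nz[OF this] show "be q a * bM q x a g = (if x = g \<and> a = (\<gamma>, m, m) then 1 else 0)"
        unfolding e f bM_def be_def prod.case by (intro mult_if_if) auto
    qed
    also have "\<dots> = (if x = g then 1 else 0)" using that e by (intro sum_if_eq) auto
    finally show ?thesis .
  qed
  show "(\<Sum>a\<in>?I. be q a * bM q x g a) = (if x = g then 1 else 0)" if "x \<in> ?I" "g \<in> ?I" for x g
  proof -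
    obtain \<alpha> i j \<gamma> m n where e: "x = (\<alpha>, i, j)" "g = (\<gamma>, m, n)" by (cases x, cases g)
    have "(\<Sum>a\<in>?I. be q a * bM q x g a) = (\<Sum>a\<in>?I. if x = g \<and> a = (\<gamma>, n, n) then 1 else 0)"
    proof (rule sum.cong[OF refl])
      fix a assume "a \<in> ?I"
      obtain \<beta> k l where f: "a = (\<beta>, k, l)" by (cases a)
      have "\<gamma> < c" "n < d \<gamma>" using that e by auto
      from nz[OF this] show "be q a * bM q x g a = (if x = g \<and> a = (\<gamma>, n, n) then 1 else 0)"
        unfolding e f bM_def be_def prod.case by (intro mult_if_if) auto
    qed
    also have "\<dots> = (if x = g then 1 else 0)" using that e by (intro sum_if_eq) auto
    finally show ?thesis .
  qed
  show "(\<Sum>a\<in>?I. \<Sum>g\<in>?I. bM q x a g * bM q y a g) = (if x = y then \<delta> else 0)" if "x \<in> ?I" "y \<in> ?I" for x y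
    using bM_special[of c d q x y, OF q that] inv that(1) by (cases x) auto
  show "(\<Sum>x\<in>?I. be q x * be q x) = 1"
  proof -
    have "(\<Sum>x\<in>?I. be q x * be q x) = (\<Sum>\<alpha><c. \<Sum>i<d \<alpha>. \<Sum>j<d \<alpha>. be q (\<alpha>, i, j) * be q (\<alpha>, i, j))"
      by (rule sum_block_idx)
    also have "\<dots> = (\<Sum>\<alpha><c. \<Sum>i<d \<alpha>. \<Sum>j<d \<alpha>. if j = i then q \<alpha> i else 0)"
      using sq(2) by (intro sum.cong refl) (auto simp: be_def)
    also have "\<dots> = 1" using tr by simp
    finally show ?thesis .
  qed
  show "(\<Sum>x\<in>?I. be q x * bM q x a g) = (if g = bbar a then blam q a else 0)" if ag: "a \<in> ?I" "g \<in> ?I" for a g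
  proof -
    obtain \<beta> k l \<gamma> m n where e: "a = (\<beta>, k, l)" "g = (\<gamma>, m, n)" by (cases a, cases g)
    have "\<beta> < c" "l < d \<beta>" using ag e by auto
    from nz[OF this] show ?thesis
      unfolding sum1[OF ag] unfolding e bbar_def be_def blam_def prod.case
      by (cases "\<beta> = \<gamma> \<and> l = m") (auto intro!: if_eq_if simp: if_distrib)
  qed
  show "blam q y * bM q a x y = bM q x a (bbar y)" if axy: "a \<in> ?I" "x \<in> ?I" "y \<in> ?I" for a x y
  proof -
    obtain \<alpha> i j \<beta> k l \<gamma> m n where e: "a = (\<alpha>, i, j)" "x = (\<beta>, k, l)" "y = (\<gamma>, m, n)"
      by (cases a, cases x, cases y)
    have "\<gamma> < c" "m < d \<gamma>" using axy e by auto
    from nz[OF this] show ?thesis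
      unfolding e bM_def blam_def bbar_def prod.case by (intro mult_if) auto
  qed
  show "bM q g y x = blam q y * bM q x (bbar y) g" if gxy: "g \<in> ?I" "x \<in> ?I" "y \<in> ?I" for g x y
  proof -
    obtain \<alpha> i j \<beta> k l \<gamma> m n where e: "g = (\<alpha>, i, j)" "x = (\<beta>, k, l)" "y = (\<gamma>, m, n)"
      by (cases g, cases x, cases y)
    have "\<gamma> < c" "m < d \<gamma>" using gxy e by auto
    from nz[OF this] show ?thesis
      unfolding e bM_def blam_def bbar_def prod.case by (intro mult_if[symmetric]) auto
  qed
  show "blam q x = blam q a * blam q g" if xag: "x \<in> ?I" "a \<in> ?I" "g \<in> ?I" "bM q x a g \<noteq> 0" for x a g
  proof -
    obtain \<alpha> i j \<beta> k l \<gamma> m n where e: "x = (\<alpha>, i, j)" "a = (\<beta>, k, l)" "g = (\<gamma>, m, n)"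
      by (cases x, cases a, cases g)
    have "\<beta> = \<gamma> \<and> l = m \<and> \<alpha> = \<beta> \<and> i = k \<and> j = n"
      using xag(4) unfolding e bM_def prod.case by (rule if_nonzeroD)
    moreover have "sqrt (q \<beta> l) \<noteq> 0" using xag(2) unfolding e by (intro nz) auto
    ultimately show ?thesis unfolding e blam_def prod.case by auto
  qed
  show "bM q (bbar x) (bbar g) (bbar a) = bM q x a g" if "x \<in> ?I" "a \<in> ?I" "g \<in> ?I" for x a g
  proof -
    obtain \<alpha> i j \<beta> k l \<gamma> m n where e: "x = (\<alpha>, i, j)" "a = (\<beta>, k, l)" "g = (\<gamma>, m, n)"
      by (cases x, cases a, cases g)
    show ?thesis unfolding e bM_def bbar_def prod.case by (intro if_eq_if) auto
  qed
  show "be q (bbar x) = be q x" if "x \<in> ?I" for x by (cases x) (auto simp: be_def bbar_def)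
  show "blam q x = 1" if x: "x \<in> ?I" "be q x \<noteq> 0" for x
  proof -
    obtain \<alpha> i j where e: "x = (\<alpha>, i, j)" by (cases x)
    have "i = j" using x(2) unfolding e be_def prod.case by (rule if_nonzeroD)
    moreover have "sqrt (q \<alpha> i) \<noteq> 0" using x(1) unfolding e by (intro nz) auto
    ultimately show ?thesis unfolding e blam_def by simp
  qed
qed

section \<open>Linear independence\<close>

text \<open>\<open>P\<close> holds the labels seen before and \<open>S\<close> those following the
  list, so that a word can be cut into pieces. The row index is 1 when the block occurred earlier,
  the column index is 1 when it occurs again.\<close>

fun laux :: "nat set \<Rightarrow> nat list \<Rightarrow> nat set \<Rightarrow> idx list" where
  "laux P [] S = []"
| "laux P (v # xs) S = (0, if v \<in> P then 1 else 0, if v \<in> set xs \<union> S then 1 else 0) # laux (insert v P) xs S"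

text \<open>
  In \<open>M\<^sub>2\<close> the blocks of a partition force equalities between the row and column indices of the
  matrix units in a nonvanishing coefficient.  The word \<open>lead xs\<close> is the lexicographically first one
  when the indices are read as opening and closing brackets: row index 0 and column index 1 open a
  pair, row index 1 and column index 0 close it.
\<close>

definition lead :: "nat list \<Rightarrow> idx list" where
  "lead xs = laux {} xs {}"

lemma laux_append: "laux P (xs @ ys) S = laux P xs (set ys \<union> S) @ laux (P \<union> set xs) ys S"
  by (induction xs arbitrary: P) (auto simp: Un_assoc)

lemma length_laux [simp]: "length (laux P xs S) = length xs"
  by (induction xs arbitrary: P) auto

lemma laux_irrel:
  "v \<notin> set xs \<Longrightarrow> laux (insert v P) xs S = laux P xs S"
  "v \<notin> set xs \<Longrightarrow> laux P xs (insert v S) = laux P xs S"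
  by (induction xs arbitrary: P) (auto simp: insert_commute[of _ v])

lemma lead_fresh:
  "lead (ys @ v # zs) = laux {} ys (insert v (set zs)) @
    (0, if v \<in> set ys then 1 else 0, if v \<in> set zs then 1 else 0) # laux (insert v (set ys)) zs {}"
  by (simp add: lead_def laux_append)

lemma lead_delete:
  assumes "v \<notin> set (ys @ zs)"
  shows "lead (ys @ zs) = laux {} ys (insert v (set zs)) @ laux (insert v (set ys)) zs {}"
  using assms by (simp add: lead_def laux_append laux_irrel)

lemma lead_double:
  "lead (ys @ v # v # zs) = laux {} ys (insert v (set zs)) @
    (0, if v \<in> set ys then 1 else 0, 1) # (0, 1, if v \<in> set zs then 1 else 0) # laux (insert v (set ys)) zs {}"
  by (simp add: lead_def laux_append)

text \<open>A letter \<open>(0, 0, 0)\<close> stands only at a singleton. A column index 1 followed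
  by a row index 1 forces the two neighbours into one block: if the blocks differ,
  \<open>nc_adjacent\<close> forbids that the left one continues to the right while the right one
  started earlier.\<close>

lemma lead_injective:
  assumes "nc xs" "nc ys" "length xs = length ys" "lead xs = lead ys"
  shows "\<exists>f. inj_on f (set xs) \<and> ys = map f xs"
  using assms
proof (induction xs arbitrary: ys rule: nc_induct)
  case (fresh x1 v x2)
  have "length ys = length x1 + Suc (length x2)" using fresh.prems by simp
  then obtain y1 u y2 where ys: "ys = y1 @ u # y2" "length y1 = length x1" "length y2 = length x2"
    by (rule length_splitE)
  have eq: "laux {} x1 (insert v (set x2)) = laux {} y1 (insert u (set y2))" "laux (insert v (set x1)) x2 {} = laux (insert u (set y1)) y2 {}"
    "(if u \<in> set y1 then 1 else 0) = (0::nat)" "(if u \<in> set y2 then 1 else 0) = (0::nat)"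
    using fresh.prems(3) fresh.hyps ys unfolding ys(1) lead_fresh by auto
  have u: "u \<notin> set (y1 @ y2)" using eq(3,4) by (auto split: if_splits)
  have "lead (x1 @ x2) = lead (y1 @ y2)"
    using eq(1,2) lead_delete[OF u] lead_delete[OF fresh.hyps(2)] by simp
  moreover have "nc (y1 @ y2)" using fresh.prems(1) ys nc_delete by blast
  ultimately obtain f where f: "inj_on f (set (x1 @ x2))" "y1 @ y2 = map f (x1 @ x2)"
    using fresh.IH[of "y1 @ y2"] ys by auto
  have y: "y1 = map f x1" "y2 = map f x2" using f(2) ys by auto
  have "inj_on (f(v := u)) (set (x1 @ v # x2))"
    using f(1) fresh.hyps(2) u unfolding y by (auto simp: inj_on_def)
  moreover have "ys = map (f(v := u)) (x1 @ v # x2)"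
    using fresh.hyps(2) unfolding ys(1) y by auto
  ultimately show ?case by blast
next
  case (double x1 v x2)
  have "length ys = length x1 + Suc (Suc (length x2))" using double.prems by simp
  then obtain y1 u y2' where ys': "ys = y1 @ u # y2'" "length y1 = length x1" "length y2' = Suc (length x2)"
    by (rule length_splitE)
  then obtain u' y2 where ys: "ys = y1 @ u # u' # y2" "length y2 = length x2" by (cases y2') auto
  have l: "lead ys = laux {} y1 (insert u (insert u' (set y2))) @
      (0, if u \<in> set y1 then 1 else 0, if u = u' \<or> u \<in> set y2 then 1 else 0) #
      (0, if u' = u \<or> u' \<in> set y1 then 1 else 0, if u' \<in> set y2 then 1 else 0) # laux (insert u' (insert u (set y1))) y2 {}"
    unfolding ys(1) by (auto simp: lead_def laux_append)
  have eq: "u = u' \<or> u \<in> set y2" "u' = u \<or> u' \<in> set y1"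
    using double.prems(3) ys ys'(2) unfolding l lead_double by (auto split: if_splits)
  have "u = u'"
  proof (rule ccontr)
    assume ne: "u \<noteq> u'"
    have "nc (y1 @ u # u' # y2)" using double.prems(1) ys by simp
    from nc_adjacent(3)[OF this ne] show False using eq ne by auto
  qed
  then have ys: "ys = y1 @ u # u # y2" "length y2 = length x2" using ys by auto
  have "nc (y1 @ u # y2)" using double.prems(1) ys nc_delete[of "y1" u "u # y2"] by simp
  moreover have "lead (x1 @ v # x2) = lead (y1 @ u # y2)"
    using double.prems(3) ys ys'(2) unfolding ys(1) lead_double lead_fresh by auto
  ultimately obtain f where f: "inj_on f (set (x1 @ v # x2))" "y1 @ u # y2 = map f (x1 @ v # x2)"
    using double.IH[of "y1 @ u # y2"] ys ys'(2) by auto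
  then have "y1 = map f x1" "u = f v" "y2 = map f x2" using ys'(2) ys by auto
  then show ?case using f ys by (intro exI[of _ f]) auto
qed simp

text \<open>Two brackets per letter, \<open>False\<close> for opening and \<open>True\<close> for
  closing; row and column therefore enter with opposite sign.\<close>

definition bits :: "idx list \<Rightarrow> bool list" where
  "bits s = concat (map (\<lambda>(\<alpha>, i, j). [i = 1, j = 0]) s)"

lemma bits_simps [simp]:
  "bits [] = []" "bits ((\<alpha>, i, j) # s) = (i = 1) # (j = 0) # bits s" "bits (s @ t) = bits s @ bits t"
  by (simp_all add: bits_def)

lemma length_bits [simp]: "length (bits s) = 2 * length s"
  by (induction s) (auto simp: bits_def)

fun lx :: "bool list \<Rightarrow> bool list \<Rightarrow> bool" where
  "lx (a # s) (b # t) \<longleftrightarrow> (\<not> a \<and> b) \<or> (a = b \<and> lx s t)"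
| "lx _ _ \<longleftrightarrow> False"

text \<open>The pair opening-closing is the smaller of the two insertions allowed for
  \<open>X\<close>, so an existing comparison survives.\<close>

lemma lx_insert:
  assumes "length P1 = length Q1" "P1 @ P2 = Q1 @ Q2 \<or> lx (P1 @ P2) (Q1 @ Q2)" "X = [False, True] \<or> X = [True, False]"
  shows "P1 @ [False, True] @ P2 = Q1 @ X @ Q2 \<or> lx (P1 @ [False, True] @ P2) (Q1 @ X @ Q2)"
  using assms by (induction P1 Q1 rule: list_induct2) auto

text \<open>The word as a binary number, so that a lexicographically least word can be found by
  minimising a natural number.\<close>

primrec nb :: "bool list \<Rightarrow> nat" where
  "nb [] = 0"
| "nb (a # s) = (if a then 2 ^ length s else 0) + nb s"

lemma nb_less: "nb s < 2 ^ length s"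
  by (induction s) auto

lemma lx_nb: "length s = length t \<Longrightarrow> lx s t \<Longrightarrow> nb s < nb t"
proof (induction s t rule: list_induct2)
  case (Cons a s b t)
  then show ?case using nb_less[of s] by (auto split: if_splits)
qed simp

abbreviation I2 :: "idx set" where
  "I2 \<equiv> block_idx (Suc 0) (\<lambda>_. 2)"

lemma bits_inj: "set s \<subseteq> I2 \<Longrightarrow> set t \<subseteq> I2 \<Longrightarrow> length s = length t \<Longrightarrow> bits s = bits t \<Longrightarrow> s = t"
proof (induction s arbitrary: t)
  case (Cons a s)
  then obtain b t' where t: "t = b # t'" by (cases t) auto
  obtain \<alpha> i j \<beta> k l where ab: "a = (\<alpha>, i, j)" "b = (\<beta>, k, l)" by (cases a, cases b)
  have "\<alpha> = 0" "\<beta> = 0" "i < 2" "j < 2" "k < 2" "l < 2" using Cons.prems t ab by auto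
  moreover have "(i = 1) = (k = 1)" "(j = 0) = (l = 0)" "s = t'" using Cons t ab by auto
  ultimately show ?case using t ab by auto
qed simp

lemma laux_I2: "set (laux P xs S) \<subseteq> I2"
  by (induction xs arbitrary: P) auto

lemma lead_I2: "lead xs \<in> tuples I2 (length xs)"
  using laux_I2[of "{}" xs "{}"] by (simp add: lead_def tuples_def)

section \<open>Leading words and independence in M_2\<close>

locale frob_M2 = frob I2 "bM q" "be q" bbar "blam q" \<delta> for q \<delta> +
  assumes q_pos: "0 < q 0 0" "0 < q 0 1"
begin

lemma qpos: "i < 2 \<Longrightarrow> sqrt (q 0 i) > 0"
  using q_pos by (cases "i = 0") (auto simp: less_2_cases_iff)

lemma tv_double_eval:
  assumes "length ys = length s1" "length zs = length s2" "(0, i, k) \<in> I2" "(0, k', j) \<in> I2"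
  shows "tv (ys @ v # v # zs) (s1 @ (0, i, k) # (0, k', j) # s2) =
    (if k = k' then 1 / sqrt (q 0 k) * tv (ys @ v # zs) (s1 @ (0, i, j) # s2) else 0)"
proof -
  have "tv (ys @ v # v # zs) (s1 @ (0, i, k) # (0, k', j) # s2) = (\<Sum>x\<in>I2. bM q x (0, i, k) (0, k', j) * tv (ys @ v # zs) (s1 @ x # s2))"
    using assms by (intro tv_comult[symmetric])
  also have "\<dots> = (\<Sum>x\<in>I2. if k = k' \<and> x = (0, i, j) then 1 / sqrt (q 0 k) * tv (ys @ v # zs) (s1 @ x # s2) else 0)"
    by (intro sum.cong refl) (auto simp: bM_def split: prod.splits)
  also have "\<dots> = (if k = k' then 1 / sqrt (q 0 k) * tv (ys @ v # zs) (s1 @ (0, i, j) # s2) else 0)"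
    using assms by (intro sum_if_eq) auto
  finally show ?thesis .
qed

lemma tv_lead: "nc xs \<Longrightarrow> tv xs (lead xs) \<noteq> 0"
proof (induction xs rule: nc_induct)
  case Nil
  then show ?case by (simp add: lead_def tv_def)
next
  case (fresh ys v zs)
  have "lead (ys @ v # zs) = laux {} ys (insert v (set zs)) @ (0, 0, 0) # laux (insert v (set ys)) zs {}"
    using fresh by (simp add: lead_fresh)
  then have "tv (ys @ v # zs) (lead (ys @ v # zs)) = be q (0, 0, 0) * tv (ys @ zs) (lead (ys @ zs))"
    using fresh lead_delete[OF fresh(2)] by (simp add: tv_fresh)
  then show ?case using fresh.IH qpos[of 0] by (simp add: be_def)
next
  case (double ys v zs)
  show ?case
    unfolding lead_double using double.IH qpos[of 1]
    by (subst tv_double_eval) (auto simp: lead_fresh)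
qed

text \<open>A nonzero coefficient forces \<open>i = j\<close> at a singleton and
  \<open>k = k'\<close> at a doubled letter. In both cases the two brackets concerned are
  opening-closing in \<open>lead\<close> and one opening and one closing in \<open>w\<close>, in
  some order; \<open>lx_insert\<close> concludes.\<close>

lemma lead_least:
  "nc xs \<Longrightarrow> w \<in> tuples I2 (length xs) \<Longrightarrow> tv xs w \<noteq> 0 \<Longrightarrow>
    bits (lead xs) = bits w \<or> lx (bits (lead xs)) (bits w)"
proof (induction xs arbitrary: w rule: nc_induct)
  case Nil
  then show ?case by (simp add: lead_def)
next
  case (fresh ys v zs)
  then have "w \<in> tuples I2 (length ys + Suc (length zs))" by simp
  then obtain w1 a w2 where w: "w = w1 @ a # w2" "w1 \<in> tuples I2 (length ys)" "a \<in> I2" "w2 \<in> tuples I2 (length zs)"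
    by (metis tuples_splitE tuples_SucE)
  obtain \<alpha> i j where a: "a = (\<alpha>, i, j)" by (cases a)
  have tv: "tv (ys @ v # zs) w = be q a * tv (ys @ zs) (w1 @ w2)"
    using w fresh by (auto simp: tuples_def intro!: tv_fresh)
  have ij: "i = j" "i < 2" using tv fresh.prems(2) w(3) by (auto simp: a be_def split: if_splits)
  have "bits (lead (ys @ zs)) = bits (w1 @ w2) \<or> lx (bits (lead (ys @ zs))) (bits (w1 @ w2))"
    using fresh.IH[of "w1 @ w2"] tv fresh.prems w by auto
  then have "bits (laux {} ys (insert v (set zs))) @ bits (laux (insert v (set ys)) zs {}) = bits w1 @ bits w2 \<or>
      lx (bits (laux {} ys (insert v (set zs))) @ bits (laux (insert v (set ys)) zs {})) (bits w1 @ bits w2)"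
    unfolding lead_delete[OF fresh.hyps(2)] by simp
  from lx_insert[OF _ this, of "[i = 1, j = 0]"] show ?case
    using ij w fresh.hyps(2) by (auto simp: lead_fresh a less_2_cases_iff tuples_def)
next
  case (double ys v zs)
  then have "w \<in> tuples I2 (length ys + Suc (Suc (length zs)))" by simp
  then obtain w1 a b w2 where w: "w = w1 @ a # b # w2" "w1 \<in> tuples I2 (length ys)" "a \<in> I2" "b \<in> I2" "w2 \<in> tuples I2 (length zs)"
    by (metis tuples_splitE tuples_SucE)
  obtain i k k' j where ab: "a = (0, i, k)" "b = (0, k', j)" using w(3,4) by (cases a; cases b) auto
  have tv: "tv (ys @ v # v # zs) w = (if k = k' then 1 / sqrt (q 0 k) * tv (ys @ v # zs) (w1 @ (0, i, j) # w2) else 0)"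
    unfolding w(1) ab using w ab by (intro tv_double_eval) (auto simp: tuples_def)
  then have k: "k = k'" "k < 2" and nz: "tv (ys @ v # zs) (w1 @ (0, i, j) # w2) \<noteq> 0"
    using double.prems(2) w(3) ab by (auto split: if_splits)
  let ?L1 = "laux {} ys (insert v (set zs))" and ?L2 = "laux (insert v (set ys)) zs {}"
  let ?i = "if v \<in> set ys then 1 else (0::nat)" and ?j = "if v \<in> set zs then 1 else (0::nat)"
  have "w1 @ (0, i, j) # w2 \<in> tuples I2 (length (ys @ v # zs))" using w ab by (auto simp: tuples_def)
  from double.IH[OF this nz]
  have "(bits ?L1 @ [?i = 1]) @ ((?j = 0) # bits ?L2) = (bits w1 @ [i = 1]) @ ((j = 0) # bits w2) \<or>
      lx ((bits ?L1 @ [?i = 1]) @ ((?j = 0) # bits ?L2)) ((bits w1 @ [i = 1]) @ ((j = 0) # bits w2))"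
    unfolding lead_fresh by simp
  \<comment> \<open>The brackets concerned are the column of the first letter and the row of the
    second; \<open>lead\<close> has inner index 1 there.\<close>
  from lx_insert[OF _ this, of "[k = 0, k = 1]"]
  show ?case using w k unfolding lead_double by (auto simp: ab less_2_cases_iff tuples_def)
qed

text \<open>Evaluate at the least leading word \<open>lead x0\<close> among the terms with nonzero
  coefficient. Any other contributing \<open>y\<close> has a leading word that is not larger, hence
  the same one, and then \<open>lead_injective\<close> with \<open>eqv\<close> gives
  \<open>y = x0\<close>.\<close>

lemma tv_independent:
  assumes X: "finite X" and nc: "\<And>xs. xs \<in> X \<Longrightarrow> nc xs \<and> length xs = m"
    and eqv: "\<And>xs ys f. xs \<in> X \<Longrightarrow> ys \<in> X \<Longrightarrow> inj_on f (set xs) \<Longrightarrow> ys = map f xs \<Longrightarrow> xs = ys"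
    and zero: "\<And>s. s \<in> tuples I2 m \<Longrightarrow> (\<Sum>xs\<in>X. c xs * complex_of_real (tv xs s)) = 0"
    and xs: "xs \<in> X"
  shows "c xs = 0"
proof (rule ccontr)
  assume "c xs \<noteq> 0"
  then have ne: "{xs \<in> X. c xs \<noteq> 0} \<noteq> {}" using xs by auto
  have fin: "finite {xs \<in> X. c xs \<noteq> 0}" using X by simp
  obtain x0 where x0: "x0 \<in> X" "c x0 \<noteq> 0" and min: "\<And>y. y \<in> X \<Longrightarrow> c y \<noteq> 0 \<Longrightarrow> nb (bits (lead x0)) \<le> nb (bits (lead y))"
    using arg_min_if_finite[OF fin ne, of "\<lambda>x. nb (bits (lead x))"] by (metis (mono_tags, lifting) mem_Collect_eq not_le)
  have l0: "lead x0 \<in> tuples I2 m" using lead_I2[of x0] nc[OF x0(1)] by simp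
  have "c y * complex_of_real (tv y (lead x0)) = 0" if y: "y \<in> X - {x0}" for y
  proof (rule ccontr)
    assume "c y * complex_of_real (tv y (lead x0)) \<noteq> 0"
    then have cy: "c y \<noteq> 0" "tv y (lead x0) \<noteq> 0" by auto
    have ny: "nc y" "length y = m" using nc y by auto
    have len: "length (bits (lead y)) = length (bits (lead x0))"
      using ny nc[OF x0(1)] by (simp add: lead_def)
    from lead_least[OF ny(1) _ cy(2)] l0 ny(2)
    have "bits (lead y) = bits (lead x0) \<or> lx (bits (lead y)) (bits (lead x0))" by auto
    then show False
    proof
      assume "bits (lead y) = bits (lead x0)"
      then have "lead y = lead x0"
        using lead_I2[of y] lead_I2[of x0] ny nc[OF x0(1)] by (intro bits_inj) (auto simp: tuples_def)
      then obtain f where "inj_on f (set y)" "x0 = map f y"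
        using lead_injective[OF ny(1), of x0] nc[OF x0(1)] ny(2) by auto
      then show False using eqv[of y x0 f] y x0 by auto
    next
      assume "lx (bits (lead y)) (bits (lead x0))"
      from lx_nb[OF len this] show False using min[of y] y cy by auto
    qed
  qed
  then have "(\<Sum>xs\<in>X. c xs * complex_of_real (tv xs (lead x0))) = c x0 * complex_of_real (tv x0 (lead x0))"
    by (simp only: sum.remove[OF X x0(1)] sum.neutral ball_simps) (simp add: sum.neutral)
  then show False using zero[OF l0] x0 tv_lead nc by auto
qed

end

lemma frob_M2_exists:
  assumes "\<delta> \<ge> 4"
  obtains q where "frob_M2 q \<delta>"
proof -
  \<comment> \<open>The numbers (1 + r) / 2 and (1 - r) / 2 have sum 1 and product 1 / \<delta>, so
    their inverses add up to \<delta>. The radicand is nonnegative because \<delta> \<ge> 4.\<close>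
  define r where "r = sqrt (1 - 4 / \<delta>)"
  have r2: "r * r = 1 - 4 / \<delta>" "0 \<le> r" using assms by (simp_all add: r_def)
  have "r * r < 1 * 1" unfolding r2(1) using assms by simp
  then have r1: "r < 1" using r2(2) by (metis mult_mono not_le zero_le_one)
  define q where "q = (\<lambda>(\<alpha>::nat) (i::nat). if i = 0 then (1 + r) / 2 else (1 - r) / 2)"
  have prod: "(1 + r) * (1 - r) = 4 / \<delta>" using r2(1) by (simp add: algebra_simps)
  have two: "{..<2} = {0, 1::nat}" by auto
  have "2 / (1 + r) + 2 / (1 - r) = 4 / ((1 + r) * (1 - r))"
    using r1 r2(2) by (simp add: field_simps)
  also have "\<dots> = \<delta>" unfolding prod using assms by simp
  finally have inv: "2 / (1 + r) + 2 / (1 - r) = \<delta>" .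
  have "frob I2 (bM q) (be q) bbar (blam q) \<delta>"
  proof (rule frob_block)
    show "0 < q \<alpha> i" for \<alpha> i using r1 r2(2) by (auto simp: q_def)
    show "(\<Sum>\<alpha><Suc 0. \<Sum>i<2. q \<alpha> i) = 1" unfolding two by (simp add: q_def field_simps)
    show "(\<Sum>j<2. 1 / q \<alpha> j) = \<delta>" for \<alpha> unfolding two using inv by (simp add: q_def)
  qed
  then have "frob_M2 q \<delta>"
    using r1 r2(2) by (intro frob_M2.intro frob_M2_axioms.intro) (auto simp: q_def)
  then show ?thesis by (rule that)
qed

text \<open>The squared norm of a combination is a quadratic form in the Gram matrix, which is the
  same here and in M_2 by \<open>gram_universal\<close>. A combination vanishing here therefore
  vanishes in M_2.\<close>

lemma (in frob) tv_independent:
  assumes \<delta>: "\<delta> \<ge> 4" and X: "finite X" and nc: "\<And>xs. xs \<in> X \<Longrightarrow> nc xs \<and> length xs = m"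
    and eqv: "\<And>xs ys f. xs \<in> X \<Longrightarrow> ys \<in> X \<Longrightarrow> inj_on f (set xs) \<Longrightarrow> ys = map f xs \<Longrightarrow> xs = ys"
    and zero: "\<And>s. s \<in> tuples I m \<Longrightarrow> (\<Sum>xs\<in>X. c xs * complex_of_real (tv xs s)) = 0"
    and xs: "xs \<in> X"
  shows "c xs = 0"
proof -
  obtain q where "frob_M2 q \<delta>" using frob_M2_exists[OF \<delta>] .
  then interpret N: frob_M2 q \<delta> .
  have norm: "complex_of_real (\<Sum>s\<in>T. (cmod (\<Sum>xs\<in>X. c xs * complex_of_real (h xs s)))\<^sup>2) =
      (\<Sum>xs\<in>X. \<Sum>ys\<in>X. c xs * cnj (c ys) * complex_of_real (\<Sum>s\<in>T. h xs s * h ys s))"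
    for T :: "'x set" and h :: "nat list \<Rightarrow> 'x \<Rightarrow> real"
  proof -
    have "complex_of_real (\<Sum>s\<in>T. (cmod (\<Sum>xs\<in>X. c xs * complex_of_real (h xs s)))\<^sup>2)
        = (\<Sum>s\<in>T. (\<Sum>xs\<in>X. c xs * complex_of_real (h xs s)) * cnj (\<Sum>xs\<in>X. c xs * complex_of_real (h xs s)))"
      unfolding of_real_sum by (intro sum.cong refl) (metis complex_norm_square)
    also have "\<dots> = (\<Sum>s\<in>T. \<Sum>xs\<in>X. \<Sum>ys\<in>X. c xs * cnj (c ys) * complex_of_real (h xs s * h ys s))"
      unfolding cnj_sum sum_product by (simp add: mult_ac)
    also have "\<dots> = (\<Sum>xs\<in>X. \<Sum>s\<in>T. \<Sum>ys\<in>X. c xs * cnj (c ys) * complex_of_real (h xs s * h ys s))"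
      by (rule sum.swap)
    also have "\<dots> = (\<Sum>xs\<in>X. \<Sum>ys\<in>X. \<Sum>s\<in>T. c xs * cnj (c ys) * complex_of_real (h xs s * h ys s))"
      by (rule sum.cong[OF refl], rule sum.swap)
    finally show ?thesis by (simp only: of_real_sum sum_distrib_left)
  qed
  have g: "(\<Sum>s\<in>tuples I m. tv xs s * tv ys s) = (\<Sum>s\<in>tuples I2 m. N.tv xs s * N.tv ys s)"
    if xy: "xs \<in> X" "ys \<in> X" for xs ys
  proof -
    have "nc ys" "nc xs" "length xs = length ys" "length xs = m" using nc[OF xy(1)] nc[OF xy(2)] by auto
    from gram_universal[OF frob_axioms N.frob_axioms this(1-3)]
    show ?thesis unfolding gram_def N.gram_def \<open>length xs = m\<close> .
  qed
  have "complex_of_real (\<Sum>s\<in>tuples I2 m. (cmod (\<Sum>xs\<in>X. c xs * complex_of_real (N.tv xs s)))\<^sup>2) =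
      complex_of_real (\<Sum>s\<in>tuples I m. (cmod (\<Sum>xs\<in>X. c xs * complex_of_real (tv xs s)))\<^sup>2)"
    unfolding norm by (intro sum.cong refl) (simp only: g)
  then have "(\<Sum>s\<in>tuples I2 m. (cmod (\<Sum>xs\<in>X. c xs * complex_of_real (N.tv xs s)))\<^sup>2) = 0"
    using zero by (simp only: of_real_eq_iff) simp
  then have "\<forall>s\<in>tuples I2 m. (cmod (\<Sum>xs\<in>X. c xs * complex_of_real (N.tv xs s)))\<^sup>2 = 0"
    by (subst (asm) sum_nonneg_eq_0_iff) simp_all
  then have "(\<Sum>xs\<in>X. c xs * complex_of_real (N.tv xs s)) = 0" if "s \<in> tuples I2 m" for s
    using that by simp
  note zero' = this
  show ?thesis
  proof (rule N.tv_independent[OF X, where m = m and xs = xs and c = c])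
    show "nc xs \<and> length xs = m" if "xs \<in> X" for xs using that by (rule nc)
    show "xs = ys" if "xs \<in> X" "ys \<in> X" "inj_on f (set xs)" "ys = map f xs" for xs ys f
      using that by (rule eqv)
    show "(\<Sum>xs\<in>X. c xs * complex_of_real (N.tv xs s)) = 0" if "s \<in> tuples I2 m" for s
      using that by (rule zero')
    show "xs \<in> X" by fact
  qed
qed

section \<open>The Frobenius algebra of a \<delta>-form\<close>

context ring_sums
begin

lemmas zero_in = zero_closed
  and one_right = r_one
  and null_left = l_null
  and sum_empty = finsum_empty

end

locale delta_algebra = cstar_algebra B for B :: "'b cstar" (structure) +
  fixes c :: nat and d :: "nat \<Rightarrow> nat" and e :: "idx \<Rightarrow> 'b" and \<psi> :: "'b \<Rightarrow> complex" and \<delta> :: real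
  assumes units: "matrix_units B c d e" and diag: "diagonalizing c d \<psi> e"
    and delta: "delta_form B \<psi> (block_idx c d) (onb B \<psi> e) \<delta>"
begin

abbreviation I :: "idx set" where
  "I \<equiv> block_idx c d"

abbreviation b :: "idx \<Rightarrow> 'b" where
  "b \<equiv> onb B \<psi> e"

definition q :: "nat \<Rightarrow> nat \<Rightarrow> real" where
  "q \<alpha> i = Re (\<psi> (e (\<alpha>, i, i)))"

lemma e_in: "a \<in> I \<Longrightarrow> e a \<in> carrier B"
  using units by (auto simp: matrix_units_def)

lemma e_mult: "\<lbrakk>(\<alpha>, i, j) \<in> I; (\<beta>, k, l) \<in> I\<rbrakk> \<Longrightarrow>
    e (\<alpha>, i, j) \<otimes> e (\<beta>, k, l) = (if \<alpha> = \<beta> \<and> j = k then e (\<alpha>, i, l) else \<zero>)"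
  using units unfolding matrix_units_def by fast

lemma e_star: "(\<alpha>, i, j) \<in> I \<Longrightarrow> star B (e (\<alpha>, i, j)) = e (\<alpha>, j, i)"
  using units unfolding matrix_units_def by fast

lemma e_span: "x \<in> carrier B \<Longrightarrow> \<exists>f. x = finsum B (\<lambda>a. f a \<odot> e a) I"
  using units unfolding matrix_units_def by blast

lemma e_indep: "finsum B (\<lambda>a. f a \<odot> e a) I = \<zero> \<Longrightarrow> a \<in> I \<Longrightarrow> f a = 0"
  using units unfolding matrix_units_def by blast

lemma state: "faithful_state B \<psi>"
  using delta by (simp add: delta_form_def)

lemma psi_add: "\<lbrakk>x \<in> carrier B; y \<in> carrier B\<rbrakk> \<Longrightarrow> \<psi> (x \<oplus> y) = \<psi> x + \<psi> y"
  and psi_smult: "x \<in> carrier B \<Longrightarrow> \<psi> (a \<odot> x) = a * \<psi> x"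
  and psi_pos: "x \<in> carrier B \<Longrightarrow> \<psi> (star B x \<otimes> x) \<in> \<real>\<^sub>\<ge>\<^sub>0"
  and psi_one: "\<psi> \<one> = 1"
  and psi_faithful: "\<lbrakk>x \<in> carrier B; \<psi> (star B x \<otimes> x) = 0\<rbrakk> \<Longrightarrow> x = \<zero>"
  using state by (auto simp: faithful_state_def)

lemma psi_zero: "\<psi> \<zero> = 0"
  using psi_smult[OF RA.zero_in, of 0] by (simp add: RA.zero_in)

lemma psi_sum:
  "finite S \<Longrightarrow> (\<And>x. x \<in> S \<Longrightarrow> f x \<in> carrier B) \<Longrightarrow> \<psi> (finsum B f S) = (\<Sum>x\<in>S. \<psi> (f x))"
  by (induction S rule: finite_induct) (simp_all add: psi_zero fs_insert psi_add RA.sum_empty)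

lemma e_nonzero: "a \<in> I \<Longrightarrow> e a \<noteq> \<zero>"
proof
  assume a: "a \<in> I" "e a = \<zero>"
  have "finsum B (\<lambda>x. (if x = a then 1 else 0) \<odot> e x) I = finsum B (\<lambda>x. if x = a then e x else \<zero>) I"
    by (rule fs_cong) (auto simp: e_in RA.zero_in)
  also have "\<dots> = \<zero>" using fs_delta[of I a e] a e_in by (simp add: RA.zero_in)
  finally show False using e_indep[of "\<lambda>x. if x = a then 1 else 0" a] a by simp
qed

lemma q_psi:
  assumes "\<alpha> < c" "i < d \<alpha>"
  shows "\<psi> (e (\<alpha>, i, i)) = complex_of_real (q \<alpha> i)" "0 < q \<alpha> i"
proof -
  have a: "(\<alpha>, i, i) \<in> I" using assms by simp
  have "star B (e (\<alpha>, i, i)) \<otimes> e (\<alpha>, i, i) = e (\<alpha>, i, i)" using a by (simp add: e_star e_mult del: in_block_idx)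
  then have "\<psi> (e (\<alpha>, i, i)) \<in> \<real>\<^sub>\<ge>\<^sub>0" "\<psi> (e (\<alpha>, i, i)) \<noteq> 0"
    using psi_pos[OF e_in[OF a]] psi_faithful[OF e_in[OF a]] e_nonzero[OF a] by auto
  then show "\<psi> (e (\<alpha>, i, i)) = complex_of_real (q \<alpha> i)" "0 < q \<alpha> i"
    by (auto simp: q_def complex_nonneg_Reals_iff complex_eq_iff)
qed

lemma psi_e:
  assumes "(\<alpha>, i, j) \<in> I"
  shows "\<psi> (e (\<alpha>, i, j)) = (if i = j then complex_of_real (q \<alpha> i) else 0)"
proof (cases "i = j")
  case False
  then have "Defs.density \<psi> e \<alpha> j i = 0" using assms diag by (auto simp: diagonalizing_def)
  then show ?thesis using False by (simp add: Defs.density_def)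
qed (use assms q_psi(1)[of \<alpha> i] in auto)

definition w :: "nat \<Rightarrow> nat \<Rightarrow> complex" where
  "w \<alpha> i = complex_of_real (1 / sqrt (q \<alpha> i))"

lemma w_sq: "\<alpha> < c \<Longrightarrow> i < d \<alpha> \<Longrightarrow> w \<alpha> i * w \<alpha> i * complex_of_real (q \<alpha> i) = 1"
  using q_psi(2)[of \<alpha> i] by (simp add: w_def flip: of_real_mult)

lemma sqrt_w: "\<alpha> < c \<Longrightarrow> i < d \<alpha> \<Longrightarrow> complex_of_real (sqrt (q \<alpha> i)) * w \<alpha> i = 1"
  using q_psi(2)[of \<alpha> i] by (simp add: w_def flip: of_real_mult)

lemma b_eq: "b (\<alpha>, i, j) = w \<alpha> j \<odot> e (\<alpha>, i, j)"
  by (simp add: onb_def w_def q_def)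

lemma b_in [simp]: "a \<in> I \<Longrightarrow> b a \<in> carrier B"
  by (cases a) (simp add: b_eq e_in)

lemma mult_lincomb:
  "z \<in> carrier B \<Longrightarrow> z \<otimes> finsum B (\<lambda>y. f y \<odot> b y) I = finsum B (\<lambda>y. f y \<odot> (z \<otimes> b y)) I"
  by (intro trans[OF fs_mult_left fs_cong]) (auto simp: smult_mult_right RA.mult_closed)

lemma psi_b:
  assumes "a \<in> I"
  shows "\<psi> (b a) = complex_of_real (be q a)"
proof -
  obtain \<alpha> i j where a: "a = (\<alpha>, i, j)" by (cases a)
  have ij: "\<alpha> < c" "i < d \<alpha>" using assms a by auto
  have "w \<alpha> i * complex_of_real (q \<alpha> i) = complex_of_real (sqrt (q \<alpha> i))"
    unfolding w_def of_real_mult[symmetric] using q_psi(2)[OF ij] by (simp add: real_div_sqrt)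
  then show ?thesis
    using assms unfolding a b_eq be_def by (auto simp: psi_smult e_in psi_e)
qed

lemma b_mult:
  assumes "a \<in> I" "g \<in> I"
  shows "b a \<otimes> b g = finsum B (\<lambda>x. complex_of_real (bM q x a g) \<odot> b x) I"
proof -
  obtain \<beta> k l \<gamma> m n where e: "a = (\<beta>, k, l)" "g = (\<gamma>, m, n)" by (cases a, cases g)
  let ?y = "if \<beta> = \<gamma> \<and> l = m then w \<beta> l \<odot> b (\<beta>, k, n) else \<zero>"
  have "b a \<otimes> b g = (w \<gamma> n * w \<beta> l) \<odot> (e (\<beta>, k, l) \<otimes> e (\<gamma>, m, n))"
    using assms e_in unfolding e b_eq by (simp add: smult_mult_left smult_mult_right smult_smult mult.commute RA.mult_closed del: in_block_idx)
  also have "\<dots> = ?y"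
    using assms unfolding e b_eq by (auto simp: e_mult smult_smult e_in mult.commute)
  finally have 1: "b a \<otimes> b g = ?y" .
  have "finsum B (\<lambda>x. complex_of_real (bM q x a g) \<odot> b x) I = finsum B (\<lambda>x. if x = (\<beta>, k, n) then ?y else \<zero>) I"
  proof (rule fs_cong)
    fix x assume x: "x \<in> I"
    obtain \<alpha> i j where x': "x = (\<alpha>, i, j)" by (cases x)
    have "complex_of_real (bM q x a g) = (if x = (\<beta>, k, n) \<and> \<beta> = \<gamma> \<and> l = m then w \<beta> l else 0)"
      unfolding e x' bM_def prod.case w_def by (cases "\<beta> = \<gamma> \<and> l = m \<and> \<alpha> = \<beta> \<and> i = k \<and> j = n") auto
    then show "complex_of_real (bM q x a g) \<odot> b x = (if x = (\<beta>, k, n) then ?y else \<zero>)"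
      using b_in[OF x] by auto
    show "(if x = (\<beta>, k, n) then ?y else \<zero>) \<in> carrier B" using x by (auto simp: RA.zero_in)
  qed
  also have "\<dots> = ?y"
  proof (cases "\<beta> = \<gamma> \<and> l = m")
    case True
    then have "(\<beta>, k, n) \<in> I" "?y \<in> carrier B" using assms unfolding e by auto
    from fs_delta[where f = "\<lambda>x. ?y", OF finite_block_idx this] show ?thesis .
  next
    case False
    then have "?y = \<zero>" by auto
    then show ?thesis by (simp only: if_cancel RA.sum_zero)
  qed
  finally show ?thesis using 1 by simp
qed

lemma b_star:
  assumes "a \<in> I"
  shows "star B (b a) = complex_of_real (blam q a) \<odot> b (bbar a)"
proof -
  obtain \<alpha> i j where a: "a = (\<alpha>, i, j)" by (cases a)
  have "complex_of_real (blam q a) * w \<alpha> i = w \<alpha> j"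
    using assms q_psi(2)[of \<alpha> i] unfolding a blam_def w_def of_real_mult[symmetric] by auto
  moreover have "cnj (w \<alpha> j) = w \<alpha> j" by (simp add: w_def)
  ultimately show ?thesis
    using assms e_in[OF assms] e_in[of "(\<alpha>, j, i)"]
    unfolding a bbar_def prod.case b_eq by (simp add: star_smult e_star smult_smult)
qed

lemma b_orth:
  assumes "a \<in> I" "g \<in> I"
  shows "\<psi> (star B (b a) \<otimes> b g) = (if a = g then 1 else 0)"
proof -
  obtain \<alpha> i j \<beta> k l where f: "a = (\<alpha>, i, j)" "g = (\<beta>, k, l)" by (cases a, cases g)
  have ag: "\<alpha> < c" "i < d \<alpha>" "j < d \<alpha>" "\<beta> < c" "k < d \<beta>" "l < d \<beta>" using assms f by auto
  have cw: "cnj (w \<alpha> j) = w \<alpha> j" by (simp add: w_def)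
  have "star B (b a) \<otimes> b g = (w \<alpha> j * w \<beta> l) \<odot> (e (\<alpha>, j, i) \<otimes> e (\<beta>, k, l))"
    using ag e_in unfolding f b_eq
    by (simp add: star_smult e_star cw smult_mult_left smult_mult_right smult_smult RA.mult_closed mult.commute)
  also have "\<psi> \<dots> = (w \<alpha> j * w \<beta> l) * \<psi> (e (\<alpha>, j, i) \<otimes> e (\<beta>, k, l))"
    using ag e_in by (intro psi_smult) (simp add: RA.mult_closed)
  also have "\<dots> = (if a = g then 1 else 0)"
    using ag w_sq[of \<alpha> j] unfolding f by (auto simp: e_mult psi_e psi_zero)
  finally show ?thesis .
qed

text \<open>The right-hand side acts as a left unit on every matrix unit, hence also on the
  expansion of \<open>\<one>\<close> in matrix units.\<close>

lemma one_eq: "\<one> = finsum B (\<lambda>y. complex_of_real (be q y) \<odot> b y) I"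
proof -
  let ?W = "finsum B (\<lambda>y. complex_of_real (be q y) \<odot> b y) I"
  have W: "?W \<in> carrier B" by simp
  have We: "?W \<otimes> e g = e g" if g: "g \<in> I" for g
  proof -
    obtain \<beta> k l where g': "g = (\<beta>, k, l)" by (cases g)
    have "?W \<otimes> e g = finsum B (\<lambda>y. (complex_of_real (be q y) \<odot> b y) \<otimes> e g) I"
      using e_in[OF g] by (intro fs_mult_right) auto
    also have "\<dots> = finsum B (\<lambda>y. if y = (\<beta>, k, k) then e g else \<zero>) I"
    proof (rule fs_cong)
      fix y assume y: "y \<in> I"
      obtain \<alpha> i j where y': "y = (\<alpha>, i, j)" by (cases y)
      have "(complex_of_real (be q y) \<odot> b y) = (if i = j then e (\<alpha>, i, j) else \<zero>)"
        using y sqrt_w[of \<alpha> i] unfolding y' be_def b_eq by (auto simp: smult_smult e_in)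
      then show "(complex_of_real (be q y) \<odot> b y) \<otimes> e g = (if y = (\<beta>, k, k) then e g else \<zero>)"
        using y g unfolding y' g' by (auto simp: e_mult e_in RA.null_left)
      show "(if y = (\<beta>, k, k) then e g else \<zero>) \<in> carrier B" using e_in[OF g] by (auto simp: RA.zero_in)
    qed
    also have "\<dots> = e g" using fs_delta[of I "(\<beta>, k, k)" "\<lambda>y. e g"] g e_in[OF g] unfolding g' by auto
    finally show ?thesis .
  qed
  obtain f where f: "\<one> = finsum B (\<lambda>a. f a \<odot> e a) I" using e_span[OF RA.unit_closed] by auto
  have "?W = ?W \<otimes> \<one>" using W by (simp add: RA.one_right)
  also have "\<dots> = finsum B (\<lambda>a. ?W \<otimes> (f a \<odot> e a)) I"
    unfolding f using W e_in by (intro fs_mult_left) auto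
  also have "\<dots> = finsum B (\<lambda>a. f a \<odot> e a) I"
    using W e_in by (intro fs_cong) (auto simp: smult_mult_right We)
  finally show ?thesis using f by simp
qed

lemma tr_one: "(\<Sum>\<alpha><c. \<Sum>i<d \<alpha>. q \<alpha> i) = 1"
proof -
  have "1 = (\<Sum>y\<in>I. \<psi> (complex_of_real (be q y) \<odot> b y))"
    unfolding psi_one[symmetric] one_eq by (intro psi_sum) auto
  also have "\<dots> = complex_of_real (\<Sum>y\<in>I. be q y * be q y)"
    by (simp add: psi_smult psi_b)
  finally have "(\<Sum>y\<in>I. be q y * be q y) = 1" by (metis of_real_eq_1_iff)
  moreover have "(\<Sum>y\<in>I. be q y * be q y) = (\<Sum>\<alpha><c. \<Sum>i<d \<alpha>. \<Sum>j<d \<alpha>. if j = i then q \<alpha> i else 0)"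
    unfolding sum_block_idx using q_psi(2) by (intro sum.cong refl) (auto simp: be_def less_imp_le)
  ultimately show ?thesis by simp
qed

lemma mult_map_eq: "mult_map B \<psi> I b = mk_linmap I 2 1 (\<lambda>s r. complex_of_real (bM q (s ! 0) (r ! 0) (r ! 1)))"
proof -
  have 1: "ip B \<psi> (b a \<otimes> b g) (b x) = complex_of_real (bM q x a g)" if x: "x \<in> I" "a \<in> I" "g \<in> I" for x a g
  proof -
    have "star B (b x) \<otimes> (b a \<otimes> b g) = finsum B (\<lambda>y. complex_of_real (bM q y a g) \<odot> (star B (b x) \<otimes> b y)) I"
      unfolding b_mult[OF x(2,3)] using x by (intro mult_lincomb) (simp add: star_closed)
    then have "ip B \<psi> (b a \<otimes> b g) (b x) = \<psi> (finsum B (\<lambda>y. complex_of_real (bM q y a g) \<odot> (star B (b x) \<otimes> b y)) I)"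
      by (simp only: ip_def)
    also have "\<dots> = (\<Sum>y\<in>I. complex_of_real (bM q y a g) * \<psi> (star B (b x) \<otimes> b y))"
      using x by (simp add: psi_sum psi_smult star_closed RA.mult_closed)
    also have "\<dots> = (\<Sum>y\<in>I. if y = x then complex_of_real (bM q y a g) else 0)"
      using x by (intro sum.cong refl) (auto simp: b_orth)
    also have "\<dots> = complex_of_real (bM q x a g)" using x by simp
    finally show ?thesis .
  qed
  have 2: "s ! 0 \<in> I" if "s \<in> tuples I 1" for s
    using that nth_mem[of 0 s] by (auto simp: tuples_def)
  have 3: "r ! 0 \<in> I" "r ! 1 \<in> I" if "r \<in> tuples I 2" for r
    using that nth_mem[of 0 r] nth_mem[of 1 r] by (auto simp: tuples_def)
  show ?thesis unfolding mult_map_def mk_linmap_def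
    by (intro ext if_cong refl, elim conjE) (rule 1[OF 2 3(1) 3(2)])
qed

lemma unit_map_eq: "unit_map B \<psi> I b = mk_linmap I 0 1 (\<lambda>s r. complex_of_real (be q (s ! 0)))"
proof -
  have 1: "ip B \<psi> \<one> (b x) = complex_of_real (be q x)" if x: "x \<in> I" for x
  proof -
    have "star B (b x) \<otimes> \<one> = finsum B (\<lambda>y. complex_of_real (be q y) \<odot> (star B (b x) \<otimes> b y)) I"
      unfolding one_eq using x by (intro mult_lincomb) (simp add: star_closed)
    then have "ip B \<psi> \<one> (b x) = \<psi> (finsum B (\<lambda>y. complex_of_real (be q y) \<odot> (star B (b x) \<otimes> b y)) I)"
      by (simp only: ip_def)
    also have "\<dots> = (\<Sum>y\<in>I. complex_of_real (be q y) * \<psi> (star B (b x) \<otimes> b y))"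
      using x by (simp add: psi_sum psi_smult star_closed RA.mult_closed)
    also have "\<dots> = (\<Sum>y\<in>I. if y = x then complex_of_real (be q y) else 0)"
      using x by (intro sum.cong refl) (auto simp: b_orth)
    also have "\<dots> = complex_of_real (be q x)" using x by simp
    finally show ?thesis .
  qed
  have 2: "s ! 0 \<in> I" if "s \<in> tuples I 1" for s
    using that nth_mem[of 0 s] by (auto simp: tuples_def)
  show ?thesis unfolding unit_map_def mk_linmap_def
    by (intro ext if_cong refl, elim conjE) (rule 1[OF 2])
qed

text \<open>The diagonal entry of the \<delta>-form identity at the first basis vector of the block,
  evaluated by \<open>bM_special\<close>.\<close>

lemma inv_sum:
  assumes "\<alpha> < c"
  shows "(\<Sum>j<d \<alpha>. 1 / q \<alpha> j) = \<delta>"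
proof -
  have "0 < d \<alpha>" using units assms by (simp add: matrix_units_def)
  then have x: "(\<alpha>, 0, 0) \<in> I" using assms by simp
  let ?x = "[(\<alpha>, 0, 0)]" and ?m = "mult_map B \<psi> I b"
  have x1: "?x \<in> tuples I 1" using x by (simp add: tuples_def)
  have "linmap_comp I 2 ?m (linmap_adj ?m) ?x ?x = complex_of_real \<delta>"
    using delta x1 by (simp add: delta_form_def linmap_scale_def linmap_id_def mk_linmap_def)
  also have "linmap_comp I 2 ?m (linmap_adj ?m) ?x ?x
      = (\<Sum>t\<in>tuples I (Suc (Suc 0)). complex_of_real (bM q (\<alpha>, 0, 0) (t ! 0) (t ! 1) * bM q (\<alpha>, 0, 0) (t ! 0) (t ! 1)))"
    unfolding linmap_comp_def linmap_adj_def mult_map_eq mk_linmap_def numeral_2_eq_2 using x1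
    by (intro sum.cong refl) (simp add: numeral_2_eq_2)
  also have "\<dots> = complex_of_real (\<Sum>a\<in>I. \<Sum>g\<in>I. bM q (\<alpha>, 0, 0) a g * bM q (\<alpha>, 0, 0) a g)"
    by (simp add: sum_tuples_Cons)
  also have "(\<Sum>a\<in>I. \<Sum>g\<in>I. bM q (\<alpha>, 0, 0) a g * bM q (\<alpha>, 0, 0) a g) = (\<Sum>j<d \<alpha>. 1 / q \<alpha> j)"
    using bM_special[OF q_psi(2) x x] by simp
  finally show ?thesis by (simp only: of_real_eq_iff)
qed

sublocale F: frob I "bM q" "be q" bbar "blam q" \<delta>
  using q_psi(2) tr_one inv_sum by (rule frob_block)

text \<open>Cauchy-Schwarz for the numbers sqrt (q_i) and 1 / sqrt (q_i) bounds the squared size of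
  a block by \<delta> times the trace of its density, and these traces add up to 1.\<close>

lemma dim_le: "real (\<Sum>\<alpha><c. (d \<alpha>)\<^sup>2) \<le> \<delta>"
proof -
  have "real ((d \<alpha>)\<^sup>2) \<le> \<delta> * (\<Sum>i<d \<alpha>. q \<alpha> i)" if a: "\<alpha> < c" for \<alpha>
  proof -
    have "(\<Sum>i<d \<alpha>. sqrt (q \<alpha> i) * sqrt (1 / q \<alpha> i))\<^sup>2 \<le> (\<Sum>i<d \<alpha>. (sqrt (q \<alpha> i))\<^sup>2) * (\<Sum>i<d \<alpha>. (sqrt (1 / q \<alpha> i))\<^sup>2)"
      by (rule Cauchy_Schwarz_ineq_sum)
    also have "(\<Sum>i<d \<alpha>. (sqrt (q \<alpha> i))\<^sup>2) = (\<Sum>i<d \<alpha>. q \<alpha> i)"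
      using q_psi(2)[OF a] by (intro sum.cong) (auto simp: less_imp_le)
    also have "(\<Sum>i<d \<alpha>. (sqrt (1 / q \<alpha> i))\<^sup>2) = (\<Sum>i<d \<alpha>. 1 / q \<alpha> i)"
      using q_psi(2)[OF a] by (intro sum.cong) (auto simp: less_imp_le)
    also have "\<dots> = \<delta>" using inv_sum[OF a] .
    also have "(\<Sum>i<d \<alpha>. sqrt (q \<alpha> i) * sqrt (1 / q \<alpha> i)) = (\<Sum>i<d \<alpha>. 1)"
    proof (rule sum.cong[OF refl])
      fix i assume "i \<in> {..<d \<alpha>}"
      then have "0 < q \<alpha> i" using q_psi(2)[OF a] by simp
      then show "sqrt (q \<alpha> i) * sqrt (1 / q \<alpha> i) = 1" by (simp flip: real_sqrt_mult)
    qed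
    finally show ?thesis by (simp add: mult.commute)
  qed
  then have "real (\<Sum>\<alpha><c. (d \<alpha>)\<^sup>2) \<le> (\<Sum>\<alpha><c. \<delta> * (\<Sum>i<d \<alpha>. q \<alpha> i))"
    unfolding of_nat_sum by (intro sum_mono) auto
  also have "\<dots> = \<delta>" unfolding sum_distrib_left[symmetric] tr_one by simp
  finally show ?thesis .
qed

section \<open>Block values in terms of the Frobenius data\<close>

definition bprod :: "idx list \<Rightarrow> 'b" where
  "bprod L = foldr (\<lambda>a y. b a \<otimes> y) L \<one>"

lemma bprod_simps [simp]: "bprod [] = \<one>" "bprod (a # L) = b a \<otimes> bprod L"
  by (simp_all add: bprod_def)

lemma bprod_in [simp]: "set L \<subseteq> I \<Longrightarrow> bprod L \<in> carrier B"
  by (induction L) (auto simp: RA.mult_closed RA.unit_closed)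

lemma bprod_append: "set L \<subseteq> I \<Longrightarrow> set K \<subseteq> I \<Longrightarrow> bprod (L @ K) = bprod L \<otimes> bprod K"
  by (induction L) (auto simp: RA.mult_assoc RA.one_left)

lemma bprod_mu:
  "set L \<subseteq> I \<Longrightarrow> bprod L = finsum B (\<lambda>y. complex_of_real (F.mu L y) \<odot> b y) I"
proof (induction L)
  case Nil
  then show ?case by (simp add: one_eq)
next
  case (Cons a L)
  then have a: "a \<in> I" by simp
  have "bprod (a # L) = finsum B (\<lambda>x. complex_of_real (F.mu L x) \<odot> (b a \<otimes> b x)) I"
    using Cons a by (simp add: mult_lincomb)
  also have "\<dots> = finsum B (\<lambda>x. finsum B (\<lambda>y. complex_of_real (bM q y a x * F.mu L x) \<odot> b y) I) I"
    using a by (intro fs_cong) (auto simp: b_mult fs_smult smult_smult mult.commute intro!: fs_cong)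
  also have "\<dots> = finsum B (\<lambda>y. finsum B (\<lambda>x. complex_of_real (bM q y a x * F.mu L x) \<odot> b y) I) I"
    by (rule fs_swap) auto
  also have "\<dots> = finsum B (\<lambda>y. complex_of_real (F.mu (a # L) y) \<odot> b y) I"
    by (intro fs_cong) (auto simp: fs_smult_sum)
  finally show ?case .
qed

lemma psi_bprod: "set L \<subseteq> I \<Longrightarrow> \<psi> (bprod L) = complex_of_real (F.Psi L)"
  unfolding bprod_mu F.Psi_def
  by (simp add: psi_sum psi_smult psi_b mult.commute)

lemma star_one: "star B \<one> = \<one>"
proof -
  have "star B (star B \<one> \<otimes> \<one>) = star B \<one> \<otimes> star B (star B \<one>)"
    by (rule star_mult) (simp_all add: star_closed RA.unit_closed)
  then show ?thesis by (simp add: star_closed star_star RA.unit_closed RA.one_right)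
qed

lemma bprod_star:
  "set L \<subseteq> I \<Longrightarrow> star B (bprod L) = complex_of_real (prod_list (map (blam q) L)) \<odot> bprod (rev (map bbar L))"
proof (induction L)
  case Nil
  then show ?case by (simp add: star_one RA.unit_closed)
next
  case (Cons a L)
  then have r: "set (rev (map bbar L)) \<subseteq> I" "bbar a \<in> I" "a \<in> I" by auto
  have "bprod (rev (map bbar (a # L))) = bprod (rev (map bbar L)) \<otimes> b (bbar a)"
    using r by (simp add: bprod_append RA.one_right)
  then show ?case
    using Cons r by (simp add: star_mult b_star smult_mult_left smult_mult_right smult_smult RA.mult_closed mult.commute)
qed

text \<open>The star puts the lower letters, reversed, in front of the upper ones; applying
  \<open>bar\<close> to the whole word restores the order in which the boundary is read. The weights
  of \<open>Y\<close> may be traded for those of \<open>X\<close> because \<open>Psi\<close>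
  vanishes unless they agree.\<close>

lemma block_value:
  assumes "set X \<subseteq> I" "set Y \<subseteq> I"
  shows "\<psi> (star B (bprod Y) \<otimes> bprod X) = complex_of_real (prod_list (map (blam q) X) * F.Psi (rev (map bbar X) @ Y))"
proof -
  have r: "set (rev (map bbar Y)) \<subseteq> I" "set (rev (map bbar X)) \<subseteq> I" using assms by auto
  have "\<psi> (star B (bprod Y) \<otimes> bprod X) = complex_of_real (prod_list (map (blam q) Y)) * \<psi> (bprod (rev (map bbar Y) @ X))"
    using assms r by (simp add: bprod_star bprod_append smult_mult_left psi_smult RA.mult_closed)
  also have "\<psi> (bprod (rev (map bbar Y) @ X)) = complex_of_real (F.Psi (rev (map bbar Y) @ X))"
    using assms r by (intro psi_bprod) auto
  also have "F.Psi (rev (map bbar Y) @ X) = F.Psi (rev (map bbar X) @ Y)"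
  proof -
    have "map bbar (map bbar Y) = Y" using assms(2) by (intro trans[OF map_map map_idI]) auto
    then have "rev (map bbar (rev (map bbar Y) @ X)) = rev (map bbar X) @ Y" by (simp add: rev_map)
    moreover have "set (rev (map bbar Y) @ X) \<subseteq> I" using assms r by auto
    ultimately show ?thesis using F.Psi_bar by metis
  qed
  finally have 1: "\<psi> (star B (bprod Y) \<otimes> bprod X) =
    complex_of_real (prod_list (map (blam q) Y)) * complex_of_real (F.Psi (rev (map bbar X) @ Y))" .
  have 2: "prod_list (map (blam q) Y) * F.Psi (rev (map bbar X) @ Y) = prod_list (map (blam q) X) * F.Psi (rev (map bbar X) @ Y)"
  proof (cases "F.Psi (rev (map bbar X) @ Y) = 0")
    case False
    have "prod_list (map (blam q) (rev (map bbar X) @ Y)) = 1"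
      using False assms r by (intro F.Psi_hom) auto
    then have "prod_list (map (blam q) Y) = prod_list (map (blam q) X)"
      by (rule F.lamp_append_rbar[OF assms(1)])
    then show ?thesis by (simp only:)
  qed simp
  show ?thesis unfolding 1 of_real_mult[symmetric] 2 ..
qed

text \<open>Multiplication and unit are the maps of one-block partitions, which makes them
  intertwiners in the operator model.\<close>

lemma mult_map_op: "mult_map B \<psi> I b = mk_linmap I 2 1 (F.op (F.tvc [0, 0, 0]))"
proof -
  have 1: "ip B \<psi> (b (r ! 0) \<otimes> b (r ! 1)) (b (s ! 0)) = F.op (F.tvc [0, 0, 0]) s r"
    if s: "s \<in> tuples I 1" and r: "r \<in> tuples I 2" for s r
  proof -
    obtain x where x: "s = [x]" "x \<in> I" using s by (auto simp: tuples_def length_Suc_conv)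
    obtain a g where ag: "r = [a, g]" "a \<in> I" "g \<in> I"
      using r by (auto simp: tuples_def length_Suc_conv numeral_2_eq_2)
    have "ip B \<psi> (b (r ! 0) \<otimes> b (r ! 1)) (b (s ! 0)) = \<psi> (star B (bprod [x]) \<otimes> bprod [a, g])"
      using x ag by (simp add: ip_def RA.one_right)
    also have "\<dots> = F.op (F.tvc [0, 0, 0]) s r"
      using x ag by (subst block_value) (auto simp: F.op_def F.tvc_def F.tv_def tuples_def)
    finally show ?thesis .
  qed
  show ?thesis unfolding mult_map_def mk_linmap_def
    by (intro ext if_cong refl, elim conjE) (rule 1)
qed

lemma unit_map_op: "unit_map B \<psi> I b = mk_linmap I 0 1 (F.op (F.tvc [0]))"
proof -
  have 1: "ip B \<psi> \<one> (b (s ! 0)) = F.op (F.tvc [0]) s r"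
    if s: "s \<in> tuples I 1" and r: "r \<in> tuples I 0" for s r
  proof -
    obtain x where x: "s = [x]" "x \<in> I" using s by (auto simp: tuples_def length_Suc_conv)
    have r0: "r = []" using r by simp
    have "ip B \<psi> \<one> (b (s ! 0)) = \<psi> (star B (bprod [x]) \<otimes> bprod [])"
      using x by (simp add: ip_def RA.one_right)
    also have "\<dots> = F.op (F.tvc [0]) s r"
      using x r0 by (subst block_value) (auto simp: F.op_def F.tvc_def F.tv_def tuples_def)
    finally show ?thesis .
  qed
  show ?thesis unfolding unit_map_def mk_linmap_def
    by (intro ext if_cong refl, elim conjE) (rule 1)
qed

end

section \<open>Partitions as label lists\<close>

text \<open>A crossing that uses the moved letter in last position is a cyclic shift of one that
  uses it in first position; the notion is circular.\<close>

lemma nc_rotate: "nc (xs @ ys) \<Longrightarrow> nc (ys @ xs)"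
proof (induction xs arbitrary: ys)
  case (Cons v xs)
  have "nc ((xs @ ys) @ [v])"
    unfolding nc_def
  proof (intro allI impI, elim conjE)
    fix i j k l
    let ?X = "xs @ ys" and ?n = "length (xs @ ys)"
    assume *: "i < j" "j < k" "k < l" "l < length (?X @ [v])" "(?X @ [v]) ! i = (?X @ [v]) ! k" "(?X @ [v]) ! j = (?X @ [v]) ! l"
    have nc: "nc (v # ?X)" using Cons.prems by simp
    have lt: "(?X @ [v]) ! m = (v # ?X) ! Suc m" if "m < ?n" for m using that by (simp only: nth_append if_True nth_Cons_Suc)
    have last: "(?X @ [v]) ! ?n = v" by (simp only: nth_append_length)
    show "(?X @ [v]) ! i = (?X @ [v]) ! j"
    proof (cases "l < ?n")
      case True
      then have "i < ?n" "j < ?n" "k < ?n" using * by auto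
      then show ?thesis
        using ncD[OF nc, of "Suc i" "Suc j" "Suc k" "Suc l"] * True lt by simp
    next
      case False
      then have l: "l = ?n" using *(4) by simp
      then have "i < ?n" "j < ?n" "k < ?n" using * by auto
      then show ?thesis
        using ncD[OF nc, of 0 "Suc i" "Suc j" "Suc k"] * lt last unfolding l by simp
    qed
  qed
  then show ?case using Cons.IH[of "ys @ [v]"] by simp
qed simp

definition point_label :: "nat \<Rightarrow> nat list \<Rightarrow> nat + nat \<Rightarrow> nat" where
  "point_label k xs x = (case x of Inl i \<Rightarrow> rev (take k xs) ! i | Inr j \<Rightarrow> drop k xs ! j)"

text \<open>
  The tensor \<open>tvc xs\<close> is read along the boundary of the strip, from the rightmost upper point to the
  left and then along the lower points to the right.
\<close>

definition list_partition :: "nat \<Rightarrow> nat \<Rightarrow> nat list \<Rightarrow> (nat + nat) set set" where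
  "list_partition k l xs = (\<lambda>v. {x \<in> points k l. point_label k xs x = v}) ` set xs"

lemma position_less: "x \<in> points k l \<Longrightarrow> position k l x < k + l"
  by (auto simp: points_def)

lemma position_inj: "inj_on (position k l) (points k l)"
  by (auto simp: points_def inj_on_def)

lemma position_image: "position k l ` points k l = {..<k + l}"
proof (intro equalityI subsetI)
  fix t assume t: "t \<in> {..<k + l}"
  show "t \<in> position k l ` points k l"
  proof (cases "t < k")
    case True
    then show ?thesis by (intro image_eqI[of _ _ "Inl t"]) (auto simp: points_def)
  next
    case False
    then show ?thesis using t by (intro image_eqI[of _ _ "Inr (l - 1 - (t - k))"]) (auto simp: points_def)
  qed
qed (auto simp: position_less)

text \<open>In the order that defines noncrossing strings the labels read
  \<open>rev (take k xs) @ rev (drop k xs)\<close>, a rotation of \<open>rev xs\<close>. This is why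
  noncrossing partitions correspond to lists with \<open>nc\<close>.\<close>

lemma point_label_position:
  assumes "length xs = k + l" "x \<in> points k l"
  shows "point_label k xs x = (rev (take k xs) @ rev (drop k xs)) ! position k l x"
  using assms by (auto simp: point_label_def points_def nth_append rev_nth)

lemma point_label_image:
  assumes "length xs = k + l"
  shows "point_label k xs ` points k l = set xs"
proof -
  let ?ys = "rev (take k xs) @ rev (drop k xs)"
  have "point_label k xs ` points k l = (\<lambda>t. ?ys ! t) ` (position k l ` points k l)"
    unfolding image_image using point_label_position[OF assms] by (intro image_cong) auto
  also have "\<dots> = (\<lambda>t. ?ys ! t) ` {0..<length ?ys}"
    unfolding position_image using assms by (simp add: atLeast0LessThan)
  also have "\<dots> = set ?ys" by (subst nth_image) simp_all
  also have "\<dots> = set (take k xs @ drop k xs)" by (simp only: set_append set_rev)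
  finally show ?thesis by simp
qed

lemma list_partition_on:
  assumes "length xs = k + l"
  shows "partition_on (points k l) (list_partition k l xs)"
  unfolding list_partition_def point_label_image[OF assms, symmetric]
  by (rule partition_onI) (auto simp: disjnt_def)

lemma list_partition_inj:
  assumes "length xs = k + l"
  shows "inj_on (\<lambda>v. {x \<in> points k l. point_label k xs x = v}) (set xs)"
  unfolding point_label_image[OF assms, symmetric] by (auto simp: inj_on_def)

lemma list_partition_NC:
  assumes len: "length xs = k + l" and nc: "nc xs"
  shows "list_partition k l xs \<in> NC k l"
proof -
  let ?ys = "rev (take k xs) @ rev (drop k xs)"
  have "nc (rev (drop k xs) @ rev (take k xs))"
    using nc_rev[OF nc] by (simp only: rev_append[symmetric] append_take_drop_id)
  then have ys: "nc ?ys" by (rule nc_rotate)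
  have "noncrossing (position k l) (list_partition k l xs)"
    unfolding noncrossing_def
  proof (intro ballI impI, elim conjE)
    fix V W x y x' y'
    assume VW: "V \<in> list_partition k l xs" "W \<in> list_partition k l xs" and m: "x \<in> V" "y \<in> W" "x' \<in> V" "y' \<in> W"
      and p: "position k l x < position k l y" "position k l y < position k l x'" "position k l x' < position k l y'"
    obtain v where V: "V = {x \<in> points k l. point_label k xs x = v}" using VW(1) by (auto simp: list_partition_def)
    obtain w where W: "W = {x \<in> points k l. point_label k xs x = w}" using VW(2) by (auto simp: list_partition_def)
    have l: "?ys ! position k l x = v" "?ys ! position k l x' = v" "?ys ! position k l y = w" "?ys ! position k l y' = w"
      using m point_label_position[OF len] unfolding V W by auto
    have "position k l y' < length ?ys" using m(4) W len by (simp add: position_less)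
    from ncD[OF ys p this] have "v = w" unfolding l by blast
    then show "V = W" using V W by simp
  qed
  then show ?thesis using list_partition_on[OF len] by (simp add: NC_def)
qed

lemma list_partition_map:
  assumes "length xs = k + l" "inj_on f (set xs)"
  shows "list_partition k l (map f xs) = list_partition k l xs"
proof -
  have lab: "point_label k (map f xs) x = f (point_label k xs x)" if "x \<in> points k l" for x
    using that assms(1) by (auto simp: point_label_def points_def take_map drop_map rev_map)
  have "list_partition k l (map f xs) = (\<lambda>v. {x \<in> points k l. point_label k (map f xs) x = f v}) ` set xs"
    unfolding list_partition_def set_map image_image ..
  also have "\<dots> = list_partition k l xs"
    unfolding list_partition_def
  proof (rule image_cong[OF refl])
    fix v assume v: "v \<in> set xs"
    have "point_label k xs x \<in> set xs" if "x \<in> points k l" for x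
      using that point_label_image[OF assms(1)] by blast
    then show "{x \<in> points k l. point_label k (map f xs) x = f v} = {x \<in> points k l. point_label k xs x = v}"
      using inj_on_eq_iff[OF assms(2)] v lab by auto
  qed
  finally show ?thesis .
qed

text \<open>Number the blocks injectively and list the numbers in the order of
  \<open>position\<close>; reversing the two parts separately then undoes the reading in
  \<open>point_label_position\<close>.\<close>

lemma NC_list_partition:
  assumes "p \<in> NC k l"
  shows "\<exists>xs. nc xs \<and> length xs = k + l \<and> list_partition k l xs = p"
proof -
  have part: "partition_on (points k l) p" and ncr: "noncrossing (position k l) p"
    using assms by (auto simp: NC_def)
  have "finite (points k l)" by (simp add: points_def)
  then have "finite p" using part finite_elements by blast
  then obtain f :: "(nat + nat) set \<Rightarrow> nat" where f: "inj_on f p"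
    using finite_imp_inj_to_nat_seg[of p] by blast
  define blk where "blk x = (THE V. V \<in> p \<and> x \<in> V)" for x
  have ex: "\<exists>!V. V \<in> p \<and> x \<in> V" if x: "x \<in> points k l" for x
  proof -
    have "x \<in> \<Union> p" using x unfolding partition_onD1[OF part] .
    then obtain W where W: "W \<in> p" "x \<in> W" by (rule UnionE)
    show ?thesis
    proof (rule ex1I[of _ W])
      show "W \<in> p \<and> x \<in> W" using W by (rule conjI)
      fix U assume U: "U \<in> p \<and> x \<in> U"
      show "U = W"
      proof (rule ccontr)
        assume "U \<noteq> W"
        then have "U \<inter> W = {}" by (rule disjointD[OF partition_onD2[OF part] conjunct1[OF U] W(1)])
        then show False using U W(2) by blast
      qed
    qed
  qed
  have blk1: "blk x \<in> p" and blk2: "x \<in> blk x" if "x \<in> points k l" for x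
    using theI'[OF ex[OF that]] unfolding blk_def by (rule conjunct1, rule conjunct2)
  have blk3: "blk x = V" if "x \<in> points k l" "V \<in> p" "x \<in> V" for x V
    unfolding blk_def using that by (intro the1_equality ex conjI)
  note blk = blk1 blk2 blk3
  define pt where "pt = the_inv_into (points k l) (position k l)"
  have pt: "pt t \<in> points k l" "position k l (pt t) = t" if "t < k + l" for t
  proof -
    have t: "t \<in> position k l ` points k l" using that position_image by simp
    show "pt t \<in> points k l" unfolding pt_def using the_inv_into_into[OF position_inj t] by blast
    show "position k l (pt t) = t" unfolding pt_def using f_the_inv_into_f[OF position_inj t] .
  qed
  have pt': "pt (position k l x) = x" if "x \<in> points k l" for x
    unfolding pt_def using the_inv_into_f_f[OF position_inj that] .
  define ys where "ys = map (\<lambda>t. f (blk (pt t))) [0..<k + l]"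
  have ly: "length ys = k + l" by (simp add: ys_def)
  have yt: "ys ! t = f (blk (pt t))" if "t < k + l" for t using that by (simp add: ys_def)
  have nc: "nc ys"
    unfolding nc_def
  proof (intro allI impI, elim conjE)
    fix i j m n
    assume *: "i < j" "j < m" "m < n" "n < length ys" "ys ! i = ys ! m" "ys ! j = ys ! n"
    then have lt: "i < k + l" "j < k + l" "m < k + l" "n < k + l" using ly by auto
    have e: "blk (pt i) = blk (pt m)" "blk (pt j) = blk (pt n)"
      using * lt yt inj_onD[OF f] blk(1)[OF pt(1)] by metis+
    have "blk (pt i) = blk (pt j)"
    proof (rule ncr[unfolded noncrossing_def, rule_format])
      show "blk (pt i) \<in> p" "blk (pt j) \<in> p" using lt pt blk by auto
      show "pt i \<in> blk (pt i)" "pt j \<in> blk (pt j)" using lt pt blk by auto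
      show "pt m \<in> blk (pt i)" "pt n \<in> blk (pt j)" unfolding e using lt pt blk by auto
      show "position k l (pt i) < position k l (pt j) \<and> position k l (pt j) < position k l (pt m) \<and>
        position k l (pt m) < position k l (pt n)" using * lt pt by simp
    qed
    then show "ys ! i = ys ! j" using lt yt by simp
  qed
  define xs where "xs = rev (take k ys) @ rev (drop k ys)"
  have lx: "length xs = k + l" using ly by (simp add: xs_def)
  have tx: "take k xs = rev (take k ys)" "drop k xs = rev (drop k ys)" using ly by (simp_all add: xs_def)
  have "nc (rev (drop k ys) @ rev (take k ys))"
    using nc_rev[OF nc] by (simp only: rev_append[symmetric] append_take_drop_id)
  then have ncx: "nc xs" unfolding xs_def by (rule nc_rotate)
  have lab: "point_label k xs x = f (blk x)" if "x \<in> points k l" for x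
    unfolding point_label_position[OF lx that] tx rev_rev_ident append_take_drop_id
    using yt[OF position_less[OF that]] pt'[OF that] by simp
  have "list_partition k l xs = (\<lambda>x. {y \<in> points k l. f (blk y) = f (blk x)}) ` points k l"
    unfolding list_partition_def point_label_image[OF lx, symmetric] image_image using lab
    by (intro image_cong) auto
  also have "\<dots> = blk ` points k l"
  proof (rule image_cong[OF refl])
    fix x assume x: "x \<in> points k l"
    have sub: "blk x \<subseteq> points k l" using part blk(1)[OF x] by (auto simp: partition_on_def)
    have "f (blk y) = f (blk x) \<longleftrightarrow> y \<in> blk x" if y: "y \<in> points k l" for y
      using inj_onD[OF f _ blk(1)[OF y] blk(1)[OF x]] blk(2)[OF y] blk(3)[OF y blk(1)[OF x]] by metis
    then show "{y \<in> points k l. f (blk y) = f (blk x)} = blk x" using sub by blast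
  qed
  also have "\<dots> = p"
  proof (intro equalityI subsetI)
    fix V assume V: "V \<in> p"
    then have "V \<noteq> {}" using part by (auto simp: partition_on_def)
    then obtain x where x: "x \<in> V" by blast
    then have "x \<in> points k l" using V partition_onD1[OF part] by blast
    then show "V \<in> blk ` points k l" using blk(3)[OF _ V x] by blast
  qed (use blk(1) in auto)
  finally show ?thesis using ncx lx by blast
qed

lemma sel_sorted_list:
  assumes "length xs = length r"
  shows "map (\<lambda>i. r ! i) (sorted_list_of_set {i. i < length xs \<and> xs ! i = v}) = sel v xs r"
proof -
  have "sorted_list_of_set {i. i < length xs \<and> xs ! i = v} = filter (\<lambda>i. xs ! i = v) [0..<length xs]"
    by (rule sorted_list_of_set.idem_if_sorted_distinct[of "filter (\<lambda>i. xs ! i = v) [0..<length xs]", THEN trans[rotated]])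
      (auto intro: arg_cong[where f = sorted_list_of_set] sorted_wrt_filter)
  moreover have "map (\<lambda>i. r ! i) (filter (\<lambda>i. xs ! i = v) [0..<length xs]) = sel v xs r"
    using assms
  proof (induction xs r rule: list_induct2)
    case (Cons x xs a r)
    have "[0..<length (x # xs)] = 0 # map Suc [0..<length xs]"
      by (simp add: upt_conv_Cons map_Suc_upt del: upt_Suc)
    then show ?case using Cons by (simp add: filter_map o_def del: upt_Suc)
  qed simp
  ultimately show ?thesis by simp
qed

context frob
begin

lemma prod_lamp_sel:
  assumes "length xs = length r" "finite L" "set xs \<subseteq> L"
  shows "(\<Prod>v\<in>L. lamp (sel v xs r)) = lamp r"
  using assms(1,3)
proof (induction xs r rule: list_induct2)
  case (Cons x xs a r)
  have "(\<Prod>v\<in>L. lamp (sel v (x # xs) (a # r))) = (\<Prod>v\<in>L. (if x = v then lam a else 1) * lamp (sel v xs r))"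
    by (intro prod.cong) auto
  also have "\<dots> = lam a * lamp r"
    unfolding prod.distrib using Cons assms(2) by (simp add: prod.delta)
  finally show ?case by simp
qed simp

end

context delta_algebra
begin

lemma ordered_prod_sel:
  assumes "length xs = length r"
  shows "ordered_prod B (\<lambda>i. b (r ! i)) {i. i < length xs \<and> xs ! i = v} = bprod (sel v xs r)"
  unfolding ordered_prod_def bprod_def sel_sorted_list[OF assms, symmetric] foldr_map o_def ..

text \<open>By \<open>block_value\<close> each block contributes the weight of its upper letters and
  one factor \<open>Psi\<close>. The weights multiply to that of \<open>r\<close> and the factors to
  \<open>tv\<close>, which together is \<open>op\<close>.\<close>

lemma partition_map_list:
  assumes len: "length xs = k + l"
  shows "partition_map B \<psi> I b k l (list_partition k l xs) = mk_linmap I k l (F.op (F.tvc xs))"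
proof -
  have "partition_coeff B \<psi> b (list_partition k l xs) r s = F.op (F.tvc xs) s r"
    if s: "s \<in> tuples I l" and r: "r \<in> tuples I k" for s r
  proof -
    let ?A = "take k xs" and ?D = "drop k xs" and ?V = "\<lambda>v. {x \<in> points k l. point_label k xs x = v}"
    have lens: "length r = k" "length s = l" "length ?A = k" "length ?D = l"
      using s r len by (auto simp: tuples_def)
    have set: "set r \<subseteq> I" "set s \<subseteq> I" using s r by (auto simp: tuples_def)
    have up: "block_up B b r (?V v) = bprod (sel v (rev ?A) r)" for v
      using ordered_prod_sel[of "rev ?A" r v] lens
      by (simp add: block_up_def points_def point_label_def image_iff)
    have down: "block_down B b s (?V v) = bprod (sel v ?D s)" for v
      using ordered_prod_sel[of ?D s v] lens
      by (simp add: block_down_def points_def point_label_def image_iff)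
    have selA: "sel v ?A (rev (map bbar r)) = rev (map bbar (sel v (rev ?A) r))" for v
      using sel_rev[of "rev ?A" "map bbar r" v] lens by (simp add: sel_map)
    have "partition_coeff B \<psi> b (list_partition k l xs) r s
        = (\<Prod>v\<in>set xs. \<psi> (star B (block_down B b s (?V v)) \<otimes> block_up B b r (?V v)))"
      unfolding partition_coeff_def list_partition_def
      by (rule prod.reindex[OF list_partition_inj[OF len], unfolded o_def])
    also have "\<dots> = (\<Prod>v\<in>set xs. complex_of_real (F.lamp (sel v (rev ?A) r) * F.Psi (sel v xs (rev (map bbar r) @ s))))"
    proof (rule prod.cong[OF refl])
      fix v
      have "sel v xs (rev (map bbar r) @ s) = rev (map bbar (sel v (rev ?A) r)) @ sel v ?D s"
        using sel_append[of ?A "rev (map bbar r)" v ?D s] lens selA by simp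
      moreover have "set (sel v (rev ?A) r) \<subseteq> I" "set (sel v ?D s) \<subseteq> I"
        using set set_sel by fast+
      ultimately show "\<psi> (star B (block_down B b s (?V v)) \<otimes> block_up B b r (?V v)) =
          complex_of_real (F.lamp (sel v (rev ?A) r) * F.Psi (sel v xs (rev (map bbar r) @ s)))"
        unfolding up down using block_value by simp
    qed
    also have "\<dots> = complex_of_real ((\<Prod>v\<in>set xs. F.lamp (sel v (rev ?A) r)) * F.tv xs (rev (map bbar r) @ s))"
      by (simp only: of_real_prod[symmetric] prod.distrib F.tv_def)
    also have "(\<Prod>v\<in>set xs. F.lamp (sel v (rev ?A) r)) = F.lamp r"
      using lens by (intro F.prod_lamp_sel) (auto dest: in_set_takeD)
    also have "complex_of_real (F.lamp r * F.tv xs (rev (map bbar r) @ s)) = F.op (F.tvc xs) s r"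
    proof -
      have "rev (map bbar r) @ s \<in> tuples I (length xs)"
        unfolding len using s r by (intro tuples_appendI F.rbar_tuples)
      then show ?thesis by (simp add: F.op_def F.tvc_def)
    qed
    finally show ?thesis .
  qed
  then show ?thesis unfolding partition_map_def mk_linmap_def by (intro ext) auto
qed

end

section \<open>The intertwiner spaces\<close>

text \<open>The equations defining an intertwiner involve only the algebra operations, so they
  survive a homomorphism that sends generators to generators.\<close>

lemma Hom_star_hom:
  assumes A: "cstar_algebra A" and D: "cstar_algebra D" and h: "h \<in> star_hom A D" and fin: "finite I"
    and u: "\<And>x y. x \<in> I \<Longrightarrow> y \<in> I \<Longrightarrow> u x y \<in> carrier A"
    and v: "\<And>x y. x \<in> I \<Longrightarrow> y \<in> I \<Longrightarrow> h (u x y) = v x y"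
    and T: "T \<in> Hom A I u k l"
  shows "T \<in> Hom D I v k l"
proof -
  interpret A: cstar_algebra A by fact
  interpret D: cstar_algebra D by fact
  have rh: "h \<in> ring_hom A D" and hs: "\<And>a x. x \<in> carrier A \<Longrightarrow> h (a \<odot>\<^bsub>A\<^esub> x) = a \<odot>\<^bsub>D\<^esub> h x"
    using h by (auto simp: star_hom_def)
  have hc: "x \<in> carrier A \<Longrightarrow> h x \<in> carrier D" for x using ring_hom_closed[OF rh] .
  have h0: "h \<zero>\<^bsub>A\<^esub> = \<zero>\<^bsub>D\<^esub>"
    using hs[of "\<one>\<^bsub>A\<^esub>" 0] A.RA.unit_closed hc[of "\<one>\<^bsub>A\<^esub>"] by simp
  have hsum: "h (finsum A f S) = finsum D (\<lambda>x. h (f x)) S"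
    if "finite S" "\<And>x. x \<in> S \<Longrightarrow> f x \<in> carrier A" for f and S :: "'s set"
    using that
  proof (induction S rule: finite_induct)
    case empty
    then show ?case using h0 by (simp add: A.RA.sum_empty D.RA.sum_empty)
  next
    case (insert x S)
    have "h (finsum A f (insert x S)) = h (f x \<oplus>\<^bsub>A\<^esub> finsum A f S)"
      using insert by (subst A.fs_insert) auto
    also have "\<dots> = h (f x) \<oplus>\<^bsub>D\<^esub> finsum D (\<lambda>x. h (f x)) S"
      using insert ring_hom_add[OF rh, of "f x" "finsum A f S"] by simp
    also have "\<dots> = finsum D (\<lambda>x. h (f x)) (insert x S)"
      using insert hc by (subst D.fs_insert) auto
    finally show ?case .
  qed
  have tp: "tensor_power A u s r \<in> carrier A \<and> h (tensor_power A u s r) = tensor_power D v s r"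
    if "length s = length r" "set s \<subseteq> I" "set r \<subseteq> I" for s r
    using that
  proof (induction s r rule: list_induct2)
    case Nil
    then show ?case using A.RA.unit_closed ring_hom_one[OF rh] by simp
  next
    case (Cons a s b r)
    then show ?case
      using u v A.RA.mult_closed ring_hom_mult[OF rh, of "u a b" "tensor_power A u s r"] by simp
  qed
  have tp': "tensor_power A u s r \<in> carrier A" "h (tensor_power A u s r) = tensor_power D v s r"
    if "s \<in> tuples I m" "r \<in> tuples I m" for s r m
    using that tp[of s r] by (auto simp: tuples_def)
  have lin: "h (finsum A (\<lambda>t. F t \<odot>\<^bsub>A\<^esub> tensor_power A u (a t) (b t)) (tuples I m))
      = finsum D (\<lambda>t. F t \<odot>\<^bsub>D\<^esub> tensor_power D v (a t) (b t)) (tuples I m)"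
    if ab: "\<And>t. t \<in> tuples I m \<Longrightarrow> a t \<in> tuples I m \<and> b t \<in> tuples I m" for F a b m
  proof -
    have "h (finsum A (\<lambda>t. F t \<odot>\<^bsub>A\<^esub> tensor_power A u (a t) (b t)) (tuples I m))
        = finsum D (\<lambda>t. h (F t \<odot>\<^bsub>A\<^esub> tensor_power A u (a t) (b t))) (tuples I m)"
      using ab tp' fin by (intro hsum) (auto intro!: A.smult_in)
    also have "\<dots> = finsum D (\<lambda>t. F t \<odot>\<^bsub>D\<^esub> tensor_power D v (a t) (b t)) (tuples I m)"
    proof (rule D.fs_cong)
      fix t assume t: "t \<in> tuples I m"
      note p = tp'[OF conjunct1[OF ab[OF t]] conjunct2[OF ab[OF t]]]
      show "h (F t \<odot>\<^bsub>A\<^esub> tensor_power A u (a t) (b t)) = F t \<odot>\<^bsub>D\<^esub> tensor_power D v (a t) (b t)"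
        using hs[OF p(1)] p(2) by simp
      show "F t \<odot>\<^bsub>D\<^esub> tensor_power D v (a t) (b t) \<in> carrier D"
        using hc[OF p(1)] p(2) by simp
    qed
    finally show ?thesis .
  qed
  have "finsum D (\<lambda>t. T s t \<odot>\<^bsub>D\<^esub> tensor_power D v t r) (tuples I k)
      = finsum D (\<lambda>t. T t r \<odot>\<^bsub>D\<^esub> tensor_power D v s t) (tuples I l)"
    if s: "s \<in> tuples I l" and r: "r \<in> tuples I k" for s r
  proof -
    have "finsum A (\<lambda>t. T s t \<odot>\<^bsub>A\<^esub> tensor_power A u t r) (tuples I k)
        = finsum A (\<lambda>t. T t r \<odot>\<^bsub>A\<^esub> tensor_power A u s t) (tuples I l)"
      using T s r by (simp add: Hom_def)
    from arg_cong[OF this, of h] show ?thesis using s r by (simp add: lin)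
  qed
  then show ?thesis using T by (simp add: Hom_def)
qed

context delta_algebra
begin

lemma span_partition_maps:
  "module.span linmap_scale (partition_map B \<psi> I b k l ` NC k l) = {mk_linmap I k l (F.op g) | g. g \<in> F.FV (k + l)}"
    (is "_ = ?T")
proof -
  interpret V: vector_space linmap_scale by (rule vector_space_linmap)
  have add: "mk_linmap I k l (F.op (\<lambda>s. g s + c * h s)) = mk_linmap I k l (F.op g) + linmap_scale c (mk_linmap I k l (F.op h))"
    for g h :: "idx list \<Rightarrow> complex" and c
    by (auto simp: fun_eq_iff mk_linmap_def linmap_scale_def F.op_def algebra_simps)
  have zero: "mk_linmap I k l (F.op (\<lambda>s. 0)) = 0"
    by (auto simp: fun_eq_iff mk_linmap_def F.op_def)
  show ?thesis
  proof
    have sub: "V.subspace ?T"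
    proof (rule V.subspaceI)
      show "0 \<in> ?T" using zero F.FV.zero by fastforce
      show "x + y \<in> ?T" if xy: "x \<in> ?T" "y \<in> ?T" for x y
      proof -
        obtain g h where "x = mk_linmap I k l (F.op g)" "g \<in> F.FV (k + l)" "y = mk_linmap I k l (F.op h)" "h \<in> F.FV (k + l)"
          using xy by blast
        then show ?thesis using add[of g 1 h] F.FV_add[of g "k + l" h]
          by (intro CollectI exI[of _ "\<lambda>s. g s + h s"]) simp
      qed
      show "linmap_scale c x \<in> ?T" if x: "x \<in> ?T" for c x
      proof -
        obtain g where "x = mk_linmap I k l (F.op g)" "g \<in> F.FV (k + l)" using x by blast
        then show ?thesis using add[of "\<lambda>s. 0" c g] zero F.FV_scale[of g "k + l" c]
          by (intro CollectI exI[of _ "\<lambda>s. c * g s"]) simp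
      qed
    qed
    have "partition_map B \<psi> I b k l ` NC k l \<subseteq> ?T"
    proof (rule image_subsetI)
      fix p assume "p \<in> NC k l"
      then obtain xs where "nc xs" "length xs = k + l" "list_partition k l xs = p"
        using NC_list_partition by blast
      then show "partition_map B \<psi> I b k l p \<in> ?T"
        using partition_map_list[of xs k l] F.FV_tvc[of xs] by auto
    qed
    then show "V.span (partition_map B \<psi> I b k l ` NC k l) \<subseteq> ?T" using sub by (rule V.span_minimal)
    show "?T \<subseteq> V.span (partition_map B \<psi> I b k l ` NC k l)"
    proof
      fix x assume "x \<in> ?T"
      then obtain g where x: "x = mk_linmap I k l (F.op g)" and g: "g \<in> F.FV (k + l)" by blast
      from g show "x \<in> V.span (partition_map B \<psi> I b k l ` NC k l)"
        unfolding x
      proof (induction rule: F.FV.induct)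
        case zero
        show ?case unfolding \<open>mk_linmap I k l (F.op (\<lambda>s. 0)) = 0\<close> by (rule V.span_zero)
      next
        case (step f xs c)
        have "mk_linmap I k l (F.op (F.tvc xs)) \<in> partition_map B \<psi> I b k l ` NC k l"
          using partition_map_list[OF step.hyps(3)] list_partition_NC[OF step.hyps(3,2)] by (metis imageI)
        then show ?case unfolding add by (intro V.span_add V.span_scale step.IH V.span_base)
      qed
    qed
  qed
qed

lemma partition_maps_independent:
  assumes \<delta>: "\<delta> \<ge> 4" and P: "finite P" "P \<subseteq> NC k l"
    and zero: "(\<Sum>p\<in>P. linmap_scale (\<gamma> p) (partition_map B \<psi> I b k l p)) = 0" and p: "p \<in> P"
  shows "\<gamma> p = 0"
proof -
  have "\<forall>p\<in>P. \<exists>xs. nc xs \<and> length xs = k + l \<and> list_partition k l xs = p"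
    using P(2) NC_list_partition by blast
  then obtain X where X: "\<And>p. p \<in> P \<Longrightarrow> nc (X p) \<and> length (X p) = k + l \<and> list_partition k l (X p) = p"
    by metis
  have inj: "inj_on X P" using X by (intro inj_on_inverseI[of _ "list_partition k l"]) blast
  have "\<gamma> (list_partition k l (X p)) = 0"
  proof (rule F.tv_independent[OF \<delta>, where X = "X ` P" and m = "k + l" and xs = "X p"
        and c = "\<lambda>xs. \<gamma> (list_partition k l xs)"])
    show "finite (X ` P)" using P by simp
    show "nc xs \<and> length xs = k + l" if "xs \<in> X ` P" for xs using that X by blast
    show "xs = ys" if eq: "xs \<in> X ` P" "ys \<in> X ` P" "inj_on f (set xs)" "ys = map f xs" for xs ys f
    proof -
      obtain p1 where p1: "xs = X p1" "p1 \<in> P" using eq(1) by (rule imageE)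
      obtain p2 where p2: "ys = X p2" "p2 \<in> P" using eq(2) by (rule imageE)
      have "length xs = k + l" using X[OF p1(2)] p1(1) by simp
      from list_partition_map[OF this eq(3)] have "list_partition k l ys = list_partition k l xs"
        unfolding eq(4) .
      then show ?thesis using X[OF p1(2)] X[OF p2(2)] unfolding p1(1) p2(1) by simp
    qed
    show "X p \<in> X ` P" using p by blast
    show "(\<Sum>xs\<in>X ` P. \<gamma> (list_partition k l xs) * complex_of_real (F.tv xs s)) = 0"
      if s: "s \<in> tuples I (k + l)" for s
    proof -
      obtain s1 s2 where s12: "s = s1 @ s2" "s1 \<in> tuples I k" "s2 \<in> tuples I l" using s by (rule tuples_splitE)
      \<comment> \<open>The matrix entry at row \<open>s2\<close> and column \<open>?r\<close> is
        the coefficient at \<open>s\<close> times a nonzero weight, so the relation between maps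
        becomes one between tensors.\<close>
      let ?r = "rev (map bbar s1)"
      have r: "?r \<in> tuples I k" using s12(2) by (rule F.rbar_tuples)
      have "map bbar (map bbar s1) = s1"
        using s12(2) by (intro trans[OF map_map map_idI]) (auto simp: tuples_def)
      then have rr: "rev (map bbar ?r) = s1" by (simp add: rev_map)
      have lam: "prod_list (map (blam q) ?r) \<noteq> 0"
        using F.lamp_pos[of ?r] r by (auto simp: tuples_def)
      have ev: "partition_map B \<psi> I b k l p s2 ?r = complex_of_real (prod_list (map (blam q) ?r)) * complex_of_real (F.tv (X p) s)"
        if p: "p \<in> P" for p
      proof -
        have "partition_map B \<psi> I b k l p = mk_linmap I k l (F.op (F.tvc (X p)))"
          using partition_map_list[of "X p" k l] X[OF p] by simp
        then have "partition_map B \<psi> I b k l p s2 ?r = F.op (F.tvc (X p)) s2 ?r"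
          using s12(3) r by (simp only: mk_linmap_def) simp
        also have "\<dots> = complex_of_real (prod_list (map (blam q) ?r)) * complex_of_real (F.tv (X p) s)"
          unfolding F.op_def rr F.tvc_def s12(1)[symmetric] using X[OF p] s by simp
        finally show ?thesis .
      qed
      have app: "(\<Sum>p\<in>S. h p) a b = (\<Sum>p\<in>S. h p a b)"
        for S :: "(nat + nat) set set set" and h :: "(nat + nat) set set \<Rightarrow> idx linmap" and a b
        by (induction S rule: infinite_finite_induct) auto
      have "0 = (\<Sum>p\<in>P. linmap_scale (\<gamma> p) (partition_map B \<psi> I b k l p)) s2 ?r" unfolding zero by simp
      also have "\<dots> = (\<Sum>p\<in>P. complex_of_real (prod_list (map (blam q) ?r)) * (\<gamma> p * complex_of_real (F.tv (X p) s)))"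
        unfolding app linmap_scale_def by (intro sum.cong refl) (simp only: ev mult.left_commute)
      also have "\<dots> = complex_of_real (prod_list (map (blam q) ?r)) * (\<Sum>p\<in>P. \<gamma> p * complex_of_real (F.tv (X p) s))"
        by (rule sum_distrib_left[symmetric])
      finally have "complex_of_real (prod_list (map (blam q) ?r)) = 0 \<or> (\<Sum>p\<in>P. \<gamma> p * complex_of_real (F.tv (X p) s)) = 0"
        unfolding mult_eq_0_iff[symmetric] by (rule sym)
      then have "(\<Sum>p\<in>P. \<gamma> p * complex_of_real (F.tv (X p) s)) = 0"
        using lam unfolding of_real_eq_0_iff by blast
      moreover have "(\<Sum>xs\<in>X ` P. \<gamma> (list_partition k l xs) * complex_of_real (F.tv xs s))
          = (\<Sum>p\<in>P. \<gamma> p * complex_of_real (F.tv (X p) s))"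
        unfolding sum.reindex[OF inj] o_def using X by (intro sum.cong refl) simp
      ultimately show ?thesis by simp
    qed
  qed
  then show ?thesis using X[OF p] by simp
qed

text \<open>One inclusion holds in every solution of the relations. For the other, the universal
  property gives a homomorphism from \<open>A\<close> to \<open>Dalg\<close>, and there all
  intertwiners come from noncrossing tensors.\<close>

lemma Hom_quantum_automorphism:
  assumes "quantum_automorphism_algebra B \<psi> I b A u"
  shows "Hom A I u k l = {mk_linmap I k l (F.op g) | g. g \<in> F.FV (k + l)}"
proof
  have A: "cstar_algebra A" and rel: "aut_relations B \<psi> I b A u"
    and univ: "\<And>(D :: test_carrier cstar) v. cstar_algebra D \<Longrightarrow> aut_relations B \<psi> I b D v \<Longrightarrow>
      \<exists>h\<in>star_hom A D. \<forall>x\<in>I. \<forall>y\<in>I. h (u x y) = v x y"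
    using assms by (auto simp: quantum_automorphism_algebra_def)
  have u: "u x y \<in> carrier A" if "x \<in> I" "y \<in> I" for x y
    using rel that by (auto simp: aut_relations_def)
  interpret R: frob_rep I "bM q" "be q" bbar "blam q" \<delta> A u
  proof (intro frob_rep.intro frob_rep_axioms.intro)
    show "frob I (bM q) (be q) bbar (blam q) \<delta>" by (rule F.frob_axioms)
    show "unitary A I u" using rel by (simp add: aut_relations_def)
    show "mk_linmap I 2 1 (\<lambda>s r. complex_of_real (bM q (s ! 0) (r ! 0) (r ! 1))) \<in> Hom A I u 2 1"
      using rel unfolding aut_relations_def mult_map_eq by blast
    show "mk_linmap I 0 1 (\<lambda>s r. complex_of_real (be q (s ! 0))) \<in> Hom A I u 0 1"
      using rel unfolding aut_relations_def unit_map_eq by blast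
  qed (use A u in auto)
  show "{mk_linmap I k l (F.op g) | g. g \<in> F.FV (k + l)} \<subseteq> Hom A I u k l"
    using R.Hom_op by blast
  obtain \<xi> S E wd where "frob_gns I (bM q) (be q) bbar (blam q) \<delta> \<xi> S E wd"
    using frob_gns_exists[OF F.frob_axioms] by blast
  then interpret G: frob_gns I "bM q" "be q" bbar "blam q" \<delta> \<xi> S E wd .
  have "aut_relations B \<psi> I b Dalg G.vv"
    unfolding aut_relations_def mult_map_op unit_map_op
  proof (intro conjI ballI)
    show "G.vv x y \<in> carrier Dalg" if "x \<in> I" "y \<in> I" for x y using that by (simp add: G.vv_def Dalg_simps G.tt_Bops)
    show "unitary Dalg I G.vv" by (rule G.unitary_vv)
    show "mk_linmap I 2 1 (F.op (F.tvc [0, 0, 0])) \<in> Hom Dalg I G.vv 2 1"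
      by (rule G.Hom_vv_op, rule F.FV_tvc) (simp_all add: F.nc_replicate_3)
    show "mk_linmap I 0 1 (F.op (F.tvc [0])) \<in> Hom Dalg I G.vv 0 1"
      by (rule G.Hom_vv_op, rule F.FV_tvc) (simp_all add: F.nc_single)
  qed
  from univ[OF cstar_algebra_Dalg this] obtain h where h: "h \<in> star_hom A Dalg"
    and hu: "\<And>x y. x \<in> I \<Longrightarrow> y \<in> I \<Longrightarrow> h (u x y) = G.vv x y" by blast
  show "Hom A I u k l \<subseteq> {mk_linmap I k l (F.op g) | g. g \<in> F.FV (k + l)}"
  proof
    fix T assume "T \<in> Hom A I u k l"
    from Hom_star_hom[OF A cstar_algebra_Dalg h finite_block_idx u hu this]
    have "T \<in> Hom Dalg I G.vv k l" .
    from G.Hom_vv_E[OF this] show "T \<in> {mk_linmap I k l (F.op g) | g. g \<in> F.FV (k + l)}" by blast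
  qed
qed

end

theorem theorem1p17:
  fixes B :: "'b cstar" and \<psi> :: "'b \<Rightarrow> complex" and \<delta> :: real and n :: nat
    and c :: nat and d :: "nat \<Rightarrow> nat" and e :: "idx \<Rightarrow> 'b"
    and A :: "'a cstar" and u :: "idx \<Rightarrow> idx \<Rightarrow> 'a"
    and I :: "idx set" and b :: "idx \<Rightarrow> 'b"
  assumes "I = block_idx c d" and "b = onb B \<psi> e"
    and "cstar_algebra B"
    and "matrix_units B c d e"
    and "n = (\<Sum>\<alpha><c. (d \<alpha>)\<^sup>2)" and "n \<ge> 4"
    and "diagonalizing c d \<psi> e"
    and "delta_form B \<psi> I b \<delta>"
    and "quantum_automorphism_algebra B \<psi> I b A u"
  shows "\<forall>k l.
    Hom A I u k l = module.span linmap_scale (partition_map B \<psi> I b k l ` NC k l) \<and>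
    inj_on (partition_map B \<psi> I b k l) (NC k l) \<and>
    \<not> module.dependent linmap_scale (partition_map B \<psi> I b k l ` NC k l)"
proof -
  have b: "b = onb B \<psi> e" and I: "I = block_idx c d" by fact+
  interpret D: delta_algebra B c d e \<psi> \<delta>
    using assms by (intro delta_algebra.intro delta_algebra_axioms.intro) auto
  interpret V: vector_space linmap_scale by (rule vector_space_linmap)
  have \<delta>: "\<delta> \<ge> 4" using D.dim_le assms(5,6) by linarith
  have Hom: "Hom A I u k l = V.span (partition_map B \<psi> I b k l ` NC k l)" for k l
    unfolding b I D.span_partition_maps
    by (rule D.Hom_quantum_automorphism) (use assms(9) in \<open>simp only: b I\<close>)
  have inj: "inj_on (partition_map B \<psi> I b k l) (NC k l)" for k l
  proof (rule inj_onI, rule ccontr)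
    fix p p' assume p: "p \<in> NC k l" "p' \<in> NC k l" "partition_map B \<psi> I b k l p = partition_map B \<psi> I b k l p'" "p \<noteq> p'"
    \<comment> \<open>Two partitions with the same map would satisfy the linear relation with
      coefficients 1 and -1.\<close>
    let ?c = "\<lambda>x. if x = p then 1 else - 1 :: complex"
    have "(\<Sum>x\<in>{p, p'}. linmap_scale (?c x) (partition_map B \<psi> I b k l x)) = 0"
      using p(3,4) by (auto simp: linmap_scale_def fun_eq_iff)
    then have "?c p = 0"
      unfolding b I using p by (intro D.partition_maps_independent[OF \<delta>, where P = "{p, p'}" and \<gamma> = ?c]) auto
    then show False by simp
  qed
  have "\<not> V.dependent (partition_map B \<psi> I b k l ` NC k l)" for k l
  proof
    assume "V.dependent (partition_map B \<psi> I b k l ` NC k l)"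
    then obtain t w v where t: "finite t" "t \<subseteq> partition_map B \<psi> I b k l ` NC k l"
      and w: "(\<Sum>v\<in>t. linmap_scale (w v) v) = 0" and v: "v \<in> t" "w v \<noteq> 0"
      unfolding V.dependent_explicit by blast
    obtain P where P: "P \<subseteq> NC k l" "t = partition_map B \<psi> I b k l ` P" "finite P"
      using finite_subset_image[OF t] by blast
    obtain p where p: "p \<in> P" "v = partition_map B \<psi> I b k l p" using v P by blast
    have "(\<Sum>p\<in>P. linmap_scale (w (partition_map B \<psi> I b k l p)) (partition_map B \<psi> I b k l p)) = 0"
      using w sum.reindex[OF inj_on_subset[OF inj P(1)], of "\<lambda>v. linmap_scale (w v) v"] P(2) by simp
    then have "w (partition_map B \<psi> I b k l p) = 0"
      unfolding b I using P p
      by (intro D.partition_maps_independent[OF \<delta>, where P = P and \<gamma> = "\<lambda>p. w (partition_map B \<psi> (block_idx c d) (onb B \<psi> e) k l p)"]) auto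
    then show False using v p by simp
  qed
  then show ?thesis using Hom inj by blast
qed

end
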